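(* Let $0<\alpha\le 2$, $d\ge1$, and let $\{\xi_i\}_{i\in\mathbb{Z}^d}$ be i.i.d. random variables in the domain of attraction of an $\alpha$-stable law, with $\mathbb{E}\xi_0^2=\infty$, satisfying Condition $\boldsymbol{A}$ and having a non-lattice distribution. Let $\{a_i\}_{i\in\mathbb{Z}^d}$ be real numbers with $\sum_{i\in\mathbb{Z}^d}|a_i|^{\alpha}L(1/|a_i|)<\infty$ and $\sum_{i\in\mathbb{Z}^d}|a_i|<\infty$, and let $X_j=\sum_{i\in\mathbb{Z}^d}a_i\xi_{j-i}$, $j\in\mathbb{Z}^d$. Let $\Gamma_n^d$, $n\ge1$, be finite subsets of $\mathbb{Z}^d$ and $$S_n=\sum_{j\in\Gamma_n^d}X_j,\qquad b_{ni}=\sum_{j\in\Gamma_n^d}a_{j-i},\qquad B_n=\inf\Big\{x\ge1:\sum_{i\in\mathbb{Z}^d}(|b_{ni}|/x)^{\alpha}L(x/|b_{ni}|)\le1\Big\},$$ and assume $B_n\to\infty$ as $n\to\infty$. Suppose that one of the following two cases holds: 1. for some $0\le c\le1$, with $c_{ni}=b_{ni}/B_n$, $\lim_{n\to\infty}\sum_{i:\,c_{ni}>0}|c_{ni}|^{\alpha}L(1/|c_{ni}|)=c$ and $\lim_{n\to\infty}\sum_{i:\,c_{ni}<0}|c_{ni}|^{\alpha}L(1/|c_{ni}|)=1-c$; in this case let $\mathcal{L}=c^{1/\alpha}S'-(1-c)^{1/\alpha}S''$ with $S',S''$ independent, each with distribution function $G$; 2. either the innovations have a symmetric distribution or $a_i\ge0$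 for all $i\in\mathbb{Z}^d$; in this case let $\mathcal{L}$ have distribution function $G$. Then for any continuous function $m$ on $\mathbb{R}$ with compact support, $$\lim_{n\to\infty}\sup_{u\in\mathbb{R}}\left|B_n\mathbb{E}\,m(S_n+u)-f_{\mathcal{L}}\left(-\frac{u}{B_n}\right)\int m(t)\,\lambda(dt)\right|=0,$$ where $\lambda$ is Lebesgue measure and $f_{\mathcal{L}}$ is the (continuous) density of $\mathcal{L}$.
   Context: $\iota=\sqrt{-1}$. Innovations: $\{\xi_i\}_{i\in\mathbb{Z}^d}$ are i.i.d. real random variables with $\mathbb{E}\xi_0^2=\infty$, in the domain of attraction of a stable law with index $0<\alpha\le2$, in the following sense: $\lim_{x\to\infty}\mathbb{P}(|\xi_0|>x)/(x^{-\alpha}L_1(x))=1$ for a function $L_1$ slowly varying at infinity, and, when $0<\alpha<2$, $\mathbb{P}(\xi_0>x)/\mathbb{P}(|\xi_0|>x)\to c^+$ and $\mathbb{P}(\xi_0<-x)/\mathbb{P}(|\xi_0|>x)\to c^-$ as $x\to\infty$, where $0\le c^+\le1$, $c^++c^-=1$. Condition $\boldsymbol{A}$: $\mathbb{E}\xi_0=0$ if $1<\alpha\le2$, and $\xi_0$ has a symmetric distribution if $\alpha=1$. Function $L$: let $b=\inf\{x\ge1:\mathbb{E}(\xi_0^2I(|\xi_0|\le x))>1\}$. For $0<\alpha<2$, $L(x)=\frac{2-\alpha}{\alpha}x^{\alpha-2}\mathbb{E}(\xi_0^2I(|\xi_0|\le x))$ for $x\ge b$ and $L(x)=\frac{2-\alpha}{\alpha}b^{\alpha-2}\mathbb{E}(\xi_0^2I(|\xi_0|\le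 b))$ for $0<x<b$. For $\alpha=2$, $L(x)=\mathbb{E}(\xi_0^2I(|\xi_0|\le x))$ for $x\ge b$ and $L(x)=\mathbb{E}(\xi_0^2I(|\xi_0|\le b))$ for $0<x<b$. $L$ is slowly varying at infinity. Convention: for $x=0$ and $p>0$, $|x|^pL(1/|x|)=0$. Characteristic function: under Condition $\boldsymbol{A}$, $\varphi_\xi(t)=\mathbb{E}e^{\iota t\xi_0}$ has near $t=0$ the form $\exp\{-c_\alpha|t|^\alpha L(1/|t|)(1-\iota\beta\tau(\alpha,t))\}$, understood asymptotically: $\log\varphi_\xi(t)=-c_\alpha|t|^\alpha L(1/|t|)(1-\iota\beta\tau(\alpha,t)+o(1))$ as $t\to0$. Here $c_\alpha>0$ is a constant, $\tau(\alpha,t)=\mathrm{sgn}(t)\tan(\pi\alpha/2)$ if $\alpha\ne1$, $\tau(1,t)=0$, and $\beta=c^+-c^-$ if $0<\alpha<2$ (for $\alpha=2$, $\tau=0$ and $\beta$ is irrelevant). $G$ denotes the distribution function of the $\alpha$-stable law with characteristic function $\exp\{-c_\alpha|t|^\alpha(1-\iota\beta\tau(\alpha,t))\}$, with the same $c_\alpha,\beta,\tau$. Non-lattice: $|\varphi_\xi(t)|<1$ for all $t\ne0$. The condition $\sum_i|a_i|^\alpha L(1/|a_i|)<\infty$ guarantees that the series defining $X_j$ converges almost surely (along any fixed enumeration of $\mathbb{Z}^d$); $S_n=\sum_{i\in\mathbb{Z}^d}b_{ni}\xi_i$. *)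

theory Defs
  imports "HOL-Probability.Probability"
begin

text \<open>Throughout, \<open>\<mu>\<close> is the common law of the innovations, a probability measure on the Borel
  sets of the reals.\<close>

definition slowly_varying :: "(real \<Rightarrow> real) \<Rightarrow> bool" where
  "slowly_varying l \<longleftrightarrow>
     l \<in> borel_measurable borel \<and> (\<forall>\<^sub>F x in at_top. l x > 0) \<and>
     (\<forall>c>0. ((\<lambda>x. l (c * x) / l x) \<longlongrightarrow> 1) at_top)"

definition domain_of_attraction :: "real \<Rightarrow> real \<Rightarrow> real \<Rightarrow> real measure \<Rightarrow> bool" where
  "domain_of_attraction \<alpha> cp cm \<mu> \<longleftrightarrow>
     (\<exists>l. slowly_varying l \<and>
        ((\<lambda>x. measure \<mu> {y. \<bar>y\<bar> > x} / (x powr (- \<alpha>) * l x)) \<longlongrightarrow> 1) at_top) \<and>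
     (\<alpha> < 2 \<longrightarrow>
        0 \<le> cp \<and> cp \<le> 1 \<and> cp + cm = 1 \<and>
        ((\<lambda>x. measure \<mu> {y. y > x} / measure \<mu> {y. \<bar>y\<bar> > x}) \<longlongrightarrow> cp) at_top \<and>
        ((\<lambda>x. measure \<mu> {y. y < - x} / measure \<mu> {y. \<bar>y\<bar> > x}) \<longlongrightarrow> cm) at_top)"

definition symmetric_law :: "real measure \<Rightarrow> bool" where
  "symmetric_law \<mu> \<longleftrightarrow> distr \<mu> borel uminus = \<mu>"

definition condition_A :: "real \<Rightarrow> real measure \<Rightarrow> bool" where
  "condition_A \<alpha> \<mu> \<longleftrightarrow>
     (1 < \<alpha> \<longrightarrow> integrable \<mu> (\<lambda>y. y) \<and> (\<integral>y. y \<partial>\<mu>) = 0) \<and>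
     (\<alpha> = 1 \<longrightarrow> symmetric_law \<mu>)"

definition non_lattice :: "real measure \<Rightarrow> bool" where
  "non_lattice \<mu> \<longleftrightarrow> (\<forall>t. t \<noteq> 0 \<longrightarrow> cmod (char \<mu> t) < 1)"

definition truncated_moment :: "real measure \<Rightarrow> real \<Rightarrow> real" where
  "truncated_moment \<mu> x = (\<integral>y. y\<^sup>2 * indicator {y. \<bar>y\<bar> \<le> x} y \<partial>\<mu>)"

definition L_start :: "real measure \<Rightarrow> real" where
  "L_start \<mu> = Inf {x. x \<ge> 1 \<and> truncated_moment \<mu> x > 1}"

text \<open>Only the values at \<open>x > 0\<close> matter. The maximum encodes that \<open>L\<close> is constant below
  \<^term>\<open>L_start \<mu>\<close>.\<close>

definition L_fun :: "real \<Rightarrow> real measure \<Rightarrow> real \<Rightarrow> real" where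
  "L_fun \<alpha> \<mu> x =
     (let y = max x (L_start \<mu>) in
      if \<alpha> < 2 then (2 - \<alpha>) / \<alpha> * y powr (\<alpha> - 2) * truncated_moment \<mu> y
      else truncated_moment \<mu> y)"

text \<open>\<open>|x|\<^sup>\<alpha> L(1/|x|)\<close>, with value \<open>0\<close> at \<open>x = 0\<close>.\<close>

definition L_weight :: "real \<Rightarrow> real measure \<Rightarrow> real \<Rightarrow> real" where
  "L_weight \<alpha> \<mu> x = (if x = 0 then 0 else \<bar>x\<bar> powr \<alpha> * L_fun \<alpha> \<mu> (1 / \<bar>x\<bar>))"

definition stable_tau :: "real \<Rightarrow> real \<Rightarrow> real" where
  "stable_tau \<alpha> t = (if \<alpha> = 1 then 0 else sgn t * tan (pi * \<alpha> / 2))"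

definition stable_char :: "real \<Rightarrow> real \<Rightarrow> real \<Rightarrow> real \<Rightarrow> complex" where
  "stable_char \<alpha> \<beta> c t =
     exp (- complex_of_real (c * \<bar>t\<bar> powr \<alpha>) * (1 - \<i> * complex_of_real (\<beta> * stable_tau \<alpha> t)))"

text \<open>The positive constant \<open>c\<^sub>\<alpha>\<close> determined by
  \<open>log \<phi>(t) = - c\<^sub>\<alpha> |t|\<^sup>\<alpha> L(1/|t|) (1 - \<i> \<beta> \<tau>(\<alpha>,t) + o(1))\<close> as \<open>t \<rightarrow> 0\<close>, where \<open>\<phi>\<close> is the characteristic
  function of \<open>\<mu>\<close>. Near \<open>t = 0\<close> the value \<open>\<phi>(t)\<close> is close to \<open>1\<close>, so the principal logarithm is
  the right one. Unless \<open>\<beta> \<tau> = 0\<close>, the limit is not a two-sided constant, hence the difference.\<close>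

definition char_const :: "real \<Rightarrow> real \<Rightarrow> real measure \<Rightarrow> real" where
  "char_const \<alpha> \<beta> \<mu> = (THE c. c > 0 \<and>
     ((\<lambda>t. Ln (char \<mu> t) / complex_of_real (- c * L_weight \<alpha> \<mu> t)
            - (1 - \<i> * complex_of_real (\<beta> * stable_tau \<alpha> t))) \<longlongrightarrow> 0) (at 0))"

text \<open>The infinite series is summed along the fixed enumeration \<open>e\<close> of the index group; under the
  hypotheses it converges almost surely but, for \<open>\<alpha> = 1\<close>, not necessarily absolutely.\<close>

definition linear_process ::
    "(nat \<Rightarrow> 'i::ab_group_add) \<Rightarrow> ('i \<Rightarrow> real) \<Rightarrow> ('i \<Rightarrow> 'w \<Rightarrow> real) \<Rightarrow> 'i \<Rightarrow> 'w \<Rightarrow> real" where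
  "linear_process e a \<xi> j \<omega> = (\<Sum>k. a (e k) * \<xi> (j - e k) \<omega>)"

text \<open>The normalising constant of a coefficient family \<open>b\<close>; the sum at \<open>x\<close> is
  \<open>\<Sum>\<^sub>i (|b\<^sub>i|/x)\<^sup>\<alpha> L(x/|b\<^sub>i|)\<close>.\<close>

definition norming_const :: "real \<Rightarrow> real measure \<Rightarrow> ('i \<Rightarrow> real) \<Rightarrow> real" where
  "norming_const \<alpha> \<mu> b =
     Inf {x. x \<ge> 1 \<and> (\<lambda>i. L_weight \<alpha> \<mu> (b i / x)) summable_on UNIV \<and>
             (\<Sum>\<^sub>\<infinity>i. L_weight \<alpha> \<mu> (b i / x)) \<le> 1}"

definition continuous_density :: "real measure \<Rightarrow> real \<Rightarrow> real" where
  "continuous_density \<nu> = (THE f. continuous_on UNIV f \<and> (\<forall>x. f x \<ge> 0) \<and>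
     \<nu> = density lborel (\<lambda>x. ennreal (f x)))"

text \<open>The law of \<open>c\<^sup>1\<^sup>/\<^sup>\<alpha> S' - (1 - c)\<^sup>1\<^sup>/\<^sup>\<alpha> S''\<close> for independent \<open>S'\<close>, \<open>S''\<close> with law \<open>G\<close>.\<close>

definition mixed_stable_law :: "real \<Rightarrow> real \<Rightarrow> real measure \<Rightarrow> real measure" where
  "mixed_stable_law \<alpha> c G =
     distr (G \<Otimes>\<^sub>M G) borel (\<lambda>(s', s''). c powr (1 / \<alpha>) * s' - (1 - c) powr (1 / \<alpha>) * s'')"

end

(*
Write W(t) = |t|^alpha L(1/|t|).  Up to a constant, x^2 W(1/x) is a truncated second moment, and
Karamata's theorem and Potter bounds make W regularly varying of index alpha.  An Abelian argument
turns the tail asymptotics of xi_0 into 1 - phi(t) ~ c_alpha W(t) (1 - i beta tau).  The constant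
B_n is the scale at which the weights W(b_ni / B_n) sum to 1, so taking the product over i shows
that phi_{S_n}(t / B_n) converges to the characteristic function of the limit law.  Since the b_ni
are bounded by sum |a_i|, non-lattice laws satisfy |phi(s)| <= exp(-k W(s)) at all relevant s, and
Potter's bound dominates |phi_{S_n}(t / B_n)| by exp(-k |t|^p) on |t| <= K B_n.  Hence the
convergence holds in L^1 on these growing intervals.  By Fourier inversion this is the local limit
theorem for test functions whose Fourier transform has compact support, and a compactly supported m
is approximated, with error e / (1 + x^2), by its convolution with a Fejer kernel.
*)

theory Submission
  imports Defs "HOL-Real_Asymp.Real_Asymp"
begin

section \<open>Regularly varying functions and oscillatory integrals\<close>

text \<open>Non-latticeness only makes the modulus of \<open>char \<mu>\<close> less than 1 at each
  point; at infinity it may come back to 1 in the limit. So the characteristic function of S_n is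
  controlled on |s| <= K for each fixed K and not on the whole line, and a general m cannot be
  inserted into the inversion formula. Replacing m by its smoothing costs B_n E 1/(1 + (S_n + u)^2),
  which has to be bounded uniformly in u: two Fejer kernels, one shifted by pi so that their zeros
  do not coincide, dominate a multiple of 1/(1 + x^2) and are themselves admissible test functions.
  The oscillatory integrals behind c_alpha converge only conditionally for alpha <= 1, so y^-alpha
  is written as a Laplace transform. At alpha = 2 the tail is of smaller order than the truncated
  moment, and a Taylor expansion takes over. The signs of the coefficients enter only through beta
  tau times the sum of sgn(c_ni) W(c_ni). Its limit kappa is all that distinguishes the two cases of
  the theorem, so one limit lemma serves both.\<close>

lemma le_power_mult: "0 < c \<Longrightarrow> c \<le> x \<Longrightarrow> c \<le> 2 ^ n * (x::real)"
proof -
  assume "0 < c" "c \<le> x"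
  moreover have "1 * x \<le> 2 ^ n * x" by (rule mult_right_mono) (use calculation in auto)
  ultimately show ?thesis by linarith
qed

text \<open>The doubling ratio is iterated along 2^n x, and \<open>loc\<close> bridges the gap from
  the last dyadic point to y; it stands in for the uniform convergence theorem. The bound holds from
  \<open>x1\<close> on although the ratio is under control only from \<open>x0\<close> on: finitely
  many uncontrolled doublings are paid for with \<open>D\<close>.\<close>

lemma potter_upper:
  fixes f :: "real \<Rightarrow> real"
  assumes x1: "0 < x1" and pos: "\<And>x. x1 \<le> x \<Longrightarrow> 0 < f x"
    and lim: "((\<lambda>x. f (2 * x) / f x) \<longlongrightarrow> 2 powr \<rho>) at_top" and \<sigma>: "\<rho> < \<sigma>"
    and loc: "\<And>x y. x1 \<le> x \<Longrightarrow> x \<le> y \<Longrightarrow> y \<le> 2 * x \<Longrightarrow> f y \<le> D * f x"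
  shows "\<exists>C>0. \<forall>x y. x1 \<le> x \<longrightarrow> x \<le> y \<longrightarrow> f y \<le> C * (y / x) powr \<sigma> * f x"
proof -
  have D: "1 \<le> D" using loc[of x1 x1] pos[of x1] x1 by simp
  have "\<forall>\<^sub>F x in at_top. f (2 * x) / f x < 2 powr \<sigma>"
    by (rule order_tendstoD(2)[OF lim]) (use \<sigma> in simp)
  then obtain x0 where x0: "\<And>x. x0 \<le> x \<Longrightarrow> f (2 * x) / f x < 2 powr \<sigma>"
    by (auto simp: eventually_at_top_linorder)
  \<comment> \<open>After \<open>N\<close> doublings every starting point x >= \<open>x1\<close> has
    passed \<open>x0\<close>. The constant \<open>E\<close> below absorbs the cost of these first
    steps.\<close>
  obtain N :: nat where N: "x0 / x1 \<le> 2 ^ N"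
    using real_arch_pow[of 2 "x0 / x1"] by (auto intro: less_imp_le)
  define E where "E = (1 + D / 2 powr \<sigma>) ^ N"
  have E0: "1 \<le> E" unfolding E_def using D by (intro one_le_power) auto
  have step: "f (2 ^ n * x) \<le> E * (2 powr \<sigma>) ^ n * f x" if x: "x1 \<le> x" for n :: nat and x
  proof (cases "n \<le> N")
    case True
    have "f (2 ^ n * x) \<le> D ^ n * f x"
    proof (induction n)
      case (Suc n)
      have *: "x1 \<le> 2 ^ n * x" by (rule le_power_mult[OF x1 x])
      have "f (2 ^ Suc n * x) \<le> D * f (2 ^ n * x)"
        using loc[OF *, of "2 ^ Suc n * x"] x x1 by (simp add: mult.assoc)
      also have "\<dots> \<le> D * (D ^ n * f x)" using Suc D by (intro mult_left_mono) auto
      finally show ?case by simp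
    qed simp
    also have "D ^ n = (D / 2 powr \<sigma>) ^ n * (2 powr \<sigma>) ^ n" by (simp add: power_divide)
    also have "(D / 2 powr \<sigma>) ^ n \<le> (1 + D / 2 powr \<sigma>) ^ n" using D by (intro power_mono) auto
    also have "\<dots> \<le> E" unfolding E_def using True D by (intro power_increasing) auto
    finally show ?thesis using pos[OF x] by (simp add: mult_right_mono)
  next
    case False
    then have "N \<le> n" by simp
    then show ?thesis
    proof (induction n rule: dec_induct)
      case base
      have "f (2 ^ N * x) \<le> D ^ N * f x"
      proof (induction N)
        case (Suc n)
        have *: "x1 \<le> 2 ^ n * x" by (rule le_power_mult[OF x1 x])
        have "f (2 ^ Suc n * x) \<le> D * f (2 ^ n * x)"
          using loc[OF *, of "2 ^ Suc n * x"] x x1 by (simp add: mult.assoc)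
        also have "\<dots> \<le> D * (D ^ n * f x)" using Suc D by (intro mult_left_mono) auto
        finally show ?case by simp
      qed simp
      also have "D ^ N = (D / 2 powr \<sigma>) ^ N * (2 powr \<sigma>) ^ N" by (simp add: power_divide)
      also have "(D / 2 powr \<sigma>) ^ N \<le> E" unfolding E_def using D by (intro power_mono) auto
      finally show ?case using pos[OF x] by (simp add: mult_right_mono)
    next
      case (step n)
      have "x0 \<le> 2 ^ N * x1" using N x1 by (simp add: field_simps)
      also have "\<dots> \<le> 2 ^ n * x" using step x x1 by (intro mult_mono power_increasing) auto
      finally have a: "f (2 * (2 ^ n * x)) / f (2 ^ n * x) < 2 powr \<sigma>" by (rule x0)
      have *: "x1 \<le> 2 ^ n * x" by (rule le_power_mult[OF x1 x])
      have "f (2 ^ Suc n * x) \<le> 2 powr \<sigma> * f (2 ^ n * x)"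
        using a pos[OF *] by (simp add: field_simps)
      also have "\<dots> \<le> 2 powr \<sigma> * (E * (2 powr \<sigma>) ^ n * f x)"
        using step by (intro mult_left_mono) auto
      finally show ?case by (simp add: mult_ac)
    qed
  qed
  define C where "C = D * E * 2 powr \<bar>\<sigma>\<bar>"
  have "C > 0" using D E0 by (simp add: C_def)
  moreover have "f y \<le> C * (y / x) powr \<sigma> * f x" if x: "x1 \<le> x" and xy: "x \<le> y" for x y
  proof -
    have xp: "0 < x" using x x1 by simp
    have yx: "1 \<le> y / x" using xy xp by simp
    define n where "n = nat \<lfloor>log 2 (y / x)\<rfloor>"
    have l0: "0 \<le> log 2 (y / x)" using yx by simp
    have n1: "real n \<le> log 2 (y / x)" unfolding n_def using l0 by simp
    have n2: "log 2 (y / x) < real n + 1" unfolding n_def using l0 by linarith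
    have a1: "2 powr real n \<le> y / x"
      using n1 yx by (subst (asm) le_log_iff) auto
    have a2: "y / x < 2 powr (real n + 1)"
      using n2 yx by (subst (asm) log_less_iff) auto
    have b1: "2 ^ n * x \<le> y" using a1 xp by (simp add: powr_realpow field_simps)
    have b2: "y \<le> 2 * (2 ^ n * x)" using a2 xp by (simp add: powr_realpow powr_add field_simps)
    have *: "x1 \<le> 2 ^ n * x" by (rule le_power_mult[OF x1 x])
    have "f y \<le> D * f (2 ^ n * x)" by (rule loc[OF * b1 b2])
    also have "\<dots> \<le> D * (E * (2 powr \<sigma>) ^ n * f x)"
      using step[OF x] D by (intro mult_left_mono) auto
    also have "(2 powr \<sigma>) ^ n = (2 powr real n) powr \<sigma>"
      by (simp add: powr_powr powr_realpow[symmetric] mult.commute)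
    \<comment> \<open>The quotient y / x lies between 2^n and 2^(n+1). For negative
      \<open>\<sigma>\<close> the comparison has to go through the upper end, which costs 2 to the
      power |sigma|.\<close>
    also have "\<dots> \<le> 2 powr \<bar>\<sigma>\<bar> * (y / x) powr \<sigma>"
    proof (cases "\<sigma> \<ge> 0")
      case True
      have "(2 powr real n) powr \<sigma> \<le> (y / x) powr \<sigma>" using a1 True by (intro powr_mono2) auto
      also have "\<dots> \<le> 2 powr \<bar>\<sigma>\<bar> * (y / x) powr \<sigma>"
        by (simp add: mult_le_cancel_right1 ge_one_powr_ge_zero)
      finally show ?thesis .
    next
      case False
      have "(2 powr real n) powr \<sigma> = 2 powr (-\<sigma>) * (2 powr (real n + 1)) powr \<sigma>"
        by (simp add: powr_powr powr_add[symmetric] algebra_simps)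
      also have "(2 powr (real n + 1)) powr \<sigma> \<le> (y / x) powr \<sigma>"
        using a2 yx False by (intro powr_mono2') auto
      finally show ?thesis using False by simp
    qed
    finally have "f y \<le> D * (E * (2 powr \<bar>\<sigma>\<bar> * (y / x) powr \<sigma>) * f x)"
      using D E0 pos[OF x] by (simp add: mult_left_mono mult_right_mono)
    then show ?thesis by (simp add: C_def mult_ac)
  qed
  ultimately show ?thesis by blast
qed

section \<open>Oscillatory integrals against powers, evaluated through Laplace transforms\<close>

definition mellin_int :: "real \<Rightarrow> real" where
  "mellin_int s = (LBINT u:{0<..}. u powr (s - 1) / (1 + u\<^sup>2))"

text \<open>The substitution t = u^2 / (1 + u^2), called \<open>g\<close> below, turns the integral
  into half of Beta(s/2, 1 - s/2). The reflection formula of the Gamma function then produces the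
  sine.\<close>

lemma mellin_int:
  assumes s: "0 < s" "s < 2"
  shows set_integrable_mellin: "set_integrable lborel {0<..} (\<lambda>u. u powr (s - 1) / (1 + u\<^sup>2))"
    and mellin_int_eq: "mellin_int s = (pi / 2) / sin (pi * s / 2)"
proof -
  define g where "g u = u\<^sup>2 / (1 + u\<^sup>2)" for u :: real
  define g' where "g' u = 2 * u / (1 + u\<^sup>2)\<^sup>2" for u :: real
  define F where "F t = t powr (s/2 - 1) * (1 - t) powr ((1 - s/2) - 1)" for t :: real
  have np: "1 + u\<^sup>2 > 0" for u :: real by (simp add: add_pos_nonneg)
  have np': "1 + u\<^sup>2 \<noteq> 0" for u :: real using np[of u] by linarith
  have der: "(g has_field_derivative g' u) (at u within {0<..})" for u
    unfolding g_def g'_def using np'[of u]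
    by (auto intro!: derivative_eq_intros simp: field_simps power2_eq_square)
  have inj: "inj_on g {0<..}"
  proof (rule inj_onI)
    fix x y :: real assume xy: "x \<in> {0<..}" "y \<in> {0<..}" "g x = g y"
    then have "x\<^sup>2 * (1 + y\<^sup>2) = y\<^sup>2 * (1 + x\<^sup>2)"
      using np'[of x] np'[of y] by (simp add: g_def frac_eq_eq)
    then have "x\<^sup>2 = y\<^sup>2" by (simp add: algebra_simps)
    then show "x = y" using xy by (simp add: power2_eq_iff)
  qed
  have img: "g ` {0<..} = {0<..<1}"
  proof safe
    fix u :: real assume "0 < u"
    then show "g u \<in> {0<..<1}" using np[of u] by (simp add: g_def)
  next
    fix t :: real assume t: "t \<in> {0<..<1}"
    have "1 + t / (1 - t) = 1 / (1 - t)" using t by (simp add: field_simps)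
    then have "g (sqrt (t / (1 - t))) = t" using t by (simp add: g_def)
    moreover have "sqrt (t / (1 - t)) > 0" using t by simp
    ultimately show "t \<in> g ` {0<..}" by (metis greaterThan_iff image_eqI)
  qed
  have e: "\<bar>g' u\<bar> * F (g u) = 2 * (u powr (s - 1) / (1 + u\<^sup>2))" if u: "0 < u" for u
  proof -
    have "1 - g u = 1 / (1 + u\<^sup>2)" using np'[of u] by (simp add: g_def field_simps)
    moreover have "u\<^sup>2 powr (s/2 - 1) = u powr (s - 2)"
    proof -
      have "u\<^sup>2 = u powr 2" using u by simp
      then have "u\<^sup>2 powr (s/2 - 1) = u powr (2 * (s/2 - 1))" by (simp only: powr_powr)
      then show ?thesis by (simp add: algebra_simps)
    qed
    ultimately have "F (g u) = u powr (s - 2) / (1 + u\<^sup>2) powr (s/2 - 1) * (1 / (1 + u\<^sup>2)) powr (- s/2)"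
      using u np[of u] by (simp add: F_def g_def powr_divide)
    also have "(1 / (1 + u\<^sup>2)) powr (- s/2) = (1 + u\<^sup>2) powr (s / 2)"
      using np[of u] by (simp add: powr_minus_divide powr_divide)
    also have "\<dots> = (1 + u\<^sup>2) powr (s / 2 - 1) * (1 + u\<^sup>2)"
      using np[of u] powr_add[of "1 + u\<^sup>2" "s/2 - 1" 1] by simp
    finally have "F (g u) = u powr (s - 2) * (1 + u\<^sup>2)" using np'[of u] np[of u] by simp
    moreover have "u powr (s - 1) = u powr (s - 2) * u" using u powr_add[of u "s - 2" 1] by simp
    moreover have "\<bar>g' u\<bar> = g' u" using u by (simp add: g'_def)
    ultimately show ?thesis using np'[of u]
      by (simp add: g'_def divide_simps) (simp add: algebra_simps power2_eq_square)
  qed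
  have B: "(F has_integral Beta (s/2) (1 - s/2)) {0..1}"
    unfolding F_def using s by (intro has_integral_Beta_real) auto
  have B': "(F has_integral Beta (s/2) (1 - s/2)) {0<..<1}"
    using has_integral_open_interval[of F "Beta (s/2) (1 - s/2)" 0 1] B by simp
  have abs: "F absolutely_integrable_on {0<..<1}"
    by (rule nonnegative_absolutely_integrable_1) (use B' in \<open>auto simp: F_def integrable_on_def\<close>)
  have "F absolutely_integrable_on (g ` {0<..}) \<and> integral (g ` {0<..}) F = Beta (s/2) (1 - s/2)"
    using abs B' unfolding img by (auto dest: integral_unique)
  then have **: "(\<lambda>u. \<bar>g' u\<bar> * F (g u)) absolutely_integrable_on {0<..}"
      "integral {0<..} (\<lambda>u. \<bar>g' u\<bar> * F (g u)) = Beta (s/2) (1 - s/2)"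
    using has_absolute_integral_change_of_variables_1'[of "{0<..}" g g' F] der inj by auto
  have h: "((\<lambda>u. \<bar>g' u\<bar> * F (g u)) has_integral Beta (s/2) (1 - s/2)) {0<..}"
    using **(1) **(2) has_integral_iff set_lebesgue_integral_eq_integral(1) by blast
  have h2: "((\<lambda>u. (1/2) * (\<bar>g' u\<bar> * F (g u))) has_integral (1/2) * Beta (s/2) (1 - s/2)) {0<..}"
    by (rule has_integral_mult_right[OF h])
  have h3: "((\<lambda>u. u powr (s - 1) / (1 + u\<^sup>2)) has_integral Beta (s/2) (1 - s/2) / 2) {0<..}"
    using has_integral_eq[OF _ h2, of "\<lambda>u. u powr (s - 1) / (1 + u\<^sup>2)"] e by simp
  have si: "(\<lambda>u. u powr (s - 1) / (1 + u\<^sup>2)) absolutely_integrable_on {0<..}"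
    by (rule nonnegative_absolutely_integrable_1) (use h3 in \<open>auto simp: integrable_on_def\<close>)
  then show I: "set_integrable lborel {0<..} (\<lambda>u. u powr (s - 1) / (1 + u\<^sup>2))"
    unfolding set_integrable_def by (subst (asm) integrable_completion) auto
  have "mellin_int s = integral {0<..} (\<lambda>u. u powr (s - 1) / (1 + u\<^sup>2))"
    unfolding mellin_int_def by (rule set_borel_integral_eq_integral(2)[OF I])
  also have "\<dots> = Beta (s/2) (1 - s/2) / 2" using h3 by (rule integral_unique)
  also have "Beta (s/2) (1 - s/2) = pi / sin (pi * (s/2))"
  proof -
    have "complex_of_real (Gamma (s/2) * Gamma (1 - s/2)) = Gamma (of_real (s/2)) * Gamma (1 - of_real (s/2))"
      by (metis Gamma_complex_of_real of_real_1 of_real_diff of_real_mult)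
    also have "\<dots> = of_real (pi / sin (pi * (s/2)))"
      unfolding Gamma_reflection_complex by (simp add: sin_of_real[symmetric])
    finally show ?thesis by (simp only: of_real_eq_iff Beta_def) simp
  qed
  finally show "mellin_int s = (pi / 2) / sin (pi * s / 2)" by simp
qed

lemma has_bochner_integral_powr_exp:
  fixes \<alpha> y :: real
  assumes a: "0 < \<alpha>" and y: "0 < y"
  shows "has_bochner_integral lborel (\<lambda>u. indicator {0<..} u * (u powr (\<alpha> - 1) * exp (- (u * y))))
    (Gamma \<alpha> * y powr - \<alpha>)"
proof -
  define f where "f u = indicator {0<..} u * (u powr (\<alpha> - 1) * exp (- u))" for u :: real
  have "((\<lambda>t. t powr (\<alpha> - 1) / exp t) has_integral Gamma \<alpha>) {0..}"
    by (rule Gamma_integral_real[OF a])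
  then have h: "((\<lambda>t. if t \<in> {0..} then t powr (\<alpha> - 1) / exp t else 0) has_integral Gamma \<alpha>) UNIV"
    by (subst has_integral_restrict_UNIV)
  have [measurable]: "f \<in> borel_measurable borel" unfolding f_def by measurable
  have "(f has_integral Gamma \<alpha>) UNIV"
    by (rule has_integral_spike[OF _ _ h, of "{0}"]) (auto simp: f_def indicator_def exp_minus field_simps)
  moreover have "0 \<le> f u" for u by (simp add: f_def indicator_def)
  ultimately have "has_bochner_integral lborel f (Gamma \<alpha>)"
    using Gamma_real_pos[OF a]
    by (intro has_bochner_integral_nn_integral nn_integral_has_integral_lborel) auto
  then have "has_bochner_integral lborel (\<lambda>u. f (0 + y * u)) (Gamma \<alpha> /\<^sub>R \<bar>y\<bar>)"
    using lborel_has_bochner_integral_real_affine_iff[of y f "Gamma \<alpha>" 0] y by simp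
  from has_bochner_integral_mult_right[OF this, of "y powr (1 - \<alpha>)"]
  have "has_bochner_integral lborel (\<lambda>u. y powr (1 - \<alpha>) * f (0 + y * u)) (y powr (1 - \<alpha>) * (Gamma \<alpha> /\<^sub>R \<bar>y\<bar>))"
    by simp
  also have "(\<lambda>u. y powr (1 - \<alpha>) * f (0 + y * u)) = (\<lambda>u. indicator {0<..} u * (u powr (\<alpha> - 1) * exp (- (u * y))))"
  proof
    fix u :: real
    have "y powr (1 - \<alpha>) * y powr (\<alpha> - 1) = 1" using y by (simp add: powr_add[symmetric])
    then show "y powr (1 - \<alpha>) * f (0 + y * u) = indicator {0<..} u * (u powr (\<alpha> - 1) * exp (- (u * y)))"
      using y by (auto simp: f_def indicator_def powr_mult mult_ac zero_less_mult_iff)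
  qed
  also have "y powr (1 - \<alpha>) * (Gamma \<alpha> /\<^sub>R \<bar>y\<bar>) = Gamma \<alpha> * y powr - \<alpha>"
  proof -
    have "y powr (1 - \<alpha>) = y powr (-\<alpha>) * y" using y powr_add[of y "-\<alpha>" 1] by simp
    then show ?thesis using y by (simp add: field_simps)
  qed
  finally show ?thesis .
qed

text \<open>Fubini, after writing \<open>y\<^bsup>-\<alpha>\<^esup>\<close> as a Laplace transform.\<close>

lemma integral_mult_powr_eq_Laplace:
  fixes h :: "real \<Rightarrow> real" and \<alpha> :: real
  assumes a: "0 < \<alpha>" and [measurable]: "h \<in> borel_measurable borel" "A \<in> sets borel"
    and A: "A \<subseteq> {0<..}" and int: "set_integrable lborel A (\<lambda>y. h y * y powr - \<alpha>)"
  shows "(LBINT y:A. h y * y powr - \<alpha>) =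
    (1 / Gamma \<alpha>) * (LBINT u:{0<..}. u powr (\<alpha> - 1) * (LBINT y:A. h y * exp (- (u * y))))"
proof -
  have Ap: "0 < y" if "y \<in> A" for y using A that by auto
  define F where "F = (\<lambda>(y, u). indicator A y * h y * (indicator {0<..} u * (u powr (\<alpha> - 1) * exp (- (u * y)))))"
  have [measurable]: "F \<in> borel_measurable (borel \<Otimes>\<^sub>M borel)" unfolding F_def by measurable
  have G: "has_bochner_integral lborel (\<lambda>u. F (y, u)) (indicator A y * h y * (Gamma \<alpha> * y powr - \<alpha>))" for y
  proof (cases "y \<in> A")
    case True
    then show ?thesis unfolding F_def prod.case
      by (intro has_bochner_integral_mult_right has_bochner_integral_powr_exp a Ap)
  next
    case False
    then show ?thesis by (simp add: F_def has_bochner_integral_zero)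
  qed
  have G': "has_bochner_integral lborel (\<lambda>u. norm (F (y, u))) (\<bar>indicator A y * h y\<bar> * (Gamma \<alpha> * y powr - \<alpha>))" for y
  proof (cases "y \<in> A")
    case True
    then show ?thesis unfolding F_def prod.case norm_mult
      by (simp only: abs_mult[symmetric] real_norm_def)
         (subst abs_mult, subst (2) abs_of_nonneg,
           auto intro!: has_bochner_integral_mult_right has_bochner_integral_powr_exp a simp: Ap)
  next
    case False
    then show ?thesis by (simp add: F_def has_bochner_integral_zero)
  qed
  have int2: "integrable (lborel \<Otimes>\<^sub>M lborel) F"
  proof (rule lborel_pair.Fubini_integrable)
    have "integrable lborel (\<lambda>y. Gamma \<alpha> * norm (indicator A y *\<^sub>R (h y * y powr - \<alpha>)))"
      using int unfolding set_integrable_def by (intro integrable_mult_right integrable_norm)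
    also have "(\<lambda>y. Gamma \<alpha> * norm (indicator A y *\<^sub>R (h y * y powr - \<alpha>))) = (\<lambda>y. LBINT u. norm (F (y, u)))"
      using G'[THEN has_bochner_integral_integral_eq] by (auto simp: abs_mult mult_ac)
    finally show "integrable lborel (\<lambda>y. LBINT u. norm (F (y, u)))" .
    show "AE y in lborel. integrable lborel (\<lambda>u. F (y, u))"
      using G by (auto intro: integrable.intros)
  qed auto
  have "Gamma \<alpha> * (LBINT y:A. h y * y powr - \<alpha>) = (LBINT y. LBINT u. F (y, u))"
    using G[THEN has_bochner_integral_integral_eq]
    by (simp add: set_lebesgue_integral_def mult_ac flip: Bochner_Integration.integral_mult_right_zero)
  also have "\<dots> = (LBINT u. LBINT y. F (y, u))"
    using lborel_pair.Fubini_integral[of "\<lambda>y u. F (y, u)"] int2 by simp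
  also have "\<dots> = (LBINT u:{0<..}. u powr (\<alpha> - 1) * (LBINT y:A. h y * exp (- (u * y))))"
    unfolding set_lebesgue_integral_def
    by (intro Bochner_Integration.integral_cong refl)
       (use A in \<open>auto simp: F_def mult_ac indicator_def subset_eq simp flip: Bochner_Integration.integral_mult_right_zero\<close>)
  finally show ?thesis using Gamma_real_pos[OF a] by (simp add: field_simps)
qed

lemma set_integrable_powr_Ioc:
  fixes a K :: real
  assumes "-1 < a"
  shows "set_integrable lborel {0<..K} (\<lambda>y. y powr a)"
proof (cases "0 \<le> K")
  case True
  have "(\<lambda>y. y powr a) integrable_on {0..K}"
    by (rule integrable_on_powr_from_0) (use assms True in auto)
  then have "(\<lambda>y. y powr a) absolutely_integrable_on {0..K}"
    by (subst absolutely_integrable_on_iff_nonneg) auto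
  then have "set_integrable lborel {0..K} (\<lambda>y. y powr a)"
    unfolding set_integrable_def by (subst (asm) integrable_completion) auto
  then show ?thesis by (rule set_integrable_subset) auto
qed (simp add: set_integrable_def)

lemma set_integrable_mult_powr_Ioc:
  fixes h :: "real \<Rightarrow> real"
  assumes [measurable]: "h \<in> borel_measurable borel" and p: "\<alpha> < p"
    and bd: "\<And>y. 0 < y \<Longrightarrow> y \<le> K \<Longrightarrow> \<bar>h y\<bar> \<le> c * y powr (p - 1)"
  shows "set_integrable lborel {0<..K} (\<lambda>y. h y * y powr - \<alpha>)"
proof (rule set_integrable_bound)
  show "set_integrable lborel {0<..K} (\<lambda>y. c * y powr (p - 1 - \<alpha>))"
    by (intro set_integrable_mult_right set_integrable_powr_Ioc) (use p in auto)
  show "AE y in lborel. y \<in> {0<..K} \<longrightarrow> norm (h y * y powr - \<alpha>) \<le> norm (c * y powr (p - 1 - \<alpha>))"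
  proof (intro AE_I2 impI)
    fix y assume y: "y \<in> {0<..K}"
    have "\<bar>h y\<bar> * y powr - \<alpha> \<le> (c * y powr (p - 1)) * y powr - \<alpha>"
      using y by (intro mult_right_mono bd) auto
    also have "\<dots> = c * y powr (p - 1 - \<alpha>)" by (simp add: powr_diff powr_minus divide_inverse)
    finally show "norm (h y * y powr - \<alpha>) \<le> norm (c * y powr (p - 1 - \<alpha>))"
      using abs_ge_self[of c] by (simp add: abs_mult) (meson mult_right_mono order_trans powr_ge_zero)
  qed
qed (simp add: set_borel_measurable_def)

lemma tendsto_integral_mult_powr:
  fixes h :: "real \<Rightarrow> real" and \<alpha> :: real
  assumes a: "0 < \<alpha>" and [measurable]: "h \<in> borel_measurable borel" "Hinf \<in> borel_measurable borel"
      "\<And>K. H K \<in> borel_measurable borel"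
    and int: "\<And>K. set_integrable lborel {0<..K} (\<lambda>y. h y * y powr - \<alpha>)"
    and H: "\<And>K u. 1 \<le> K \<Longrightarrow> 0 < u \<Longrightarrow> (LBINT y:{0<..K}. h y * exp (- (u * y))) = H K u"
    and lim: "\<And>u. 0 < u \<Longrightarrow> ((\<lambda>K. H K u) \<longlongrightarrow> Hinf u) at_top"
    and bd: "\<And>K u. 1 \<le> K \<Longrightarrow> 0 < u \<Longrightarrow> \<bar>H K u\<bar> \<le> w u"
    and w: "set_integrable lborel {0<..} (\<lambda>u. u powr (\<alpha> - 1) * w u)"
  shows "((\<lambda>K. LBINT y:{0<..K}. h y * y powr - \<alpha>) \<longlongrightarrow>
     (1 / Gamma \<alpha>) * (LBINT u:{0<..}. u powr (\<alpha> - 1) * Hinf u)) at_top"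
proof -
  have "((\<lambda>K. LBINT u:{0<..}. u powr (\<alpha> - 1) * H K u) \<longlongrightarrow> (LBINT u:{0<..}. u powr (\<alpha> - 1) * Hinf u)) at_top"
    unfolding set_lebesgue_integral_def
  proof (rule integral_dominated_convergence_at_top)
    show "integrable lborel (\<lambda>u. indicator {0<..} u *\<^sub>R (u powr (\<alpha> - 1) * w u))"
      using w by (simp add: set_integrable_def)
    show "AE u in lborel. ((\<lambda>K. indicator {0<..} u *\<^sub>R (u powr (\<alpha> - 1) * H K u)) \<longlongrightarrow>
        indicator {0<..} u *\<^sub>R (u powr (\<alpha> - 1) * Hinf u)) at_top"
      by (intro AE_I2) (auto simp: indicator_def intro!: tendsto_intros lim)
    show "\<forall>\<^sub>F K in at_top. AE u in lborel. norm (indicator {0<..} u *\<^sub>R (u powr (\<alpha> - 1) * H K u))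
        \<le> indicator {0<..} u *\<^sub>R (u powr (\<alpha> - 1) * w u)"
      using eventually_ge_at_top[of 1]
      by eventually_elim (auto simp: indicator_def abs_mult intro!: AE_I2 mult_left_mono bd)
  qed auto
  then have l: "((\<lambda>K. (1 / Gamma \<alpha>) * (LBINT u:{0<..}. u powr (\<alpha> - 1) * H K u)) \<longlongrightarrow>
      (1 / Gamma \<alpha>) * (LBINT u:{0<..}. u powr (\<alpha> - 1) * Hinf u)) at_top"
    by (intro tendsto_intros)
  have ev: "\<forall>\<^sub>F K in at_top. (1 / Gamma \<alpha>) * (LBINT u:{0<..}. u powr (\<alpha> - 1) * H K u) =
      (LBINT y:{0<..K}. h y * y powr - \<alpha>)"
    using eventually_ge_at_top[of 1]
  proof eventually_elim
    case (elim K)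
    have "(LBINT y:{0<..K}. h y * y powr - \<alpha>) = (1 / Gamma \<alpha>) *
        (LBINT u:{0<..}. u powr (\<alpha> - 1) * (LBINT y:{0<..K}. h y * exp (- (u * y))))"
      by (rule integral_mult_powr_eq_Laplace[OF a _ _ _ int]) auto
    also have "(LBINT u:{0<..}. u powr (\<alpha> - 1) * (LBINT y:{0<..K}. h y * exp (- (u * y)))) =
       (LBINT u:{0<..}. u powr (\<alpha> - 1) * H K u)"
      by (intro set_lebesgue_integral_cong) (auto simp: H elim)
    finally show ?case by simp
  qed
  show ?thesis by (rule Lim_transform_eventually[OF l ev])
qed

lemma integral_exp_sin_Ioc:
  assumes "0 \<le> (K::real)"
  shows "(LBINT y:{0<..K}. sin y * exp (- (u * y))) =
    (1 - exp (- (u * K)) * (u * sin K + cos K)) / (1 + u\<^sup>2)"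
  using LBINT_I0c_exp_mscale_sin[where u=u and t=K] interval_integral_Ioc[of 0 K "\<lambda>x. exp (- (u * x)) * sin x"] assms
  by (simp add: zero_ereal_def mult.commute)

lemma integral_exp_cos_Ioc:
  assumes "0 \<le> (K::real)"
  shows "(LBINT y:{0<..K}. cos y * exp (- (u * y))) =
    (u - exp (- (u * K)) * (u * cos K - sin K)) / (1 + u\<^sup>2)" (is "_ = ?F K")
proof -
  have np: "1 + u\<^sup>2 \<noteq> 0" by (metis add_pos_nonneg less_numeral_extra(3) zero_le_power2 zero_less_one)
  have "(LBINT y=ereal 0..ereal K. cos y * exp (- (u * y))) = ?F K - ?F 0"
  proof (rule interval_integral_FTC_finite)
    fix x
    have "((\<lambda>K. u - exp (- (u * K)) * (u * cos K - sin K)) has_real_derivative cos x * exp (- (u * x)) * (1 + u\<^sup>2))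
        (at x within {min 0 K..max 0 K})"
      by (auto intro!: derivative_eq_intros simp: algebra_simps power2_eq_square)
    from DERIV_cdivide[OF this, of "1 + u\<^sup>2"]
    show "(?F has_vector_derivative cos x * exp (- (u * x))) (at x within {min 0 K..max 0 K})"
      using np by (simp add: has_real_derivative_iff_has_vector_derivative)
  qed (auto intro!: continuous_intros)
  then show ?thesis using interval_integral_Ioc[of 0 K "\<lambda>x. cos x * exp (- (u * x))"] assms
    by simp
qed

lemma integral_exp_Ioc:
  assumes "0 \<le> (K::real)" "u \<noteq> 0"
  shows "(LBINT y:{0<..K}. exp (- (u * y))) = (1 - exp (- (u * K))) / u" (is "_ = ?F K")
proof -
  have "(LBINT y=ereal 0..ereal K. exp (- (u * y))) = ?F K - ?F 0"
  proof (rule interval_integral_FTC_finite)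
    show "(?F has_vector_derivative exp (- (u * x))) (at x within {min 0 K..max 0 K})" for x
      using assms by (auto intro!: derivative_eq_intros
             simp: has_real_derivative_iff_has_vector_derivative[symmetric] power2_eq_square field_simps)
  qed (auto intro!: continuous_intros)
  then show ?thesis using interval_integral_Ioc[of 0 K "\<lambda>x. exp (- (u * x))"] assms
    by simp
qed

lemma mult_exp_neg_le_one: "0 \<le> u \<Longrightarrow> u * exp (- u) \<le> (1::real)"
  using exp_ge_add_one_self[of u] by (simp add: exp_minus field_simps del: exp_ge_add_one_self)

lemma abs_mult_add_le:
  fixes u :: real
  assumes "0 < u" "\<bar>c\<bar> \<le> 1" "\<bar>s\<bar> \<le> 1"
  shows "\<bar>u * s + c\<bar> \<le> u + 1"
proof -
  have "\<bar>u * s + c\<bar> \<le> \<bar>u * s\<bar> + \<bar>c\<bar>" by (rule abs_triangle_ineq)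
  also have "\<bar>u * s\<bar> \<le> u * 1" unfolding abs_mult using assms by (intro mult_mono) auto
  finally show ?thesis using assms by linarith
qed

text \<open>For K >= 1 the exponential is at most exp(-u), and u exp(-u) <= 1. So the boundary term
  at K is bounded uniformly in K and u, which yields the majorants \<open>w\<close> for the sine and
  cosine integrals.\<close>

lemma abs_exp_mult_le:
  fixes u :: real
  assumes "1 \<le> K" "0 < u" "\<bar>c\<bar> \<le> 1" "\<bar>s\<bar> \<le> 1"
  shows "\<bar>exp (- (u * K)) * (u * s + c)\<bar> \<le> 2"
proof -
  have e: "exp (- (u * K)) \<le> exp (- u)" using assms by simp
  have "\<bar>exp (- (u * K)) * (u * s + c)\<bar> = exp (- (u * K)) * \<bar>u * s + c\<bar>" by (simp add: abs_mult)
  also have "\<dots> \<le> exp (- u) * (u * 1 + 1)"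
    using abs_mult_add_le[of u c s] assms by (intro mult_mono[OF e]) auto
  also have "\<dots> \<le> 2" using mult_exp_neg_le_one[of u] assms exp_le_one_iff[of "-u"] by (simp add: algebra_simps del: exp_le_one_iff)
  finally show ?thesis .
qed

lemma exp_mult_tendsto_0:
  fixes u :: real
  assumes "0 < u" "\<And>K. \<bar>f K\<bar> \<le> B"
  shows "((\<lambda>K. exp (- (u * K)) * f K) \<longlongrightarrow> 0) at_top"
proof (rule Lim_null_comparison)
  show "\<forall>\<^sub>F K in at_top. norm (exp (- (u * K)) * f K) \<le> exp (- (u * K)) * B"
    using assms by (auto simp: abs_mult intro!: always_eventually)
  have "((\<lambda>K. exp (- (u * K)) * B) \<longlongrightarrow> 0 * B) at_top"
    by (intro tendsto_intros) (use assms(1) in real_asymp)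
  then show "((\<lambda>K. exp (- (u * K)) * B) \<longlongrightarrow> 0) at_top" by simp
qed

lemma one_plus_sq_pos: "0 < 1 + (u::real)\<^sup>2"
  by (simp add: add_pos_nonneg)

text \<open>The Laplace integral of the sine tends to 1 / (1 + u^2). In the majorant the numerator 3
  is 1 plus the bound 2 for the boundary term.\<close>

lemma tendsto_integral_sin_powr:
  assumes a: "0 < \<alpha>" "\<alpha> < 2"
  shows "((\<lambda>K. LBINT y:{0<..K}. sin y * y powr - \<alpha>) \<longlongrightarrow> mellin_int \<alpha> / Gamma \<alpha>) at_top"
proof -
  have "((\<lambda>K. LBINT y:{0<..K}. sin y * y powr - \<alpha>) \<longlongrightarrow>
     (1 / Gamma \<alpha>) * (LBINT u:{0<..}. u powr (\<alpha> - 1) * (1 / (1 + u\<^sup>2)))) at_top"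
  proof (rule tendsto_integral_mult_powr[OF a(1), where H = "\<lambda>K u. (1 - exp (- (u * K)) * (u * sin K + cos K)) / (1 + u\<^sup>2)"
         and w = "\<lambda>u. 3 / (1 + u\<^sup>2)"])
    show "set_integrable lborel {0<..K} (\<lambda>y. sin y * y powr - \<alpha>)" for K :: real
      by (rule set_integrable_mult_powr_Ioc[where p = 2 and c = 1])
         (use a in \<open>auto simp: abs_sin_x_le_abs_x[THEN order_trans]\<close>)
    show "(LBINT y:{0<..K}. sin y * exp (- (u * y))) = (1 - exp (- (u * K)) * (u * sin K + cos K)) / (1 + u\<^sup>2)"
      if "1 \<le> K" for K u :: real using integral_exp_sin_Ioc[of K u] that by simp
    show "((\<lambda>K. (1 - exp (- (u * K)) * (u * sin K + cos K)) / (1 + u\<^sup>2)) \<longlongrightarrow> 1 / (1 + u\<^sup>2)) at_top" if u: "0 < u" for u :: real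
    proof -
      have "\<bar>u * sin K + cos K\<bar> \<le> u + 1" for K :: real
        using abs_mult_add_le[OF u, of "cos K" "sin K"] by simp
      from exp_mult_tendsto_0[OF u this]
      have "((\<lambda>K. (1 - exp (- (u * K)) * (u * sin K + cos K)) / (1 + u\<^sup>2)) \<longlongrightarrow> (1 - 0) / (1 + u\<^sup>2)) at_top"
        using one_plus_sq_pos[of u] by (intro tendsto_intros) auto
      then show ?thesis by simp
    qed
    show "\<bar>(1 - exp (- (u * K)) * (u * sin K + cos K)) / (1 + u\<^sup>2)\<bar> \<le> 3 / (1 + u\<^sup>2)" if "1 \<le> K" "0 < u" for K u :: real
      using abs_exp_mult_le[OF that, of "cos K" "sin K"] one_plus_sq_pos[of u]
      by (simp add: divide_right_mono)
    have "set_integrable lborel {0<..} (\<lambda>u. 3 * (u powr (\<alpha> - 1) / (1 + u\<^sup>2)))"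
      by (intro set_integrable_mult_right set_integrable_mellin a)
    then show "set_integrable lborel {0<..} (\<lambda>u. u powr (\<alpha> - 1) * (3 / (1 + u\<^sup>2)))" by (simp add: mult.commute)
  qed auto
  then show ?thesis by (simp add: mellin_int_def)
qed

text \<open>The Laplace integral of the cosine is u / (1 + u^2) in the limit, and the extra u raises
  the Mellin exponent to alpha + 1. The restriction alpha < 1 makes y^-alpha integrable at 0 and
  keeps this exponent below 2.\<close>

lemma tendsto_integral_cos_powr:
  assumes a: "0 < \<alpha>" "\<alpha> < 1"
  shows "((\<lambda>K. LBINT y:{0<..K}. cos y * y powr - \<alpha>) \<longlongrightarrow> mellin_int (\<alpha> + 1) / Gamma \<alpha>) at_top"
proof -
  have p: "u powr \<alpha> = u powr (\<alpha> - 1) * u" if "0 < u" for u :: real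
    using powr_add[of u "\<alpha> - 1" 1] that by simp
  have "((\<lambda>K. LBINT y:{0<..K}. cos y * y powr - \<alpha>) \<longlongrightarrow>
     (1 / Gamma \<alpha>) * (LBINT u:{0<..}. u powr (\<alpha> - 1) * (u / (1 + u\<^sup>2)))) at_top"
  proof (rule tendsto_integral_mult_powr[OF a(1), where H = "\<lambda>K u. (u - exp (- (u * K)) * (u * cos K - sin K)) / (1 + u\<^sup>2)"
         and w = "\<lambda>u. (u + 2) / (1 + u\<^sup>2)"])
    show "set_integrable lborel {0<..K} (\<lambda>y. cos y * y powr - \<alpha>)" for K :: real
      by (rule set_integrable_mult_powr_Ioc[where p = 1 and c = 1]) (use a in auto)
    show "(LBINT y:{0<..K}. cos y * exp (- (u * y))) = (u - exp (- (u * K)) * (u * cos K - sin K)) / (1 + u\<^sup>2)"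
      if "1 \<le> K" for K u :: real using integral_exp_cos_Ioc[of K u] that by simp
    show "((\<lambda>K. (u - exp (- (u * K)) * (u * cos K - sin K)) / (1 + u\<^sup>2)) \<longlongrightarrow> u / (1 + u\<^sup>2)) at_top" if u: "0 < u" for u :: real
    proof -
      have "\<bar>u * cos K - sin K\<bar> \<le> u + 1" for K :: real
      using abs_mult_add_le[OF u, of "- sin K" "cos K"] by simp
      from exp_mult_tendsto_0[OF u this]
      have "((\<lambda>K. (u - exp (- (u * K)) * (u * cos K - sin K)) / (1 + u\<^sup>2)) \<longlongrightarrow> (u - 0) / (1 + u\<^sup>2)) at_top"
        using one_plus_sq_pos[of u] by (intro tendsto_intros) auto
      then show ?thesis by simp
    qed
    show "\<bar>(u - exp (- (u * K)) * (u * cos K - sin K)) / (1 + u\<^sup>2)\<bar> \<le> (u + 2) / (1 + u\<^sup>2)" if "1 \<le> K" "0 < u" for K u :: real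
      using abs_exp_mult_le[OF that, of "- sin K" "cos K"] one_plus_sq_pos[of u] that
      by (simp add: divide_right_mono)
    have "set_integrable lborel {0<..} (\<lambda>u. u powr ((\<alpha> + 1) - 1) / (1 + u\<^sup>2) + 2 * (u powr (\<alpha> - 1) / (1 + u\<^sup>2)))"
      by (intro set_integral_add set_integrable_mult_right set_integrable_mellin) (use a in auto)
    also have "?this \<longleftrightarrow> set_integrable lborel {0<..} (\<lambda>u. u powr (\<alpha> - 1) * ((u + 2) / (1 + u\<^sup>2)))"
      by (intro set_integrable_cong) (auto simp: p add_divide_distrib algebra_simps)
    finally show "set_integrable lborel {0<..} (\<lambda>u. u powr (\<alpha> - 1) * ((u + 2) / (1 + u\<^sup>2)))" .
  qed auto
  also have "(LBINT u:{0<..}. u powr (\<alpha> - 1) * (u / (1 + u\<^sup>2))) = mellin_int (\<alpha> + 1)"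
    unfolding mellin_int_def by (intro set_lebesgue_integral_cong) (auto simp: p)
  finally show ?thesis by simp
qed

text \<open>For alpha > 1 the cosine alone is not integrable against y^-alpha near 0; subtracting it
  from 1 restores integrability. The integrand is nonnegative, so the Laplace integrals increase
  with K and their own limit serves as majorant.\<close>

lemma tendsto_integral_one_minus_cos_powr:
  assumes a: "1 < \<alpha>" "\<alpha> < 2"
  shows "((\<lambda>K. LBINT y:{0<..K}. (1 - cos y) * y powr - \<alpha>) \<longlongrightarrow> mellin_int (\<alpha> - 1) / Gamma \<alpha>) at_top"
proof -
  have eq: "1 / u - u / (1 + u\<^sup>2) = 1 / (u * (1 + u\<^sup>2))" if "0 < u" for u :: real
    using that one_plus_sq_pos[of u] by (simp add: field_simps power2_eq_square)
  have p: "u powr (\<alpha> - 1) * (1 / u - u / (1 + u\<^sup>2)) = u powr ((\<alpha> - 1) - 1) / (1 + u\<^sup>2)" if "0 < u" for u :: real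
    using powr_add[of u "\<alpha> - 1 - 1" 1] that by (simp add: eq)
  have HK: "(LBINT y:{0<..K}. (1 - cos y) * exp (- (u * y))) =
        (1 - exp (- (u * K))) / u - (u - exp (- (u * K)) * (u * cos K - sin K)) / (1 + u\<^sup>2)"
    if "1 \<le> K" "0 < u" for K u :: real
  proof -
    have i: "set_integrable lborel {0<..K} f" if "continuous_on UNIV f" for f :: "real \<Rightarrow> real"
      by (rule set_integrable_subset[OF borel_integrable_atLeastAtMost'[of 0 K f]])
         (use that continuous_on_subset in auto)
    have "(LBINT y:{0<..K}. (1 - cos y) * exp (- (u * y))) = (LBINT y:{0<..K}. exp (- (u * y)) - cos y * exp (- (u * y)))"
      by (simp add: algebra_simps)
    also have "\<dots> = (LBINT y:{0<..K}. exp (- (u * y))) - (LBINT y:{0<..K}. cos y * exp (- (u * y)))"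
      by (intro set_integral_diff i continuous_intros)
    finally show ?thesis using integral_exp_Ioc[of K u] integral_exp_cos_Ioc[of K u] that by simp
  qed
  have limH: "((\<lambda>K. (1 - exp (- (u * K))) / u - (u - exp (- (u * K)) * (u * cos K - sin K)) / (1 + u\<^sup>2))
       \<longlongrightarrow> 1 / u - u / (1 + u\<^sup>2)) at_top" if u: "0 < u" for u :: real
  proof -
    have b: "\<bar>u * cos K - sin K\<bar> \<le> u + 1" for K :: real
      using abs_mult_add_le[OF u, of "- sin K" "cos K"] by simp
    have "((\<lambda>K. (1 - exp (- (u * K)) * 1) / u - (u - exp (- (u * K)) * (u * cos K - sin K)) / (1 + u\<^sup>2)) \<longlongrightarrow>
        (1 - 0) / u - (u - 0) / (1 + u\<^sup>2)) at_top"
      using one_plus_sq_pos[of u] u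
      by (intro tendsto_diff tendsto_divide tendsto_const exp_mult_tendsto_0[OF u b] exp_mult_tendsto_0[OF u, of _ 1]) auto
    then show ?thesis by simp
  qed
  have "((\<lambda>K. LBINT y:{0<..K}. (1 - cos y) * y powr - \<alpha>) \<longlongrightarrow>
     (1 / Gamma \<alpha>) * (LBINT u:{0<..}. u powr (\<alpha> - 1) * (1 / u - u / (1 + u\<^sup>2)))) at_top"
  proof (rule tendsto_integral_mult_powr[where H = "\<lambda>K u. (1 - exp (- (u * K))) / u - (u - exp (- (u * K)) * (u * cos K - sin K)) / (1 + u\<^sup>2)"
         and w = "\<lambda>u. 1 / u - u / (1 + u\<^sup>2)"])
    show "set_integrable lborel {0<..K} (\<lambda>y. (1 - cos y) * y powr - \<alpha>)" for K :: real
    proof (rule set_integrable_mult_powr_Ioc[where p = 2 and c = 1])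
      fix y :: real assume y: "0 < y"
      have "1 - cos y = 2 * (sin (y/2))\<^sup>2" using cos_double_sin[of "y/2"] by simp
      also have "\<dots> \<le> 2 * \<bar>sin (y/2)\<bar>" using abs_sin_le_one[of "y/2"]
        using power2_le_iff_abs_le[of 1 "sin (y/2)"] power_decreasing[of 1 2 "\<bar>sin (y/2)\<bar>"] by simp
      also have "\<dots> \<le> 2 * \<bar>y/2\<bar>" by (intro mult_left_mono abs_sin_x_le_abs_x) auto
      finally show "\<bar>1 - cos y\<bar> \<le> 1 * y powr (2 - 1)" using y by simp
    qed (use a in auto)
    show "\<bar>(1 - exp (- (u * K))) / u - (u - exp (- (u * K)) * (u * cos K - sin K)) / (1 + u\<^sup>2)\<bar> \<le> 1 / u - u / (1 + u\<^sup>2)"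
      if K: "1 \<le> K" and u: "0 < u" for K u :: real
    proof -
      let ?H = "\<lambda>K. (1 - exp (- (u * K))) / u - (u - exp (- (u * K)) * (u * cos K - sin K)) / (1 + u\<^sup>2)"
      have i: "set_integrable lborel {0<..K} (\<lambda>y. (1 - cos y) * exp (- (u * y)))" for K :: real
        by (rule set_integrable_subset[OF borel_integrable_atLeastAtMost'[of 0 K]])
           (auto intro!: continuous_intros)
      have mono: "?H K \<le> ?H K'" if "1 \<le> K" "K \<le> K'" for K K'
        using HK[of K u] HK[of K' u] that u
          integral_mono[OF i[of K, unfolded set_integrable_def] i[of K', unfolded set_integrable_def]]
        by (force simp: set_lebesgue_integral_def indicator_def)
      have "?H K \<le> 1 / u - u / (1 + u\<^sup>2)"
        by (rule tendsto_lowerbound[OF limH[OF u]])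
           (use eventually_ge_at_top[of K] in \<open>eventually_elim, use mono K in auto\<close>)
      moreover have "0 \<le> ?H K" unfolding HK[OF K u, symmetric] set_lebesgue_integral_def
        by (intro Bochner_Integration.integral_nonneg) auto
      ultimately show ?thesis by simp
    qed
    have "set_integrable lborel {0<..} (\<lambda>u. u powr ((\<alpha> - 1) - 1) / (1 + u\<^sup>2))"
      by (intro set_integrable_mellin) (use a in auto)
    also have "?this \<longleftrightarrow> set_integrable lborel {0<..} (\<lambda>u. u powr (\<alpha> - 1) * (1 / u - u / (1 + u\<^sup>2)))"
      by (intro set_integrable_cong) (auto simp: p)
    finally show "set_integrable lborel {0<..} (\<lambda>u. u powr (\<alpha> - 1) * (1 / u - u / (1 + u\<^sup>2)))" .
  qed (use a HK limH in auto)
  also have "(LBINT u:{0<..}. u powr (\<alpha> - 1) * (1 / u - u / (1 + u\<^sup>2))) = mellin_int (\<alpha> - 1)"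
    unfolding mellin_int_def by (intro set_lebesgue_integral_cong) (auto simp: p)
  finally show ?thesis by simp
qed

lemma mellin_int_pos: "0 < s \<Longrightarrow> s < 2 \<Longrightarrow> 0 < mellin_int s"
  unfolding mellin_int_eq by (intro divide_pos_pos sin_gt_zero) (auto simp: field_simps)

text \<open>Together with the next lemma this is the origin of tan(pi alpha / 2) in the stable
  characteristic function: shifting the Mellin exponent by 1 exchanges sine and cosine in the closed
  form.\<close>

lemma mellin_int_plus_one:
  assumes "0 < \<alpha>" "\<alpha> < 1"
  shows "mellin_int (\<alpha> + 1) = mellin_int \<alpha> * tan (pi * \<alpha> / 2)"
proof -
  have "sin (pi * (\<alpha> + 1) / 2) = cos (pi * \<alpha> / 2)"
    using sin_cos_eq[of "pi * (\<alpha> + 1) / 2"] by (simp add: algebra_simps add_divide_distrib)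
  moreover have "0 < sin (pi * \<alpha> / 2)" using assms by (intro sin_gt_zero) (auto simp: field_simps)
  ultimately show ?thesis using assms by (simp add: mellin_int_eq tan_def)
qed

lemma mellin_int_minus_one:
  assumes "1 < \<alpha>" "\<alpha> < 2"
  shows "mellin_int (\<alpha> - 1) = - mellin_int \<alpha> * tan (pi * \<alpha> / 2)"
proof -
  have "sin (pi * (\<alpha> - 1) / 2) = - cos (pi * \<alpha> / 2)"
    using cos_sin_eq[of "pi * \<alpha> / 2"] sin_minus[of "pi/2 - pi * \<alpha> / 2"]
    by (simp add: algebra_simps diff_divide_distrib)
  moreover have "0 < sin (pi * \<alpha> / 2)" using assms by (intro sin_gt_zero) (auto simp: field_simps)
  ultimately show ?thesis using assms by (simp add: mellin_int_eq tan_def)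
qed

section \<open>Tails and truncated moments\<close>

locale stable_domain = real_distribution \<mu> for \<mu> :: "real measure" +
  fixes \<alpha> cp cm :: real
  assumes alpha_pos: "0 < \<alpha>" and alpha_le: "\<alpha> \<le> 2"
    and attraction: "domain_of_attraction \<alpha> cp cm \<mu>"
    and infinite_variance: "(\<integral>\<^sup>+y. ennreal (y\<^sup>2) \<partial>\<mu>) = \<infinity>"
    and cond_A: "condition_A \<alpha> \<mu>"
begin

section \<open>Regular variation of the tail\<close>

definition tail :: "real \<Rightarrow> real" where
  "tail x = measure \<mu> {y. \<bar>y\<bar> > x}"

abbreviation V :: "real \<Rightarrow> real" where
  "V \<equiv> truncated_moment \<mu>"

lemma tail_nonneg: "0 \<le> tail x" and tail_le_1: "tail x \<le> 1"
  by (simp_all add: tail_def)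

lemma tail_antimono: "x \<le> y \<Longrightarrow> tail y \<le> tail x"
  unfolding tail_def by (intro finite_measure_mono) auto

text \<open>A vanishing tail would make the law bounded and its second moment finite. Positivity at
  every point, and not only eventually, permits division by \<open>tail x\<close>
  throughout.\<close>

lemma tail_pos: "0 < tail x"
proof (rule ccontr)
  assume "\<not> 0 < tail x"
  then have "tail x = 0" using tail_nonneg[of x] by linarith
  then have 0: "measure \<mu> {y. \<bar>y\<bar> > x} = 0" by (simp add: tail_def)
  have "AE y in \<mu>. \<not> \<bar>y\<bar> > x"
    by (rule AE_I[of _ _ "{y. \<bar>y\<bar> > x}"]) (use 0 in \<open>auto simp: emeasure_eq_measure\<close>)
  then have "AE y in \<mu>. ennreal (y\<^sup>2) \<le> ennreal (x\<^sup>2)"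
  proof eventually_elim
    case (elim y)
    then show ?case by (intro ennreal_leI) (metis abs_ge_zero not_le power2_abs power_mono)
  qed
  then have "(\<integral>\<^sup>+y. ennreal (y\<^sup>2) \<partial>\<mu>) \<le> (\<integral>\<^sup>+y. ennreal (x\<^sup>2) \<partial>\<mu>)" by (rule nn_integral_mono_AE)
  also have "\<dots> < \<infinity>" by (simp add: emeasure_space_1[simplified])
  finally show False using infinite_variance by simp
qed

text \<open>The slowly varying factor of the hypothesis is used here and nowhere else: it cancels in
  the ratio, and afterwards only the regular variation of \<open>tail\<close> matters.\<close>

lemma tail_ratio:
  assumes c: "0 < c"
  shows "((\<lambda>x. tail (c * x) / tail x) \<longlongrightarrow> c powr - \<alpha>) at_top"
proof -
  from attraction obtain l where l: "slowly_varying l"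
      "((\<lambda>x. tail x / (x powr (- \<alpha>) * l x)) \<longlongrightarrow> 1) at_top"
    by (auto simp: domain_of_attraction_def tail_def)
  define q where "q x = tail x / (x powr (- \<alpha>) * l x)" for x
  have q: "(q \<longlongrightarrow> 1) at_top" using l(2) by (simp add: q_def[abs_def])
  have cx: "filterlim (\<lambda>x. c * x) at_top at_top" using c by real_asymp
  have qc: "((\<lambda>x. q (c * x)) \<longlongrightarrow> 1) at_top" by (rule filterlim_compose[OF q cx])
  have lr: "((\<lambda>x. l (c * x) / l x) \<longlongrightarrow> 1) at_top" using l(1) c by (simp add: slowly_varying_def)
  have lpos: "\<forall>\<^sub>F x in at_top. 0 < l x" using l(1) by (simp add: slowly_varying_def)
  have lposc: "\<forall>\<^sub>F x in at_top. 0 < l (c * x)" by (rule eventually_compose_filterlim[OF lpos cx])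
  have "((\<lambda>x. q (c * x) * (c powr - \<alpha> * (l (c * x) / l x)) / q x) \<longlongrightarrow> 1 * (c powr - \<alpha> * 1) / 1) at_top"
    by (intro tendsto_intros qc q lr) auto
  moreover have "\<forall>\<^sub>F x in at_top. q (c * x) * (c powr - \<alpha> * (l (c * x) / l x)) / q x = tail (c * x) / tail x"
    using lpos lposc eventually_gt_at_top[of 0]
  proof eventually_elim
    case (elim x)
    then show ?case using c tail_pos[of x] by (simp add: q_def powr_mult field_simps)
  qed
  ultimately show ?thesis by (simp add: Lim_transform_eventually)
qed

text \<open>For large x this comes from the limit ratio 2^-alpha. On the remaining range
  \<open>tail x\<close> is at most 1 and \<open>tail (2 * x)\<close> at least
  \<open>tail (2 * x0)\<close>, whence the second entry of \<open>D\<close>.\<close>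

lemma tail_doubling: "\<exists>D. \<forall>x\<ge>1. tail x \<le> D * tail (2 * x)"
proof -
  have "((\<lambda>x. tail (2 * x) / tail x) \<longlongrightarrow> 2 powr - \<alpha>) at_top" by (rule tail_ratio) simp
  then have "\<forall>\<^sub>F x in at_top. tail (2 * x) / tail x > 2 powr - \<alpha> / 2"
    by (rule order_tendstoD(1)) simp
  then obtain x0 where x0: "\<And>x. x0 \<le> x \<Longrightarrow> tail (2 * x) / tail x > 2 powr - \<alpha> / 2"
    by (auto simp: eventually_at_top_linorder)
  define D where "D = max (2 / 2 powr - \<alpha>) (1 / tail (2 * x0))"
  have "tail x \<le> D * tail (2 * x)" for x
  proof (cases "x0 \<le> x")
    case True
    then have "tail x \<le> 2 / 2 powr - \<alpha> * tail (2 * x)" using x0[of x] tail_pos[of x] by (simp add: field_simps)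
    also have "\<dots> \<le> D * tail (2 * x)" by (intro mult_right_mono) (auto simp: D_def tail_nonneg)
    finally show ?thesis .
  next
    case False
    have "tail x \<le> 1" by (rule tail_le_1)
    also have "1 \<le> 1 / tail (2 * x0) * tail (2 * x)"
      using tail_antimono[of "2 * x" "2 * x0"] False tail_pos[of "2 * x0"] by (simp add: field_simps)
    also have "\<dots> \<le> D * tail (2 * x)" by (intro mult_right_mono) (auto simp: D_def tail_nonneg)
    finally show ?thesis .
  qed
  then show ?thesis by blast
qed

text \<open>The reciprocal of the tail is regularly varying with index alpha, so the upper Potter
  bound applies to it; the doubling constant supplies its local comparability.\<close>

lemma tail_potter_lower:
  assumes p: "\<alpha> < p"
  shows "\<exists>C>0. \<forall>x y. 1 \<le> x \<longrightarrow> x \<le> y \<longrightarrow> tail x \<le> C * (y / x) powr p * tail y"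
proof -
  obtain D where D: "\<And>x. 1 \<le> x \<Longrightarrow> tail x \<le> D * tail (2 * x)" using tail_doubling by auto
  have D0: "0 \<le> D" using D[of 1] tail_pos[of 1] tail_pos[of 2]
    by (metis mult.commute mult_1 mult_nonneg_nonpos2 not_le less_imp_le order_less_le_trans order_refl)
  have "\<exists>C>0. \<forall>x y. 1 \<le> x \<longrightarrow> x \<le> y \<longrightarrow> 1 / tail y \<le> C * (y / x) powr p * (1 / tail x)"
  proof (rule potter_upper[where \<rho> = \<alpha> and D = D])
    have "((\<lambda>x. inverse (tail (2 * x) / tail x)) \<longlongrightarrow> inverse (2 powr - \<alpha>)) at_top"
      by (intro tendsto_inverse tail_ratio) auto
    then show "((\<lambda>x. (1 / tail (2 * x)) / (1 / tail x)) \<longlongrightarrow> 2 powr \<alpha>) at_top"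
      by (simp add: powr_minus divide_inverse mult.commute)
    fix x y :: real assume xy: "1 \<le> x" "x \<le> y" "y \<le> 2 * x"
    have "tail x \<le> D * tail (2 * x)" using D xy by simp
    also have "\<dots> \<le> D * tail y" using D0 xy by (intro mult_left_mono tail_antimono) auto
    finally show "1 / tail y \<le> D * (1 / tail x)" using tail_pos[of x] tail_pos[of y] by (simp add: field_simps)
  qed (use tail_pos p in auto)
  then show ?thesis using tail_pos by (simp add: field_simps)
qed

lemma tail_potter_upper:
  assumes p: "p < \<alpha>"
  shows "\<exists>C>0. \<forall>x y. 1 \<le> x \<longrightarrow> x \<le> y \<longrightarrow> tail y \<le> C * (y / x) powr - p * tail x"
proof (rule potter_upper[where \<rho> = "- \<alpha>" and D = 1])
  show "((\<lambda>x. tail (2 * x) / tail x) \<longlongrightarrow> 2 powr - \<alpha>) at_top" by (rule tail_ratio) simp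
qed (use tail_pos tail_antimono p in auto)

text \<open>A majorant for tail(y x) / tail(x) on 0 < y <= K, uniform in x, as dominated convergence
  requires. Potter's bound is available only at arguments at least 1, hence the case distinction on
  y x.\<close>

lemma tail_domination:
  assumes p: "\<alpha> < p" and K: "0 < K"
  shows "\<exists>C>0. \<forall>x y. 1 \<le> x \<longrightarrow> 0 < y \<longrightarrow> y \<le> K \<longrightarrow> tail (y * x) \<le> C * y powr - p * tail x"
proof -
  have p0: "0 < p" using p alpha_pos by simp
  obtain C where C: "0 < C" "\<And>x y. 1 \<le> x \<Longrightarrow> x \<le> y \<Longrightarrow> tail x \<le> C * (y / x) powr p * tail y"
    using tail_potter_lower[OF p] by auto
  define C' where "C' = max C (max (C / tail 1) (K powr p))"
  have "tail (y * x) \<le> C' * y powr - p * tail x" if x: "1 \<le> x" and y: "0 < y" "y \<le> K" for x y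
  proof -
    have pn: "0 \<le> y powr - p * tail x" by (simp add: tail_nonneg)
    consider "1 \<le> y" | "y < 1" "1 \<le> y * x" | "y < 1" "y * x < 1" by linarith
    then show ?thesis
    proof cases
      case 1
      have "tail (y * x) \<le> tail x" using 1 x by (intro tail_antimono) (simp add: mult_le_cancel_right1)
      also have "\<dots> = y powr p * (y powr - p * tail x)" using y by (simp add: powr_minus)
      also have "\<dots> \<le> C' * (y powr - p * tail x)"
      proof (rule mult_right_mono[OF _ pn])
        have "y powr p \<le> K powr p" using y p0 by (intro powr_mono2) auto
        then show "y powr p \<le> C'" by (simp add: C'_def)
      qed
      finally show ?thesis by (simp add: mult.assoc)
    next
      case 2
      have "y * x \<le> x" using 2 x by (simp add: mult_le_cancel_right1)
      then have "tail (y * x) \<le> C * (x / (y * x)) powr p * tail x" by (rule C(2)[OF 2(2)])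
      also have "x / (y * x) = 1 / y" using x by simp
      also have "(1 / y) powr p = y powr - p" using y by (simp add: powr_divide powr_minus_divide)
      finally have "tail (y * x) \<le> C * (y powr - p * tail x)" by (simp add: mult.assoc)
      also have "\<dots> \<le> C' * (y powr - p * tail x)" by (rule mult_right_mono[OF _ pn]) (simp add: C'_def)
      finally show ?thesis by (simp add: mult.assoc)
    next
      case 3
      \<comment> \<open>In this case x < 1/y, so the Potter loss x^p between 1 and x is at most
        y^-p.\<close>
      have "tail (y * x) \<le> tail 1 / tail 1" using tail_le_1[of "y * x"] tail_pos[of 1] by simp
      also have "\<dots> \<le> C * (x / 1) powr p * tail x / tail 1"
        using C(2)[of 1 x] x tail_pos[of 1] by (intro divide_right_mono) auto
      also have "\<dots> = (C / tail 1) * x powr p * tail x" by simp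
      also have "x powr p \<le> (1 / y) powr p" using x y 3 p0 by (intro powr_mono2) (auto simp: field_simps)
      also have "(1 / y) powr p = y powr - p" using y by (simp add: powr_divide powr_minus_divide)
      finally have "tail (y * x) \<le> (C / tail 1) * (y powr - p * tail x)"
        using C(1) tail_pos[of 1] tail_pos[of x] by (simp add: mult.assoc mult_left_mono mult_right_mono divide_right_mono)
      also have "\<dots> \<le> C' * (y powr - p * tail x)" by (rule mult_right_mono[OF _ pn]) (simp add: C'_def)
      finally show ?thesis by (simp add: mult.assoc)
    qed
  qed
  moreover have "C' > 0" using C(1) by (simp add: C'_def)
  ultimately show ?thesis by blast
qed

text \<open>Layer-cake formula: g at the truncated variable is the integral of g' up to it, and
  Fubini turns the expectation of the indicator into a tail probability. The cap K keeps the double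
  integral finite without any growth condition on g.\<close>

lemma integral_min_eq:
  fixes \<zeta> g g' :: "real \<Rightarrow> real"
  assumes [measurable]: "\<zeta> \<in> borel_measurable borel" and z0: "\<And>y. 0 \<le> \<zeta> y"
    and g: "g 0 = 0" "\<And>y. (g has_real_derivative g' y) (at y)" "continuous_on UNIV g'"
    and x: "0 < x" and K: "0 < K"
  shows "(\<integral>y. g (min (\<zeta> y / x) K) \<partial>\<mu>) = (LBINT v:{0<..K}. g' v * measure \<mu> {y. \<zeta> y > v * x})"
proof -
  have [measurable]: "g' \<in> borel_measurable borel" using g(3) by (rule borel_measurable_continuous_onI)
  interpret P: pair_sigma_finite \<mu> lborel ..
  define F where "F = (\<lambda>(y, v). indicator {0<..K} v * g' v * indicator {v. v * x < \<zeta> y} v)"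
  have [measurable]: "F \<in> borel_measurable (\<mu> \<Otimes>\<^sub>M lborel)" unfolding F_def by measurable
  have "compact (g' ` {0..K})"
    by (intro compact_continuous_image continuous_on_subset[OF g(3)]) auto
  then obtain B where B: "\<And>v. v \<in> {0..K} \<Longrightarrow> \<bar>g' v\<bar> \<le> B"
    using compact_imp_bounded[of "g' ` {0..K}"] unfolding bounded_iff by (metis image_eqI real_norm_def)
  have B0: "0 \<le> B" using B[of 0] K by auto
  have Fb: "norm (F (y, v)) \<le> indicator {0<..K} v * B" for y v
    using B[of v] by (auto simp: F_def indicator_def)
  have iB: "integrable lborel (\<lambda>v. indicator {0<..K} v * B)"
    using K by (intro integrable_mult_left integrable_real_indicator) auto
  have iF: "integrable lborel (\<lambda>v. F (y, v))" for y
  proof (rule Bochner_Integration.integrable_bound[OF iB])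
    show "AE v in lborel. norm (F (y, v)) \<le> norm (indicator {0<..K} v * B)"
      using Fb[of y] B0 by (intro AE_I2) (simp add: abs_mult)
  qed auto
  have iFn: "(LBINT v. norm (F (y, v))) \<le> K * B" for y
  proof -
    have "(LBINT v. norm (F (y, v))) \<le> (LBINT v. indicator {0<..K} v * B)"
      by (intro integral_mono integrable_norm iF iB Fb)
    also have "\<dots> = K * B" using K by simp
    finally show ?thesis .
  qed
  have int: "integrable (\<mu> \<Otimes>\<^sub>M lborel) F"
  proof (rule P.Fubini_integrable)
    show "integrable \<mu> (\<lambda>y. LBINT v. norm (F (y, v)))"
      by (rule integrable_const_bound[where B = "K * B"]) (auto intro!: AE_I2 simp: iFn[unfolded real_norm_def])
  qed (use iF in auto)
  have inner: "(LBINT v. F (y, v)) = g (min (\<zeta> y / x) K)" for y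
  proof -
    let ?m = "min (\<zeta> y / x) K"
    have m0: "0 \<le> ?m" using z0[of y] x K by simp
    have "(LBINT v. F (y, v)) = (LBINT v. g' v * indicator {0..?m} v)"
    proof (rule integral_cong_AE)
      show "AE v in lborel. F (y, v) = g' v * indicator {0..?m} v"
        using AE_lborel_singleton[of 0] AE_lborel_singleton[of "\<zeta> y / x"]
        by eventually_elim (use x in \<open>auto simp: F_def indicator_def field_simps\<close>)
    qed auto
    also have "\<dots> = g ?m - g 0"
    proof (rule integral_FTC_Icc_real)
      fix v show "DERIV g v :> g' v" using g(2) by simp
    next
      fix v show "isCont g' v" using g(3) by (simp add: continuous_on_eq_continuous_at)
    qed (use m0 in auto)
    finally show ?thesis using g(1) by simp
  qed
  have outer: "(\<integral>y. F (y, v) \<partial>\<mu>) = indicator {0<..K} v * g' v * measure \<mu> {y. \<zeta> y > v * x}" for v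
  proof -
    have "(\<integral>y. F (y, v) \<partial>\<mu>) = indicator {0<..K} v * g' v * (\<integral>y. indicator {y. \<zeta> y > v * x} y \<partial>\<mu>)"
      unfolding F_def prod.case by (subst Bochner_Integration.integral_mult_right_zero[symmetric]) (simp add: indicator_def mult_ac)
    then show ?thesis by simp
  qed
  have "(\<integral>y. g (min (\<zeta> y / x) K) \<partial>\<mu>) = (\<integral>y. (LBINT v. F (y, v)) \<partial>\<mu>)" by (simp add: inner)
  also have "\<dots> = (LBINT v. (\<integral>y. F (y, v) \<partial>\<mu>))"
    using P.Fubini_integral[of "\<lambda>y v. F (y, v)"] int by simp
  also have "\<dots> = (LBINT v:{0<..K}. g' v * measure \<mu> {y. \<zeta> y > v * x})"
    by (simp add: outer set_lebesgue_integral_def mult.assoc)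
  finally show ?thesis .
qed

text \<open>After the layer-cake formula the ratio of tails converges pointwise to c v^-alpha, and
  \<open>tail_domination\<close> supplies the majorant. Allowing any nonnegative
  \<open>\<zeta>\<close> below |y| covers |y| itself and the positive and negative parts of y at
  once.\<close>

lemma tail_integral_limit:
  fixes \<zeta> g g' :: "real \<Rightarrow> real"
  assumes [measurable]: "\<zeta> \<in> borel_measurable borel" and z: "\<And>y. 0 \<le> \<zeta> y" "\<And>y. \<zeta> y \<le> \<bar>y\<bar>"
    and lim: "((\<lambda>x. measure \<mu> {y. \<zeta> y > x} / tail x) \<longlongrightarrow> c) at_top"
    and g: "g 0 = 0" "\<And>y. (g has_real_derivative g' y) (at y)" "continuous_on UNIV g'"
    and K: "0 < K" and p: "\<alpha> < p" and bd: "\<And>y. 0 < y \<Longrightarrow> y \<le> K \<Longrightarrow> \<bar>g' y\<bar> \<le> D * y powr (p - 1)"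
  shows "((\<lambda>x. (\<integral>y. g (min (\<zeta> y / x) K) \<partial>\<mu>) / tail x) \<longlongrightarrow> c * (LBINT v:{0<..K}. g' v * v powr - \<alpha>)) at_top"
proof -
  \<comment> \<open>An exponent strictly between alpha and p: above alpha for the tail bound, below
    p so that v^(p - 1 - q) is integrable at 0.\<close>
  define q where "q = (\<alpha> + p) / 2"
  have q: "\<alpha> < q" "q < p" using p by (auto simp: q_def)
  obtain C where C: "0 < C" "\<And>x y. 1 \<le> x \<Longrightarrow> 0 < y \<Longrightarrow> y \<le> K \<Longrightarrow> tail (y * x) \<le> C * y powr - q * tail x"
    using tail_domination[OF q(1) K] by auto
  define Tz where "Tz x = measure \<mu> {y. \<zeta> y > x}" for x
  have Tz: "0 \<le> Tz x" "Tz x \<le> tail x" for x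
    unfolding Tz_def tail_def by (auto intro!: finite_measure_mono dest: order_less_le_trans[OF _ z(2)])
  have [measurable]: "g' \<in> borel_measurable borel" using g(3) by (rule borel_measurable_continuous_onI)
  have "antimono Tz" unfolding Tz_def by (intro antimonoI finite_measure_mono) auto
  then have "mono (\<lambda>x. - Tz x)" by (auto simp: mono_def antimono_def)
  then have "(\<lambda>x. - Tz x) \<in> borel_measurable borel" by (rule borel_measurable_mono)
  then have "(\<lambda>x. - (- Tz x)) \<in> borel_measurable borel" by (rule borel_measurable_uminus)
  then have [measurable]: "Tz \<in> borel_measurable borel" by simp
  have D0: "0 \<le> D" using order_trans[OF abs_ge_zero bd[OF K order_refl]] K by (simp add: zero_le_mult_iff)
  have "((\<lambda>x. LBINT v. indicator {0<..K} v *\<^sub>R (g' v * (Tz (v * x) / tail x))) \<longlongrightarrow>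
      (LBINT v. indicator {0<..K} v *\<^sub>R (c * (g' v * v powr - \<alpha>)))) at_top"
  proof (rule integral_dominated_convergence_at_top)
    show "integrable lborel (\<lambda>v. indicator {0<..K} v *\<^sub>R (D * C * v powr (p - 1 - q)))"
      using set_integrable_mult_right[OF set_integrable_powr_Ioc[of "p - 1 - q" K], of "D * C"] q
      by (simp add: set_integrable_def)
    show "AE v in lborel. ((\<lambda>x. indicator {0<..K} v *\<^sub>R (g' v * (Tz (v * x) / tail x))) \<longlongrightarrow>
        indicator {0<..K} v *\<^sub>R (c * (g' v * v powr - \<alpha>))) at_top"
    proof (intro AE_I2)
      fix v :: real
      show "((\<lambda>x. indicator {0<..K} v *\<^sub>R (g' v * (Tz (v * x) / tail x))) \<longlongrightarrow>
        indicator {0<..K} v *\<^sub>R (c * (g' v * v powr - \<alpha>))) at_top"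
      proof (cases "v \<in> {0<..K}")
        case True
        then have v: "0 < v" by simp
        have vx: "filterlim (\<lambda>x. v * x) at_top at_top" using v by real_asymp
        have "((\<lambda>x. Tz (v * x) / tail (v * x)) \<longlongrightarrow> c) at_top"
          using filterlim_compose[OF lim vx] by (simp add: Tz_def)
        from tendsto_mult[OF this tail_ratio[OF v]]
        have "((\<lambda>x. Tz (v * x) / tail x) \<longlongrightarrow> c * v powr - \<alpha>) at_top"
          using tail_pos by (simp add: less_imp_neq[THEN not_sym])
        from tendsto_mult[OF tendsto_const[of "g' v"] this] show ?thesis using True by (simp add: mult_ac)
      qed simp
    qed
    show "\<forall>\<^sub>F x in at_top. AE v in lborel. norm (indicator {0<..K} v *\<^sub>R (g' v * (Tz (v * x) / tail x)))
        \<le> indicator {0<..K} v *\<^sub>R (D * C * v powr (p - 1 - q))"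
      using eventually_ge_at_top[of 1]
    proof eventually_elim
      case (elim x)
      have "\<bar>g' v * (Tz (v * x) / tail x)\<bar> \<le> D * C * v powr (p - 1 - q)" if v: "0 < v" "v \<le> K" for v
      proof -
        have "\<bar>g' v * (Tz (v * x) / tail x)\<bar> = \<bar>g' v\<bar> * (Tz (v * x) / tail x)"
          using Tz tail_pos[of x] by (simp add: abs_mult)
        also have "\<dots> \<le> (D * v powr (p - 1)) * (C * v powr - q)"
        proof (rule mult_mono[OF bd[OF v]])
          have "Tz (v * x) \<le> C * v powr - q * tail x" using Tz(2)[of "v * x"] C(2)[OF elim v] by linarith
          then show "Tz (v * x) / tail x \<le> C * v powr - q" using tail_pos[of x] by (simp add: field_simps)
        qed (use Tz tail_pos[of x] D0 in auto)
        also have "\<dots> = D * C * v powr (p - 1 - q)" by (simp add: powr_diff powr_minus divide_inverse)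
        finally show ?thesis .
      qed
      then show ?case by (auto simp: indicator_def)
    qed
  qed auto
  then have l: "((\<lambda>x. LBINT v:{0<..K}. g' v * (Tz (v * x) / tail x)) \<longlongrightarrow> c * (LBINT v:{0<..K}. g' v * v powr - \<alpha>)) at_top"
    by (simp add: set_lebesgue_integral_def mult.left_commute[of _ c])
  have ev: "\<forall>\<^sub>F x in at_top. (LBINT v:{0<..K}. g' v * (Tz (v * x) / tail x)) = (\<integral>y. g (min (\<zeta> y / x) K) \<partial>\<mu>) / tail x"
    using eventually_gt_at_top[of 0]
  proof eventually_elim
    case (elim x)
    show ?case unfolding integral_min_eq[OF assms(1) z(1) g elim K] Tz_def[symmetric]
      by (simp add: set_lebesgue_integral_def)
  qed
  show ?thesis by (rule Lim_transform_eventually[OF l ev])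
qed

end

lemma LBINT_powr_Ioc01:
  fixes a :: real
  assumes a: "-1 < a"
  shows "(LBINT y:{0<..1}. y powr a) = 1 / (a + 1)"
proof -
  have h: "((\<lambda>y. y powr a) has_integral (1 powr (a + 1) / (a + 1))) {0..1::real}"
    by (rule has_integral_powr_from_0) (use a in auto)
  have "((\<lambda>y. if y \<in> {0<..1} then y powr a else 0) has_integral 1 / (a + 1)) {0..1::real}"
    by (rule has_integral_spike[of "{0}", rotated 2]) (use h in auto)
  then have "((\<lambda>y. y powr a) has_integral 1 / (a + 1)) {0<..1}"
    by (subst (asm) has_integral_restrict) auto
  then show ?thesis
    using set_borel_integral_eq_integral(2)[OF set_integrable_powr_Ioc[OF a, of 1]] integral_unique by metis
qed

context stable_domain
begin

section \<open>Truncated second moment and Karamata's theorem\<close>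

lemma integrable_bounded [simp]:
  "f \<in> borel_measurable borel \<Longrightarrow> (\<And>y. \<bar>f y\<bar> \<le> B) \<Longrightarrow> integrable \<mu> f"
  for f :: "real \<Rightarrow> real"
  by (rule integrable_const_bound[where B = B]) auto

lemma integrable_truncated: "integrable \<mu> (\<lambda>y. y\<^sup>2 * indicator {y. \<bar>y\<bar> \<le> x} y)"
proof (rule integrable_bounded[of _ "x\<^sup>2"])
  show "\<bar>y\<^sup>2 * indicator {y. \<bar>y\<bar> \<le> x} y\<bar> \<le> x\<^sup>2" for y
    by (auto simp: indicator_def abs_le_square_iff[symmetric])
qed measurable

lemma V_mono: "x \<le> y \<Longrightarrow> V x \<le> V y"
  unfolding truncated_moment_def
  by (intro integral_mono integrable_truncated) (auto simp: indicator_def)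

lemma V_nonneg: "0 \<le> V x"
  unfolding truncated_moment_def by (intro Bochner_Integration.integral_nonneg) auto

lemma V_unbounded: "\<exists>x\<ge>1. V x > c"
proof (rule ccontr)
  assume "\<not> ?thesis"
  then have c: "V x \<le> c" if "1 \<le> x" for x using that by force
  have "(\<integral>\<^sup>+y. ennreal (y\<^sup>2) \<partial>\<mu>) = (\<integral>\<^sup>+y. (SUP n. ennreal (y\<^sup>2 * indicator {y. \<bar>y\<bar> \<le> real n} y)) \<partial>\<mu>)"
  proof (intro nn_integral_cong)
    fix y :: real
    obtain n :: nat where n: "\<bar>y\<bar> \<le> real n" using real_arch_simple by blast
    show "ennreal (y\<^sup>2) = (SUP n. ennreal (y\<^sup>2 * indicator {y. \<bar>y\<bar> \<le> real n} y))"
      by (rule antisym[OF SUP_upper2[of n] SUP_least]) (use n in \<open>auto simp: indicator_def\<close>)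
  qed
  also have "\<dots> = (SUP n. \<integral>\<^sup>+y. ennreal (y\<^sup>2 * indicator {y. \<bar>y\<bar> \<le> real n} y) \<partial>\<mu>)"
    by (intro nn_integral_monotone_convergence_SUP)
       (auto simp: incseq_def le_fun_def indicator_def intro!: ennreal_leI)
  also have "\<dots> = (SUP n. ennreal (V (real n)))"
    unfolding truncated_moment_def
    by (intro SUP_cong refl nn_integral_eq_integral integrable_truncated) auto
  also have "\<dots> \<le> ennreal c"
  proof (rule SUP_least)
    fix n :: nat
    have "V (real n) \<le> V (max 1 (real n))" by (rule V_mono) simp
    also have "\<dots> \<le> c" by (rule c) simp
    finally show "ennreal (V (real n)) \<le> ennreal c" by (rule ennreal_leI)
  qed
  finally show False using infinite_variance by (simp add: top_unique)
qed

abbreviation b :: real where "b \<equiv> L_start \<mu>"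

lemma L_start_ge_1: "1 \<le> b"
  unfolding L_start_def using V_unbounded[of 1] by (intro cInf_greatest) auto

lemma V_gt_1: "b < x \<Longrightarrow> 1 < V x"
proof -
  assume "b < x"
  then obtain x' where "x' < x" "1 \<le> x'" "V x' > 1"
    unfolding L_start_def using V_unbounded[of 1] by (subst (asm) cInf_less_iff) (auto intro: bdd_belowI[of _ 1])
  then show ?thesis using V_mono[of x' x] by simp
qed

text \<open>Right continuity carries the lower bound from the points beyond \<open>b\<close> to
  \<open>b\<close> itself, where the strict inequality defining \<open>L_start\<close> may
  fail.\<close>

lemma V_right_limit: "(\<lambda>n. V (x + 1 / Suc n)) \<longlonglongrightarrow> V x"
  unfolding truncated_moment_def
proof (rule integral_dominated_convergence)
  show "integrable \<mu> (\<lambda>y. y\<^sup>2 * indicator {y. \<bar>y\<bar> \<le> x + 1} y)" by (rule integrable_truncated)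
  show "AE y in \<mu>. norm (y\<^sup>2 * indicator {y. \<bar>y\<bar> \<le> x + 1 / Suc n} y :: real) \<le> y\<^sup>2 * indicator {y. \<bar>y\<bar> \<le> x + 1} y" for n
  proof (intro AE_I2)
    fix y :: real
    have "\<bar>y\<bar> \<le> x + 1" if "\<bar>y\<bar> \<le> x + 1 / Suc n"
      by (rule order_trans[OF that]) simp
    then show "norm (y\<^sup>2 * indicator {y. \<bar>y\<bar> \<le> x + 1 / Suc n} y :: real) \<le> y\<^sup>2 * indicator {y. \<bar>y\<bar> \<le> x + 1} y"
      by (auto simp: indicator_def)
  qed
  show "AE y in \<mu>. (\<lambda>n. y\<^sup>2 * indicator {y. \<bar>y\<bar> \<le> x + 1 / Suc n} y :: real) \<longlonglongrightarrow> y\<^sup>2 * indicator {y. \<bar>y\<bar> \<le> x} y"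
  proof (intro AE_I2 tendsto_intros)
    fix y :: real
    show "(\<lambda>n. indicator {y. \<bar>y\<bar> \<le> x + 1 / Suc n} y :: real) \<longlonglongrightarrow> indicator {y. \<bar>y\<bar> \<le> x} y"
    proof (cases "\<bar>y\<bar> \<le> x")
      case True
      then have "\<bar>y\<bar> \<le> x + 1 / Suc n" for n by (simp add: add_increasing2)
      then show ?thesis using True by simp
    next
      case False
      have "(\<lambda>n. x + 1 / Suc n) \<longlonglongrightarrow> x + 0" by (intro tendsto_intros LIMSEQ_Suc lim_1_over_n)
      then have "\<forall>\<^sub>F n in sequentially. x + 1 / Suc n < \<bar>y\<bar>" by (rule order_tendstoD) (use False in auto)
      then show ?thesis by (intro tendsto_eventually) (use False in \<open>auto elim!: eventually_mono\<close>)
    qed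
  qed
qed measurable

lemma V_ge_1: "b \<le> x \<Longrightarrow> 1 \<le> V x"
proof -
  have "1 \<le> V b"
    by (rule LIMSEQ_le_const[OF V_right_limit]) (auto intro!: exI[of _ 0] less_imp_le[OF V_gt_1])
  then show "b \<le> x \<Longrightarrow> 1 \<le> V x" using V_mono[of b x] by simp
qed

text \<open>Karamata's theorem for alpha < 2, read off from \<open>tail_integral_limit\<close> with
  g(v) = v^2 and K = 1. The expectation of min(|y|/x, 1)^2 is V(x)/x^2 plus the tail, and 2/(2 -
  alpha) - 1 = alpha/(2 - alpha).\<close>

lemma V_tail_ratio:
  assumes "\<alpha> < 2"
  shows "((\<lambda>x. V x / (x\<^sup>2 * tail x)) \<longlongrightarrow> \<alpha> / (2 - \<alpha>)) at_top"
proof -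
  have "((\<lambda>x. (\<integral>y. (min (\<bar>y\<bar> / x) 1)\<^sup>2 \<partial>\<mu>) / tail x) \<longlongrightarrow> 1 * (LBINT v:{0<..1}. (2 * v) * v powr - \<alpha>)) at_top"
  proof (rule tail_integral_limit[where p = 2 and D = 2])
    have "(\<lambda>x. measure \<mu> {y. \<bar>y\<bar> > x} / tail x) = (\<lambda>x. 1)"
      using tail_pos by (simp add: fun_eq_iff tail_def[symmetric] less_imp_neq[THEN not_sym])
    then show "((\<lambda>x. measure \<mu> {y. \<bar>y\<bar> > x} / tail x) \<longlongrightarrow> 1) at_top" by simp
  qed (use assms in \<open>auto intro!: derivative_eq_intros continuous_intros\<close>)
  also have "(LBINT v:{0<..1}. (2 * v) * v powr - \<alpha>) = (LBINT v:{0<..1}. 2 * v powr (1 - \<alpha>))"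
    by (intro set_lebesgue_integral_cong) (auto simp: powr_diff powr_minus divide_inverse)
  also have "\<dots> = 2 * (1 / (1 - \<alpha> + 1))"
    unfolding set_integral_mult_right by (subst LBINT_powr_Ioc01) (use assms in auto)
  finally have "((\<lambda>x. (\<integral>y. (min (\<bar>y\<bar> / x) 1)\<^sup>2 \<partial>\<mu>) / tail x - 1) \<longlongrightarrow> 1 * (2 * (1 / (1 - \<alpha> + 1))) - 1) at_top"
    by (intro tendsto_intros)
  also have "1 * (2 * (1 / (1 - \<alpha> + 1))) - 1 = \<alpha> / (2 - \<alpha>)" using assms by (simp add: field_simps)
  finally show ?thesis
  proof (rule Lim_transform_eventually)
    show "\<forall>\<^sub>F x in at_top. (\<integral>y. (min (\<bar>y\<bar> / x) 1)\<^sup>2 \<partial>\<mu>) / tail x - 1 = V x / (x\<^sup>2 * tail x)"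
      using eventually_gt_at_top[of 0]
    proof eventually_elim
      case (elim x)
      have "(\<integral>y. (min (\<bar>y\<bar> / x) 1)\<^sup>2 \<partial>\<mu>) = (\<integral>y. (y\<^sup>2 * indicator {y. \<bar>y\<bar> \<le> x} y) / x\<^sup>2 + indicator {y. \<bar>y\<bar> > x} y \<partial>\<mu>)"
        by (intro Bochner_Integration.integral_cong refl)
           (use elim in \<open>auto simp: indicator_def min_def power_divide field_simps\<close>)
      also have "\<dots> = V x / x\<^sup>2 + tail x"
        by (subst Bochner_Integration.integral_add)
           (auto simp: truncated_moment_def tail_def emeasure_eq_measure intro!: integrable_divide integrable_truncated)
      finally show ?case using tail_pos[of x] elim by (simp add: field_simps)
    qed
  qed
qed

text \<open>The shell x/2 < |y| <= x has probability tail(x/2) - tail(x), and y^2 is at least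
  (x/2)^2 on it.\<close>

lemma V_halving: "0 \<le> x \<Longrightarrow> V (x / 2) + (x / 2)\<^sup>2 * (tail (x / 2) - tail x) \<le> V x"
proof -
  assume x: "0 \<le> x"
  have "tail (x/2) - tail x = measure \<mu> ({y. \<bar>y\<bar> > x/2} - {y. \<bar>y\<bar> > x})"
    unfolding tail_def by (subst finite_measure_Diff) (use x in auto)
  also have "{y. \<bar>y\<bar> > x/2} - {y. \<bar>y\<bar> > x} = {y. x/2 < \<bar>y\<bar> \<and> \<bar>y\<bar> \<le> x}" by auto
  finally have "V (x/2) + (x/2)\<^sup>2 * (tail (x/2) - tail x) =
     (\<integral>y. y\<^sup>2 * indicator {y. \<bar>y\<bar> \<le> x/2} y + (x/2)\<^sup>2 * indicator {y. x/2 < \<bar>y\<bar> \<and> \<bar>y\<bar> \<le> x} y \<partial>\<mu>)"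
    using integrable_truncated[of "x/2"] by (subst Bochner_Integration.integral_add)
       (auto simp: truncated_moment_def emeasure_eq_measure)
  also have "\<dots> \<le> V x"
    unfolding truncated_moment_def
  proof (intro integral_mono Bochner_Integration.integrable_add integrable_truncated)
    fix y :: real
    have "(x/2)\<^sup>2 \<le> y\<^sup>2" if "x/2 < \<bar>y\<bar>"
      using that x by (metis abs_le_square_iff abs_of_nonneg divide_nonneg_nonneg less_imp_le zero_le_numeral)
    then show "y\<^sup>2 * indicator {y. \<bar>y\<bar> \<le> x/2} y + (x/2)\<^sup>2 * indicator {y. x/2 < \<bar>y\<bar> \<and> \<bar>y\<bar> \<le> x} y
        \<le> y\<^sup>2 * indicator {y. \<bar>y\<bar> \<le> x} y"
      using x by (auto simp: indicator_def)
  qed (auto simp: emeasure_eq_measure)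
  finally show ?thesis .
qed

lemma V_dyadic: "0 \<le> x \<Longrightarrow> (\<Sum>j<n. (x / 2 ^ Suc j)\<^sup>2 * (tail (x / 2 ^ Suc j) - tail (x / 2 ^ j))) \<le> V x"
proof -
  assume x: "0 \<le> x"
  have "V (x / 2 ^ n) + (\<Sum>j<n. (x / 2 ^ Suc j)\<^sup>2 * (tail (x / 2 ^ Suc j) - tail (x / 2 ^ j))) \<le> V x"
  proof (induction n)
    case (Suc n)
    then show ?case using V_halving[of "x / 2 ^ n"] x by (simp add: mult.commute)
  qed simp
  then show ?thesis using V_nonneg[of "x / 2 ^ n"] by simp
qed

text \<open>At alpha = 2 the Karamata constant alpha/(2 - alpha) becomes infinite. In the limit the
  j-th dyadic shell below x contributes (4^(j+1) - 4^j) / 4^(j+1) = 3/4 of x^2 tail(x), so n shells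
  push V(x) / (x^2 tail(x)) eventually above any number smaller than 3n/4.\<close>

lemma tail_V_ratio_2:
  assumes a2: "\<alpha> = 2"
  shows "((\<lambda>x. x\<^sup>2 * tail x / V x) \<longlongrightarrow> 0) at_top"
proof -
  have "filterlim (\<lambda>x. V x / (x\<^sup>2 * tail x)) at_top at_top"
    unfolding filterlim_at_top_dense
  proof
    fix Z :: real
    obtain n :: nat where "Z * 4 / 3 < real n" using reals_Archimedean2[of "Z * 4/3"] by auto
    then have n: "Z < 3/4 * real n" by (simp add: field_simps)
    define S where "S x = (\<Sum>j<n. (1 / 2 ^ Suc j)\<^sup>2 * (tail ((1 / 2 ^ Suc j) * x) / tail x - tail ((1 / 2 ^ j) * x) / tail x))" for x
    have p4: "(2 ^ j)\<^sup>2 = (4::real) ^ j" for j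
    proof -
      have "(2 ^ j)\<^sup>2 = ((2::real)\<^sup>2) ^ j" by (metis power_mult mult.commute)
      then show ?thesis by simp
    qed
    have pw: "(1 / 2 ^ j) powr - \<alpha> = (4::real) ^ j" for j
    proof -
      have "(1 / 2 ^ j) powr - \<alpha> = ((2::real) ^ j) powr 2" unfolding a2 by (simp add: powr_minus_divide powr_divide)
      also have "\<dots> = (2 ^ j)\<^sup>2" by simp
      also have "\<dots> = 4 ^ j" by (rule p4)
      finally show ?thesis .
    qed
    have "(S \<longlongrightarrow> (\<Sum>j<n. (1 / 2 ^ Suc j)\<^sup>2 * ((1 / 2 ^ Suc j) powr - \<alpha> - (1 / 2 ^ j) powr - \<alpha>))) at_top"
      unfolding S_def by (intro tendsto_intros tail_ratio) auto
    also have "(\<Sum>j<n. (1 / 2 ^ Suc j)\<^sup>2 * ((1 / 2 ^ Suc j) powr - \<alpha> - (1 / 2 ^ j) powr - \<alpha>)) = (\<Sum>j<n. 3 / 4)"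
    proof (intro sum.cong refl)
      fix j
      have "(2 ^ Suc j)\<^sup>2 = (4 * 4 ^ j :: real)" using p4[of "Suc j"] by simp
      then show "(1 / 2 ^ Suc j)\<^sup>2 * ((1 / 2 ^ Suc j) powr - \<alpha> - (1 / 2 ^ j) powr - \<alpha>) = (3 / 4 :: real)"
        unfolding pw by (simp add: power_divide del: power_Suc) (simp add: field_simps)
    qed
    finally have "(S \<longlongrightarrow> 3/4 * real n) at_top" by (simp add: mult.commute)
    then have "\<forall>\<^sub>F x in at_top. Z < S x" by (rule order_tendstoD) (rule n)
    then show "\<forall>\<^sub>F x in at_top. Z < V x / (x\<^sup>2 * tail x)"
      using eventually_gt_at_top[of 0]
    proof eventually_elim
      case (elim x)
      have "S x = (\<Sum>j<n. (x / 2 ^ Suc j)\<^sup>2 * (tail (x / 2 ^ Suc j) - tail (x / 2 ^ j))) / (x\<^sup>2 * tail x)"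
        unfolding S_def sum_divide_distrib
        by (intro sum.cong refl) (use elim in \<open>simp add: power_divide diff_divide_distrib mult_ac del: power_Suc\<close>)
      also have "\<dots> \<le> V x / (x\<^sup>2 * tail x)"
        using elim tail_nonneg[of x] by (intro divide_right_mono V_dyadic) auto
      finally show ?case using elim by simp
    qed
  qed
  then have "((\<lambda>x. inverse (V x / (x\<^sup>2 * tail x))) \<longlongrightarrow> 0) at_top"
    by (rule tendsto_inverse_0_at_top)
  then show ?thesis by simp
qed

lemma V_diff_le: "1 \<le> c \<Longrightarrow> 0 \<le> x \<Longrightarrow> V (c * x) \<le> V x + (c * x)\<^sup>2 * tail x"
proof -
  assume c: "1 \<le> c" and x: "0 \<le> x"
  have "V (c * x) \<le> (\<integral>y. y\<^sup>2 * indicator {y. \<bar>y\<bar> \<le> x} y + (c * x)\<^sup>2 * indicator {y. \<bar>y\<bar> > x} y \<partial>\<mu>)"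
    unfolding truncated_moment_def
  proof (intro integral_mono Bochner_Integration.integrable_add integrable_truncated)
    fix y :: real
    have "y\<^sup>2 \<le> (c * x)\<^sup>2" if "\<bar>y\<bar> \<le> c * x"
      using that by (metis abs_ge_zero power2_abs power_mono)
    then show "y\<^sup>2 * indicator {y. \<bar>y\<bar> \<le> c * x} y
        \<le> y\<^sup>2 * indicator {y. \<bar>y\<bar> \<le> x} y + (c * x)\<^sup>2 * indicator {y. \<bar>y\<bar> > x} y"
      by (auto simp: indicator_def)
  qed (auto simp: emeasure_eq_measure)
  also have "\<dots> = V x + (c * x)\<^sup>2 * tail x"
    by (subst Bochner_Integration.integral_add)
       (auto simp: truncated_moment_def tail_def emeasure_eq_measure intro!: integrable_truncated)
  finally show ?thesis .
qed

text \<open>For alpha < 2 the ratio is that of x^2 tail(x). For alpha = 2 the growth of V from x to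
  c x is at most c^2 x^2 tail(x) = o(V(x)). This settles c >= 1, and smaller c follow by exchanging
  the roles of x and c x.\<close>

lemma V_ratio:
  assumes c: "0 < c"
  shows "((\<lambda>x. V (c * x) / V x) \<longlongrightarrow> c powr (2 - \<alpha>)) at_top"
proof (cases "\<alpha> < 2")
  case True
  have cx: "filterlim (\<lambda>x. c * x) at_top at_top" using c by real_asymp
  have l: "((\<lambda>x. V (c * x) / ((c * x)\<^sup>2 * tail (c * x)) * (c\<^sup>2 * (tail (c * x) / tail x)) / (V x / (x\<^sup>2 * tail x)))
      \<longlongrightarrow> \<alpha> / (2 - \<alpha>) * (c\<^sup>2 * c powr - \<alpha>) / (\<alpha> / (2 - \<alpha>))) at_top"
    by (intro tendsto_intros filterlim_compose[OF V_tail_ratio cx] V_tail_ratio tail_ratio)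
       (use True c alpha_pos in auto)
  have "c\<^sup>2 * c powr - \<alpha> = c powr (2 - \<alpha>)" using c by (simp add: powr_diff powr_minus divide_inverse)
  then have e: "\<alpha> / (2 - \<alpha>) * (c\<^sup>2 * c powr - \<alpha>) / (\<alpha> / (2 - \<alpha>)) = c powr (2 - \<alpha>)"
    using True alpha_pos by simp
  show ?thesis
  proof (rule Lim_transform_eventually[OF l[unfolded e]])
    show "\<forall>\<^sub>F x in at_top. V (c * x) / ((c * x)\<^sup>2 * tail (c * x)) * (c\<^sup>2 * (tail (c * x) / tail x)) / (V x / (x\<^sup>2 * tail x)) = V (c * x) / V x"
      using eventually_gt_at_top[of 0]
    proof eventually_elim
      case (elim x)
      then show ?case using tail_pos[of x] tail_pos[of "c * x"] c by (simp add: field_simps power2_eq_square)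
    qed
  qed
next
  case False
  then have a2: "\<alpha> = 2" using alpha_le by simp
  have ge: "((\<lambda>x. V (c * x) / V x) \<longlongrightarrow> 1) at_top" if c: "1 \<le> c" for c
  proof (rule tendsto_sandwich)
    show "\<forall>\<^sub>F x in at_top. 1 \<le> V (c * x) / V x"
      using eventually_ge_at_top[of b]
    proof eventually_elim
      case (elim x)
      have "V x \<le> V (c * x)" using elim c L_start_ge_1 by (intro V_mono) (simp add: mult_le_cancel_right1)
      then show ?case using V_ge_1[OF elim] by simp
    qed
    show "\<forall>\<^sub>F x in at_top. V (c * x) / V x \<le> 1 + c\<^sup>2 * (x\<^sup>2 * tail x / V x)"
      using eventually_ge_at_top[of b]
    proof eventually_elim
      case (elim x)
      then show ?case using V_diff_le[OF c, of x] L_start_ge_1 V_ge_1[OF elim]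
        by (simp add: field_simps power_mult_distrib)
    qed
    have "((\<lambda>x. 1 + c\<^sup>2 * (x\<^sup>2 * tail x / V x)) \<longlongrightarrow> 1 + c\<^sup>2 * 0) at_top"
      by (intro tendsto_intros tail_V_ratio_2 a2)
    then show "((\<lambda>x. 1 + c\<^sup>2 * (x\<^sup>2 * tail x / V x)) \<longlongrightarrow> 1) at_top" by simp
  qed auto
  have "((\<lambda>x. V (c * x) / V x) \<longlongrightarrow> 1) at_top"
  proof (cases "1 \<le> c")
    case False
    then have "((\<lambda>x. V ((1/c) * x) / V x) \<longlongrightarrow> 1) at_top" using c by (intro ge) auto
    moreover have "filterlim (\<lambda>x. c * x) at_top at_top" using c by real_asymp
    ultimately have "((\<lambda>x. V ((1/c) * (c * x)) / V (c * x)) \<longlongrightarrow> 1) at_top" by (rule filterlim_compose)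
    from tendsto_inverse[OF this] show ?thesis using c by simp
  qed (rule ge)
  then show ?thesis using a2 c by simp
qed

section \<open>The weight W near zero and on bounded ranges\<close>

definition W_const :: real where
  "W_const = (if \<alpha> < 2 then (2 - \<alpha>) / \<alpha> else 1)"

abbreviation W :: "real \<Rightarrow> real" where
  "W \<equiv> L_weight \<alpha> \<mu>"

lemma W_const_pos: "0 < W_const"
  using alpha_pos by (simp add: W_const_def)

lemma W_eq:
  assumes s: "s \<noteq> 0"
  shows "W s = W_const * \<bar>s\<bar> powr \<alpha> * max (1 / \<bar>s\<bar>) b powr (\<alpha> - 2) * V (max (1 / \<bar>s\<bar>) b)"
  using s L_start_ge_1 alpha_le by (auto simp: L_weight_def L_fun_def Let_def W_const_def)

lemma W_0 [simp]: "W 0 = 0"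
  by (simp add: L_weight_def)

lemma W_abs [simp]: "W \<bar>s\<bar> = W s"
  by (simp add: L_weight_def)

lemma W_minus [simp]: "W (- s) = W s"
  by (simp add: L_weight_def)

lemma W_pos: "s \<noteq> 0 \<Longrightarrow> 0 < W s"
  unfolding W_eq using W_const_pos V_ge_1[of "max (1 / \<bar>s\<bar>) b"] L_start_ge_1
  by (intro mult_pos_pos) auto

lemma W_nonneg: "0 \<le> W s"
  using W_pos[of s] by (cases "s = 0") auto

lemma W_eq_sq:
  assumes s: "s \<noteq> 0"
  shows "W s = s\<^sup>2 * (W_const * max 1 (b * \<bar>s\<bar>) powr (\<alpha> - 2) * V (max (1 / \<bar>s\<bar>) b))"
proof -
  have "max 1 (b * \<bar>s\<bar>) = \<bar>s\<bar> * max (1 / \<bar>s\<bar>) b"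
    using s by (auto simp: max_def field_simps)
  then have "max 1 (b * \<bar>s\<bar>) powr (\<alpha> - 2) = \<bar>s\<bar> powr (\<alpha> - 2) * max (1 / \<bar>s\<bar>) b powr (\<alpha> - 2)"
    using L_start_ge_1 by (simp add: powr_mult)
  moreover have "s\<^sup>2 * \<bar>s\<bar> powr (\<alpha> - 2) = \<bar>s\<bar> powr \<alpha>"
    using s by (simp add: powr_diff)
  ultimately show ?thesis unfolding W_eq[OF s] by (simp add: mult_ac)
qed

lemma W_small: "s \<noteq> 0 \<Longrightarrow> b \<le> 1 / \<bar>s\<bar> \<Longrightarrow> W s = W_const * s\<^sup>2 * V (1 / \<bar>s\<bar>)"
proof -
  assume s: "s \<noteq> 0" "b \<le> 1 / \<bar>s\<bar>"
  then have "b * \<bar>s\<bar> \<le> 1" by (simp add: field_simps)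
  then show ?thesis unfolding W_eq_sq[OF s(1)] using s by (simp add: max_def)
qed

text \<open>The factors that remain after dividing W by s^2 decrease in |s|, because alpha <= 2 and
  V is monotone. Unlike the Potter bounds, this scaling inequality holds globally and with constant
  1, which gives control of the norming sums when the scale varies.\<close>

lemma W_sq_antimono:
  assumes "0 < \<bar>s\<bar>" "\<bar>s\<bar> \<le> \<bar>t\<bar>"
  shows "W t \<le> (t / s)\<^sup>2 * W s"
proof -
  have s: "s \<noteq> 0" and t: "t \<noteq> 0" using assms by auto
  have "1 / \<bar>t\<bar> \<le> 1 / \<bar>s\<bar>" using assms by (simp add: field_simps)
  then have "V (max (1 / \<bar>t\<bar>) b) \<le> V (max (1 / \<bar>s\<bar>) b)" by (intro V_mono) auto
  moreover have "max 1 (b * \<bar>t\<bar>) powr (\<alpha> - 2) \<le> max 1 (b * \<bar>s\<bar>) powr (\<alpha> - 2)"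
  proof (rule powr_mono2')
    show "max 1 (b * \<bar>s\<bar>) \<le> max 1 (b * \<bar>t\<bar>)" using assms L_start_ge_1 by (intro max.mono mult_left_mono) auto
  qed (use alpha_le in auto)
  ultimately have "max 1 (b * \<bar>t\<bar>) powr (\<alpha> - 2) * V (max (1 / \<bar>t\<bar>) b) \<le>
      max 1 (b * \<bar>s\<bar>) powr (\<alpha> - 2) * V (max (1 / \<bar>s\<bar>) b)"
    by (intro mult_mono) (auto simp: V_nonneg)
  then have "t\<^sup>2 * (W_const * (max 1 (b * \<bar>t\<bar>) powr (\<alpha> - 2) * V (max (1 / \<bar>t\<bar>) b))) \<le>
      t\<^sup>2 * (W_const * (max 1 (b * \<bar>s\<bar>) powr (\<alpha> - 2) * V (max (1 / \<bar>s\<bar>) b)))"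
    using W_const_pos by (intro mult_left_mono) auto
  then show ?thesis unfolding W_eq_sq[OF s] W_eq_sq[OF t] using s by (simp add: power_divide mult.assoc)
qed

lemma W_inverse_eventually: "\<forall>\<^sub>F x in at_top. W (1 / x) = W_const * V x / x\<^sup>2"
  using eventually_ge_at_top[of b]
proof eventually_elim
  case (elim x)
  then show ?case using W_small[of "1/x"] L_start_ge_1 by (simp add: power_divide)
qed

lemma W_ratio_at_top:
  assumes c: "0 < c"
  shows "((\<lambda>x. W (1 / (c * x)) / W (1 / x)) \<longlongrightarrow> c powr - \<alpha>) at_top"
proof -
  have cx: "filterlim (\<lambda>x. c * x) at_top at_top" using c by real_asymp
  have l: "((\<lambda>x. V (c * x) / V x / c\<^sup>2) \<longlongrightarrow> c powr (2 - \<alpha>) / c\<^sup>2) at_top"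
    by (intro tendsto_intros V_ratio c) (use c in auto)
  have e: "c powr (2 - \<alpha>) / c\<^sup>2 = c powr - \<alpha>" using c by (simp add: powr_diff powr_minus divide_inverse)
  show ?thesis
  proof (rule Lim_transform_eventually[OF l[unfolded e]])
    show "\<forall>\<^sub>F x in at_top. V (c * x) / V x / c\<^sup>2 = W (1 / (c * x)) / W (1 / x)"
      using W_inverse_eventually eventually_compose_filterlim[OF W_inverse_eventually cx] eventually_gt_at_top[of 0]
    proof eventually_elim
      case (elim x)
      show ?case unfolding elim(1,2) using c W_const_pos elim(3) by (simp add: power_mult_distrib)
    qed
  qed
qed

lemma W_ratio:
  assumes t: "t \<noteq> 0"
  shows "((\<lambda>s. W (t * s) / W s) \<longlongrightarrow> \<bar>t\<bar> powr \<alpha>) (at 0)"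
proof -
  have "filterlim (\<lambda>s::real. 1 / \<bar>s\<bar>) at_top (at 0)"
    by (simp add: divide_inverse filterlim_compose[OF filterlim_inverse_at_top_right] filterlim_at tendsto_rabs_zero)
       (intro filterlim_compose[OF filterlim_inverse_at_top_right], auto simp: filterlim_at eventually_at_filter intro!: tendsto_eq_intros)
  from filterlim_compose[OF W_ratio_at_top[of "1 / \<bar>t\<bar>"] this]
  have "((\<lambda>s. W (1 / (1 / \<bar>t\<bar> * (1 / \<bar>s\<bar>))) / W (1 / (1 / \<bar>s\<bar>))) \<longlongrightarrow> (1 / \<bar>t\<bar>) powr - \<alpha>) (at 0)"
    using t by simp
  also have "(\<lambda>s. W (1 / (1 / \<bar>t\<bar> * (1 / \<bar>s\<bar>))) / W (1 / (1 / \<bar>s\<bar>))) = (\<lambda>s. W (t * s) / W s)"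
    by (simp flip: abs_mult)
  also have "(1 / \<bar>t\<bar>) powr - \<alpha> = \<bar>t\<bar> powr \<alpha>" using t by (simp add: powr_minus_divide powr_divide)
  finally show ?thesis .
qed

text \<open>For alpha < 2 the tail and W(1/x) are of the same order; for alpha = 2 the tail is of
  smaller order. The one-sided bound lets later estimates treat both cases together.\<close>

lemma tail_le_W: "\<exists>C. \<forall>\<^sub>F x in at_top. tail x \<le> C * W (1 / x)"
proof (cases "\<alpha> < 2")
  case True
  have "((\<lambda>x. V x / (x\<^sup>2 * tail x)) \<longlongrightarrow> \<alpha> / (2 - \<alpha>)) at_top" by (rule V_tail_ratio[OF True])
  then have "\<forall>\<^sub>F x in at_top. V x / (x\<^sup>2 * tail x) > \<alpha> / (2 - \<alpha>) / 2"
    by (rule order_tendstoD) (use True alpha_pos in \<open>simp add: field_simps\<close>)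
  then have "\<forall>\<^sub>F x in at_top. tail x \<le> 2 * W (1 / x)"
    using W_inverse_eventually eventually_gt_at_top[of 0]
  proof eventually_elim
    case (elim x)
    have "\<alpha> * (x\<^sup>2 * tail x) < 2 * ((2 - \<alpha>) * V x)"
      using elim(1,3) True alpha_pos tail_pos[of x] by (simp add: divide_less_eq less_divide_eq mult_ac)
    then show ?case unfolding elim(2) using elim(3) True alpha_pos
      by (simp add: W_const_def pos_le_divide_eq divide_le_eq mult_ac)
  qed
  then show ?thesis by blast
next
  case False
  then have a2: "\<alpha> = 2" using alpha_le by simp
  from tail_V_ratio_2[OF a2] have "\<forall>\<^sub>F x in at_top. x\<^sup>2 * tail x / V x < 1" by (rule order_tendstoD) simp
  then have "\<forall>\<^sub>F x in at_top. tail x \<le> 1 * W (1 / x)"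
    using W_inverse_eventually eventually_ge_at_top[of b]
  proof eventually_elim
    case (elim x)
    have "tail x * x\<^sup>2 < V x" using elim(1) V_ge_1[OF elim(3)] by (simp add: divide_less_eq mult.commute)
    then show ?case unfolding elim(2) using False elim(3) L_start_ge_1 by (simp add: W_const_def pos_le_divide_eq)
  qed
  then show ?thesis by blast
qed

text \<open>Potter's bound for W(1/x) on x >= 1/R. Any exponent below alpha would do, and alpha/2 is
  a convenient choice. The range includes the region where L is constant: V >= 1 from
  \<open>b\<close> on gives one doubling constant that is valid on the whole of it.\<close>

lemma W_potter:
  assumes R: "0 < R"
  shows "\<exists>C>0. \<forall>s t. 0 < \<bar>s\<bar> \<longrightarrow> \<bar>s\<bar> \<le> \<bar>t\<bar> \<longrightarrow> \<bar>t\<bar> \<le> R \<longrightarrow> W s \<le> C * (\<bar>s\<bar> / \<bar>t\<bar>) powr (\<alpha> / 2) * W t"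
proof -
  have "((\<lambda>x. V (2 * x) / V x) \<longlongrightarrow> 2 powr (2 - \<alpha>)) at_top" by (rule V_ratio) simp
  then have "\<forall>\<^sub>F x in at_top. V (2 * x) / V x < 2 * 2 powr (2 - \<alpha>)"
    by (rule order_tendstoD) simp
  then obtain x0 where x0: "\<And>x. x0 \<le> x \<Longrightarrow> V (2 * x) / V x < 2 * 2 powr (2 - \<alpha>)"
    by (auto simp: eventually_at_top_linorder)
  \<comment> \<open>The first entry serves large arguments. Below \<open>x0\<close> it suffices that
    V(2 x) <= V(2 x0) and V(x) >= 1.\<close>
  define D where "D = max (2 * 2 powr (2 - \<alpha>)) (V (2 * x0))"
  have D: "V (2 * x) \<le> D * V x" if x: "b \<le> x" for x
  proof (cases "x0 \<le> x")
    case True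
    have "V (2 * x) \<le> 2 * 2 powr (2 - \<alpha>) * V x" using x0[OF True] V_ge_1[OF x] by (simp add: field_simps)
    also have "\<dots> \<le> D * V x" by (intro mult_right_mono) (auto simp: D_def V_nonneg)
    finally show ?thesis .
  next
    case False
    have "V (2 * x) \<le> V (2 * x0) * 1" using False by (auto intro: V_mono)
    also have "\<dots> \<le> D * V x" using V_ge_1[OF x] V_nonneg[of "2 * x0"] by (intro mult_mono) (auto simp: D_def le_max_iff_disj)
    finally show ?thesis .
  qed
  have D0: "0 \<le> D" using V_nonneg[of "2 * x0"] by (simp add: D_def)
  have "\<exists>C>0. \<forall>x y. 1 / R \<le> x \<longrightarrow> x \<le> y \<longrightarrow> W (1 / y) \<le> C * (y / x) powr (- (\<alpha> / 2)) * W (1 / x)"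
  proof (rule potter_upper[where \<rho> = "- \<alpha>" and D = D])
    show "((\<lambda>x. W (1 / (2 * x)) / W (1 / x)) \<longlongrightarrow> 2 powr - \<alpha>) at_top" by (rule W_ratio_at_top) simp
    fix x y :: real assume xy: "1 / R \<le> x" "x \<le> y" "y \<le> 2 * x"
    have x: "0 < x" using xy(1) R by (meson less_le_trans zero_less_divide_1_iff)
    then have y: "0 < y" using xy by simp
    have b0: "0 < b" using L_start_ge_1 by simp
    have "V (max y b) \<le> V (2 * max x b)" using xy x b0 by (intro V_mono) (auto simp: max_def)
    also have "\<dots> \<le> D * V (max x b)" by (rule D) simp
    finally have 1: "V (max y b) \<le> D * V (max x b)" .
    have 2: "max y b powr (\<alpha> - 2) \<le> max x b powr (\<alpha> - 2)"
      using xy x b0 alpha_le by (intro powr_mono2') auto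
    have 3: "(1 / y) powr \<alpha> \<le> (1 / x) powr \<alpha>"
      using xy x y alpha_pos by (intro powr_mono2) (auto simp: field_simps)
    have "W_const * (1 / y) powr \<alpha> * max y b powr (\<alpha> - 2) * V (max y b) \<le>
       W_const * (1 / x) powr \<alpha> * max x b powr (\<alpha> - 2) * (D * V (max x b))"
      using W_const_pos by (intro mult_mono 1 2 3) (auto simp: V_nonneg D0)
    then show "W (1 / y) \<le> D * W (1 / x)" using x y W_eq[of "1/x"] W_eq[of "1/y"] by (simp add: mult_ac)
  next
    fix x assume "1 / R \<le> x"
    then have "0 < x" using R by (meson less_le_trans zero_less_divide_1_iff)
    then show "0 < W (1 / x)" by (intro W_pos) simp
  qed (use R alpha_pos in auto)
  then obtain C where C: "0 < C" "\<And>x y. 1 / R \<le> x \<Longrightarrow> x \<le> y \<Longrightarrow> W (1 / y) \<le> C * (y / x) powr (- (\<alpha> / 2)) * W (1 / x)"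
    by blast
  have "W s \<le> C * (\<bar>s\<bar> / \<bar>t\<bar>) powr (\<alpha> / 2) * W t" if "0 < \<bar>s\<bar>" "\<bar>s\<bar> \<le> \<bar>t\<bar>" "\<bar>t\<bar> \<le> R" for s t
  proof -
    have "1 / R \<le> 1 / \<bar>t\<bar>" "1 / \<bar>t\<bar> \<le> 1 / \<bar>s\<bar>" using that R by (auto simp: field_simps)
    from C(2)[OF this] have "W s \<le> C * (1 / \<bar>s\<bar> / (1 / \<bar>t\<bar>)) powr (- (\<alpha> / 2)) * W t" by simp
    also have "1 / \<bar>s\<bar> / (1 / \<bar>t\<bar>) = \<bar>t\<bar> / \<bar>s\<bar>" by simp
    also have "(\<bar>t\<bar> / \<bar>s\<bar>) powr (- (\<alpha> / 2)) = (\<bar>s\<bar> / \<bar>t\<bar>) powr (\<alpha> / 2)"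
      using that by (simp add: powr_minus powr_divide)
    finally show ?thesis .
  qed
  then show ?thesis using C(1) by blast
qed

text \<open>Extends an estimate near s = 0 to all |s| <= R: away from 0 the function h is bounded
  above and W is bounded below, the latter by comparison with the value at 1/x1 through Potter's
  bound.\<close>

lemma bounded_by_W:
  assumes bd: "\<And>x. 0 < x \<Longrightarrow> h x \<le> B" and ev: "\<forall>\<^sub>F x in at_top. h x \<le> C0 * W (1 / x)" and R: "0 < R"
  shows "\<exists>C>0. \<forall>s. 0 < \<bar>s\<bar> \<longrightarrow> \<bar>s\<bar> \<le> R \<longrightarrow> h (1 / \<bar>s\<bar>) \<le> C * W s"
proof -
  obtain x0 where x0: "\<And>x. x0 \<le> x \<Longrightarrow> h x \<le> C0 * W (1 / x)"
    using ev by (auto simp: eventually_at_top_linorder)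
  define x1 where "x1 = max 1 (max x0 (1 / R))"
  have x1: "1 \<le> x1" "x0 \<le> x1" "1 / R \<le> x1" by (auto simp: x1_def)
  obtain C1 where C1: "0 < C1" "\<And>s t. 0 < \<bar>s\<bar> \<Longrightarrow> \<bar>s\<bar> \<le> \<bar>t\<bar> \<Longrightarrow> \<bar>t\<bar> \<le> R \<Longrightarrow> W s \<le> C1 * (\<bar>s\<bar> / \<bar>t\<bar>) powr (\<alpha> / 2) * W t"
    using W_potter[OF R] by blast
  define C where "C = max 1 (max C0 (\<bar>B\<bar> * C1 / W (1 / x1)))"
  have "h (1 / \<bar>s\<bar>) \<le> C * W s" if s: "0 < \<bar>s\<bar>" "\<bar>s\<bar> \<le> R" for s
  proof (cases "x1 \<le> 1 / \<bar>s\<bar>")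
    case True
    then have "h (1 / \<bar>s\<bar>) \<le> C0 * W s" using x0[of "1 / \<bar>s\<bar>"] x1 by simp
    also have "\<dots> \<le> C * W s" by (intro mult_right_mono) (auto simp: C_def W_nonneg)
    finally show ?thesis .
  next
    case False
    have p: "0 < W (1 / x1)" using x1 by (intro W_pos) auto
    have le: "\<bar>1 / x1\<bar> \<le> \<bar>s\<bar>" using False s x1 by (simp add: field_simps)
    have "W (1 / x1) \<le> C1 * (\<bar>1 / x1\<bar> / \<bar>s\<bar>) powr (\<alpha> / 2) * W s"
      using x1 by (intro C1 le s) auto
    also have "\<dots> \<le> C1 * 1 * W s"
    proof (intro mult_right_mono mult_left_mono W_nonneg)
      have "\<bar>1 / x1\<bar> / \<bar>s\<bar> \<le> 1" using le s(1) by (simp add: divide_le_eq_1 del: abs_divide)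
      then show "(\<bar>1 / x1\<bar> / \<bar>s\<bar>) powr (\<alpha> / 2) \<le> 1" using alpha_pos
        by (intro powr_le1) auto
    qed (use C1 in auto)
    finally have *: "1 \<le> C1 * W s / W (1 / x1)" using p by (simp add: field_simps)
    have "h (1 / \<bar>s\<bar>) \<le> \<bar>B\<bar> * 1" using bd[of "1 / \<bar>s\<bar>"] s by simp
    also have "\<dots> \<le> \<bar>B\<bar> * (C1 * W s / W (1 / x1))" by (intro mult_left_mono *) auto
    also have "\<dots> = (\<bar>B\<bar> * C1 / W (1 / x1)) * W s" by simp
    also have "\<dots> \<le> C * W s" by (intro mult_right_mono) (auto simp: C_def W_nonneg)
    finally show ?thesis .
  qed
  moreover have "0 < C" by (simp add: C_def)
  ultimately show ?thesis by blast
qed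

text \<open>The half of Karamata's theorem that concerns integrals beyond x. The dyadic shells
  contribute a geometric series with ratio 2^(1 - p), which converges because alpha > 1 leaves room
  for p strictly between 1 and alpha.\<close>

lemma integral_tail_le:
  assumes a: "1 < \<alpha>"
  shows "\<exists>C>0. \<forall>x\<ge>1. (\<integral>y. \<bar>y\<bar> * indicator {y. \<bar>y\<bar> > x} y \<partial>\<mu>) \<le> C * x * tail x"
proof -
  define p where "p = (1 + \<alpha>) / 2"
  have p: "1 < p" "p < \<alpha>" using a by (auto simp: p_def)
  obtain C where C: "0 < C" "\<And>x y. 1 \<le> x \<Longrightarrow> x \<le> y \<Longrightarrow> tail y \<le> C * (y / x) powr - p * tail x"
    using tail_potter_upper[OF p(2)] by blast
  have int: "integrable \<mu> (\<lambda>y. y)" using cond_A a by (simp add: condition_A_def)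
  have inti: "integrable \<mu> (\<lambda>y. \<bar>y\<bar> * indicator {y. \<bar>y\<bar> > x} y)" for x
    by (rule Bochner_Integration.integrable_bound[OF integrable_norm[OF int]]) (auto simp: indicator_def)
  define E where "E x = (\<integral>y. \<bar>y\<bar> * indicator {y. \<bar>y\<bar> > x} y \<partial>\<mu>)" for x
  have step: "E x \<le> 2 * x * tail x + E (2 * x)" if "0 \<le> x" for x
  proof -
    have "E x \<le> (\<integral>y. 2 * x * indicator {y. \<bar>y\<bar> > x} y + \<bar>y\<bar> * indicator {y. \<bar>y\<bar> > 2 * x} y \<partial>\<mu>)"
      unfolding E_def using that
      by (intro integral_mono Bochner_Integration.integrable_add inti integrable_mult_right integrable_real_indicator)
         (auto simp: indicator_def emeasure_eq_measure)
    also have "\<dots> = 2 * x * tail x + E (2 * x)"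
      by (subst Bochner_Integration.integral_add) (auto simp: tail_def E_def emeasure_eq_measure intro!: inti)
    finally show ?thesis .
  qed
  define r where "r = 2 powr (1 - p)"
  have r: "0 < r" "r < 1" using p by (auto simp: r_def powr_less_one)
  have n: "E x \<le> 2 * C * x * tail x * (\<Sum>j<n. r ^ j) + E (2 ^ n * x)" if x: "1 \<le> x" for x n
  proof (induction n)
    case (Suc n)
    have "E (2 ^ n * x) \<le> 2 * (2 ^ n * x) * tail (2 ^ n * x) + E (2 ^ Suc n * x)"
      using step[of "2 ^ n * x"] x by (simp add: mult.assoc)
    moreover have "2 * (2 ^ n * x) * tail (2 ^ n * x) \<le> 2 * C * x * tail x * r ^ n"
    proof -
      have "tail (2 ^ n * x) \<le> C * (2 ^ n * x / x) powr - p * tail x"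
        using x le_power_mult[of x x n] by (intro C) auto
      also have "(2 ^ n * x / x) powr - p = (2 powr - p) ^ n"
        using x by (simp add: powr_realpow[symmetric] powr_powr mult.commute)
      finally have "2 * (2 ^ n * x) * tail (2 ^ n * x) \<le> 2 * (2 ^ n * x) * (C * (2 powr - p) ^ n * tail x)"
        using x by (intro mult_left_mono) auto
      also have "\<dots> = 2 * C * x * tail x * (2 * 2 powr - p) ^ n" by (simp add: power_mult_distrib mult_ac)
      also have "2 * 2 powr - p = r" by (simp add: r_def powr_diff powr_minus divide_inverse)
      finally show ?thesis .
    qed
    ultimately show ?case using Suc by (simp add: distrib_left)
  qed simp
  have Elim: "(\<lambda>n. E (2 ^ n * x)) \<longlonglongrightarrow> 0" if x: "1 \<le> x" for x
  proof -
    have "(\<lambda>n. E (2 ^ n * x)) \<longlonglongrightarrow> (\<integral>y. 0 \<partial>\<mu>)"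
      unfolding E_def
    proof (rule integral_dominated_convergence)
      show "integrable \<mu> (\<lambda>y. \<bar>y\<bar>)" using int by auto
      show "AE y in \<mu>. (\<lambda>n. \<bar>y\<bar> * indicator {y. \<bar>y\<bar> > 2 ^ n * x} y) \<longlonglongrightarrow> 0"
      proof (intro AE_I2)
        fix y :: real
        have "filterlim (\<lambda>n. 2 ^ n * x) at_top sequentially" using x by real_asymp
        then have "\<forall>\<^sub>F n in sequentially. \<bar>y\<bar> < 2 ^ n * x" by (simp add: filterlim_at_top_dense)
        then show "(\<lambda>n. \<bar>y\<bar> * indicator {y. \<bar>y\<bar> > 2 ^ n * x} y) \<longlonglongrightarrow> 0"
          by (intro tendsto_eventually) (force elim!: eventually_mono simp: indicator_def)
      qed
    qed (auto simp: indicator_def)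
    then show ?thesis by simp
  qed
  define C' where "C' = 2 * C * (1 / (1 - r))"
  have "E x \<le> C' * x * tail x" if x: "1 \<le> x" for x
  proof (rule LIMSEQ_le_const[of "\<lambda>n. C' * x * tail x + E (2 ^ n * x)"])
    have "(\<lambda>n. C' * x * tail x + E (2 ^ n * x)) \<longlonglongrightarrow> C' * x * tail x + 0" by (intro tendsto_intros Elim x)
    then show "(\<lambda>n. C' * x * tail x + E (2 ^ n * x)) \<longlonglongrightarrow> C' * x * tail x" by simp
    have "E x \<le> C' * x * tail x + E (2 ^ n * x)" for n
    proof -
      have "(\<Sum>j<n. r ^ j) \<le> (\<Sum>j. r ^ j)" using r by (intro sum_le_suminf summable_geometric) auto
      also have "\<dots> = 1 / (1 - r)" using r by (intro suminf_geometric) auto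
      finally have "2 * C * x * tail x * (\<Sum>j<n. r ^ j) \<le> 2 * C * x * tail x * (1 / (1 - r))"
        using x C tail_nonneg[of x] by (intro mult_left_mono) auto
      then show ?thesis using n[OF x, of n] by (simp add: C'_def)
    qed
    then show "\<exists>N. \<forall>n\<ge>N. E x \<le> C' * x * tail x + E (2 ^ n * x)" by blast
  qed
  moreover have "0 < C'" using C r by (simp add: C'_def)
  ultimately show ?thesis unfolding E_def by blast
qed

end

section \<open>The characteristic function near zero\<close>

text \<open>Interchange of the limits in x and K. The truncation error is at most r(K) once x is
  large, how large may depend on K, and r(K) vanishes.\<close>

lemma tendsto_by_truncation:
  fixes F :: "real \<Rightarrow> real" and FK :: "real \<Rightarrow> real \<Rightarrow> real"
  assumes FK: "\<And>K. 1 \<le> K \<Longrightarrow> ((\<lambda>x. FK K x) \<longlongrightarrow> a K) at_top" and a: "(a \<longlongrightarrow> l) at_top"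
    and r: "(r \<longlongrightarrow> 0) at_top" and diff: "\<And>K. 1 \<le> K \<Longrightarrow> \<forall>\<^sub>F x in at_top. \<bar>F x - FK K x\<bar> \<le> r K"
  shows "(F \<longlongrightarrow> l) at_top"
proof (rule tendstoI)
  fix e :: real assume e: "0 < e"
  have "\<forall>\<^sub>F K in at_top. dist (a K) l < e/3" using tendstoD[OF a, of "e/3"] e by simp
  moreover have "\<forall>\<^sub>F K in at_top. dist (r K) 0 < e/3" using tendstoD[OF r, of "e/3"] e by simp
  ultimately have "\<forall>\<^sub>F K in at_top. dist (a K) l < e/3 \<and> dist (r K) 0 < e/3 \<and> 1 \<le> K"
    using eventually_ge_at_top[of "1::real"] by eventually_elim auto
  then obtain K where K: "dist (a K) l < e/3" "dist (r K) 0 < e/3" "1 \<le> K"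
    by (auto dest: eventually_happens)
  have "\<forall>\<^sub>F x in at_top. dist (FK K x) (a K) < e/3" using tendstoD[OF FK[OF K(3)], of "e/3"] e by simp
  then show "\<forall>\<^sub>F x in at_top. dist (F x) l < e" using diff[OF K(3)]
  proof eventually_elim
    case (elim x)
    then show ?case using K unfolding dist_real_def by linarith
  qed
qed

lemma Ln_div_tendsto_1: "((\<lambda>z. Ln z / (z - 1)) \<longlongrightarrow> 1) (at 1)"
proof -
  have "(Ln has_field_derivative inverse 1) (at 1)" by (rule has_field_derivative_Ln) simp
  then show ?thesis by (simp add: has_field_derivative_iff)
qed

context stable_domain
begin

lemma tail_integral_limit_at_top:
  fixes \<zeta> g g' :: "real \<Rightarrow> real"
  assumes \<zeta>: "\<zeta> \<in> borel_measurable borel" "\<And>y. 0 \<le> \<zeta> y" "\<And>y. \<zeta> y \<le> \<bar>y\<bar>"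
    and lim: "((\<lambda>x. measure \<mu> {y. \<zeta> y > x} / tail x) \<longlongrightarrow> c) at_top"
    and g: "g 0 = 0" "\<And>y. (g has_real_derivative g' y) (at y)" "continuous_on UNIV g'"
    and p: "\<alpha> < p" and bd: "\<And>y. 0 < y \<Longrightarrow> \<bar>g' y\<bar> \<le> D * y powr (p - 1)"
    and a: "((\<lambda>K. LBINT v:{0<..K}. g' v * v powr - \<alpha>) \<longlongrightarrow> a) at_top"
    and r: "(r \<longlongrightarrow> 0) at_top"
    and diff: "\<And>K. 1 \<le> K \<Longrightarrow> \<forall>\<^sub>F x in at_top.
       \<bar>(\<integral>y. g (\<zeta> y / x) \<partial>\<mu>) - (\<integral>y. g (min (\<zeta> y / x) K) \<partial>\<mu>)\<bar> \<le> r K * tail x"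
  shows "((\<lambda>x. (\<integral>y. g (\<zeta> y / x) \<partial>\<mu>) / tail x) \<longlongrightarrow> c * a) at_top"
proof (rule tendsto_by_truncation[where FK = "\<lambda>K x. (\<integral>y. g (min (\<zeta> y / x) K) \<partial>\<mu>) / tail x"])
  fix K :: real assume K: "1 \<le> K"
  show "((\<lambda>x. (\<integral>y. g (min (\<zeta> y / x) K) \<partial>\<mu>) / tail x) \<longlongrightarrow> c * (LBINT v:{0<..K}. g' v * v powr - \<alpha>)) at_top"
    by (rule tail_integral_limit[OF \<zeta> lim g _ p bd]) (use K in auto)
  show "\<forall>\<^sub>F x in at_top. \<bar>(\<integral>y. g (\<zeta> y / x) \<partial>\<mu>) / tail x - (\<integral>y. g (min (\<zeta> y / x) K) \<partial>\<mu>) / tail x\<bar> \<le> r K"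
    using diff[OF K]
  proof eventually_elim
    case (elim x)
    then show ?case using tail_pos[of x]
      by (simp add: pos_divide_le_eq flip: diff_divide_distrib)
  qed
qed (use a r in \<open>auto intro!: tendsto_intros\<close>)

text \<open>For bounded g the cap at K matters only if |y| > K x, an event of probability about
  K^-alpha tail(x). This is the source of the error function \<open>r\<close>.\<close>

lemma tail_integral_limit_bounded:
  fixes \<zeta> g g' :: "real \<Rightarrow> real"
  assumes \<zeta>[measurable]: "\<zeta> \<in> borel_measurable borel" and z: "\<And>y. 0 \<le> \<zeta> y" "\<And>y. \<zeta> y \<le> \<bar>y\<bar>"
    and lim: "((\<lambda>x. measure \<mu> {y. \<zeta> y > x} / tail x) \<longlongrightarrow> c) at_top"
    and g: "g 0 = 0" "\<And>y. (g has_real_derivative g' y) (at y)" "continuous_on UNIV g'"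
    and p: "\<alpha> < p" and bd: "\<And>y. 0 < y \<Longrightarrow> \<bar>g' y\<bar> \<le> D * y powr (p - 1)"
    and a: "((\<lambda>K. LBINT v:{0<..K}. g' v * v powr - \<alpha>) \<longlongrightarrow> a) at_top"
    and B: "\<And>y. \<bar>g y\<bar> \<le> B"
  shows "((\<lambda>x. (\<integral>y. g (\<zeta> y / x) \<partial>\<mu>) / tail x) \<longlongrightarrow> c * a) at_top"
proof (rule tail_integral_limit_at_top[OF \<zeta> z lim g p bd a, where r = "\<lambda>K. 4 * B * K powr - \<alpha>"])
  have "continuous_on UNIV g" using g(2) by (meson DERIV_isCont continuous_at_imp_continuous_on)
  then have [measurable]: "g \<in> borel_measurable borel" by (rule borel_measurable_continuous_onI)
  have B0: "0 \<le> B" using B[of 0] by linarith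
  show "((\<lambda>K. 4 * B * K powr - \<alpha>) \<longlongrightarrow> 0) at_top" using alpha_pos by real_asymp
  fix K :: real assume K: "1 \<le> K"
  have "((\<lambda>x. tail (K * x) / tail x) \<longlongrightarrow> K powr - \<alpha>) at_top" using K by (intro tail_ratio) auto
  then have "\<forall>\<^sub>F x in at_top. tail (K * x) / tail x < 2 * K powr - \<alpha>"
    by (rule order_tendstoD) (use K in auto)
  then show "\<forall>\<^sub>F x in at_top. \<bar>(\<integral>y. g (\<zeta> y / x) \<partial>\<mu>) - (\<integral>y. g (min (\<zeta> y / x) K) \<partial>\<mu>)\<bar> \<le> 4 * B * K powr - \<alpha> * tail x"
    using eventually_gt_at_top[of 0]
  proof eventually_elim
    case (elim x)
    have i: "integrable \<mu> (\<lambda>y. g (\<zeta> y / x))" "integrable \<mu> (\<lambda>y. g (min (\<zeta> y / x) K))"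
      by (rule integrable_bounded[where B = B]; use B in auto)+
    have "\<bar>(\<integral>y. g (\<zeta> y / x) \<partial>\<mu>) - (\<integral>y. g (min (\<zeta> y / x) K) \<partial>\<mu>)\<bar> = \<bar>\<integral>y. g (\<zeta> y / x) - g (min (\<zeta> y / x) K) \<partial>\<mu>\<bar>"
      using i by simp
    also have "\<dots> \<le> (\<integral>y. \<bar>g (\<zeta> y / x) - g (min (\<zeta> y / x) K)\<bar> \<partial>\<mu>)" by (rule integral_abs_bound)
    also have "\<dots> \<le> (\<integral>y. 2 * B * indicator {y. \<bar>y\<bar> > K * x} y \<partial>\<mu>)"
    proof (intro integral_mono integrable_abs Bochner_Integration.integrable_diff i)
      fix y
      have "\<bar>g (\<zeta> y / x) - g (min (\<zeta> y / x) K)\<bar> \<le> 2 * B"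
        using abs_triangle_ineq4[of "g (\<zeta> y / x)" "g (min (\<zeta> y / x) K)"] B[of "\<zeta> y / x"] B[of "min (\<zeta> y / x) K"] by linarith
      moreover have "min (\<zeta> y / x) K = \<zeta> y / x" if "\<not> \<bar>y\<bar> > K * x"
        using z(2)[of y] that elim(2) by (simp add: min_def field_simps)
      ultimately show "\<bar>g (\<zeta> y / x) - g (min (\<zeta> y / x) K)\<bar> \<le> 2 * B * indicator {y. \<bar>y\<bar> > K * x} y"
        by (auto simp: indicator_def)
    qed (auto simp: emeasure_eq_measure)
    also have "\<dots> = 2 * B * tail (K * x)" by (simp add: tail_def)
    also have "\<dots> \<le> 2 * B * (2 * K powr - \<alpha> * tail x)"
      using elim(1) tail_pos[of x] B0 by (intro mult_left_mono) (auto simp: divide_less_eq)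
    finally show ?case by (simp add: mult_ac)
  qed
qed

text \<open>This is the constant c_alpha, as \<open>char_const_eq\<close> shows. For alpha < 2 it is
  the improper integral of sin(v) v^-alpha over the positive half-line; at alpha = 2 it is the 1/2
  in 1 - cos z ~ z^2/2.\<close>

definition scale_const :: real where
  "scale_const = (if \<alpha> < 2 then mellin_int \<alpha> / Gamma \<alpha> else 1 / 2)"

abbreviation \<beta> :: real where "\<beta> \<equiv> cp - cm"

definition tau0 :: real where
  "tau0 = (if \<alpha> = 1 then 0 else tan (pi * \<alpha> / 2))"

lemma stable_tau_eq: "stable_tau \<alpha> t = sgn t * tau0"
  by (simp add: stable_tau_def tau0_def)

lemma scale_const_pos: "0 < scale_const"
  using alpha_pos by (simp add: scale_const_def mellin_int_pos Gamma_real_pos)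

text \<open>Brings the tail balance into the form required by \<open>tail_integral_limit\<close>,
  with a nonnegative variable bounded by |y|; for x > 0 the events coincide.\<close>

lemma tail_pos_part: "\<alpha> < 2 \<Longrightarrow> ((\<lambda>x. measure \<mu> {y. max y 0 > x} / tail x) \<longlongrightarrow> cp) at_top"
proof -
  assume "\<alpha> < 2"
  then have "((\<lambda>x. measure \<mu> {y. y > x} / tail x) \<longlongrightarrow> cp) at_top"
    using attraction by (simp add: domain_of_attraction_def tail_def)
  then show ?thesis
    by (rule Lim_transform_eventually)
       (use eventually_gt_at_top[of "0::real"] in eventually_elim, auto simp: less_max_iff_disj)
qed

lemma tail_neg_part: "\<alpha> < 2 \<Longrightarrow> ((\<lambda>x. measure \<mu> {y. max (- y) 0 > x} / tail x) \<longlongrightarrow> cm) at_top"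
proof -
  assume "\<alpha> < 2"
  then have "((\<lambda>x. measure \<mu> {y. y < - x} / tail x) \<longlongrightarrow> cm) at_top"
    using attraction by (simp add: domain_of_attraction_def tail_def)
  then show ?thesis
  proof (rule Lim_transform_eventually)
    have h: "{y. y < - x} = {y. max (- y) 0 > x}" if "0 < x" for x :: real using that by auto
    show "\<forall>\<^sub>F x in at_top. measure \<mu> {y. y < - x} / tail x = measure \<mu> {y. max (- y) 0 > x} / tail x"
      using eventually_gt_at_top[of "0::real"] by eventually_elim (simp only: h)
  qed
qed

section \<open>Real and imaginary part of the characteristic function for alpha < 2\<close>

lemma integrable_sin: "integrable \<mu> (\<lambda>y. sin (f y))" and integrable_cos: "integrable \<mu> (\<lambda>y. cos (f y))"
  if "f \<in> borel_measurable borel" for f :: "real \<Rightarrow> real"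
  using that by (auto intro!: integrable_bounded[where B = 1])

text \<open>Cosine is even, so only |y| enters; with g = 1 - cos the layer-cake derivative is the
  sine, whose integral against v^-alpha is known.\<close>

lemma cos_part:
  assumes a2: "\<alpha> < 2"
  shows "((\<lambda>x. (\<integral>y. 1 - cos (y / x) \<partial>\<mu>) / tail x) \<longlongrightarrow> scale_const) at_top"
proof -
  have "((\<lambda>x. (\<integral>y. 1 - cos (\<bar>y\<bar> / x) \<partial>\<mu>) / tail x) \<longlongrightarrow> 1 * (mellin_int \<alpha> / Gamma \<alpha>)) at_top"
  proof (rule tail_integral_limit_bounded[where p = 2 and D = 1 and B = 2 and g' = sin])
    have "(\<lambda>x. measure \<mu> {y. \<bar>y\<bar> > x} / tail x) = (\<lambda>x. 1)"
      using tail_pos by (simp add: fun_eq_iff tail_def[symmetric] less_imp_neq[THEN not_sym])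
    then show "((\<lambda>x. measure \<mu> {y. \<bar>y\<bar> > x} / tail x) \<longlongrightarrow> 1) at_top" by simp
    show "((\<lambda>K. LBINT v:{0<..K}. sin v * v powr - \<alpha>) \<longlongrightarrow> mellin_int \<alpha> / Gamma \<alpha>) at_top"
      by (rule tendsto_integral_sin_powr[OF alpha_pos a2])
    show "\<bar>sin y\<bar> \<le> 1 * y powr (2 - 1)" if "0 < y" for y :: real
      using abs_sin_x_le_abs_x[of y] that by simp
    show "\<bar>1 - cos y\<bar> \<le> 2" for y :: real using abs_cos_le_one[of y] by linarith
  qed (use a2 in \<open>auto intro!: derivative_eq_intros continuous_intros\<close>)
  moreover have "cos (\<bar>y\<bar> / x) = cos (y / x)" for x y :: real
    by (cases "0 \<le> y") (simp_all add: minus_divide_left[symmetric])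
  ultimately show ?thesis using a2 by (simp add: scale_const_def)
qed

lemma sin_split: "sin (y / x) = sin (max y 0 / x) - sin (max (- y) 0 / x)" for x y :: real
  by (auto simp: max_def minus_divide_left[symmetric])

text \<open>The positive and negative parts of y contribute cp and cm times the same cosine
  integral. Their difference produces \<open>\<beta>\<close>, and \<open>mellin_int_plus_one\<close>
  brings in the tangent.\<close>

lemma sin_part_less_1:
  assumes a1: "\<alpha> < 1"
  shows "((\<lambda>x. (\<integral>y. sin (y / x) \<partial>\<mu>) / tail x) \<longlongrightarrow> scale_const * \<beta> * tau0) at_top"
proof -
  have a2: "\<alpha> < 2" using a1 by simp
  have S: "((\<lambda>x. (\<integral>y. sin (\<zeta> y / x) \<partial>\<mu>) / tail x) \<longlongrightarrow> c * (mellin_int (\<alpha> + 1) / Gamma \<alpha>)) at_top"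
    if "\<zeta> \<in> borel_measurable borel" "\<And>y. 0 \<le> \<zeta> y" "\<And>y. \<zeta> y \<le> \<bar>y\<bar>"
      "((\<lambda>x. measure \<mu> {y. \<zeta> y > x} / tail x) \<longlongrightarrow> c) at_top" for \<zeta> c
  proof (rule tail_integral_limit_bounded[where p = 1 and D = 1 and B = 1 and g' = cos, OF that])
    show "((\<lambda>K. LBINT v:{0<..K}. cos v * v powr - \<alpha>) \<longlongrightarrow> mellin_int (\<alpha> + 1) / Gamma \<alpha>) at_top"
      by (rule tendsto_integral_cos_powr[OF alpha_pos a1])
  qed (use a1 in \<open>auto intro!: derivative_eq_intros continuous_intros\<close>)
  have "((\<lambda>x. (\<integral>y. sin (max y 0 / x) \<partial>\<mu>) / tail x - (\<integral>y. sin (max (- y) 0 / x) \<partial>\<mu>) / tail x) \<longlongrightarrow>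
     cp * (mellin_int (\<alpha> + 1) / Gamma \<alpha>) - cm * (mellin_int (\<alpha> + 1) / Gamma \<alpha>)) at_top"
    by (intro tendsto_diff S tail_pos_part[OF a2] tail_neg_part[OF a2]) auto
  moreover have "(\<integral>y. sin (y / x) \<partial>\<mu>) = (\<integral>y. sin (max y 0 / x) \<partial>\<mu>) - (\<integral>y. sin (max (- y) 0 / x) \<partial>\<mu>)" for x
    by (subst Bochner_Integration.integral_diff[symmetric]) (auto intro!: integrable_sin simp: sin_split[symmetric])
  moreover have "cp * (mellin_int (\<alpha> + 1) / Gamma \<alpha>) - cm * (mellin_int (\<alpha> + 1) / Gamma \<alpha>) = scale_const * \<beta> * tau0"
    unfolding mellin_int_plus_one[OF alpha_pos a1]
    using a1 a2 by (simp add: scale_const_def tau0_def algebra_simps diff_divide_distrib)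
  ultimately show ?thesis by (simp add: diff_divide_distrib)
qed

lemma sin_part_eq_1:
  assumes a1: "\<alpha> = 1"
  shows "(\<integral>y. sin (y / x) \<partial>\<mu>) = 0"
proof -
  have s: "distr \<mu> borel uminus = \<mu>" using cond_A a1 by (simp add: condition_A_def symmetric_law_def)
  have "(\<integral>y. sin (y / x) \<partial>\<mu>) = (\<integral>y. sin (y / x) \<partial>(distr \<mu> borel uminus))" by (simp only: s)
  also have "\<dots> = (\<integral>y. sin (- y / x) \<partial>\<mu>)" by (rule integral_distr) auto
  also have "\<dots> = - (\<integral>y. sin (y / x) \<partial>\<mu>)" by (simp add: minus_divide_left[symmetric])
  finally show ?thesis by simp
qed

lemma x_minus_sin_bounds: "0 \<le> y \<Longrightarrow> 0 \<le> y - sin y" "0 \<le> y \<Longrightarrow> y - sin y \<le> 2 * y" for y :: real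
  using abs_sin_x_le_abs_x[of y] by auto

text \<open>For alpha > 1 the derivative of the sine is too large at 0. Since the mean is zero, the
  sine may be replaced by -(y - sin y), and the derivative 1 - cos y does vanish at 0. The new g
  grows linearly, so the error of truncation at K is measured by the expectation of |y| beyond K x,
  which \<open>integral_tail_le\<close> bounds by a multiple of K^(1 - alpha) x tail(x).\<close>

lemma sin_part_1_2:
  assumes a1: "1 < \<alpha>" and a2: "\<alpha> < 2"
  shows "((\<lambda>x. (\<integral>y. sin (y / x) \<partial>\<mu>) / tail x) \<longlongrightarrow> scale_const * \<beta> * tau0) at_top"
proof -
  have int: "integrable \<mu> (\<lambda>y. y)" and mean: "(\<integral>y. y \<partial>\<mu>) = 0"
    using cond_A a1 by (auto simp: condition_A_def)
  obtain C where C: "0 < C" "\<And>x. 1 \<le> x \<Longrightarrow> (\<integral>y. \<bar>y\<bar> * indicator {y. \<bar>y\<bar> > x} y \<partial>\<mu>) \<le> C * x * tail x"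
    using integral_tail_le[OF a1] by blast
  define g where "g y = y - sin y" for y :: real
  have [measurable]: "g \<in> borel_measurable borel" unfolding g_def by measurable
  have gb: "\<bar>g y\<bar> \<le> 2 * \<bar>y\<bar>" for y using abs_sin_x_le_abs_x[of y] by (auto simp: g_def)
  have gi: "integrable \<mu> (\<lambda>y. g (\<zeta> y / x))"
    if [measurable]: "\<zeta> \<in> borel_measurable borel" and "\<And>y. \<bar>\<zeta> y\<bar> \<le> \<bar>y\<bar>" for \<zeta> and x :: real
  proof (rule Bochner_Integration.integrable_bound)
    show "integrable \<mu> (\<lambda>y. 2 * \<bar>y\<bar> / \<bar>x\<bar>)" using int by auto
    show "AE y in \<mu>. norm (g (\<zeta> y / x)) \<le> norm (2 * \<bar>y\<bar> / \<bar>x\<bar>)"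
      using that(2) by (intro AE_I2) (auto intro!: order_trans[OF gb] divide_right_mono)
  qed auto
  have S: "((\<lambda>x. (\<integral>y. g (\<zeta> y / x) \<partial>\<mu>) / tail x) \<longlongrightarrow> c * (mellin_int (\<alpha> - 1) / Gamma \<alpha>)) at_top"
    if \<zeta>[measurable]: "\<zeta> \<in> borel_measurable borel" and z: "\<And>y. 0 \<le> \<zeta> y" "\<And>y. \<zeta> y \<le> \<bar>y\<bar>"
      and lim: "((\<lambda>x. measure \<mu> {y. \<zeta> y > x} / tail x) \<longlongrightarrow> c) at_top" for \<zeta> c
  proof (rule tail_integral_limit_at_top[where p = 2 and D = 1 and g' = "\<lambda>y. 1 - cos y" and r = "\<lambda>K. 4 * C * K powr (1 - \<alpha>)", OF \<zeta> z lim])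
    show "((\<lambda>K. LBINT v:{0<..K}. (1 - cos v) * v powr - \<alpha>) \<longlongrightarrow> mellin_int (\<alpha> - 1) / Gamma \<alpha>) at_top"
      by (rule tendsto_integral_one_minus_cos_powr[OF a1 a2])
    show "\<bar>1 - cos y\<bar> \<le> 1 * y powr (2 - 1)" if y: "0 < y" for y :: real
    proof -
      have "1 - cos y = 2 * (sin (y/2))\<^sup>2" using cos_double_sin[of "y/2"] by simp
      also have "\<dots> \<le> 2 * \<bar>sin (y/2)\<bar>" using abs_sin_le_one[of "y/2"]
        using power2_le_iff_abs_le[of 1 "sin (y/2)"] power_decreasing[of 1 2 "\<bar>sin (y/2)\<bar>"] by simp
      also have "\<dots> \<le> 2 * \<bar>y/2\<bar>" by (intro mult_left_mono abs_sin_x_le_abs_x) auto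
      finally show "\<bar>1 - cos y\<bar> \<le> 1 * y powr (2 - 1)" using y by simp
    qed
    show "((\<lambda>K. 4 * C * K powr (1 - \<alpha>)) \<longlongrightarrow> 0) at_top" using a1 by real_asymp
    fix K :: real assume K: "1 \<le> K"
    have "((\<lambda>x. tail (K * x) / tail x) \<longlongrightarrow> K powr - \<alpha>) at_top" using K by (intro tail_ratio) auto
    then have "\<forall>\<^sub>F x in at_top. tail (K * x) / tail x < 2 * K powr - \<alpha>"
      by (rule order_tendstoD) (use K in auto)
    then show "\<forall>\<^sub>F x in at_top. \<bar>(\<integral>y. g (\<zeta> y / x) \<partial>\<mu>) - (\<integral>y. g (min (\<zeta> y / x) K) \<partial>\<mu>)\<bar> \<le> 4 * C * K powr (1 - \<alpha>) * tail x"
      using eventually_ge_at_top[of 1]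
    proof eventually_elim
      case (elim x)
      have x: "0 < x" using elim by simp
      have i1: "integrable \<mu> (\<lambda>y. g (\<zeta> y / x))" by (rule gi) (use z in auto)
      have i2: "integrable \<mu> (\<lambda>y. g (min (\<zeta> y / x) K))"
      proof -
        have "(\<lambda>y. g (min (\<zeta> y / x) K)) = (\<lambda>y. g (min (\<zeta> y) (K * x) / x))"
          using x by (auto simp: min_def field_simps)
        moreover have "\<bar>min (\<zeta> y) (K * x)\<bar> \<le> \<bar>y\<bar>" for y
          using z[of y] x K by (auto simp: min_def)
        ultimately show ?thesis by (simp add: gi)
      qed
      have "\<bar>(\<integral>y. g (\<zeta> y / x) \<partial>\<mu>) - (\<integral>y. g (min (\<zeta> y / x) K) \<partial>\<mu>)\<bar> = \<bar>\<integral>y. g (\<zeta> y / x) - g (min (\<zeta> y / x) K) \<partial>\<mu>\<bar>"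
        using i1 i2 by simp
      also have "\<dots> \<le> (\<integral>y. \<bar>g (\<zeta> y / x) - g (min (\<zeta> y / x) K)\<bar> \<partial>\<mu>)" by (rule integral_abs_bound)
      also have "\<dots> \<le> (\<integral>y. 2 / x * (\<bar>y\<bar> * indicator {y. \<bar>y\<bar> > K * x} y) \<partial>\<mu>)"
      proof (intro integral_mono integrable_abs Bochner_Integration.integrable_diff i1 i2 integrable_mult_right)
        show "integrable \<mu> (\<lambda>y. \<bar>y\<bar> * indicator {y. \<bar>y\<bar> > K * x} y)"
          by (rule Bochner_Integration.integrable_bound[OF integrable_norm[OF int]]) (auto simp: indicator_def)
        fix y
        show "\<bar>g (\<zeta> y / x) - g (min (\<zeta> y / x) K)\<bar> \<le> 2 / x * (\<bar>y\<bar> * indicator {y. \<bar>y\<bar> > K * x} y)"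
        proof (cases "\<zeta> y / x \<le> K")
          case False
          have 1: "\<bar>g (\<zeta> y / x) - g K\<bar> \<le> 2 * (\<zeta> y / x)"
            using x_minus_sin_bounds[of "\<zeta> y / x"] x_minus_sin_bounds[of K] False K by (auto simp: g_def abs_le_iff)
          also have "\<dots> \<le> 2 / x * \<bar>y\<bar>" using z(2)[of y] x by (simp add: divide_right_mono)
          finally have "\<bar>g (\<zeta> y / x) - g (min (\<zeta> y / x) K)\<bar> \<le> 2 / x * \<bar>y\<bar>" using False by (simp add: min_def)
          moreover have "K * x < \<bar>y\<bar>" using False z(2)[of y] x by (simp add: field_simps)
          ultimately show ?thesis by simp
        qed (use x in \<open>simp add: min_def\<close>)
      qed
      also have "\<dots> = 2 / x * (\<integral>y. \<bar>y\<bar> * indicator {y. \<bar>y\<bar> > K * x} y \<partial>\<mu>)" by (rule integral_mult_right_zero)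
      also have "\<dots> \<le> 2 / x * (C * (K * x) * tail (K * x))"
        using x K elim by (intro mult_left_mono C) (auto intro: order_trans[OF _ mult_mono[of 1 K 1 x]])
      also have "\<dots> = 2 * C * K * tail (K * x)" using x by simp
      also have "\<dots> \<le> 2 * C * K * (2 * K powr - \<alpha> * tail x)"
        using elim(1) tail_pos[of x] C(1) K by (intro mult_left_mono) (auto simp: divide_less_eq)
      also have "\<dots> = 4 * C * K powr (1 - \<alpha>) * tail x"
        using K by (simp add: powr_diff powr_minus divide_inverse)
      finally show ?case .
    qed
  qed (use a2 in \<open>auto intro!: derivative_eq_intros continuous_intros simp: g_def\<close>)
  have "((\<lambda>x. (\<integral>y. g (max y 0 / x) \<partial>\<mu>) / tail x - (\<integral>y. g (max (- y) 0 / x) \<partial>\<mu>) / tail x) \<longlongrightarrow>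
     cp * (mellin_int (\<alpha> - 1) / Gamma \<alpha>) - cm * (mellin_int (\<alpha> - 1) / Gamma \<alpha>)) at_top"
    by (intro tendsto_diff S tail_pos_part[OF a2] tail_neg_part[OF a2]) auto
  from tendsto_minus[OF this]
  have "((\<lambda>x. - ((\<integral>y. g (max y 0 / x) \<partial>\<mu>) / tail x - (\<integral>y. g (max (- y) 0 / x) \<partial>\<mu>) / tail x)) \<longlongrightarrow>
     scale_const * \<beta> * tau0) at_top"
    using a1 a2 alpha_pos by (simp add: scale_const_def tau0_def mellin_int_minus_one algebra_simps diff_divide_distrib)
  moreover have "(\<integral>y. sin (y / x) \<partial>\<mu>) = - ((\<integral>y. g (max y 0 / x) \<partial>\<mu>) - (\<integral>y. g (max (- y) 0 / x) \<partial>\<mu>))" for x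
  proof -
    have "(\<integral>y. g (max y 0 / x) \<partial>\<mu>) - (\<integral>y. g (max (- y) 0 / x) \<partial>\<mu>) = (\<integral>y. g (max y 0 / x) - g (max (- y) 0 / x) \<partial>\<mu>)"
      by (intro Bochner_Integration.integral_diff[symmetric] gi) auto
    also have "\<dots> = (\<integral>y. y / x - sin (y / x) \<partial>\<mu>)"
      by (intro Bochner_Integration.integral_cong refl) (auto simp: g_def max_def minus_divide_left[symmetric])
    also have "\<dots> = (\<integral>y. y / x \<partial>\<mu>) - (\<integral>y. sin (y / x) \<partial>\<mu>)"
      by (intro Bochner_Integration.integral_diff integrable_sin integrable_divide int) auto
    finally show ?thesis using mean by simp
  qed
  ultimately show ?thesis by (simp add: diff_divide_distrib)
qed

text \<open>The factor (2 - alpha)/alpha in the definition of L is what cancels the Karamata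
  constant, so that W(1/x) can replace the tail as normalisation.\<close>

lemma W_tail_ratio:
  assumes a2: "\<alpha> < 2"
  shows "((\<lambda>x. tail x / W (1 / x)) \<longlongrightarrow> 1) at_top"
proof -
  have "((\<lambda>x. inverse (W_const * (V x / (x\<^sup>2 * tail x)))) \<longlongrightarrow> inverse (W_const * (\<alpha> / (2 - \<alpha>)))) at_top"
    using a2 alpha_pos W_const_pos by (intro tendsto_intros V_tail_ratio) auto
  also have "inverse (W_const * (\<alpha> / (2 - \<alpha>))) = 1" using a2 alpha_pos by (simp add: W_const_def)
  finally show ?thesis
  proof (rule Lim_transform_eventually)
    show "\<forall>\<^sub>F x in at_top. inverse (W_const * (V x / (x\<^sup>2 * tail x))) = tail x / W (1 / x)"
      using W_inverse_eventually by eventually_elim (simp add: field_simps)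
  qed
qed

lemma char_eq_cos_sin:
  "char \<mu> t = complex_of_real (\<integral>y. cos (t * y) \<partial>\<mu>) + \<i> * complex_of_real (\<integral>y. sin (t * y) \<partial>\<mu>)"
proof -
  have "char \<mu> t = (\<integral>y. complex_of_real (cos (t * y)) + \<i> * complex_of_real (sin (t * y)) \<partial>\<mu>)"
    unfolding char_def by (intro Bochner_Integration.integral_cong refl) (simp add: Re_exp Im_exp complex_eq_iff)
  also have "\<dots> = (\<integral>y. complex_of_real (cos (t * y)) \<partial>\<mu>) + (\<integral>y. \<i> * complex_of_real (sin (t * y)) \<partial>\<mu>)"
    by (intro Bochner_Integration.integral_add integrable_mult_right integrable_of_real integrable_sin integrable_cos) auto
  finally show ?thesis by simp
qed

lemma char_minus: "char \<mu> (- t) = cnj (char \<mu> t)"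
  by (simp add: char_eq_cos_sin)

lemma char_asymp_less_2:
  assumes a2: "\<alpha> < 2"
  shows "((\<lambda>x. (1 - char \<mu> (1 / x)) / W (1 / x)) \<longlongrightarrow> scale_const * (1 - \<i> * complex_of_real (\<beta> * tau0))) at_top"
proof -
  have s: "((\<lambda>x. (\<integral>y. sin (y / x) \<partial>\<mu>) / tail x) \<longlongrightarrow> scale_const * \<beta> * tau0) at_top"
  proof (cases "\<alpha> = 1")
    case True
    have "tau0 = 0" using True unfolding tau0_def by auto
    then show ?thesis using sin_part_eq_1[OF True] by simp
  next
    case False
    then show ?thesis using sin_part_less_1 sin_part_1_2 a2 by (cases "\<alpha> < 1") auto
  qed
  have "((\<lambda>x. (complex_of_real ((\<integral>y. 1 - cos (y / x) \<partial>\<mu>) / tail x) - \<i> * complex_of_real ((\<integral>y. sin (y / x) \<partial>\<mu>) / tail x)) *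
     complex_of_real (tail x / W (1 / x))) \<longlongrightarrow>
     (complex_of_real scale_const - \<i> * complex_of_real (scale_const * \<beta> * tau0)) * complex_of_real 1) at_top"
    by (intro tendsto_intros cos_part[OF a2] s W_tail_ratio[OF a2])
  also have "(complex_of_real scale_const - \<i> * complex_of_real (scale_const * \<beta> * tau0)) * complex_of_real 1 =
      scale_const * (1 - \<i> * complex_of_real (\<beta> * tau0))" by (simp add: algebra_simps)
  also have "(\<lambda>x. (complex_of_real ((\<integral>y. 1 - cos (y / x) \<partial>\<mu>) / tail x) - \<i> * complex_of_real ((\<integral>y. sin (y / x) \<partial>\<mu>) / tail x)) *
     complex_of_real (tail x / W (1 / x))) = (\<lambda>x. (1 - char \<mu> (1 / x)) / W (1 / x))"
  proof
    fix x
    have h: "(\<integral>y. 1 - cos (y / x) \<partial>\<mu>) = 1 - (\<integral>y. cos (y / x) \<partial>\<mu>)"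
      by (subst Bochner_Integration.integral_diff) (auto intro!: integrable_cos simp: prob_space[simplified])
    show "(complex_of_real ((\<integral>y. 1 - cos (y / x) \<partial>\<mu>) / tail x) - \<i> * complex_of_real ((\<integral>y. sin (y / x) \<partial>\<mu>) / tail x)) *
     complex_of_real (tail x / W (1 / x)) = (1 - char \<mu> (1 / x)) / W (1 / x)"
      unfolding h using tail_pos[of x] by (simp add: char_eq_cos_sin algebra_simps diff_divide_distrib add_divide_distrib)
  qed
  finally show ?thesis .
qed

text \<open>At alpha = 2 the second moment truncated at epsilon x dominates. Below the cut the
  Taylor remainder |y/x|^3 is at most epsilon y^2/x^2. Above it the linear term, which costs nothing
  because the mean is zero, leaves at most 2|y|/x. Its expectation beyond the cut is of order
  epsilon tail(epsilon x), hence o(V(x)/x^2).\<close>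

lemma char_asymp_2:
  assumes a2: "\<alpha> = 2"
  shows "((\<lambda>x. (1 - char \<mu> (1 / x)) / W (1 / x)) \<longlongrightarrow> scale_const * (1 - \<i> * complex_of_real (\<beta> * tau0))) at_top"
proof -
  have int: "integrable \<mu> (\<lambda>y. y)" and mean: "(\<integral>y. y \<partial>\<mu>) = 0"
    using cond_A a2 by (auto simp: condition_A_def)
  obtain C where C: "0 < C" "\<And>x. 1 \<le> x \<Longrightarrow> (\<integral>y. \<bar>y\<bar> * indicator {y. \<bar>y\<bar> > x} y \<partial>\<mu>) \<le> C * x * tail x"
    using integral_tail_le a2 by auto
  have inti: "integrable \<mu> (\<lambda>y. \<bar>y\<bar> * indicator {y. \<bar>y\<bar> > x} y)" for x
    by (rule Bochner_Integration.integrable_bound[OF integrable_norm[OF int]]) (auto simp: indicator_def)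
  have wc: "W_const = 1" using a2 unfolding W_const_def by auto
  have cc: "scale_const = 1/2" "tau0 = 0" using a2 unfolding scale_const_def tau0_def by auto
  have key: "cmod ((1 - char \<mu> (1 / x)) - complex_of_real (V (\<epsilon> * x) / (2 * x\<^sup>2))) \<le> \<epsilon> * (V (\<epsilon> * x) / x\<^sup>2) + 2 * C * \<epsilon> * tail (\<epsilon> * x)"
    if e: "0 < \<epsilon>" and x: "0 < x" "1 \<le> \<epsilon> * x" for \<epsilon> x
  proof -
    define f where "f y = 1 - iexp (y / x) + \<i> * complex_of_real (y / x)" for y
    define q where "q y = complex_of_real (y\<^sup>2 * indicator {y. \<bar>y\<bar> \<le> \<epsilon> * x} y / (2 * x\<^sup>2))" for y
    have i1: "integrable \<mu> (\<lambda>y. iexp (y / x))"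
      by (rule integrable_const_bound[where B = 1]) auto
    have i2: "integrable \<mu> (\<lambda>y. \<i> * complex_of_real (y / x))"
      by (intro integrable_mult_right integrable_of_real integrable_divide int)
    have if1: "integrable \<mu> f" unfolding f_def using i1 i2 by simp
    have iq: "integrable \<mu> q" unfolding q_def by (intro integrable_of_real integrable_divide integrable_truncated)
    have "(\<integral>y. f y \<partial>\<mu>) = 1 - (\<integral>y. iexp (y / x) \<partial>\<mu>) + (\<integral>y. \<i> * complex_of_real (y / x) \<partial>\<mu>)"
      unfolding f_def using i1 i2 by (simp add: prob_space[simplified])
    also have "(\<integral>y. \<i> * complex_of_real (y / x) \<partial>\<mu>) = 0"
      using mean by (simp add: of_real_divide[symmetric] del: of_real_divide)
    also have "(\<integral>y. iexp (y / x) \<partial>\<mu>) = char \<mu> (1 / x)" by (simp add: char_def)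
    finally have "(1 - char \<mu> (1 / x)) = (\<integral>y. f y \<partial>\<mu>)" by simp
    moreover have "complex_of_real (V (\<epsilon> * x) / (2 * x\<^sup>2)) = (\<integral>y. q y \<partial>\<mu>)"
      unfolding q_def truncated_moment_def by (simp add: of_real_divide[symmetric] del: of_real_divide)
    ultimately have "cmod ((1 - char \<mu> (1 / x)) - complex_of_real (V (\<epsilon> * x) / (2 * x\<^sup>2))) = cmod (\<integral>y. f y - q y \<partial>\<mu>)"
      using if1 iq by simp
    also have "\<dots> \<le> (\<integral>y. cmod (f y - q y) \<partial>\<mu>)" by (rule integral_norm_bound)
    also have "\<dots> \<le> (\<integral>y. \<epsilon> * (y\<^sup>2 * indicator {y. \<bar>y\<bar> \<le> \<epsilon> * x} y) / x\<^sup>2 + 2 / x * (\<bar>y\<bar> * indicator {y. \<bar>y\<bar> > \<epsilon> * x} y) \<partial>\<mu>)"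
    proof (intro integral_mono integrable_norm Bochner_Integration.integrable_diff if1 iq Bochner_Integration.integrable_add
         integrable_divide integrable_mult_right inti integrable_truncated)
      fix y
      show "cmod (f y - q y) \<le> \<epsilon> * (y\<^sup>2 * indicator {y. \<bar>y\<bar> \<le> \<epsilon> * x} y) / x\<^sup>2 + 2 / x * (\<bar>y\<bar> * indicator {y. \<bar>y\<bar> > \<epsilon> * x} y)"
      proof (cases "\<bar>y\<bar> \<le> \<epsilon> * x")
        case True
        have "f y - q y = - (iexp (y/x) - (\<Sum>k\<le>2. (\<i> * complex_of_real (y/x)) ^ k / fact k))"
          using True x by (simp add: f_def q_def numeral_2_eq_2 power2_eq_square field_simps)
        also have "cmod \<dots> \<le> \<bar>y/x\<bar> ^ Suc 2 / fact (Suc 2)"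
          unfolding norm_minus_cancel by (rule iexp_approx1)
        also have "\<dots> \<le> \<bar>y/x\<bar> ^ Suc 2 / 1" by (intro divide_left_mono) (auto simp: fact_ge_1)
        also have "\<dots> = \<bar>y/x\<bar> ^ 3" by (simp add: numeral_3_eq_3)
        also have "\<dots> = \<bar>y/x\<bar> * (y\<^sup>2 / x\<^sup>2)" by (simp add: power3_eq_cube power2_eq_square power_divide)
        also have "\<dots> \<le> \<epsilon> * (y\<^sup>2 / x\<^sup>2)"
          using True x by (intro mult_right_mono) (auto simp: field_simps)
        finally show ?thesis using True by simp
      next
        case False
        have "cmod (iexp (y/x) - (\<Sum>k\<le>1. (\<i> * complex_of_real (y/x)) ^ k / fact k)) \<le> 2 * \<bar>y/x\<bar>^1 / fact 1"
          by (rule iexp_approx2)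
        moreover have "f y - q y = - (iexp (y/x) - (\<Sum>k\<le>1. (\<i> * complex_of_real (y/x)) ^ k / fact k))"
          using False by (simp add: f_def q_def)
        then have "cmod (f y - q y) = cmod (iexp (y/x) - (\<Sum>k\<le>1. (\<i> * complex_of_real (y/x)) ^ k / fact k))"
          by (simp only: norm_minus_cancel)
        ultimately show ?thesis using False x by simp
      qed
    qed
    also have "\<dots> = \<epsilon> * V (\<epsilon> * x) / x\<^sup>2 + 2 / x * (\<integral>y. \<bar>y\<bar> * indicator {y. \<bar>y\<bar> > \<epsilon> * x} y \<partial>\<mu>)"
      unfolding truncated_moment_def using inti integrable_truncated by simp
    also have "\<dots> \<le> \<epsilon> * V (\<epsilon> * x) / x\<^sup>2 + 2 / x * (C * (\<epsilon> * x) * tail (\<epsilon> * x))"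
      using x by (intro add_mono order_refl mult_left_mono C) auto
    also have "\<dots> = \<epsilon> * (V (\<epsilon> * x) / x\<^sup>2) + 2 * C * \<epsilon> * tail (\<epsilon> * x)" using x by simp
    finally show ?thesis .
  qed
  have "((\<lambda>x. (1 - char \<mu> (1 / x)) / W (1 / x)) \<longlongrightarrow> complex_of_real (1/2)) at_top"
  proof (rule tendstoI)
    fix \<delta> :: real assume d: "0 < \<delta>"
    \<comment> \<open>With V(epsilon x)/V(x) at most 2, the first error term costs at most delta/4.
      The two others are made smaller than delta/4 by taking x large.\<close>
    define \<epsilon> where "\<epsilon> = \<delta> / 8"
    have e: "0 < \<epsilon>" using d by (simp add: \<epsilon>_def)
    have ex: "filterlim (\<lambda>x. \<epsilon> * x) at_top at_top" using e by real_asymp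
    have l1: "((\<lambda>x. V (\<epsilon> * x) / V x) \<longlongrightarrow> 1) at_top" using V_ratio[OF e] e a2 by simp
    have l2: "((\<lambda>x. ((\<epsilon> * x)\<^sup>2 * tail (\<epsilon> * x) / V (\<epsilon> * x)) * (V (\<epsilon> * x) / V x) * (2 * C / \<epsilon>)) \<longlongrightarrow> 0 * 1 * (2 * C / \<epsilon>)) at_top"
      by (intro tendsto_intros l1 filterlim_compose[OF tail_V_ratio_2[OF a2] ex])
    have b1: "\<forall>\<^sub>F x in at_top. \<bar>V (\<epsilon> * x) / V x - 1\<bar> < min 1 (\<delta> / 4)"
      using tendstoD[OF l1, of "min 1 (\<delta>/4)"] d by (simp add: dist_real_def)
    have b2: "\<forall>\<^sub>F x in at_top. ((\<epsilon> * x)\<^sup>2 * tail (\<epsilon> * x) / V (\<epsilon> * x)) * (V (\<epsilon> * x) / V x) * (2 * C / \<epsilon>) < \<delta> / 4"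
      using order_tendstoD(2)[OF l2, of "\<delta>/4"] d by simp
    have b3: "\<forall>\<^sub>F x in at_top. max 1 b \<le> \<epsilon> * x" using ex unfolding filterlim_at_top by blast
    show "\<forall>\<^sub>F x in at_top. dist ((1 - char \<mu> (1 / x)) / W (1 / x)) (complex_of_real (1/2)) < \<delta>"
      using b1 b2 b3 W_inverse_eventually eventually_ge_at_top[of b]
    proof eventually_elim
      case (elim x)
      have x: "0 < x" using elim(5) L_start_ge_1 by simp
      have v: "1 \<le> V x" "1 \<le> V (\<epsilon> * x)" using V_ge_1 elim by auto
      have Wx: "W (1 / x) = V x / x\<^sup>2" using elim(4) by (simp add: wc)
      have Wp: "0 < W (1 / x)" using x by (intro W_pos) simp
      have A: "cmod ((1 - char \<mu> (1 / x)) / W (1 / x) - complex_of_real (V (\<epsilon> * x) / V x / 2)) \<le>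
           \<epsilon> * (V (\<epsilon> * x) / V x) + (2 * C * \<epsilon> * tail (\<epsilon> * x)) / W (1 / x)"
      proof -
        have "complex_of_real (V (\<epsilon> * x) / V x / 2) = complex_of_real (V (\<epsilon> * x) / (2 * x\<^sup>2)) / W (1 / x)"
          unfolding Wx using x v by (simp flip: of_real_divide)
        then have "(1 - char \<mu> (1 / x)) / W (1 / x) - complex_of_real (V (\<epsilon> * x) / V x / 2) =
            ((1 - char \<mu> (1 / x)) - complex_of_real (V (\<epsilon> * x) / (2 * x\<^sup>2))) / W (1 / x)"
          by (simp add: diff_divide_distrib)
        then have "cmod ((1 - char \<mu> (1 / x)) / W (1 / x) - complex_of_real (V (\<epsilon> * x) / V x / 2)) =
            cmod ((1 - char \<mu> (1 / x)) - complex_of_real (V (\<epsilon> * x) / (2 * x\<^sup>2))) / W (1 / x)"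
          using Wp by (simp add: norm_divide)
        also have "\<dots> \<le> (\<epsilon> * (V (\<epsilon> * x) / x\<^sup>2) + 2 * C * \<epsilon> * tail (\<epsilon> * x)) / W (1 / x)"
          using Wp elim(3) by (intro divide_right_mono key e x) auto
        also have "\<dots> = \<epsilon> * (V (\<epsilon> * x) / V x) + (2 * C * \<epsilon> * tail (\<epsilon> * x)) / W (1 / x)"
          unfolding add_divide_distrib using x v by (simp add: Wx)
        finally show ?thesis .
      qed
      have B: "(2 * C * \<epsilon> * tail (\<epsilon> * x)) / W (1 / x) < \<delta> / 4"
      proof -
        have "(2 * C * \<epsilon> * tail (\<epsilon> * x)) / W (1 / x) =
            ((\<epsilon> * x)\<^sup>2 * tail (\<epsilon> * x) / V (\<epsilon> * x)) * (V (\<epsilon> * x) / V x) * (2 * C / \<epsilon>)"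
          unfolding Wx using x v e by (simp add: power2_eq_square)
        then show ?thesis using elim(2) by simp
      qed
      have D: "\<epsilon> * (V (\<epsilon> * x) / V x) \<le> \<delta> / 4"
      proof -
        have "V (\<epsilon> * x) / V x \<le> 2" using elim(1) by linarith
        then have "\<epsilon> * (V (\<epsilon> * x) / V x) \<le> \<epsilon> * 2" using e by (intro mult_left_mono) auto
        then show ?thesis by (simp add: \<epsilon>_def)
      qed
      have E: "cmod (complex_of_real (V (\<epsilon> * x) / V x / 2) - complex_of_real (1/2)) < \<delta> / 4"
      proof -
        have "complex_of_real (V (\<epsilon> * x) / V x / 2) - complex_of_real (1/2) = complex_of_real ((V (\<epsilon> * x) / V x - 1) / 2)"
          by (simp add: diff_divide_distrib)
        then have *: "cmod (complex_of_real (V (\<epsilon> * x) / V x / 2) - complex_of_real (1/2)) = \<bar>V (\<epsilon> * x) / V x - 1\<bar> / 2"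
          by (simp only: norm_of_real) simp
        have "\<bar>V (\<epsilon> * x) / V x - 1\<bar> < \<delta> / 4" using elim(1) by (rule less_le_trans) simp
        then have "\<bar>V (\<epsilon> * x) / V x - 1\<bar> / 2 < \<delta> / 4" by (rule le_less_trans[rotated]) simp
        then show ?thesis by (simp only: *)
      qed
      have "dist ((1 - char \<mu> (1 / x)) / W (1 / x)) (complex_of_real (1/2)) \<le>
          dist ((1 - char \<mu> (1 / x)) / W (1 / x)) (complex_of_real (V (\<epsilon> * x) / V x / 2)) +
          dist (complex_of_real (V (\<epsilon> * x) / V x / 2)) (complex_of_real (1/2))" by (rule dist_triangle)
      then show ?case using A B D E d unfolding dist_norm by linarith
    qed
  qed
  then show ?thesis by (simp add: cc)
qed

end

context stable_domain
begin

text \<open>The limit along t = 1/x covers positive t, and complex conjugation carries it to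
  negative t, in accordance with the sign change of \<open>stable_tau\<close>.\<close>

lemma char_asymp:
  "((\<lambda>t. (1 - char \<mu> t) / W t - scale_const * (1 - \<i> * complex_of_real (\<beta> * stable_tau \<alpha> t))) \<longlongrightarrow> 0) (at 0)"
proof -
  let ?f = "\<lambda>t. (1 - char \<mu> t) / W t"
  let ?l = "scale_const * (1 - \<i> * complex_of_real (\<beta> * tau0))"
  have "((\<lambda>x. ?f (1 / x)) \<longlongrightarrow> ?l) at_top"
    using char_asymp_less_2 char_asymp_2 alpha_le by (cases "\<alpha> < 2") auto
  then have r: "(?f \<longlongrightarrow> ?l) (at_right 0)"
    by (simp add: filterlim_at_right_to_top inverse_eq_divide)
  then have "((\<lambda>t. cnj (?f t)) \<longlongrightarrow> cnj ?l) (at_right 0)" by (intro tendsto_cnj)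
  then have "((\<lambda>t. ?f (- t)) \<longlongrightarrow> cnj ?l) (at_right 0)" by (simp add: char_minus)
  then have l: "(?f \<longlongrightarrow> cnj ?l) (at_left 0)" by (simp add: filterlim_at_left_to_right)
  have "((\<lambda>t. ?f t - scale_const * (1 - \<i> * complex_of_real (\<beta> * stable_tau \<alpha> t))) \<longlongrightarrow> 0) (at_right 0)"
  proof (rule Lim_transform_eventually)
    show "((\<lambda>t. ?f t - ?l) \<longlongrightarrow> 0) (at_right 0)" using r by (simp only: LIM_zero_iff)
    show "\<forall>\<^sub>F t in at_right 0. ?f t - ?l = ?f t - scale_const * (1 - \<i> * complex_of_real (\<beta> * stable_tau \<alpha> t))"
      by (auto simp: eventually_at_filter stable_tau_eq)
  qed
  moreover have "((\<lambda>t. ?f t - scale_const * (1 - \<i> * complex_of_real (\<beta> * stable_tau \<alpha> t))) \<longlongrightarrow> 0) (at_left 0)"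
  proof (rule Lim_transform_eventually)
    show "((\<lambda>t. ?f t - cnj ?l) \<longlongrightarrow> 0) (at_left 0)" using l by (simp only: LIM_zero_iff)
    show "\<forall>\<^sub>F t in at_left 0. ?f t - cnj ?l = ?f t - scale_const * (1 - \<i> * complex_of_real (\<beta> * stable_tau \<alpha> t))"
      by (auto simp: eventually_at_filter stable_tau_eq)
  qed
  ultimately show ?thesis by (simp add: filterlim_split_at)
qed

section \<open>Logarithm of the characteristic function and bounds on bounded intervals\<close>

lemma tau_bound: "cmod (1 - \<i> * complex_of_real (\<beta> * stable_tau \<alpha> t)) \<le> 1 + \<bar>\<beta> * tau0\<bar>"
proof -
  have "cmod (1 - \<i> * complex_of_real (\<beta> * stable_tau \<alpha> t)) \<le> 1 + \<bar>\<beta> * stable_tau \<alpha> t\<bar>"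
    using norm_triangle_ineq4[of 1 "\<i> * complex_of_real (\<beta> * stable_tau \<alpha> t)"] by (simp add: norm_mult del: of_real_mult)
  also have "\<bar>\<beta> * stable_tau \<alpha> t\<bar> \<le> \<bar>\<beta> * tau0\<bar>"
    by (auto simp: stable_tau_eq abs_mult sgn_if)
  finally show ?thesis by simp
qed

text \<open>The comparison term has real part \<open>scale_const\<close>, hence at least this
  modulus, and the error is eventually smaller. So the characteristic function differs from 1 near
  0, which permits the quotient Ln z / (z - 1) in the passage to logarithms.\<close>

lemma char_bounds_near_0:
  "\<forall>\<^sub>F t in at 0. cmod (1 - char \<mu> t) \<le> scale_const * (2 + \<bar>\<beta> * tau0\<bar>) * W t \<and> char \<mu> t \<noteq> 1"
proof -
  have "\<forall>\<^sub>F t in at 0. dist ((1 - char \<mu> t) / W t - scale_const * (1 - \<i> * complex_of_real (\<beta> * stable_tau \<alpha> t))) 0 < scale_const"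
    by (rule tendstoD[OF char_asymp scale_const_pos])
  moreover have "\<forall>\<^sub>F t::real in at 0. t \<noteq> 0" by (simp add: eventually_at_filter)
  ultimately show ?thesis
  proof eventually_elim
    case (elim t)
    let ?l = "scale_const * (1 - \<i> * complex_of_real (\<beta> * stable_tau \<alpha> t))"
    have Wp: "0 < W t" using elim by (intro W_pos)
    have d: "cmod ((1 - char \<mu> t) / W t - ?l) < scale_const" using elim by simp
    have "cmod ((1 - char \<mu> t) / W t) \<le> cmod ((1 - char \<mu> t) / W t - ?l) + cmod ?l"
      using norm_triangle_ineq[of "(1 - char \<mu> t) / W t - ?l" ?l] by simp
    also have "cmod ?l \<le> scale_const * (1 + \<bar>\<beta> * tau0\<bar>)"
      unfolding norm_mult using scale_const_pos by (simp add: mult_left_mono[OF tau_bound] del: of_real_mult)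
    finally have "cmod ((1 - char \<mu> t) / W t) \<le> scale_const * (2 + \<bar>\<beta> * tau0\<bar>)"
      using d by (simp add: algebra_simps)
    then have 1: "cmod (1 - char \<mu> t) \<le> scale_const * (2 + \<bar>\<beta> * tau0\<bar>) * W t"
      using Wp by (simp add: norm_divide divide_le_eq)
    have "char \<mu> t \<noteq> 1"
    proof
      assume "char \<mu> t = 1"
      then have "cmod ?l < scale_const" using d by (simp add: norm_minus_cancel)
      moreover have "scale_const * 1 \<le> scale_const * cmod (1 - \<i> * complex_of_real (\<beta> * stable_tau \<alpha> t))"
        using complex_Re_le_cmod[of "1 - \<i> * complex_of_real (\<beta> * stable_tau \<alpha> t)"] scale_const_pos
        by (intro mult_left_mono) (auto simp del: of_real_mult)
      ultimately show False using scale_const_pos by (simp add: norm_mult del: of_real_mult)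
    qed
    with 1 show ?case by simp
  qed
qed

lemma char_tendsto_1: "(char \<mu> \<longlongrightarrow> 1) (at 0)"
  using isCont_char[of 0] char_zero by (simp add: isCont_def)

text \<open>Ln z differs from z - 1 by o(|z - 1|), and 1 - \<open>char \<mu> t\<close> is O(W(t));
  so at the scale of W the logarithm may replace the difference.\<close>

lemma Ln_char_asymp:
  "((\<lambda>t. Ln (char \<mu> t) / W t + scale_const * (1 - \<i> * complex_of_real (\<beta> * stable_tau \<alpha> t))) \<longlongrightarrow> 0) (at 0)"
proof -
  let ?l = "\<lambda>t. scale_const * (1 - \<i> * complex_of_real (\<beta> * stable_tau \<alpha> t))"
  let ?B = "scale_const * (2 + \<bar>\<beta> * tau0\<bar>)"
  have ne: "\<forall>\<^sub>F t in at 0. char \<mu> t \<noteq> 1" using char_bounds_near_0 by eventually_elim simp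
  have fl: "filterlim (char \<mu>) (at 1) (at 0)" using char_tendsto_1 ne by (simp add: filterlim_at)
  have X: "((\<lambda>t. Ln (char \<mu> t) / (char \<mu> t - 1)) \<longlongrightarrow> 1) (at 0)"
    by (rule filterlim_compose[OF Ln_div_tendsto_1 fl])
  then have X1: "((\<lambda>t. Ln (char \<mu> t) / (char \<mu> t - 1) - 1) \<longlongrightarrow> 0) (at 0)" by (simp only: LIM_zero_iff)
  have "((\<lambda>t. (Ln (char \<mu> t) / (char \<mu> t - 1) - 1) * ((char \<mu> t - 1) / W t)) \<longlongrightarrow> 0) (at 0)"
  proof (rule lim_null_mult_right_bounded[OF X1, where B = ?B])
    have "\<forall>\<^sub>F t::real in at 0. t \<noteq> 0" by (simp add: eventually_at_filter)
    with char_bounds_near_0 show "\<forall>\<^sub>F t in at 0. cmod ((char \<mu> t - 1) / W t) \<le> ?B"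
    proof eventually_elim
      case (elim t)
      then show ?case using W_pos[of t] by (simp add: norm_divide divide_le_eq norm_minus_commute)
    qed
  qed
  from tendsto_add[OF this tendsto_minus[OF char_asymp]]
  have "((\<lambda>t. (Ln (char \<mu> t) / (char \<mu> t - 1) - 1) * ((char \<mu> t - 1) / W t) + - ((1 - char \<mu> t) / W t - ?l t)) \<longlongrightarrow> 0) (at 0)"
    by simp
  then show ?thesis
  proof (rule Lim_transform_eventually)
    show "\<forall>\<^sub>F t in at 0. (Ln (char \<mu> t) / (char \<mu> t - 1) - 1) * ((char \<mu> t - 1) / W t) + - ((1 - char \<mu> t) / W t - ?l t) =
        Ln (char \<mu> t) / W t + ?l t"
      using ne
    proof eventually_elim
      case (elim t)
      have "(A / z - 1) * (z / w) = A / w - z / w" if "z \<noteq> 0" for A z w :: complex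
        using that by (simp add: left_diff_distrib diff_divide_distrib)
      from this[of "char \<mu> t - 1"] elim
      have "(Ln (char \<mu> t) / (char \<mu> t - 1) - 1) * ((char \<mu> t - 1) / W t) = Ln (char \<mu> t) / W t - (char \<mu> t - 1) / W t"
        by simp
      then show ?case by (simp add: diff_divide_distrib)
    qed
  qed
qed

text \<open>Resolves the definite description. Another admissible c would make (scale_const - c)(1 -
  i beta tau) tend to 0, and the real part of this is the constant scale_const - c.\<close>

lemma char_const_eq: "char_const \<alpha> \<beta> \<mu> = scale_const"
  unfolding char_const_def
proof (rule the_equality)
  have W0: "\<forall>\<^sub>F t::real in at 0. t \<noteq> 0" by (simp add: eventually_at_filter)
  have "((\<lambda>t. (Ln (char \<mu> t) / W t + scale_const * (1 - \<i> * complex_of_real (\<beta> * stable_tau \<alpha> t))) / (- scale_const)) \<longlongrightarrow> 0 / complex_of_real (- scale_const)) (at 0)"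
    using scale_const_pos by (intro tendsto_divide Ln_char_asymp tendsto_const) auto
  also have "(\<lambda>t. (Ln (char \<mu> t) / W t + scale_const * (1 - \<i> * complex_of_real (\<beta> * stable_tau \<alpha> t))) / (- scale_const)) =
      (\<lambda>t. Ln (char \<mu> t) / complex_of_real (- scale_const * W t) - (1 - \<i> * complex_of_real (\<beta> * stable_tau \<alpha> t)))"
    using scale_const_pos by (intro ext) (simp add: add_divide_distrib diff_divide_distrib mult.commute)
  finally show "0 < scale_const \<and> ((\<lambda>t. Ln (char \<mu> t) / complex_of_real (- scale_const * W t) -
       (1 - \<i> * complex_of_real (\<beta> * stable_tau \<alpha> t))) \<longlongrightarrow> 0) (at 0)"
    using scale_const_pos by simp
next
  fix c assume c: "0 < c \<and> ((\<lambda>t. Ln (char \<mu> t) / complex_of_real (- c * W t) -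
       (1 - \<i> * complex_of_real (\<beta> * stable_tau \<alpha> t))) \<longlongrightarrow> 0) (at 0)"
  let ?s = "\<lambda>t. 1 - \<i> * complex_of_real (\<beta> * stable_tau \<alpha> t)"
  have "((\<lambda>t. (Ln (char \<mu> t) / complex_of_real (- c * W t) - ?s t) * complex_of_real c) \<longlongrightarrow> 0 * complex_of_real c) (at 0)"
    using c by (intro tendsto_mult tendsto_const) auto
  from tendsto_add[OF this Ln_char_asymp]
  have "((\<lambda>t. (Ln (char \<mu> t) / complex_of_real (- c * W t) - ?s t) * complex_of_real c + (Ln (char \<mu> t) / W t + scale_const * ?s t)) \<longlongrightarrow> 0) (at 0)"
    by simp
  also have "(\<lambda>t. (Ln (char \<mu> t) / complex_of_real (- c * W t) - ?s t) * complex_of_real c + (Ln (char \<mu> t) / W t + scale_const * ?s t)) =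
      (\<lambda>t. complex_of_real (scale_const - c) * ?s t)"
  proof
    fix t
    have "Ln (char \<mu> t) / complex_of_real (- c * W t) * complex_of_real c = - (Ln (char \<mu> t) / W t)"
      using c by simp
    then show "(Ln (char \<mu> t) / complex_of_real (- c * W t) - ?s t) * complex_of_real c + (Ln (char \<mu> t) / W t + scale_const * ?s t) =
       complex_of_real (scale_const - c) * ?s t"
      by (simp only: left_diff_distrib) (simp add: algebra_simps)
  qed
  finally have "((\<lambda>t. Re (complex_of_real (scale_const - c) * ?s t)) \<longlongrightarrow> Re 0) (at (0::real))" by (rule tendsto_Re)
  then have "((\<lambda>t. scale_const - c) \<longlongrightarrow> 0) (at (0::real))" by simp
  then show "c = scale_const" by (simp add: tendsto_const_iff)
qed

lemma char_le_W:
  assumes R: "0 < R"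
  shows "\<exists>C>0. \<forall>s. \<bar>s\<bar> \<le> R \<longrightarrow> cmod (1 - char \<mu> s) \<le> C * W s"
proof -
  have abs: "cmod (1 - char \<mu> \<bar>s\<bar>) = cmod (1 - char \<mu> s)" for s
  proof (cases "0 \<le> s")
    case False
    have "cmod (cnj (1 - char \<mu> s)) = cmod (1 - char \<mu> s)" by (rule complex_mod_cnj)
    then show ?thesis using False by (simp add: char_minus abs_if)
  qed simp
  have "\<exists>C>0. \<forall>s. 0 < \<bar>s\<bar> \<longrightarrow> \<bar>s\<bar> \<le> R \<longrightarrow> cmod (1 - char \<mu> (1 / (1 / \<bar>s\<bar>))) \<le> C * W s"
  proof (rule bounded_by_W[where B = 2 and h = "\<lambda>x. cmod (1 - char \<mu> (1 / x))", OF _ _ R])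
    show "cmod (1 - char \<mu> (1 / x)) \<le> 2" for x
      using norm_triangle_ineq4[of 1 "char \<mu> (1 / x)"] cmod_char_le_1[of "1/x"] by simp
    have "filterlim (\<lambda>x::real. 1 / x) (at 0) at_top" by real_asymp
    from eventually_compose_filterlim[OF char_bounds_near_0 this]
    show "\<forall>\<^sub>F x in at_top. cmod (1 - char \<mu> (1 / x)) \<le> scale_const * (2 + \<bar>\<beta> * tau0\<bar>) * W (1 / x)"
      by eventually_elim simp
  qed
  then obtain C where C: "0 < C" "\<And>s. 0 < \<bar>s\<bar> \<Longrightarrow> \<bar>s\<bar> \<le> R \<Longrightarrow> cmod (1 - char \<mu> s) \<le> C * W s"
    by (auto simp: abs)
  have "cmod (1 - char \<mu> s) \<le> C * W s" if "\<bar>s\<bar> \<le> R" for s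
    using C(2)[OF _ that] by (cases "s = 0") (auto simp: char_zero)
  then show ?thesis using C(1) by blast
qed

text \<open>Near 0 the bound is the real part of the logarithmic asymptotics. On d <= |s| <= R the
  modulus is continuous and below 1 by non-latticeness, hence at most some \<open>\<rho>\<close> < 1
  by compactness, while W is bounded above there. The radius R is arbitrary, and k depends on
  it.\<close>

lemma char_le_exp_W:
  assumes nl: "non_lattice \<mu>" and R: "0 < R"
  shows "\<exists>k>0. \<forall>s. \<bar>s\<bar> \<le> R \<longrightarrow> cmod (char \<mu> s) \<le> exp (- k * W s)"
proof -
  have "\<forall>\<^sub>F t in at 0. dist (Ln (char \<mu> t) / W t + scale_const * (1 - \<i> * complex_of_real (\<beta> * stable_tau \<alpha> t))) 0 < scale_const / 2"
    using scale_const_pos by (intro tendstoD[OF Ln_char_asymp]) auto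
  moreover have "\<forall>\<^sub>F t in at 0. char \<mu> t \<noteq> 0"
    by (rule tendsto_imp_eventually_ne[OF char_tendsto_1]) simp
  moreover have "\<forall>\<^sub>F t::real in at 0. t \<noteq> 0" by (simp add: eventually_at_filter)
  ultimately have "\<forall>\<^sub>F t in at 0. cmod (char \<mu> t) \<le> exp (- (scale_const / 2) * W t)"
  proof eventually_elim
    case (elim t)
    let ?z = "Ln (char \<mu> t) / W t + scale_const * (1 - \<i> * complex_of_real (\<beta> * stable_tau \<alpha> t))"
    have Wp: "0 < W t" using elim by (intro W_pos)
    have "Re ?z \<le> scale_const / 2"
      using complex_Re_le_cmod[of ?z] elim(1) unfolding dist_norm diff_0_right by linarith
    moreover have "Re ?z = Re (Ln (char \<mu> t)) / W t + scale_const" by (simp add: Re_divide_of_real)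
    ultimately have "Re (Ln (char \<mu> t)) / W t \<le> - (scale_const / 2)" by linarith
    then have "Re (Ln (char \<mu> t)) \<le> - (scale_const / 2) * W t" using Wp by (simp add: divide_le_eq)
    moreover have "cmod (char \<mu> t) = exp (Re (Ln (char \<mu> t)))" using elim(2) by (simp add: norm_exp_eq_Re[symmetric])
    ultimately show ?case by simp
  qed
  then obtain d where d: "0 < d" "\<And>t. t \<noteq> 0 \<Longrightarrow> \<bar>t\<bar> < d \<Longrightarrow> cmod (char \<mu> t) \<le> exp (- (scale_const / 2) * W t)"
    by (auto simp: eventually_at dist_real_def)
  define S where "S = {-R..-d} \<union> {d..R}"
  have "\<exists>\<rho><1. 0 < \<rho> \<and> (\<forall>s\<in>S. cmod (char \<mu> s) \<le> \<rho>)"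
  proof (cases "S = {}")
    case True
    then show ?thesis by (intro exI[of _ "1/2"]) auto
  next
    case False
    have "continuous_on S (\<lambda>s. cmod (char \<mu> s))"
      by (intro continuous_intros continuous_at_imp_continuous_on ballI isCont_char)
    moreover have "compact S" by (auto simp: S_def intro!: compact_Un)
    ultimately obtain s0 where s0: "s0 \<in> S" "\<And>s. s \<in> S \<Longrightarrow> cmod (char \<mu> s) \<le> cmod (char \<mu> s0)"
      using continuous_attains_sup[of S "\<lambda>s. cmod (char \<mu> s)"] False by blast
    have "s0 \<noteq> 0" using s0(1) d(1) by (auto simp: S_def)
    then have "cmod (char \<mu> s0) < 1" using nl by (simp add: non_lattice_def)
    \<comment> \<open>The maximum with 1/2 keeps \<open>\<rho>\<close> positive, so that its
      logarithm can be used.\<close>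
    then show ?thesis using s0(2) by (intro exI[of _ "max (cmod (char \<mu> s0)) (1/2)"]) (auto simp: le_max_iff_disj)
  qed
  then obtain \<rho> where \<rho>: "\<rho> < 1" "0 < \<rho>" "\<And>s. s \<in> S \<Longrightarrow> cmod (char \<mu> s) \<le> \<rho>" by blast
  obtain C where C: "0 < C" "\<And>s t. 0 < \<bar>s\<bar> \<Longrightarrow> \<bar>s\<bar> \<le> \<bar>t\<bar> \<Longrightarrow> \<bar>t\<bar> \<le> R \<Longrightarrow> W s \<le> C * (\<bar>s\<bar> / \<bar>t\<bar>) powr (\<alpha> / 2) * W t"
    using W_potter[OF R] by blast
  have WR: "0 < W R" using R by (intro W_pos) auto
  have Wb: "W s \<le> C * W R" if "\<bar>s\<bar> \<le> R" "s \<noteq> 0" for s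
  proof -
    have "W s \<le> C * (\<bar>s\<bar> / \<bar>R\<bar>) powr (\<alpha> / 2) * W R" using that R by (intro C) auto
    also have "\<dots> \<le> C * 1 * W R"
      using that R C alpha_pos by (intro mult_right_mono mult_left_mono powr_le1) (auto simp: W_nonneg)
    finally show ?thesis by simp
  qed
  \<comment> \<open>The first entry serves |s| < d. The second makes exp(-k W(s)) at least
    \<open>\<rho>\<close> wherever W(s) <= C W(R).\<close>
  define k where "k = min (scale_const / 2) (- ln \<rho> / (C * W R))"
  have kle: "k \<le> scale_const / 2" unfolding k_def by (rule min.cobounded1)
  have k: "0 < k" using scale_const_pos C(1) WR \<rho> by (auto simp: k_def intro!: divide_neg_pos)
  have "cmod (char \<mu> s) \<le> exp (- k * W s)" if s: "\<bar>s\<bar> \<le> R" for s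
  proof -
    consider "s = 0" | "s \<noteq> 0" "\<bar>s\<bar> < d" | "s \<noteq> 0" "d \<le> \<bar>s\<bar>" by linarith
    then show ?thesis
    proof cases
      case 2
      then have "cmod (char \<mu> s) \<le> exp (- (scale_const / 2) * W s)" by (intro d)
      also have "\<dots> \<le> exp (- k * W s)"
        using mult_right_mono[OF kle W_nonneg[of s]] by simp
      finally show ?thesis .
    next
      case 3
      then have "s \<in> S" using s by (auto simp: S_def abs_if split: if_splits)
      then have "cmod (char \<mu> s) \<le> exp (ln \<rho>)" using \<rho> by simp
      also have "\<dots> \<le> exp (- k * W s)"
      proof -
        have "k * W s \<le> (- ln \<rho> / (C * W R)) * (C * W R)"
          using Wb[OF s 3(1)] k C(1) WR by (intro mult_mono) (auto simp: k_def W_nonneg)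
        then show ?thesis using C(1) WR by simp
      qed
      finally show ?thesis .
    qed (simp add: char_zero)
  qed
  then show ?thesis using k by blast
qed

end

section \<open>Convergence of the linear process\<close>

text \<open>Partial sums frozen once their modulus reaches r. This is stopping at a hitting time,
  written as a recursion so that measurability and dependence on the first n terms alone follow by
  induction.\<close>

primrec stopped_sum :: "real \<Rightarrow> (nat \<Rightarrow> real) \<Rightarrow> nat \<Rightarrow> real" where
  "stopped_sum r y 0 = 0"
| "stopped_sum r y (Suc n) = stopped_sum r y n + (if \<bar>stopped_sum r y n\<bar> < r then y n else 0)"

text \<open>Either the walk has been frozen outside (-r, r), or no partial sum has left that
  interval so far. This turns a statement about the maximum into one about the last stopped
  value.\<close>

lemma stopped_sum_cases:
  assumes "0 < r"
  shows "r \<le> \<bar>stopped_sum r y n\<bar> \<or>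
    stopped_sum r y n = (\<Sum>k<n. y k) \<and> (\<forall>m\<le>n. \<bar>\<Sum>k<m. y k\<bar> < r)"
proof (induction n)
  case (Suc n)
  then show ?case by (auto simp: le_Suc_eq)
qed (use assms in simp)

lemma stopped_sum_cong: "(\<And>k. k < n \<Longrightarrow> y k = y' k) \<Longrightarrow> stopped_sum r y n = stopped_sum r y' n"
  by (induction n) auto

lemma stopped_sum_bounded: "0 \<le> B \<Longrightarrow> (\<And>k. \<bar>y k\<bar> \<le> B) \<Longrightarrow> \<bar>stopped_sum r y n\<bar> \<le> real n * B"
proof (induction n)
  case (Suc n)
  then have "\<bar>stopped_sum r y n\<bar> \<le> real n * B" by simp
  moreover have "\<bar>if \<bar>stopped_sum r y n\<bar> < r then y n else 0\<bar> \<le> B" using Suc.prems by simp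
  ultimately show ?case
    using abs_triangle_ineq[of "stopped_sum r y n" "if \<bar>stopped_sum r y n\<bar> < r then y n else 0"]
    by (simp add: algebra_simps)
qed simp

lemma measurable_stopped_sum:
  assumes "\<And>k. k < n \<Longrightarrow> (\<lambda>\<omega>. Y k \<omega>) \<in> borel_measurable N"
  shows "(\<lambda>\<omega>. stopped_sum r (\<lambda>k. Y k \<omega>) n) \<in> borel_measurable N"
  using assms
proof (induction n)
  case (Suc n)
  have [measurable]: "(\<lambda>\<omega>. stopped_sum r (\<lambda>k. Y k \<omega>) n) \<in> borel_measurable N" using Suc by auto
  have [measurable]: "Y n \<in> borel_measurable N" using Suc.prems by simp
  show ?case unfolding stopped_sum.simps by measurable
qed simp

section \<open>Maximal inequality and almost sure convergence of random series\<close>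

context prob_space
begin

lemma AE_summable_of_integral:
  fixes f :: "nat \<Rightarrow> 'a \<Rightarrow> real"
  assumes int: "\<And>k. integrable M (f k)" and nn: "\<And>k \<omega>. 0 \<le> f k \<omega>"
    and sm: "summable (\<lambda>k. \<integral>\<omega>. f k \<omega> \<partial>M)"
  shows "AE \<omega> in M. summable (\<lambda>k. f k \<omega>)"
proof -
  have [measurable]: "f k \<in> borel_measurable M" for k using int by auto
  have "(\<integral>\<^sup>+\<omega>. (\<Sum>k. ennreal (f k \<omega>)) \<partial>M) = (\<Sum>k. \<integral>\<^sup>+\<omega>. ennreal (f k \<omega>) \<partial>M)"
    by (rule nn_integral_suminf) auto
  also have "\<dots> = (\<Sum>k. ennreal (\<integral>\<omega>. f k \<omega> \<partial>M))"
    by (intro arg_cong[where f = suminf] ext nn_integral_eq_integral int AE_I2 nn)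
  also have "\<dots> = ennreal (\<Sum>k. \<integral>\<omega>. f k \<omega> \<partial>M)"
    by (intro suminf_ennreal2 sm Bochner_Integration.integral_nonneg nn)
  also have "\<dots> \<noteq> \<infinity>" by simp
  finally have "AE \<omega> in M. (\<Sum>k. ennreal (f k \<omega>)) \<noteq> \<infinity>"
    by (intro nn_integral_PInf_AE) auto
  then show ?thesis
    by eventually_elim (use nn summable_suminf_not_top in auto)
qed

text \<open>On the event in question the stopped sum ends with modulus at least r, and its second
  moment is at most the sum of the variances, because each new term is centred and independent of
  the past. The offset m serves the Cauchy criterion later.\<close>

lemma Kolmogorov_inequality:
  fixes Y :: "nat \<Rightarrow> 'a \<Rightarrow> real"
  assumes ind: "indep_vars (\<lambda>_. borel) Y UNIV" and mean: "\<And>k. expectation (Y k) = 0"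
    and bd: "\<And>k \<omega>. \<bar>Y k \<omega>\<bar> \<le> B" and r: "0 < r"
  shows "prob {\<omega> \<in> space M. \<exists>n\<le>N. r \<le> \<bar>\<Sum>k<n. Y (m + k) \<omega>\<bar>} \<le> (\<Sum>k<N. expectation (\<lambda>\<omega>. (Y (m + k) \<omega>)\<^sup>2)) / r\<^sup>2"
proof -
  have B0: "0 \<le> B" using bd[of 0 undefined] by linarith
  have Y[measurable]: "Y k \<in> borel_measurable M" for k using ind by (simp add: indep_vars_def)
  define Z where "Z n \<omega> = stopped_sum r (\<lambda>k. Y (m + k) \<omega>) n" for n \<omega>
  have [measurable]: "Z n \<in> borel_measurable M" for n
    unfolding Z_def by (intro measurable_stopped_sum) auto
  have Zb: "\<bar>Z n \<omega>\<bar> \<le> real n * B" for n \<omega> unfolding Z_def by (intro stopped_sum_bounded B0 bd)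
  have i: "integrable M f" if "f \<in> borel_measurable M" "\<And>\<omega>. \<bar>f \<omega>\<bar> \<le> K" for f :: "'a \<Rightarrow> real" and K :: real
    by (rule integrable_const_bound[where B = K]) (use that in auto)
  have iZ: "integrable M (\<lambda>\<omega>. (Z n \<omega>)\<^sup>2)" for n
    by (rule integrable_const_bound[where B = "(real n * B)\<^sup>2"]) (auto simp: abs_le_square_iff[symmetric] intro!: AE_I2 order_trans[OF Zb])
  have iY: "integrable M (\<lambda>\<omega>. (Y k \<omega>)\<^sup>2)" for k
    by (rule integrable_const_bound[where B = "B\<^sup>2"]) (auto simp: abs_le_square_iff[symmetric] intro!: AE_I2 order_trans[OF bd])
  have step: "expectation (\<lambda>\<omega>. (Z n \<omega>)\<^sup>2) \<le> (\<Sum>k<n. expectation (\<lambda>\<omega>. (Y (m + k) \<omega>)\<^sup>2))" for n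
  proof (induction n)
    case (Suc n)
    \<comment> \<open>The walk on the event that it still moves. The cross term of the square is
      then 2 U Y also when the walk is frozen, and \<open>U\<close> depends on the first n variables
      only.\<close>
    define U where "U \<omega> = (if \<bar>Z n \<omega>\<bar> < r then Z n \<omega> else 0)" for \<omega>
    have [measurable]: "U \<in> borel_measurable M" unfolding U_def by measurable
    have Ub: "\<bar>U \<omega>\<bar> \<le> real n * B" for \<omega> using Zb[of n \<omega>] B0 by (auto simp: U_def)
    have "indep_var borel U borel (Y (m + n))"
    proof -
      let ?A = "{m..<m+n}" and ?B = "{m+n}"
      define h where "h y = (let z = stopped_sum r (\<lambda>k. y (m + k)) n in if \<bar>z\<bar> < r then z else 0)" for y :: "nat \<Rightarrow> real"
      have hm: "h \<in> borel_measurable (PiM ?A (\<lambda>_. borel))"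
      proof -
        have [measurable]: "(\<lambda>y. stopped_sum r (\<lambda>k. y (m + k)) n) \<in> borel_measurable (PiM ?A (\<lambda>_. borel :: real measure))"
          by (intro measurable_stopped_sum measurable_component_singleton) auto
        show ?thesis unfolding h_def Let_def by measurable
      qed
      have "indep_var (PiM ?A (\<lambda>_. borel)) (\<lambda>\<omega>. restrict (\<lambda>i. Y i \<omega>) ?A) (PiM ?B (\<lambda>_. borel)) (\<lambda>\<omega>. restrict (\<lambda>i. Y i \<omega>) ?B)"
        by (rule indep_var_restrict[OF ind]) auto
      then have "indep_var borel (h \<circ> (\<lambda>\<omega>. restrict (\<lambda>i. Y i \<omega>) ?A)) borel ((\<lambda>y. y (m + n)) \<circ> (\<lambda>\<omega>. restrict (\<lambda>i. Y i \<omega>) ?B))"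
        by (rule indep_var_compose[OF _ hm]) (auto intro: measurable_component_singleton)
      moreover have "h \<circ> (\<lambda>\<omega>. restrict (\<lambda>i. Y i \<omega>) ?A) = U"
      proof
        fix \<omega>
        have "stopped_sum r (\<lambda>k. restrict (\<lambda>i. Y i \<omega>) ?A (m + k)) n = Z n \<omega>"
          unfolding Z_def by (rule stopped_sum_cong) auto
        then show "(h \<circ> (\<lambda>\<omega>. restrict (\<lambda>i. Y i \<omega>) ?A)) \<omega> = U \<omega>" by (simp add: h_def U_def)
      qed
      moreover have "(\<lambda>y. y (m + n)) \<circ> (\<lambda>\<omega>. restrict (\<lambda>i. Y i \<omega>) ?B) = Y (m + n)" by auto
      ultimately show ?thesis by simp
    qed
    then have "expectation (\<lambda>\<omega>. U \<omega> * Y (m + n) \<omega>) = expectation U * expectation (Y (m + n))"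
      by (rule indep_var_lebesgue_integral)
         (auto intro!: integrable_const_bound[where f = U and B = "real n * B"]
           integrable_const_bound[where f = "Y (m + n)" and B = B] AE_I2 Ub bd)
    then have 0: "expectation (\<lambda>\<omega>. U \<omega> * Y (m + n) \<omega>) = 0" by (simp only: mean mult_zero_right)
    have iUY: "integrable M (\<lambda>\<omega>. U \<omega> * Y (m + n) \<omega>)"
    proof (rule integrable_const_bound)
      have "\<bar>U \<omega> * Y (m + n) \<omega>\<bar> \<le> (real n * B) * B" for \<omega>
        unfolding abs_mult using B0 by (intro mult_mono Ub bd) auto
      then show "AE \<omega> in M. norm (U \<omega> * Y (m + n) \<omega>) \<le> (real n * B) * B" by simp
    qed measurable
    have "expectation (\<lambda>\<omega>. (Z (Suc n) \<omega>)\<^sup>2) \<le> expectation (\<lambda>\<omega>. (Z n \<omega>)\<^sup>2 + 2 * (U \<omega> * Y (m + n) \<omega>) + (Y (m + n) \<omega>)\<^sup>2)"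
    proof (intro integral_mono Bochner_Integration.integrable_add iZ iY integrable_mult_right iUY)
      fix \<omega>
      have "Z (Suc n) \<omega> = Z n \<omega> + (if \<bar>Z n \<omega>\<bar> < r then Y (m + n) \<omega> else 0)" by (simp add: Z_def)
      then show "(Z (Suc n) \<omega>)\<^sup>2 \<le> (Z n \<omega>)\<^sup>2 + 2 * (U \<omega> * Y (m + n) \<omega>) + (Y (m + n) \<omega>)\<^sup>2"
        by (simp add: U_def power2_sum)
    qed
    also have "\<dots> = expectation (\<lambda>\<omega>. (Z n \<omega>)\<^sup>2) + expectation (\<lambda>\<omega>. (Y (m + n) \<omega>)\<^sup>2)"
      using iZ[of n] iY[of "m + n"] iUY 0 by simp
    finally show ?case using Suc by simp
  qed (simp add: Z_def)
  have "prob {\<omega> \<in> space M. \<exists>n\<le>N. r \<le> \<bar>\<Sum>k<n. Y (m + k) \<omega>\<bar>} \<le> prob {\<omega> \<in> space M. r\<^sup>2 \<le> (Z N \<omega>)\<^sup>2}"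
  proof (intro finite_measure_mono subsetI)
    fix \<omega> assume \<omega>: "\<omega> \<in> {\<omega> \<in> space M. \<exists>n\<le>N. r \<le> \<bar>\<Sum>k<n. Y (m + k) \<omega>\<bar>}"
    then have "r \<le> \<bar>Z N \<omega>\<bar>"
      using stopped_sum_cases[OF r, of "\<lambda>k. Y (m + k) \<omega>" N] by (force simp: Z_def)
    then show "\<omega> \<in> {\<omega> \<in> space M. r\<^sup>2 \<le> (Z N \<omega>)\<^sup>2}" using r \<omega> by (simp add: abs_le_square_iff[symmetric])
  qed measurable
  also have "\<dots> \<le> expectation (\<lambda>\<omega>. (Z N \<omega>)\<^sup>2) / r\<^sup>2"
    by (rule integral_Markov_inequality_measure[OF iZ, where A = "space M"]) (use r in auto)
  also have "\<dots> \<le> (\<Sum>k<N. expectation (\<lambda>\<omega>. (Y (m + k) \<omega>)\<^sup>2)) / r\<^sup>2"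
    by (intro divide_right_mono step) auto
  finally show ?thesis .
qed

text \<open>Khinchine-Kolmogorov theorem. The event that some block sum starting at m reaches r has
  probability at most the remaining variance over r^2, so almost surely some m avoids it. Letting r
  run through 1/(j + 1) gives the Cauchy criterion.\<close>

lemma AE_summable_independent:
  fixes Y :: "nat \<Rightarrow> 'a \<Rightarrow> real"
  assumes ind: "indep_vars (\<lambda>_. borel) Y UNIV" and mean: "\<And>k. expectation (Y k) = 0"
    and bd: "\<And>k \<omega>. \<bar>Y k \<omega>\<bar> \<le> B" and sm: "summable (\<lambda>k. expectation (\<lambda>\<omega>. (Y k \<omega>)\<^sup>2))"
  shows "AE \<omega> in M. summable (\<lambda>k. Y k \<omega>)"
proof -
  have Y[measurable]: "Y k \<in> borel_measurable M" for k using ind by (simp add: indep_vars_def)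
  define v where "v k = expectation (\<lambda>\<omega>. (Y k \<omega>)\<^sup>2)" for k
  have v0: "0 \<le> v k" for k by (simp add: v_def)
  define A where "A m r = {\<omega> \<in> space M. \<exists>n. r \<le> \<bar>\<Sum>k<n. Y (m + k) \<omega>\<bar>}" for m r
  have [measurable]: "A m r \<in> sets M" for m r unfolding A_def by measurable
  have PA: "prob (A m r) \<le> (\<Sum>k. v (k + m)) / r\<^sup>2" if r: "0 < r" for m r
  proof -
    define E where "E N = {\<omega> \<in> space M. \<exists>n\<le>N. r \<le> \<bar>\<Sum>k<n. Y (m + k) \<omega>\<bar>}" for N
    have "(\<lambda>N. prob (E N)) \<longlonglongrightarrow> prob (\<Union>N. E N)"
    proof (rule finite_Lim_measure_incseq)
      show "range E \<subseteq> sets M" unfolding E_def by auto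
      show "incseq E" unfolding E_def incseq_def by (auto intro: order_trans)
    qed
    moreover have "(\<Union>N. E N) = A m r" by (auto simp: E_def A_def)
    moreover have "prob (E N) \<le> (\<Sum>k. v (k + m)) / r\<^sup>2" for N
    proof -
      have "prob (E N) \<le> (\<Sum>k<N. v (m + k)) / r\<^sup>2"
        unfolding E_def v_def by (rule Kolmogorov_inequality[OF ind mean bd r])
      also have "(\<Sum>k<N. v (m + k)) \<le> (\<Sum>k. v (k + m))"
        unfolding add.commute[of m] using sm v0 by (intro sum_le_suminf summable_ignore_initial_segment) (auto simp: v_def)
      finally show ?thesis by (simp add: divide_right_mono)
    qed
    ultimately show ?thesis by (intro LIMSEQ_le_const2) auto
  qed
  have "AE \<omega> in M. \<exists>m. \<omega> \<notin> A m r" if r: "0 < r" for r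
  proof (rule AE_I)
    show "{\<omega> \<in> space M. \<not> (\<exists>m. \<omega> \<notin> A m r)} \<subseteq> (\<Inter>m. A m r)" by auto
    have "prob (\<Inter>m. A m r) \<le> 0 / r\<^sup>2"
    proof (rule LIMSEQ_le_const)
      show "(\<lambda>m. (\<Sum>k. v (k + m)) / r\<^sup>2) \<longlonglongrightarrow> 0 / r\<^sup>2"
        using sm r by (intro tendsto_divide tendsto_const suminf_exist_split2) (auto simp: v_def)
      have "prob (\<Inter>m. A m r) \<le> (\<Sum>k. v (k + m)) / r\<^sup>2" for m
        by (rule order_trans[OF finite_measure_mono PA[OF r]]) auto
      then show "\<exists>N. \<forall>m\<ge>N. prob (\<Inter>m. A m r) \<le> (\<Sum>k. v (k + m)) / r\<^sup>2" by blast
    qed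
    then show "emeasure M (\<Inter>m. A m r) = 0" by (simp add: emeasure_eq_measure measure_le_0_iff)
  qed auto
  then have "AE \<omega> in M. \<forall>j. \<exists>m. \<omega> \<notin> A m (1 / real (Suc j))" by (subst AE_all_countable) auto
  then show ?thesis using AE_space
  proof eventually_elim
    case (elim \<omega>)
    show ?case unfolding summable_Cauchy
    proof (intro allI impI)
      fix e :: real assume "0 < e"
      then obtain j where j: "1 / real (Suc j) < e / 2" using reals_Archimedean[of "e / 2"] by (auto simp: inverse_eq_divide)
      obtain m where m: "\<omega> \<notin> A m (1 / real (Suc j))" using elim by blast
      have S: "\<bar>\<Sum>k=m..<n. Y k \<omega>\<bar> < e / 2" if "m \<le> n" for n
      proof -
        have "(\<Sum>k=m..<n. Y k \<omega>) = (\<Sum>k<n - m. Y (m + k) \<omega>)"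
          using that sum.shift_bounds_nat_ivl[of "\<lambda>k. Y k \<omega>" 0 m "n - m"] by (simp add: lessThan_atLeast0 add.commute)
        moreover have "\<bar>\<Sum>k<n - m. Y (m + k) \<omega>\<bar> < 1 / real (Suc j)" using m elim by (force simp: A_def not_le)
        ultimately show ?thesis using j by simp
      qed
      have "norm (\<Sum>k=p..<q. Y k \<omega>) < e" if "m \<le> p" for p q
      proof (cases "p \<le> q")
        case True
        have "(\<Sum>k=p..<q. Y k \<omega>) = (\<Sum>k=m..<q. Y k \<omega>) - (\<Sum>k=m..<p. Y k \<omega>)"
          using that True sum.atLeastLessThan_concat[of m p q "\<lambda>k. Y k \<omega>"] by simp
        then show ?thesis using S[of p] S[of q] that True by simp
      qed (use \<open>0 < e\<close> in simp)
      then show "\<exists>N. \<forall>p\<ge>N. \<forall>q. norm (\<Sum>k=p..<q. Y k \<omega>) < e" by blast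
    qed
  qed
qed

end

section \<open>Almost sure convergence of the series defining the process\<close>

context stable_domain
begin

text \<open>A truncated moment of order q > alpha is governed by the tail through the layer-cake
  limit, and hence by W. Below, q = 1 serves alpha < 1 and q = 2 serves alpha = 1.\<close>

lemma integral_min_power_le_W:
  fixes q :: nat
  assumes q: "\<alpha> < real q" and R: "0 < R"
  shows "\<exists>C>0. \<forall>s. \<bar>s\<bar> \<le> R \<longrightarrow> (\<integral>y. (min \<bar>s * y\<bar> 1) ^ q \<partial>\<mu>) \<le> C * W s"
proof -
  have q0: "0 < q" using q alpha_pos by (cases q) auto
  have l: "((\<lambda>x. (\<integral>y. (min (\<bar>y\<bar> / x) 1) ^ q \<partial>\<mu>) / tail x) \<longlongrightarrow> 1 * (LBINT v:{0<..1}. (real q * v ^ (q - 1)) * v powr - \<alpha>)) at_top"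
  proof (rule tail_integral_limit[where p = "real q" and D = "real q"])
    have "(\<lambda>x. measure \<mu> {y. \<bar>y\<bar> > x} / tail x) = (\<lambda>x. 1)"
      using tail_pos by (simp add: fun_eq_iff tail_def[symmetric] less_imp_neq[THEN not_sym])
    then show "((\<lambda>x. measure \<mu> {y. \<bar>y\<bar> > x} / tail x) \<longlongrightarrow> 1) at_top" by simp
    show "\<bar>real q * y ^ (q - 1)\<bar> \<le> real q * y powr (real q - 1)" if "0 < y" for y :: real
      using that q0 by (simp add: powr_realpow[symmetric] abs_mult)
  qed (use q q0 in \<open>auto intro!: derivative_eq_intros continuous_intros\<close>)
  define I where "I = (LBINT v:{0<..1}. (real q * v ^ (q - 1)) * v powr - \<alpha>)"
  have "\<forall>\<^sub>F x in at_top. (\<integral>y. (min (\<bar>y\<bar> / x) 1) ^ q \<partial>\<mu>) / tail x < \<bar>I\<bar> + 1"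
  proof (rule order_tendstoD(2))
    show "((\<lambda>x. (\<integral>y. (min (\<bar>y\<bar> / x) 1) ^ q \<partial>\<mu>) / tail x) \<longlongrightarrow> I) at_top"
      using l unfolding I_def mult_1 .
    show "I < \<bar>I\<bar> + 1" using abs_ge_self[of I] by simp
  qed
  moreover obtain C1 where "\<forall>\<^sub>F x in at_top. tail x \<le> C1 * W (1 / x)" using tail_le_W by blast
  ultimately have ev: "\<forall>\<^sub>F x in at_top. (\<integral>y. (min (\<bar>y\<bar> / x) 1) ^ q \<partial>\<mu>) \<le> ((\<bar>I\<bar> + 1) * C1) * W (1 / x)"
  proof eventually_elim
    case (elim x)
    have "(\<integral>y. (min (\<bar>y\<bar> / x) 1) ^ q \<partial>\<mu>) \<le> (\<bar>I\<bar> + 1) * tail x"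
      using elim(1) tail_pos[of x] by (simp add: divide_less_eq)
    also have "\<dots> \<le> (\<bar>I\<bar> + 1) * (C1 * W (1 / x))" using elim(2) by (intro mult_left_mono) auto
    finally show ?case by (simp add: mult_ac)
  qed
  have "\<exists>C>0. \<forall>s. 0 < \<bar>s\<bar> \<longrightarrow> \<bar>s\<bar> \<le> R \<longrightarrow> (\<integral>y. (min (\<bar>y\<bar> / (1 / \<bar>s\<bar>)) 1) ^ q \<partial>\<mu>) \<le> C * W s"
  proof (rule bounded_by_W[where B = 1 and h = "\<lambda>x. \<integral>y. (min (\<bar>y\<bar> / x) 1) ^ q \<partial>\<mu>", OF _ ev R])
    fix x :: real assume x: "0 < x"
    have b: "0 \<le> (min (\<bar>y\<bar> / x) 1) ^ q" "(min (\<bar>y\<bar> / x) 1) ^ q \<le> 1" for y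
      using x by (auto intro!: power_le_one)
    have "(\<integral>y. (min (\<bar>y\<bar> / x) 1) ^ q \<partial>\<mu>) \<le> (\<integral>y. 1 \<partial>\<mu>)"
      by (intro integral_mono integrable_bounded[where B = 1] b) (use b in auto)
    then show "(\<integral>y. (min (\<bar>y\<bar> / x) 1) ^ q \<partial>\<mu>) \<le> 1" by (simp add: prob_space[simplified])
  qed
  then obtain C where C: "0 < C" "\<And>s. 0 < \<bar>s\<bar> \<Longrightarrow> \<bar>s\<bar> \<le> R \<Longrightarrow> (\<integral>y. (min (\<bar>y\<bar> / (1 / \<bar>s\<bar>)) 1) ^ q \<partial>\<mu>) \<le> C * W s"
    by blast
  have "(\<integral>y. (min \<bar>s * y\<bar> 1) ^ q \<partial>\<mu>) \<le> C * W s" if "\<bar>s\<bar> \<le> R" for s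
    using C(2)[OF _ that] q0 by (cases "s = 0") (auto simp: abs_mult mult.commute zero_power)
  then show ?thesis using C(1) by blast
qed

text \<open>Three regimes. For alpha > 1 the first moment gives absolute convergence. For alpha < 1
  the truncated first moments are summable, and eventually no truncation occurs. At alpha = 1
  absolute convergence may fail, and a three-series argument is used in which symmetry keeps the
  truncated means at zero.\<close>

lemma AE_summable_linear:
  fixes X :: "nat \<Rightarrow> 'w \<Rightarrow> real" and c :: "nat \<Rightarrow> real"
  assumes M: "prob_space M" and ind: "prob_space.indep_vars M (\<lambda>_. borel) X UNIV"
    and law: "\<And>k. distr M borel (X k) = \<mu>"
    and sW: "summable (\<lambda>k. W (c k))" and sc: "summable (\<lambda>k. \<bar>c k\<bar>)"
  shows "AE \<omega> in M. summable (\<lambda>k. c k * X k \<omega>)"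
proof -
  interpret M: prob_space M by (rule M)
  have X[measurable]: "X k \<in> borel_measurable M" for k using ind by (simp add: M.indep_vars_def)
  have E: "(\<integral>\<omega>. f (X k \<omega>) \<partial>M) = (\<integral>y. f y \<partial>\<mu>)" if "f \<in> borel_measurable borel" for f :: "real \<Rightarrow> real" and k
    unfolding law[of k, symmetric] by (rule integral_distr[symmetric]) (use that in auto)
  have I: "integrable M (\<lambda>\<omega>. f (X k \<omega>))" if "integrable \<mu> f" for f :: "real \<Rightarrow> real" and k
    using that unfolding law[of k, symmetric] by (rule integrable_distr[rotated]) auto
  define R where "R = (\<Sum>k. \<bar>c k\<bar>) + 1"
  have R0: "0 < R" unfolding R_def using suminf_nonneg[OF sc] by simp
  have cR: "\<bar>c k\<bar> \<le> R" for k
    using sum_le_suminf[OF sc, of "{k}"] by (simp add: R_def)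
  show ?thesis
  proof (cases "1 < \<alpha>")
    case True
    have int: "integrable \<mu> (\<lambda>y. \<bar>y\<bar>)" using cond_A True by (auto simp: condition_A_def)
    have "AE \<omega> in M. summable (\<lambda>k. \<bar>c k\<bar> * \<bar>X k \<omega>\<bar>)"
    proof (rule M.AE_summable_of_integral)
      show "integrable M (\<lambda>\<omega>. \<bar>c k\<bar> * \<bar>X k \<omega>\<bar>)" for k by (intro integrable_mult_right I int)
      have "(\<integral>\<omega>. \<bar>X k \<omega>\<bar> \<partial>M) = (\<integral>y. \<bar>y\<bar> \<partial>\<mu>)" for k by (rule E) simp
      then show "summable (\<lambda>k. \<integral>\<omega>. \<bar>c k\<bar> * \<bar>X k \<omega>\<bar> \<partial>M)" using sc by (simp add: summable_mult2)
    qed auto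
    then show ?thesis by eventually_elim (rule summable_norm_cancel, simp add: abs_mult)
  next
    case False
    define q :: nat where "q = (if \<alpha> < 1 then 1 else 2)"
    have q: "\<alpha> < real q" using False by (auto simp: q_def)
    have q0: "0 < q" by (simp add: q_def)
    obtain C where C: "0 < C" "\<And>s. \<bar>s\<bar> \<le> R \<Longrightarrow> (\<integral>y. (min \<bar>s * y\<bar> 1) ^ q \<partial>\<mu>) \<le> C * W s"
      using integral_min_power_le_W[OF q R0] by blast
    have mb: "0 \<le> (min \<bar>s * y\<bar> 1) ^ q" "(min \<bar>s * y\<bar> 1) ^ q \<le> 1" for s y :: real
      by (auto intro!: power_le_one)
    have im: "integrable \<mu> (\<lambda>y. (min \<bar>s * y\<bar> 1) ^ q)" for s
      by (rule integrable_bounded[where B = 1]) (use mb in auto)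
    have sq: "summable (\<lambda>k. \<integral>y. (min \<bar>c k * y\<bar> 1) ^ q \<partial>\<mu>)"
    proof (rule summable_comparison_test')
      show "summable (\<lambda>k. C * W (c k))" by (intro summable_mult sW)
      show "norm (\<integral>y. (min \<bar>c k * y\<bar> 1) ^ q \<partial>\<mu>) \<le> C * W (c k)" for k
        using C(2)[OF cR] Bochner_Integration.integral_nonneg[of \<mu> "\<lambda>y. (min \<bar>c k * y\<bar> 1) ^ q"] mb by simp
    qed
    have "AE \<omega> in M. summable (\<lambda>k. (min \<bar>c k * X k \<omega>\<bar> 1) ^ q)"
    proof (rule M.AE_summable_of_integral)
      show "integrable M (\<lambda>\<omega>. (min \<bar>c k * X k \<omega>\<bar> 1) ^ q)" for k by (rule I[OF im])
      show "summable (\<lambda>k. \<integral>\<omega>. (min \<bar>c k * X k \<omega>\<bar> 1) ^ q \<partial>M)"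
        using sq by (subst E[of "\<lambda>y. (min \<bar>c _ * y\<bar> 1) ^ q"]) auto
    qed (rule mb)
    moreover have small: "\<forall>\<^sub>F k in sequentially. \<bar>c k * X k \<omega>\<bar> < 1" if "summable (\<lambda>k. (min \<bar>c k * X k \<omega>\<bar> 1) ^ q)" for \<omega>
    proof -
      have "\<forall>\<^sub>F k in sequentially. (min \<bar>c k * X k \<omega>\<bar> 1) ^ q < 1"
        by (rule order_tendstoD(2)[OF summable_LIMSEQ_zero[OF that]]) simp
      then show ?thesis
      proof eventually_elim
        case (elim k)
        show ?case
        proof (rule ccontr)
          assume "\<not> \<bar>c k * X k \<omega>\<bar> < 1"
          then have "min \<bar>c k * X k \<omega>\<bar> 1 = 1" by simp
          then show False using elim by simp
        qed
      qed
    qed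
    ultimately have sml: "AE \<omega> in M. summable (\<lambda>k. (min \<bar>c k * X k \<omega>\<bar> 1) ^ q) \<and> (\<forall>\<^sub>F k in sequentially. \<bar>c k * X k \<omega>\<bar> < 1)"
      by auto
    show ?thesis
    proof (cases "\<alpha> < 1")
      case True
      from sml show ?thesis
      proof eventually_elim
        case (elim \<omega>)
        have "summable (\<lambda>k. norm (c k * X k \<omega>))"
        proof (rule summable_cong[THEN iffD1])
          show "summable (\<lambda>k. (min \<bar>c k * X k \<omega>\<bar> 1) ^ q)" using elim by simp
          show "\<forall>\<^sub>F k in sequentially. (min \<bar>c k * X k \<omega>\<bar> 1) ^ q = norm (c k * X k \<omega>)"
            using elim[THEN conjunct2] by eventually_elim (simp add: q_def True)
        qed
        then show ?case by (rule summable_norm_cancel)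
      qed
    next
      case False
      then have a1: "\<alpha> = 1" and q2: "q = 2" using \<open>\<not> 1 < \<alpha>\<close> by (auto simp: q_def)
      have sym: "distr \<mu> borel uminus = \<mu>" using cond_A a1 by (simp add: condition_A_def symmetric_law_def)
      \<comment> \<open>Truncation to 0 outside [-1, 1] is odd, so symmetry gives mean zero; its
        square is below min(|c y|, 1)^2.\<close>
      define t where "t k y = (if \<bar>c k * y\<bar> \<le> 1 then c k * y else 0)" for k y
      have [measurable]: "t k \<in> borel_measurable borel" for k unfolding t_def by measurable
      have "AE \<omega> in M. summable (\<lambda>k. t k (X k \<omega>))"
      proof (rule M.AE_summable_independent[where B = 1])
        show "M.indep_vars (\<lambda>_. borel) (\<lambda>k \<omega>. t k (X k \<omega>)) UNIV"
          by (rule M.indep_vars_compose2[OF ind]) auto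
        show "M.expectation (\<lambda>\<omega>. t k (X k \<omega>)) = 0" for k
        proof -
          have "(\<integral>y. t k y \<partial>\<mu>) = (\<integral>y. t k y \<partial>(distr \<mu> borel uminus))" by (simp only: sym)
          also have "\<dots> = (\<integral>y. t k (- y) \<partial>\<mu>)" by (rule integral_distr) auto
          also have "\<dots> = - (\<integral>y. t k y \<partial>\<mu>)"
            by (subst Bochner_Integration.integral_minus[symmetric], rule Bochner_Integration.integral_cong) (auto simp: t_def)
          finally show ?thesis by (simp add: E)
        qed
        show "\<bar>t k (X k \<omega>)\<bar> \<le> 1" for k \<omega> by (simp add: t_def)
        show "summable (\<lambda>k. M.expectation (\<lambda>\<omega>. (t k (X k \<omega>))\<^sup>2))"
        proof (rule summable_comparison_test'[OF sq])
          fix k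
          have tm: "(t k y)\<^sup>2 \<le> (min \<bar>c k * y\<bar> 1) ^ q" for y by (simp add: t_def q2)
          have "(\<integral>y. (t k y)\<^sup>2 \<partial>\<mu>) \<le> (\<integral>y. (min \<bar>c k * y\<bar> 1) ^ q \<partial>\<mu>)"
            by (intro integral_mono im tm integrable_bounded[where B = 1])
               (auto intro: order_trans[OF tm] mb)
          then show "norm (M.expectation (\<lambda>\<omega>. (t k (X k \<omega>))\<^sup>2)) \<le> (\<integral>y. (min \<bar>c k * y\<bar> 1) ^ q \<partial>\<mu>)"
            by (simp add: E[of "\<lambda>y. (t k y)\<^sup>2"])
        qed
      qed
      with sml show ?thesis
      proof eventually_elim
        case (elim \<omega>)
        show ?case
        proof (rule summable_cong[THEN iffD1])
          show "summable (\<lambda>k. t k (X k \<omega>))" using elim by simp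
          show "\<forall>\<^sub>F k in sequentially. t k (X k \<omega>) = c k * X k \<omega>"
            using elim(1)[THEN conjunct2] by eventually_elim (simp add: t_def)
        qed
      qed
    qed
  qed
qed

end

lemma (in prob_space) indep_vars_inj_reindex:
  assumes ind: "indep_vars (\<lambda>_. N) X UNIV" and f: "inj f"
  shows "indep_vars (\<lambda>_. N) (\<lambda>i. X (f i)) UNIV"
  unfolding indep_vars_def
proof (intro conjI ballI)
  define F where "F = (\<lambda>i. sigma_sets (space M) {X i -` A \<inter> space M |A. A \<in> sets N})"
  have F: "indep_sets F UNIV" using ind by (simp add: indep_vars_def F_def)
  have "indep_sets (\<lambda>i. F (f i)) UNIV"
    unfolding indep_sets_def
  proof (intro conjI ballI allI impI)
    show "F (f i) \<subseteq> events" for i using F by (simp add: indep_sets_def)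
  next
    fix J A assume J: "J \<noteq> {}" "finite J" and A: "A \<in> Pi J (\<lambda>i. F (f i))"
    define A' where "A' i = A (inv f i)" for i
    have A'f: "A' (f j) = A j" for j by (simp add: A'_def inv_f_f[OF f])
    have "A' \<in> Pi (f ` J) F" using A by (auto simp: A'f)
    then have "prob (\<Inter>i\<in>f ` J. A' i) = (\<Prod>i\<in>f ` J. prob (A' i))"
      using F J unfolding indep_sets_def by (auto dest!: spec[of _ "f ` J"])
    moreover have "(\<Prod>i\<in>f ` J. prob (A' i)) = (\<Prod>j\<in>J. prob (A j))"
      by (subst prod.reindex) (auto intro: inj_on_subset[OF f] simp: A'f)
    ultimately show "prob (\<Inter>j\<in>J. A j) = (\<Prod>j\<in>J. prob (A j))" by (simp add: A'f)
  qed
  then show "indep_sets (\<lambda>i. sigma_sets (space M) {X (f i) -` A \<inter> space M |A. A \<in> sets N}) UNIV"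
    by (simp add: F_def)
qed (use ind in \<open>simp add: indep_vars_def\<close>)

section \<open>The characteristic function of the sum as an infinite product\<close>

lemma summable_on_finite_sum:
  fixes f :: "'j \<Rightarrow> 'i \<Rightarrow> real"
  assumes "finite J" "\<And>j. j \<in> J \<Longrightarrow> f j summable_on A"
  shows "(\<lambda>x. \<Sum>j\<in>J. f j x) summable_on A"
  using assms by (induction J rule: finite_induct) (auto intro: summable_on_add)

text \<open>Up to a tail sum of g, a product over a large finite set is determined by its part over
  a fixed set F0, uniformly over all families dominated by g. On F0 the factors w N converge to z,
  so the limit along the sets F N is also the limit along all finite sets.\<close>

lemma prod_tendsto_finite_subsets:
  fixes z :: "'i \<Rightarrow> complex" and w :: "nat \<Rightarrow> 'i \<Rightarrow> complex" and g :: "'i \<Rightarrow> real"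
  assumes g: "g summable_on UNIV" and zg: "\<And>i. norm (1 - z i) \<le> g i" and wg: "\<And>N i. norm (1 - w N i) \<le> g i"
    and z1: "\<And>i. norm (z i) \<le> 1" and w1: "\<And>N i. norm (w N i) \<le> 1"
    and lim: "\<And>i. (\<lambda>N. w N i) \<longlonglongrightarrow> z i"
    and F: "\<And>N. finite (F N)" "\<And>i. \<forall>\<^sub>F N in sequentially. i \<in> F N"
    and l: "(\<lambda>N. \<Prod>i\<in>F N. w N i) \<longlonglongrightarrow> l"
  shows "((\<lambda>A. \<Prod>i\<in>A. z i) \<longlongrightarrow> l) (finite_subsets_at_top UNIV)"
proof (rule tendstoI)
  fix e :: real assume e: "0 < e"
  have g0: "0 \<le> g i" for i using zg[of i] norm_ge_zero order_trans by blast
  have "(sum g \<longlongrightarrow> infsum g UNIV) (finite_subsets_at_top UNIV)"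
    using has_sum_infsum[OF g] by (simp add: has_sum_def)
  from tendstoD[OF this, of "e/10"] e obtain F0 where F0: "finite F0"
      "\<And>A. finite A \<Longrightarrow> F0 \<subseteq> A \<Longrightarrow> dist (sum g A) (infsum g UNIV) < e/10"
    by (auto simp: eventually_finite_subsets_at_top)
  have tl: "sum g (A - F0) < e/5" if "finite A" "F0 \<subseteq> A" for A
  proof -
    have "sum g A = sum g F0 + sum g (A - F0)" using sum.subset_diff[of F0 A g] that by simp
    then show ?thesis using F0(2)[OF F0(1) order_refl] F0(2)[OF that] unfolding dist_real_def by linarith
  qed
  have cmp: "norm ((\<Prod>i\<in>A. v i) - (\<Prod>i\<in>F0. v i)) < e/5"
    if A: "finite A" "F0 \<subseteq> A" and v: "\<And>i. norm (v i) \<le> 1" "\<And>i. norm (1 - v i) \<le> g i" for A and v :: "'i \<Rightarrow> complex"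
  proof -
    have "(\<Prod>i\<in>A. v i) - (\<Prod>i\<in>F0. v i) = (\<Prod>i\<in>A. v i) - (\<Prod>i\<in>A. if i \<in> F0 then v i else 1)"
      using A by (simp add: prod.If_cases Int_absorb1)
    also have "norm \<dots> \<le> (\<Sum>i\<in>A. norm (v i - (if i \<in> F0 then v i else 1)))"
      by (rule norm_prod_diff) (use v in auto)
    also have "\<dots> = (\<Sum>i\<in>A. if i \<in> F0 then 0 else norm (v i - 1))" by (intro sum.cong) auto
    also have "\<dots> \<le> (\<Sum>i\<in>A. if i \<in> F0 then 0 else g i)"
      using v(2) by (intro sum_mono) (auto simp: norm_minus_commute)
    also have "\<dots> = sum g (A - F0)" using A by (simp add: sum.If_cases Diff_eq)
    also have "\<dots> < e/5" by (rule tl[OF A])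
    finally show ?thesis .
  qed
  have "(\<lambda>N. \<Prod>i\<in>F0. w N i) \<longlonglongrightarrow> (\<Prod>i\<in>F0. z i)" by (intro tendsto_prod lim)
  from tendstoD[OF this, of "e/5"] e have 1: "\<forall>\<^sub>F N in sequentially. norm ((\<Prod>i\<in>F0. w N i) - (\<Prod>i\<in>F0. z i)) < e/5"
    by (simp add: dist_norm)
  from tendstoD[OF l, of "e/5"] e have 2: "\<forall>\<^sub>F N in sequentially. norm ((\<Prod>i\<in>F N. w N i) - l) < e/5"
    by (simp add: dist_norm)
  have 3: "\<forall>\<^sub>F N in sequentially. F0 \<subseteq> F N"
    unfolding subset_eq by (intro eventually_ball_finite F0(1) ballI F(2))
  have "\<forall>\<^sub>F N in sequentially. norm ((\<Prod>i\<in>F0. w N i) - (\<Prod>i\<in>F0. z i)) < e/5 \<and>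
     norm ((\<Prod>i\<in>F N. w N i) - l) < e/5 \<and> F0 \<subseteq> F N"
    using 1 2 3 by eventually_elim auto
  then obtain N where N: "norm ((\<Prod>i\<in>F0. w N i) - (\<Prod>i\<in>F0. z i)) < e/5"
     "norm ((\<Prod>i\<in>F N. w N i) - l) < e/5" "F0 \<subseteq> F N"
    by (auto dest: eventually_happens)
  have N4: "norm ((\<Prod>i\<in>F N. w N i) - (\<Prod>i\<in>F0. w N i)) < e/5"
    by (rule cmp[OF F(1) N(3)]) (use w1 wg in auto)
  have "dist (\<Prod>i\<in>A. z i) l < e" if A: "finite A" "F0 \<subseteq> A" for A
  proof -
    have 5: "norm ((\<Prod>i\<in>A. z i) - (\<Prod>i\<in>F0. z i)) < e/5" by (rule cmp[OF A]) (use z1 zg in auto)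
    \<comment> \<open>Telescopes through the products of z over F0, of w N over F0 and of w N over F
      N. The terms with \<open>-1\<close> and \<open>2\<close> combine to a single subtraction of
      the middle difference.\<close>
    have "(\<Prod>i\<in>A. z i) - l = ((\<Prod>i\<in>A. z i) - (\<Prod>i\<in>F0. z i)) - ((\<Prod>i\<in>F0. w N i) - (\<Prod>i\<in>F0. z i)) * (-1)
        * 1 + (((\<Prod>i\<in>F N. w N i) - l) - ((\<Prod>i\<in>F N. w N i) - (\<Prod>i\<in>F0. w N i))) - 2 * ((\<Prod>i\<in>F0. w N i) - (\<Prod>i\<in>F0. z i))"
      by (simp add: algebra_simps)
    also have "norm \<dots> \<le> norm ((\<Prod>i\<in>A. z i) - (\<Prod>i\<in>F0. z i)) + norm ((\<Prod>i\<in>F0. w N i) - (\<Prod>i\<in>F0. z i))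
        + (norm ((\<Prod>i\<in>F N. w N i) - l) + norm ((\<Prod>i\<in>F N. w N i) - (\<Prod>i\<in>F0. w N i)))"
    proof -
      have "norm (p - q * (-1) * 1 + (r - s) - 2 * q) \<le> norm p + norm q + (norm r + norm s)" for p q r s :: complex
      proof -
        have "p - q * (-1) * 1 + (r - s) - 2 * q = (p - q) + (r - s)" by (simp add: algebra_simps)
        also have "norm \<dots> \<le> norm (p - q) + norm (r - s)" by (rule norm_triangle_ineq)
        also have "\<dots> \<le> (norm p + norm q) + (norm r + norm s)" by (intro add_mono norm_triangle_ineq4)
        finally show ?thesis .
      qed
      then show ?thesis .
    qed
    finally show ?thesis using 5 N N4 e unfolding dist_norm by linarith
  qed
  then show "\<forall>\<^sub>F A in finite_subsets_at_top UNIV. dist (\<Prod>i\<in>A. z i) l < e"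
    unfolding eventually_finite_subsets_at_top using F0(1) by blast
qed

context stable_domain
begin

text \<open>W need not be monotone, since V may jump. In Potter's bound the power of |p|/|q| is at
  most 1, and only the constant remains.\<close>

lemma W_quasi_mono:
  assumes R: "0 < R"
  shows "\<exists>C>0. \<forall>p q. \<bar>p\<bar> \<le> \<bar>q\<bar> \<longrightarrow> \<bar>q\<bar> \<le> R \<longrightarrow> W p \<le> C * W q"
proof -
  obtain C where C: "0 < C" "\<And>s t. 0 < \<bar>s\<bar> \<Longrightarrow> \<bar>s\<bar> \<le> \<bar>t\<bar> \<Longrightarrow> \<bar>t\<bar> \<le> R \<Longrightarrow> W s \<le> C * (\<bar>s\<bar> / \<bar>t\<bar>) powr (\<alpha> / 2) * W t"
    using W_potter[OF R] by blast
  have "W p \<le> C * W q" if "\<bar>p\<bar> \<le> \<bar>q\<bar>" "\<bar>q\<bar> \<le> R" for p q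
  proof (cases "p = 0")
    case False
    then have "W p \<le> C * (\<bar>p\<bar> / \<bar>q\<bar>) powr (\<alpha> / 2) * W q" using that by (intro C) auto
    also have "\<dots> \<le> C * 1 * W q"
      using that False C alpha_pos by (intro mult_right_mono mult_left_mono powr_le1) (auto simp: W_nonneg)
    finally show ?thesis by simp
  qed (use C W_nonneg in simp)
  then show ?thesis using C(1) by blast
qed

text \<open>The sum is at most card J times its largest term in modulus, to which quasi-monotonicity
  and then the quadratic scaling of \<open>W_sq_antimono\<close> apply. This carries summability of
  W(a_i) over to the coefficients of a finite sum of X_j.\<close>

lemma W_sum_bound:
  fixes J :: "'j set"
  assumes J: "finite J" and A: "0 < A"
  shows "\<exists>C>0. \<forall>x. (\<forall>j\<in>J. \<bar>x j\<bar> \<le> A) \<longrightarrow> W (s * (\<Sum>j\<in>J. x j)) \<le> C * (\<Sum>j\<in>J. W (x j))"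
proof -
  define K where "K = \<bar>s\<bar> * real (card J) + 1"
  have K: "1 \<le> K" by (simp add: K_def)
  obtain C where C: "0 < C" "\<And>p q. \<bar>p\<bar> \<le> \<bar>q\<bar> \<Longrightarrow> \<bar>q\<bar> \<le> K * A \<Longrightarrow> W p \<le> C * W q"
    using W_quasi_mono[of "K * A"] K A by auto
  have "W (s * (\<Sum>j\<in>J. x j)) \<le> (C * K\<^sup>2) * (\<Sum>j\<in>J. W (x j))" if x: "\<forall>j\<in>J. \<bar>x j\<bar> \<le> A" for x
  proof (cases "\<forall>j\<in>J. x j = 0")
    case True
    then have "(\<Sum>j\<in>J. x j) = 0" by simp
    then show ?thesis using C K by (simp add: sum_nonneg W_nonneg)
  next
    case False
    then have ne: "J \<noteq> {}" by auto
    have "Max ((\<lambda>j. \<bar>x j\<bar>) ` J) \<in> (\<lambda>j. \<bar>x j\<bar>) ` J" using J ne by (intro Max_in) auto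
    then obtain j0 where j0': "j0 \<in> J" "Max ((\<lambda>j. \<bar>x j\<bar>) ` J) = \<bar>x j0\<bar>" by auto
    then have j0: "j0 \<in> J" "\<And>j. j \<in> J \<Longrightarrow> \<bar>x j\<bar> \<le> \<bar>x j0\<bar>"
      using Max_ge[of "(\<lambda>j. \<bar>x j\<bar>) ` J"] J by (auto simp flip: j0'(2))
    have x0: "x j0 \<noteq> 0" using False j0 by force
    have "\<bar>\<Sum>j\<in>J. x j\<bar> \<le> (\<Sum>j\<in>J. \<bar>x j\<bar>)" by (rule sum_abs)
    also have "\<dots> \<le> real (card J) * \<bar>x j0\<bar>" using sum_bounded_above[of J "\<lambda>j. \<bar>x j\<bar>" "\<bar>x j0\<bar>"] j0 by simp
    finally have "\<bar>s * (\<Sum>j\<in>J. x j)\<bar> \<le> \<bar>s\<bar> * (real (card J) * \<bar>x j0\<bar>)"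
      unfolding abs_mult by (intro mult_left_mono) auto
    also have "\<dots> \<le> \<bar>K * x j0\<bar>" using K by (simp add: K_def abs_mult algebra_simps)
    finally have "W (s * (\<Sum>j\<in>J. x j)) \<le> C * W (K * x j0)"
      using x j0 K by (intro C) (auto simp: abs_mult intro!: mult_left_mono)
    also have "W (K * x j0) \<le> (K * x j0 / x j0)\<^sup>2 * W (x j0)"
      using x0 K mult_right_mono[OF K, of "\<bar>x j0\<bar>"] by (intro W_sq_antimono) (auto simp: abs_mult)
    also have "K * x j0 / x j0 = K" using x0 by simp
    also have "W (x j0) \<le> (\<Sum>j\<in>J. W (x j))" using J j0 by (intro member_le_sum) (auto simp: W_nonneg)
    finally show ?thesis using C K by (simp add: mult.assoc mult_left_mono)
  qed
  moreover have "0 < C * K\<^sup>2" using C K by simp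
  ultimately show ?thesis by blast
qed

text \<open>Cutting every series after N terms leaves a finite linear combination of innovations,
  whose characteristic function is a finite product once the terms are regrouped by innovation.
  Almost sure convergence gives the limit along N, and the summable bound g removes the dependence
  on the enumeration e.\<close>

lemma char_linear_process:
  fixes M :: "'w measure" and \<xi> :: "'i::ab_group_add \<Rightarrow> 'w \<Rightarrow> real" and a :: "'i \<Rightarrow> real" and e :: "nat \<Rightarrow> 'i"
  assumes M: "prob_space M" and ind: "prob_space.indep_vars M (\<lambda>_. borel) \<xi> UNIV"
    and law: "\<And>i. distr M borel (\<xi> i) = \<mu>" and e: "bij e"
    and sW: "(\<lambda>i. W (a i)) summable_on UNIV" and sa: "(\<lambda>i. \<bar>a i\<bar>) summable_on UNIV"
    and \<Gamma>: "finite \<Gamma>"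
  defines "bs \<equiv> \<lambda>i. \<Sum>j\<in>\<Gamma>. a (j - i)" and "S \<equiv> \<lambda>\<omega>. \<Sum>j\<in>\<Gamma>. linear_process e a \<xi> j \<omega>"
  shows "S \<in> borel_measurable M"
    and "((\<lambda>A. \<Prod>i\<in>A. char \<mu> (s * bs i)) \<longlongrightarrow> char (distr M borel S) s) (finite_subsets_at_top UNIV)"
proof -
  interpret M: prob_space M by (rule M)
  have \<xi>[measurable]: "\<xi> i \<in> borel_measurable M" for i using ind by (simp add: M.indep_vars_def)
  show Sm[measurable]: "S \<in> borel_measurable M" unfolding S_def linear_process_def by measurable
  have se: "summable (\<lambda>k. W (a (e k)))" "summable (\<lambda>k. \<bar>a (e k)\<bar>)"
    using summable_on_imp_summable summable_on_reindex_bij_betw[OF e] sW sa by blast+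
  have "AE \<omega> in M. summable (\<lambda>k. a (e k) * \<xi> (j - e k) \<omega>)" for j
  proof (rule AE_summable_linear[OF M _ law se])
    have "inj (\<lambda>k. j - e k)" using bij_is_inj[OF e] by (auto simp: inj_def)
    then show "M.indep_vars (\<lambda>_. borel) (\<lambda>k. \<xi> (j - e k)) UNIV" by (rule M.indep_vars_inj_reindex[OF ind])
  qed
  then have ae: "AE \<omega> in M. \<forall>j\<in>\<Gamma>. summable (\<lambda>k. a (e k) * \<xi> (j - e k) \<omega>)"
    using \<Gamma> by (simp add: AE_finite_all)
  define P where "P N \<omega> = (\<Sum>j\<in>\<Gamma>. \<Sum>k<N. a (e k) * \<xi> (j - e k) \<omega>)" for N \<omega>
  have [measurable]: "P N \<in> borel_measurable M" for N unfolding P_def by measurable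
  have Plim: "AE \<omega> in M. (\<lambda>N. P N \<omega>) \<longlonglongrightarrow> S \<omega>"
    using ae
  proof eventually_elim
    case (elim \<omega>)
    then show ?case unfolding P_def S_def linear_process_def
      by (intro tendsto_sum summable_LIMSEQ) auto
  qed
  have charS: "(\<lambda>N. char (distr M borel (P N)) s) \<longlonglongrightarrow> char (distr M borel S) s"
    unfolding char_def
  proof (subst integral_distr, simp, simp, subst integral_distr, simp, simp, rule integral_dominated_convergence[where w = "\<lambda>_. 1"])
    show "AE \<omega> in M. (\<lambda>N. iexp (s * P N \<omega>)) \<longlonglongrightarrow> iexp (s * S \<omega>)"
      using Plim by eventually_elim (intro tendsto_intros)
  qed auto
  define A where "A N x = (if x \<in> e ` {..<N} then a x else 0)" for N x
  define bN where "bN N i = (\<Sum>j\<in>\<Gamma>. A N (j - i))" for N i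
  \<comment> \<open>The second part contains every index with a nonzero truncated coefficient. The
    first ensures that every index belongs eventually, even if \<open>\<Gamma>\<close> is
    empty.\<close>
  define F where "F N = e ` {..<N} \<union> (\<Union>j\<in>\<Gamma>. (\<lambda>x. j - x) ` e ` {..<N})" for N
  have Ff: "finite (F N)" for N unfolding F_def using \<Gamma> by auto
  have PF: "P N \<omega> = (\<Sum>i\<in>F N. bN N i * \<xi> i \<omega>)" for N \<omega>
  proof -
    have "(\<Sum>k<N. a (e k) * \<xi> (j - e k) \<omega>) = (\<Sum>i\<in>F N. A N (j - i) * \<xi> i \<omega>)" if j: "j \<in> \<Gamma>" for j
    proof -
      have "(\<Sum>i\<in>F N. A N (j - i) * \<xi> i \<omega>) = (\<Sum>i\<in>(\<lambda>x. j - x) ` e ` {..<N}. A N (j - i) * \<xi> i \<omega>)"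
      proof (rule sum.mono_neutral_right[OF Ff])
        show "\<forall>i\<in>F N - (\<lambda>x. j - x) ` e ` {..<N}. A N (j - i) * \<xi> i \<omega> = 0"
        proof
          fix i assume i: "i \<in> F N - (\<lambda>x. j - x) ` e ` {..<N}"
          have "j - i \<notin> e ` {..<N}"
          proof
            assume "j - i \<in> e ` {..<N}"
            then have "j - (j - i) \<in> (\<lambda>x. j - x) ` e ` {..<N}" by (rule imageI)
            then show False using i by simp
          qed
          then show "A N (j - i) * \<xi> i \<omega> = 0" by (simp add: A_def)
        qed
      qed (use j in \<open>auto simp: F_def\<close>)
      also have "\<dots> = (\<Sum>x\<in>e ` {..<N}. A N x * \<xi> (j - x) \<omega>)"
        by (subst sum.reindex) (auto simp: inj_on_def)
      also have "\<dots> = (\<Sum>k<N. A N (e k) * \<xi> (j - e k) \<omega>)"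
        by (subst sum.reindex) (auto intro: inj_on_subset[OF bij_is_inj[OF e]])
      also have "\<dots> = (\<Sum>k<N. a (e k) * \<xi> (j - e k) \<omega>)" by (intro sum.cong) (auto simp: A_def)
      finally show ?thesis by simp
    qed
    then have "P N \<omega> = (\<Sum>j\<in>\<Gamma>. \<Sum>i\<in>F N. A N (j - i) * \<xi> i \<omega>)" unfolding P_def by (intro sum.cong) auto
    also have "\<dots> = (\<Sum>i\<in>F N. bN N i * \<xi> i \<omega>)" by (subst sum.swap) (simp add: bN_def sum_distrib_right)
    finally show ?thesis .
  qed
  have charP: "char (distr M borel (P N)) s = (\<Prod>i\<in>F N. char \<mu> (s * bN N i))" for N
  proof -
    have "M.indep_vars (\<lambda>_. borel) (\<lambda>i \<omega>. bN N i * \<xi> i \<omega>) (F N)"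
      by (rule M.indep_vars_compose2[where Y = "\<lambda>i x. bN N i * x", OF M.indep_vars_subset[OF ind]]) auto
    then have "char (distr M borel (\<lambda>\<omega>. \<Sum>i\<in>F N. bN N i * \<xi> i \<omega>)) s = (\<Prod>i\<in>F N. char (distr M borel (\<lambda>\<omega>. bN N i * \<xi> i \<omega>)) s)"
      by (rule M.char_distr_sum)
    also have "(\<lambda>\<omega>. \<Sum>i\<in>F N. bN N i * \<xi> i \<omega>) = P N" by (simp add: PF fun_eq_iff)
    also have "(\<Prod>i\<in>F N. char (distr M borel (\<lambda>\<omega>. bN N i * \<xi> i \<omega>)) s) = (\<Prod>i\<in>F N. char \<mu> (s * bN N i))"
    proof (intro prod.cong refl)
      fix i
      have "char (distr M borel (\<lambda>\<omega>. bN N i * \<xi> i \<omega>)) s = (\<integral>\<omega>. iexp (s * (bN N i * \<xi> i \<omega>)) \<partial>M)"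
        unfolding char_def by (rule integral_distr) auto
      also have "\<dots> = (\<integral>y. iexp (s * (bN N i * y)) \<partial>(distr M borel (\<xi> i)))"
        by (rule integral_distr[symmetric]) auto
      also have "\<dots> = char \<mu> (s * bN N i)" by (simp add: law char_def mult.assoc)
      finally show "char (distr M borel (\<lambda>\<omega>. bN N i * \<xi> i \<omega>)) s = char \<mu> (s * bN N i)" .
    qed
    finally show ?thesis .
  qed
  define A0 where "A0 = (\<Sum>\<^sub>\<infinity>x. \<bar>a x\<bar>) + 1"
  have aA0: "\<bar>a x\<bar> \<le> A0" for x
    using finite_sum_le_infsum[OF sa, of "{x}"] by (simp add: A0_def)
  have A0: "0 < A0" using infsum_nonneg[of UNIV "\<lambda>x. \<bar>a x\<bar>"] by (simp add: A0_def)
  obtain C1 where C1: "0 < C1" "\<And>x. (\<forall>j\<in>\<Gamma>. \<bar>x j\<bar> \<le> A0) \<Longrightarrow> W (s * (\<Sum>j\<in>\<Gamma>. x j)) \<le> C1 * (\<Sum>j\<in>\<Gamma>. W (x j))"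
    using W_sum_bound[OF \<Gamma> A0, of s] by blast
  define R where "R = \<bar>s\<bar> * (real (card \<Gamma>) * A0) + 1"
  have R0: "0 < R" using A0 by (simp add: R_def add_nonneg_pos)
  obtain C2 where C2: "0 < C2" "\<And>t. \<bar>t\<bar> \<le> R \<Longrightarrow> cmod (1 - char \<mu> t) \<le> C2 * W t"
    using char_le_W[OF R0] by blast
  define g where "g i = C2 * (C1 * (\<Sum>j\<in>\<Gamma>. W (a (j - i))))" for i
  \<comment> \<open>Stated for terms that are a(j - i) or 0, so that it serves the full coefficients
    \<open>bs\<close> and the truncated ones \<open>bN\<close> alike.\<close>
  have key: "cmod (1 - char \<mu> (s * (\<Sum>j\<in>\<Gamma>. x j))) \<le> g i" if x: "\<And>j. x j = 0 \<or> x j = a (j - i)" for x i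
  proof -
    have xb: "\<bar>x j\<bar> \<le> A0" for j using x[of j] aA0[of "j - i"] A0 by auto
    have "\<bar>\<Sum>j\<in>\<Gamma>. x j\<bar> \<le> (\<Sum>j\<in>\<Gamma>. \<bar>x j\<bar>)" by (rule sum_abs)
    also have "\<dots> \<le> real (card \<Gamma>) * A0" using sum_bounded_above[of \<Gamma> "\<lambda>j. \<bar>x j\<bar>" A0] xb by simp
    finally have "\<bar>s\<bar> * \<bar>\<Sum>j\<in>\<Gamma>. x j\<bar> \<le> \<bar>s\<bar> * (real (card \<Gamma>) * A0)" by (rule mult_left_mono) simp
    then have "\<bar>s * (\<Sum>j\<in>\<Gamma>. x j)\<bar> \<le> R" unfolding R_def abs_mult by linarith
    then have "cmod (1 - char \<mu> (s * (\<Sum>j\<in>\<Gamma>. x j))) \<le> C2 * W (s * (\<Sum>j\<in>\<Gamma>. x j))" by (rule C2)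
    also have "\<dots> \<le> C2 * (C1 * (\<Sum>j\<in>\<Gamma>. W (x j)))" using C1 C2 xb by (intro mult_left_mono) auto
    also have "\<dots> \<le> g i" unfolding g_def
    proof (intro mult_left_mono sum_mono)
      show "W (x j) \<le> W (a (j - i))" for j using x[of j] by (auto simp: W_nonneg)
    qed (use C1 C2 in auto)
    finally show ?thesis .
  qed
  have eF: "\<forall>\<^sub>F N in sequentially. x \<in> e ` {..<N}" for x
  proof -
    obtain k where "x = e k" using bij_is_surj[OF e] by blast
    then show ?thesis by (intro eventually_mono[OF eventually_gt_at_top[of k]]) auto
  qed
  show "((\<lambda>A. \<Prod>i\<in>A. char \<mu> (s * bs i)) \<longlongrightarrow> char (distr M borel S) s) (finite_subsets_at_top UNIV)"
  proof (rule prod_tendsto_finite_subsets[where g = g and w = "\<lambda>N i. char \<mu> (s * bN N i)" and F = F])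
    show "g summable_on UNIV"
    proof -
      have "(\<lambda>i. W (a (j - i))) summable_on UNIV" for j
      proof -
        have "bij (\<lambda>i. j - i)" by (rule o_bij[where g = "\<lambda>i. j - i"]) auto
        then show ?thesis using summable_on_reindex_bij_betw[of "\<lambda>i. j - i" UNIV UNIV "\<lambda>i. W (a i)"] sW by simp
      qed
      then have "(\<lambda>i. \<Sum>j\<in>\<Gamma>. W (a (j - i))) summable_on UNIV"
        using \<Gamma> by (intro summable_on_finite_sum) auto
      then show ?thesis unfolding g_def by (intro summable_on_cmult_right)
    qed
    show "cmod (1 - char \<mu> (s * bs i)) \<le> g i" for i unfolding bs_def by (rule key) auto
    show "cmod (1 - char \<mu> (s * bN N i)) \<le> g i" for N i unfolding bN_def by (rule key) (auto simp: A_def)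
    show "(\<lambda>N. char \<mu> (s * bN N i)) \<longlonglongrightarrow> char \<mu> (s * bs i)" for i
    proof (rule tendsto_eventually)
      have "\<forall>\<^sub>F N in sequentially. \<forall>j\<in>\<Gamma>. j - i \<in> e ` {..<N}"
        by (intro eventually_ball_finite \<Gamma> ballI eF)
      then show "\<forall>\<^sub>F N in sequentially. char \<mu> (s * bN N i) = char \<mu> (s * bs i)"
        by eventually_elim (simp add: bN_def bs_def A_def)
    qed
    show "\<forall>\<^sub>F N in sequentially. i \<in> F N" for i
      using eF[of i] by eventually_elim (simp add: F_def)
    show "(\<lambda>N. \<Prod>i\<in>F N. char \<mu> (s * bN N i)) \<longlonglongrightarrow> char (distr M borel S) s"
      using charS by (simp add: charP)
  qed (use Ff cmod_char_le_1 in auto)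
qed

end

section \<open>The Fejer kernel\<close>

definition triangle :: "real \<Rightarrow> real" where
  "triangle s = max 0 (1 - \<bar>s\<bar>)"

text \<open>The value at \<open>0\<close> makes the Fejer kernel continuous.\<close>

definition fejer :: "real \<Rightarrow> real" where
  "fejer x = (if x = 0 then 1 / (2 * pi) else (1 - cos x) / (pi * x\<^sup>2))"

lemma triangle_measurable [measurable]: "triangle \<in> borel_measurable borel"
  unfolding triangle_def by measurable

lemma fejer_measurable [measurable]: "fejer \<in> borel_measurable borel"
  unfolding fejer_def by measurable

lemma triangle_bounds: "0 \<le> triangle s" "triangle s \<le> 1" "triangle s \<le> indicator {-1..1} s"
  by (auto simp: triangle_def indicator_def)

lemma triangle_0 [simp]: "triangle 0 = 1"
  by (simp add: triangle_def)

lemma isCont_triangle: "isCont triangle s"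
  unfolding triangle_def by (intro continuous_intros)

lemma fejer_nonneg: "0 \<le> fejer x"
  by (simp add: fejer_def)

lemma fejer_minus: "fejer (- x) = fejer x"
  by (simp add: fejer_def)

lemma fejer_le: "x \<noteq> 0 \<Longrightarrow> fejer x \<le> 1 / x\<^sup>2"
proof -
  assume x: "x \<noteq> 0"
  have "1 - cos x \<le> pi" using cos_ge_minus_one[of x] pi_gt3 by linarith
  then have "(1 - cos x) / (pi * x\<^sup>2) \<le> pi / (pi * x\<^sup>2)" using x by (intro divide_right_mono) auto
  then show ?thesis using x by (simp add: fejer_def)
qed

text \<open>Integration by parts suggests the antiderivative (Si x - (1 - cos x)/x) / pi, and the
  sine integral tends to pi/2. With the value 0 for the quotient at x = 0 it is differentiable there
  too.\<close>

lemma fejer_integral_half: "(\<integral>\<^sup>+x. ennreal (fejer x) * indicator {0..} x \<partial>lborel) = ennreal (1 / 2)"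
proof -
  define F where "F x = (Si x - (if x = 0 then 0 else (1 - cos x) / x)) / pi" for x :: real
  have "(\<integral>\<^sup>+x. ennreal (fejer x) * indicator {0..} x \<partial>lborel) = ennreal (1 / 2 - F 0)"
  proof (rule nn_integral_FTC_atLeast)
    fix x :: real
    show "DERIV F x :> fejer x"
    proof (cases "x = 0")
      case True
      have "((\<lambda>h::real. (1 - cos h) / h / h) \<longlongrightarrow> 1 / 2) (at 0)" by real_asymp
      then have "((\<lambda>h. ((if 0 + h = 0 then 0 else (1 - cos (0 + h)) / (0 + h)) - 0) / h) \<longlongrightarrow> 1 / 2) (at (0::real))"
        by (rule Lim_transform_eventually) (auto simp: eventually_at_filter)
      then have "((\<lambda>x::real. if x = 0 then 0 else (1 - cos x) / x) has_real_derivative 1 / 2) (at 0)"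
        unfolding DERIV_def by simp
      from DERIV_cdivide[OF DERIV_diff[OF DERIV_Si this], of pi]
      show ?thesis using True by (simp add: F_def[abs_def] fejer_def)
    next
      case False
      have "((\<lambda>x. (1 - cos x) / x) has_real_derivative (sin x * x - (1 - cos x)) / x\<^sup>2) (at x)"
        using False by (auto intro!: derivative_eq_intros simp: power2_eq_square)
      then have "((\<lambda>x. if x = 0 then 0 else (1 - cos x) / x) has_real_derivative (sin x * x - (1 - cos x)) / x\<^sup>2) (at x)"
        by (rule has_field_derivative_transform_within_open[where S = "- {0}"]) (use False in auto)
      from DERIV_cdivide[OF DERIV_diff[OF DERIV_Si[of x] this], of pi]
      show ?thesis using False
        by (simp add: F_def[abs_def] fejer_def field_simps power2_eq_square)
    qed
    show "0 \<le> fejer x" by (rule fejer_nonneg)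
  next
    have "((\<lambda>x::real. (1 - cos x) / x) \<longlongrightarrow> 0) at_top"
    proof (rule Lim_null_comparison)
      show "\<forall>\<^sub>F x::real in at_top. norm ((1 - cos x) / x) \<le> 2 / x"
        using eventually_gt_at_top[of "0::real"]
      proof eventually_elim
        case (elim x)
        have "1 - cos x \<le> 2" using cos_ge_minus_one[of x] by linarith
        then show ?case using elim by (simp add: abs_mult divide_right_mono)
      qed
      show "((\<lambda>x::real. 2 / x) \<longlongrightarrow> 0) at_top" by real_asymp
    qed
    then have "((\<lambda>x. (Si x - (1 - cos x) / x) / pi) \<longlongrightarrow> (pi / 2 - 0) / pi) at_top"
      by (intro tendsto_intros Si_at_top) auto
    then have "((\<lambda>x. (Si x - (1 - cos x) / x) / pi) \<longlongrightarrow> 1 / 2) at_top" by simp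
    then show "(F \<longlongrightarrow> 1 / 2) at_top"
      by (rule Lim_transform_eventually)
         (use eventually_gt_at_top[of "0::real"] in \<open>eventually_elim, simp add: F_def\<close>)
  qed measurable
  moreover have "F 0 = 0" by (simp add: F_def Si_def zero_ereal_def)
  ultimately show ?thesis by simp
qed

lemma has_bochner_integral_fejer: "has_bochner_integral lborel fejer 1"
proof (rule has_bochner_integral_nn_integral)
  have "(\<integral>\<^sup>+x. ennreal (fejer x) \<partial>lborel) =
      (\<integral>\<^sup>+x. ennreal (fejer x) * indicator {0..} x + ennreal (fejer x) * indicator {..<0} x \<partial>lborel)"
    by (intro nn_integral_cong) (auto simp: indicator_def)
  also have "\<dots> = (\<integral>\<^sup>+x. ennreal (fejer x) * indicator {0..} x \<partial>lborel) + (\<integral>\<^sup>+x. ennreal (fejer x) * indicator {..<0} x \<partial>lborel)"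
    by (rule nn_integral_add) auto
  also have "(\<integral>\<^sup>+x. ennreal (fejer x) * indicator {..<0} x \<partial>lborel) =
      (\<integral>\<^sup>+x. ennreal (fejer (0 + (-1) * x)) * indicator {..<0} (0 + (-1) * x) \<partial>lborel)"
    by (subst nn_integral_real_affine[of _ "-1" 0]) auto
  also have "\<dots> = (\<integral>\<^sup>+x. ennreal (fejer x) * indicator {0..} x \<partial>lborel)"
    by (intro nn_integral_cong_AE, use AE_lborel_singleton[of 0] in eventually_elim)
       (auto simp: indicator_def fejer_minus)
  also have "\<dots> + \<dots> = ennreal 1"
    unfolding fejer_integral_half by (subst ennreal_plus[symmetric]) auto
  finally show "(\<integral>\<^sup>+x. ennreal (fejer x) \<partial>lborel) = ennreal 1" .
qed (auto simp: fejer_nonneg)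

lemmas integrable_fejer = has_bochner_integral_fejer[THEN integrable.intros]
lemmas integral_fejer = has_bochner_integral_fejer[THEN has_bochner_integral_integral_eq]

text \<open>On each half of [-1, 1] the integrand is a linear function times an exponential, with
  antiderivatives \<open>A2\<close> and \<open>A1\<close>. The boundary terms in 1/x cancel, and
  those in 1/x^2 combine to (2 - 2 cos x) / x^2.\<close>

lemma integral_triangle_iexp: "(CLBINT s. triangle s * iexp (s * x)) = 2 * pi * fejer x"
proof -
  let ?f = "\<lambda>s. complex_of_real (triangle s) * iexp (s * x)"
  have "(?f has_integral complex_of_real (2 * pi * fejer x)) {-1..1}"
  proof (cases "x = 0")
    case True
    have "((\<lambda>s. complex_of_real (1 + s)) has_integral complex_of_real (0 + 0\<^sup>2/2) - complex_of_real (-1 + (-1)\<^sup>2/2)) {-1..0::real}"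
      by (rule fundamental_theorem_of_calculus) (auto intro!: derivative_eq_intros has_vector_derivative_real_field)
    then have 1: "(?f has_integral (1/2)) {-1..0}"
      by (rule has_integral_eq[rotated, THEN has_integral_eq_rhs]) (auto simp: triangle_def True)
    have "((\<lambda>s. complex_of_real (1 - s)) has_integral complex_of_real (1 - 1\<^sup>2/2) - complex_of_real (0 - 0\<^sup>2/2)) {0..1::real}"
      by (rule fundamental_theorem_of_calculus) (auto intro!: derivative_eq_intros has_vector_derivative_real_field)
    then have 2: "(?f has_integral (1/2)) {0..1}"
      by (rule has_integral_eq[rotated, THEN has_integral_eq_rhs]) (auto simp: triangle_def True)
    show ?thesis using has_integral_combine[OF _ _ 1 2] True by (simp add: fejer_def)
  next
    case False
    let ?x = "complex_of_real x"
    define A1 where "A1 s = (1 - complex_of_real s) * exp (\<i> * (s * ?x)) / (\<i> * ?x) - exp (\<i> * (s * ?x)) / ?x\<^sup>2" for s :: real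
    define A2 where "A2 s = (1 + complex_of_real s) * exp (\<i> * (s * ?x)) / (\<i> * ?x) + exp (\<i> * (s * ?x)) / ?x\<^sup>2" for s :: real
    have d1: "(A1 has_vector_derivative (1 - complex_of_real s) * exp (\<i> * (s * ?x))) (at s within T)" for s T
      unfolding A1_def using False
      by (auto intro!: derivative_eq_intros has_vector_derivative_real_field simp: field_simps power2_eq_square)
    have d2: "(A2 has_vector_derivative (1 + complex_of_real s) * exp (\<i> * (s * ?x))) (at s within T)" for s T
      unfolding A2_def using False
      by (auto intro!: derivative_eq_intros has_vector_derivative_real_field simp: field_simps power2_eq_square)
    have "((\<lambda>s. (1 + complex_of_real s) * exp (\<i> * (s * ?x))) has_integral A2 0 - A2 (-1)) {-1..0}"
      by (rule fundamental_theorem_of_calculus) (auto intro: d2)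
    then have 1: "(?f has_integral (A2 0 - A2 (-1))) {-1..0}"
      by (rule has_integral_eq[rotated]) (auto simp: triangle_def)
    have "((\<lambda>s. (1 - complex_of_real s) * exp (\<i> * (s * ?x))) has_integral A1 1 - A1 0) {0..1}"
      by (rule fundamental_theorem_of_calculus) (auto intro: d1)
    then have 2: "(?f has_integral (A1 1 - A1 0)) {0..1}"
      by (rule has_integral_eq[rotated]) (auto simp: triangle_def)
    have "(A2 0 - A2 (-1)) + (A1 1 - A1 0) = (2 - (exp (\<i> * ?x) + exp (- (\<i> * ?x)))) / ?x\<^sup>2"
      using False by (simp add: A1_def A2_def field_simps)
    also have "exp (\<i> * ?x) + exp (- (\<i> * ?x)) = 2 * cos ?x" by (simp add: cos_exp_eq)
    also have "(2 - 2 * cos ?x) / ?x\<^sup>2 = complex_of_real (2 * pi * fejer x)"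
      using False by (simp add: fejer_def cos_of_real field_simps)
    finally show ?thesis using has_integral_combine[OF _ _ 1 2] by simp
  qed
  then have h: "(?f has_integral complex_of_real (2 * pi * fejer x)) UNIV"
    by (rule has_integral_on_superset) (auto simp: triangle_def)
  have int: "integrable lborel ?f"
  proof (rule Bochner_Integration.integrable_bound)
    show "integrable lborel (indicator {-1..1::real} :: real \<Rightarrow> real)" by (rule integrable_real_indicator) auto
    show "AE s in lborel. norm (?f s) \<le> norm (indicator {-1..1} s :: real)"
      using triangle_bounds by (auto simp: norm_mult)
  qed simp
  have "(CLBINT s. ?f s) = integral UNIV ?f" by (rule integral_lborel[OF int, symmetric])
  also have "\<dots> = complex_of_real (2 * pi * fejer x)" by (rule integral_unique[OF h])
  finally show ?thesis by simp
qed

lemma integrable_triangle: "c \<noteq> 0 \<Longrightarrow> integrable lborel (\<lambda>s. triangle (c * s))"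
proof -
  have "integrable lborel triangle"
  proof (rule Bochner_Integration.integrable_bound)
    show "integrable lborel (indicator {-1..1::real} :: real \<Rightarrow> real)" by (rule integrable_real_indicator) auto
    show "AE s in lborel. norm (triangle s) \<le> norm (indicator {-1..1} s :: real)"
      using triangle_bounds by auto
  qed simp
  then show "c \<noteq> 0 \<Longrightarrow> integrable lborel (\<lambda>s. triangle (c * s))"
    using lborel_integrable_real_affine[of triangle c 0] by simp
qed

lemma fejer_scaled:
  assumes d: "0 < \<delta>"
  shows "complex_of_real (fejer (x / \<delta>) / \<delta>) = (1 / (2 * pi)) * (CLBINT s. triangle (\<delta> * s) * iexp (s * x))"
proof -
  have "2 * pi * complex_of_real (fejer (x / \<delta>)) = (CLBINT s. triangle s * iexp (s * (x / \<delta>)))"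
    using integral_triangle_iexp[of "x / \<delta>"] by simp
  also have "\<dots> = \<bar>\<delta>\<bar> *\<^sub>R (CLBINT s. triangle (0 + \<delta> * s) * iexp ((0 + \<delta> * s) * (x / \<delta>)))"
    by (rule lborel_integral_real_affine) (use d in auto)
  also have "\<dots> = \<delta> * (CLBINT s. triangle (\<delta> * s) * iexp (s * x))"
    using d by (simp add: scaleR_conv_of_real)
  finally show ?thesis using d by (simp add: field_simps)
qed

text \<open>The kernel alone vanishes at the nonzero multiples of 2 pi. Shifting by pi turns cos x
  into -cos x, so the two numerators add up to the constant 2, while \<open>D\<close> bounds both
  x^2 and (x - pi)^2. The result is a band-limited function that dominates 1/(1 + x^2) up to the
  factor pi^3.\<close>

lemma fejer_lower: "1 / (pi ^ 3 * (1 + x\<^sup>2)) \<le> fejer x + fejer (x - pi)"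
proof -
  define D where "D = 2 * (x\<^sup>2 + pi\<^sup>2)"
  have D0: "0 < D" by (simp add: D_def add_nonneg_pos)
  have D1: "x\<^sup>2 \<le> D" unfolding D_def by (simp add: add_increasing2)
  have D2: "(x - pi)\<^sup>2 \<le> D"
    using zero_le_power2[of "x + pi"] by (simp add: D_def power2_eq_square algebra_simps)
  have lb: "(1 - cos z) / (pi * D) \<le> fejer z" if "z\<^sup>2 \<le> D" for z
  proof (cases "z = 0")
    case False
    then show ?thesis using that D0 by (auto simp: fejer_def intro!: divide_left_mono mult_pos_pos)
  qed (simp add: fejer_def)
  have "cos (x - pi) = - cos x" by (simp add: cos_diff)
  then have "(1 - cos x) / (pi * D) + (1 + cos x) / (pi * D) \<le> fejer x + fejer (x - pi)"
    using lb[OF D1] lb[OF D2] by simp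
  moreover have "(1 - cos x) / (pi * D) + (1 + cos x) / (pi * D) = 2 / (pi * D)"
    by (simp add: add_divide_distrib[symmetric])
  moreover have "1 / (pi ^ 3 * (1 + x\<^sup>2)) \<le> 2 / (pi * D)"
  proof -
    have p: "1 \<le> pi\<^sup>2" using pi_gt3 by (simp add: one_le_power)
    have "pi * D \<le> 2 * (pi ^ 3 * (1 + x\<^sup>2))"
    proof -
      have "x\<^sup>2 + pi\<^sup>2 \<le> pi\<^sup>2 * (1 + x\<^sup>2)" using mult_right_mono[OF p, of "x\<^sup>2"] by (simp add: algebra_simps)
      then have "pi * (2 * (x\<^sup>2 + pi\<^sup>2)) \<le> pi * (2 * (pi\<^sup>2 * (1 + x\<^sup>2)))" by (intro mult_left_mono) auto
      then show ?thesis by (simp add: D_def power3_eq_cube power2_eq_square mult_ac)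
    qed
    then show ?thesis using D0 by (simp add: frac_le_eq field_simps one_plus_numeral add_pos_nonneg)
  qed
  ultimately show ?thesis by linarith
qed

section \<open>A local limit theorem from convergence of characteristic functions\<close>

definition fourier_density :: "(real \<Rightarrow> complex) \<Rightarrow> real \<Rightarrow> complex" where
  "fourier_density \<phi> x = (1 / (2 * pi)) * (CLBINT t. iexp (- (t * x)) * \<phi> t)"

lemma norm_fourier_density_le:
  assumes "integrable lborel \<phi>"
  shows "cmod (fourier_density \<phi> x) \<le> (LBINT t. cmod (\<phi> t))"
proof -
  have "cmod (CLBINT t. iexp (- (t * x)) * \<phi> t) \<le> (LBINT t. cmod (iexp (- (t * x)) * \<phi> t))"
    by (rule integral_norm_bound)
  then have "cmod (CLBINT t. iexp (- (t * x)) * \<phi> t) \<le> (LBINT t. cmod (\<phi> t))" by (simp add: norm_mult)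
  moreover have "1 / (2 * pi) \<le> 1" using pi_gt3 by simp
  ultimately have "(1 / (2 * pi)) * cmod (CLBINT t. iexp (- (t * x)) * \<phi> t) \<le> 1 * (LBINT t. cmod (\<phi> t))"
    by (intro mult_mono) auto
  then show ?thesis by (simp add: fourier_density_def norm_mult norm_divide)
qed

text \<open>The local limit theorem for test functions whose Fourier transform \<open>H\<close> has compact support,
  via \<open>B \<integral> h(x + u) dP = \<integral> H(t/B) e\<^bsup>itu/B\<^esup> char P (t/B) dt\<close>.\<close>

locale char_convergence =
  fixes P :: "nat \<Rightarrow> real measure" and B :: "nat \<Rightarrow> real" and \<phi> :: "real \<Rightarrow> complex"
  assumes P: "\<And>n. real_distribution (P n)" and B: "filterlim B at_top sequentially"
    and \<phi>: "integrable lborel \<phi>"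
    and conv: "\<And>K. 0 < K \<Longrightarrow> (\<lambda>n. LBINT t:{-(K * B n)..K * B n}. cmod (char (P n) (t / B n) - \<phi> t)) \<longlonglongrightarrow> 0"
begin

definition fourier_synth :: "(real \<Rightarrow> complex) \<Rightarrow> real \<Rightarrow> complex" where
  "fourier_synth H x = (CLBINT s. H s * iexp (s * x))"

lemma phi_measurable [measurable]: "\<phi> \<in> borel_measurable borel"
  using \<phi> by auto

text \<open>Fubini brings in the characteristic function; the substitution s = t / B n has the
  factor B n on the left as its Jacobian.\<close>

lemma synth_expectation:
  fixes H :: "real \<Rightarrow> complex"
  assumes H[measurable]: "H \<in> borel_measurable borel" and Hb: "\<And>s. cmod (H s) \<le> C * indicator {-K..K} s"
    and Bp: "0 < B n"
  shows "B n * (\<integral>x. fourier_synth H (x + u) \<partial>P n) =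
    (CLBINT t. H (t / B n) * iexp (t * u / B n) * char (P n) (t / B n))"
proof -
  interpret R: real_distribution "P n" by (rule P)
  interpret PP: pair_sigma_finite "P n" lborel ..
  have [measurable_cong]: "sets (P n) = sets borel" by simp
  define F where "F = (\<lambda>(x, s). H s * iexp (s * (x + u)))"
  have [measurable]: "F \<in> borel_measurable (P n \<Otimes>\<^sub>M lborel)" unfolding F_def by measurable
  have iH: "integrable lborel (\<lambda>s. C * indicator {-K..K} s)"
    by (cases "-K \<le> K") (auto intro!: integrable_mult_right integrable_real_indicator)
  have nF: "norm (F (x, s)) = cmod (H s)" for x s by (simp add: F_def norm_mult)
  have iHn: "integrable lborel (\<lambda>s. cmod (H s))"
    by (rule Bochner_Integration.integrable_bound[OF iH]) (use Hb in \<open>auto intro: order_trans[OF _ abs_ge_self]\<close>)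
  have iF: "integrable lborel (\<lambda>s. F (x, s))" for x
    by (rule Bochner_Integration.integrable_bound[OF iHn]) (auto simp: nF)
  have int: "integrable (P n \<Otimes>\<^sub>M lborel) F"
    by (rule PP.Fubini_integrable) (auto simp: nF iF)
  have "(\<integral>x. fourier_synth H (x + u) \<partial>P n) = (\<integral>x. (CLBINT s. F (x, s)) \<partial>P n)"
    by (simp add: F_def fourier_synth_def)
  also have "\<dots> = (CLBINT s. (\<integral>x. F (x, s) \<partial>P n))"
    using PP.Fubini_integral[of "\<lambda>x s. F (x, s)"] int by simp
  also have "\<dots> = (CLBINT s. H s * iexp (s * u) * char (P n) s)"
  proof (intro Bochner_Integration.integral_cong refl)
    fix s
    have "(\<integral>x. F (x, s) \<partial>P n) = (\<integral>x. H s * iexp (s * u) * iexp (s * x) \<partial>P n)"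
      by (intro Bochner_Integration.integral_cong refl) (simp add: F_def distrib_left exp_add mult_ac)
    then show "(\<integral>x. F (x, s) \<partial>P n) = H s * iexp (s * u) * char (P n) s"
      by (simp add: char_def)
  qed
  also have "\<dots> = \<bar>1 / B n\<bar> *\<^sub>R (CLBINT t. H (0 + 1 / B n * t) * iexp ((0 + 1 / B n * t) * u) * char (P n) (0 + 1 / B n * t))"
    by (rule lborel_integral_real_affine) (use Bp in auto)
  finally show ?thesis using Bp by (simp add: scaleR_conv_of_real mult_ac)
qed

text \<open>The error splits into H(t/B)(char - phi), which lives on |t| <= K B and is small by
  \<open>conv\<close>, and (H(t/B) - H(0)) phi, which is small by dominated convergence. The shift u
  enters through a factor of modulus 1, so both estimates are uniform in u.\<close>

lemma synth_local_limit:
  fixes H :: "real \<Rightarrow> complex"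
  assumes H[measurable]: "H \<in> borel_measurable borel" and Hb: "\<And>s. cmod (H s) \<le> C * indicator {-K..K} s"
    and K: "0 < K" and cont: "isCont H 0" and e: "0 < e"
  shows "\<forall>\<^sub>F n in sequentially. \<forall>u. cmod (B n * (\<integral>x. fourier_synth H (x + u) \<partial>P n)
     - 2 * pi * H 0 * fourier_density \<phi> (- u / B n)) \<le> e"
proof -
  have C0: "0 \<le> C" using order_trans[OF norm_ge_zero Hb[of 0]] K by simp
  have Hb': "cmod (H s) \<le> C" for s using Hb[of s] C0 by (cases "s \<in> {-K..K}") auto
  have cb: "cmod (char (P n) t) \<le> 1" for n t using real_distribution.cmod_char_le_1[OF P] by simp
  have cm[measurable]: "char (P n) \<in> borel_measurable borel" for n
    using real_distribution.char_measurable[OF P] by simp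
  have Bp: "\<forall>\<^sub>F n in sequentially. 0 < B n" using B by (simp add: filterlim_at_top_dense)
  have i\<phi>: "integrable lborel (\<lambda>t. cmod (\<phi> t))" using \<phi> by (rule integrable_norm)
  define D1 where "D1 n = (LBINT t:{-(K * B n)..K * B n}. cmod (char (P n) (t / B n) - \<phi> t))" for n
  define D2 where "D2 n = (LBINT t. cmod (H (t / B n) - H 0) * cmod (\<phi> t))" for n
  have "D2 \<longlonglongrightarrow> (LBINT t::real. 0)"
    unfolding D2_def
  proof (rule integral_dominated_convergence[where w = "\<lambda>t. (2 * C) * cmod (\<phi> t)"])
    show "integrable lborel (\<lambda>t. (2 * C) * cmod (\<phi> t))" by (intro integrable_mult_right i\<phi>)
    show "AE t in lborel. (\<lambda>n. cmod (H (t / B n) - H 0) * cmod (\<phi> t)) \<longlonglongrightarrow> 0"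
    proof (intro AE_I2)
      fix t :: real
      have "(\<lambda>n. t / B n) \<longlonglongrightarrow> 0" by (rule real_tendsto_divide_at_top[OF tendsto_const B])
      then have "(\<lambda>n. H (t / B n)) \<longlonglongrightarrow> H 0" by (rule isCont_tendsto_compose[OF cont])
      then have "(\<lambda>n. cmod (H (t / B n) - H 0) * cmod (\<phi> t)) \<longlonglongrightarrow> cmod (H 0 - H 0) * cmod (\<phi> t)"
        by (intro tendsto_intros)
      then show "(\<lambda>n. cmod (H (t / B n) - H 0) * cmod (\<phi> t)) \<longlonglongrightarrow> 0" by simp
    qed
    fix n
    have "cmod (H (t / B n) - H 0) \<le> 2 * C" for t
      using norm_triangle_ineq4[of "H (t / B n)" "H 0"] Hb'[of "t / B n"] Hb'[of 0] by linarith
    then show "AE t in lborel. norm (cmod (H (t / B n) - H 0) * cmod (\<phi> t)) \<le> (2 * C) * cmod (\<phi> t)"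
      by (auto simp: abs_mult intro!: mult_right_mono)
  qed auto
  then have "(\<lambda>n. C * D1 n + D2 n) \<longlonglongrightarrow> C * 0 + 0"
    unfolding D1_def by (intro tendsto_intros conv K) simp
  then have "\<forall>\<^sub>F n in sequentially. C * D1 n + D2 n < e"
    by (rule order_tendstoD) (use e in simp)
  then show ?thesis using Bp
  proof eventually_elim
    case (elim n)
    show ?case
    proof
      fix u
      define I where "I = {-(K * B n)..K * B n}"
      have i1: "integrable lborel (\<lambda>t. H (t / B n) * iexp (t * u / B n) * char (P n) (t / B n))"
      proof (rule Bochner_Integration.integrable_bound)
        show "integrable lborel (\<lambda>t. C * indicator I t)" unfolding I_def
          by (cases "0 \<le> K * B n") (auto intro!: integrable_mult_right integrable_real_indicator)
        have "cmod (H (t / B n) * iexp (t * u / B n) * char (P n) (t / B n)) \<le> C * indicator I t" for t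
        proof -
          have "cmod (H (t / B n) * iexp (t * u / B n) * char (P n) (t / B n)) \<le> cmod (H (t / B n)) * 1 * 1"
            unfolding norm_mult by (intro mult_mono) (auto intro: cb)
          also have "\<dots> \<le> C * indicator {-K..K} (t / B n)" using Hb by simp
          also have "indicator {-K..K} (t / B n) = (indicator I t :: real)"
            using elim(2) by (auto simp: I_def indicator_def field_simps)
          finally show ?thesis .
        qed
        then show "AE t in lborel. norm (H (t / B n) * iexp (t * u / B n) * char (P n) (t / B n)) \<le> norm (C * indicator I t)"
          by (auto intro: order_trans[OF _ abs_ge_self])
      qed measurable
      have i2: "integrable lborel (\<lambda>t. H 0 * (iexp (t * u / B n) * \<phi> t))"
        by (intro integrable_mult_right, rule Bochner_Integration.integrable_bound[OF i\<phi>]) (auto simp: norm_mult)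
      have ia: "integrable lborel (\<lambda>t. indicator I t * cmod (char (P n) (t / B n) - \<phi> t))"
      proof (rule Bochner_Integration.integrable_bound)
        show "integrable lborel (\<lambda>t. indicator I t + cmod (\<phi> t))" unfolding I_def
          by (cases "0 \<le> K * B n") (auto intro!: Bochner_Integration.integrable_add i\<phi> integrable_real_indicator)
        have "cmod (char (P n) (t / B n) - \<phi> t) \<le> 1 + cmod (\<phi> t)" for t
          using norm_triangle_ineq4[of "char (P n) (t / B n)" "\<phi> t"] cb[of n "t / B n"] by linarith
        then show "AE t in lborel. norm (indicator I t * cmod (char (P n) (t / B n) - \<phi> t)) \<le> norm (indicator I t + cmod (\<phi> t))"
          by (auto simp: indicator_def)
      qed (auto simp: I_def)
      have ib: "integrable lborel (\<lambda>t. cmod (H (t / B n) - H 0) * cmod (\<phi> t))"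
      proof (rule Bochner_Integration.integrable_bound)
        show "integrable lborel (\<lambda>t. (2 * C) * cmod (\<phi> t))" by (intro integrable_mult_right i\<phi>)
        have "cmod (H (t / B n) - H 0) \<le> 2 * C" for t
          using norm_triangle_ineq4[of "H (t / B n)" "H 0"] Hb'[of "t / B n"] Hb'[of 0] by linarith
        then show "AE t in lborel. norm (cmod (H (t / B n) - H 0) * cmod (\<phi> t)) \<le> norm ((2 * C) * cmod (\<phi> t))"
          using C0 by (auto simp: abs_mult intro!: mult_right_mono)
      qed measurable
      have "2 * pi * H 0 * fourier_density \<phi> (- u / B n) = (CLBINT t. H 0 * (iexp (t * u / B n) * \<phi> t))"
        by (simp add: fourier_density_def)
      then have E: "B n * (\<integral>x. fourier_synth H (x + u) \<partial>P n) - 2 * pi * H 0 * fourier_density \<phi> (- u / B n)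
          = (CLBINT t. H (t / B n) * iexp (t * u / B n) * char (P n) (t / B n) - H 0 * (iexp (t * u / B n) * \<phi> t))"
        using synth_expectation[OF H Hb elim(2), of u] i1 i2 by simp
      have "cmod (B n * (\<integral>x. fourier_synth H (x + u) \<partial>P n) - 2 * pi * H 0 * fourier_density \<phi> (- u / B n))
          \<le> (LBINT t. C * (indicator I t * cmod (char (P n) (t / B n) - \<phi> t)) + cmod (H (t / B n) - H 0) * cmod (\<phi> t))"
        unfolding E
      proof (rule order_trans[OF integral_norm_bound integral_mono])
        show "integrable lborel (\<lambda>t. norm (H (t / B n) * iexp (t * u / B n) * char (P n) (t / B n) - H 0 * (iexp (t * u / B n) * \<phi> t)))"
          by (intro integrable_norm Bochner_Integration.integrable_diff i1 i2)
        show "integrable lborel (\<lambda>t. C * (indicator I t * cmod (char (P n) (t / B n) - \<phi> t)) + cmod (H (t / B n) - H 0) * cmod (\<phi> t))"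
          by (intro Bochner_Integration.integrable_add integrable_mult_right ia ib)
        fix t
        have "H (t / B n) * iexp (t * u / B n) * char (P n) (t / B n) - H 0 * (iexp (t * u / B n) * \<phi> t) =
            iexp (t * u / B n) * (H (t / B n) * (char (P n) (t / B n) - \<phi> t) + (H (t / B n) - H 0) * \<phi> t)"
          by (simp add: algebra_simps)
        also have "cmod \<dots> = cmod (H (t / B n) * (char (P n) (t / B n) - \<phi> t) + (H (t / B n) - H 0) * \<phi> t)"
          unfolding norm_mult by simp
        also have "\<dots> \<le> cmod (H (t / B n)) * cmod (char (P n) (t / B n) - \<phi> t) + cmod (H (t / B n) - H 0) * cmod (\<phi> t)"
          using norm_triangle_ineq[of "H (t / B n) * (char (P n) (t / B n) - \<phi> t)" "(H (t / B n) - H 0) * \<phi> t"]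
          unfolding norm_mult .
        also have "cmod (H (t / B n)) \<le> C * indicator I t"
        proof -
          have "indicator {-K..K} (t / B n) = (indicator I t :: real)"
            using elim(2) by (auto simp: I_def indicator_def field_simps)
          then show ?thesis using Hb[of "t / B n"] by simp
        qed
        finally show "norm (H (t / B n) * iexp (t * u / B n) * char (P n) (t / B n) - H 0 * (iexp (t * u / B n) * \<phi> t)) \<le>
            C * (indicator I t * cmod (char (P n) (t / B n) - \<phi> t)) + cmod (H (t / B n) - H 0) * cmod (\<phi> t)"
          by (simp add: mult.assoc mult_right_mono)
      qed
      also have "\<dots> = C * D1 n + D2 n"
      proof -
        have "(LBINT t. C * (indicator I t * cmod (char (P n) (t / B n) - \<phi> t)) + cmod (H (t / B n) - H 0) * cmod (\<phi> t)) =
            C * (LBINT t. indicator I t * cmod (char (P n) (t / B n) - \<phi> t)) + (LBINT t. cmod (H (t / B n) - H 0) * cmod (\<phi> t))"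
          by (subst Bochner_Integration.integral_add[OF integrable_mult_right[OF ia] ib])
             (simp only: integral_mult_right_zero)
        then show ?thesis by (simp only: D1_def D2_def I_def set_lebesgue_integral_def real_scaleR_def)
      qed
      also have "\<dots> \<le> e" using elim(1) by simp
      finally show "cmod (B n * (\<integral>x. fourier_synth H (x + u) \<partial>P n) - 2 * pi * H 0 * fourier_density \<phi> (- u / B n)) \<le> e" .
    qed
  qed
qed

end

text \<open>A compactly supported continuous function is approximated by its convolution with a narrow
  Fejer kernel, whose Fourier transform has compact support.\<close>

lemma fejer_approximation:
  fixes m :: "real \<Rightarrow> real"
  assumes cont: "continuous_on UNIV m" and supp: "\<And>x. R < \<bar>x\<bar> \<Longrightarrow> m x = 0" and R: "1 \<le> R" and e: "0 < e"
  shows "\<exists>\<delta>>0. \<forall>x. \<bar>m x - (LBINT y. m y * (fejer ((x - y) / \<delta>) / \<delta>))\<bar> \<le> e / (1 + x\<^sup>2)"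
proof -
  have [measurable]: "m \<in> borel_measurable borel" using cont by (rule borel_measurable_continuous_onI)
  have "compact (m ` {-R..R})" by (intro compact_continuous_image continuous_on_subset[OF cont]) auto
  then obtain Mb' where Mb': "\<And>x. x \<in> {-R..R} \<Longrightarrow> \<bar>m x\<bar> \<le> Mb'"
    using compact_imp_bounded[of "m ` {-R..R}"] unfolding bounded_iff by (metis image_eqI real_norm_def)
  then have "\<bar>m x\<bar> \<le> max 1 Mb'" for x using supp[of x] by (cases "x \<in> {-R..R}") (force simp: le_max_iff_disj)+
  then obtain Mb where Mb: "1 \<le> Mb" "\<And>x. \<bar>m x\<bar> \<le> Mb" by (meson max.cobounded1)
  \<comment> \<open>Beyond 2 R the distance from x to the support of m is at least |x|/2, and the
    decay of the kernel suffices. Up to 2 R uniform continuity is used.\<close>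
  define Q where "Q = 2 * R"
  define e1 where "e1 = e / (1 + Q\<^sup>2) / 2"
  have e1: "0 < e1" using e by (simp add: e1_def add_pos_nonneg)
  have "uniformly_continuous_on {-(Q+R+1)..Q+R+1} m"
    by (intro compact_uniformly_continuous continuous_on_subset[OF cont]) auto
  then obtain \<eta>0 where \<eta>0: "0 < \<eta>0" "\<And>x y. x \<in> {-(Q+R+1)..Q+R+1} \<Longrightarrow> y \<in> {-(Q+R+1)..Q+R+1} \<Longrightarrow> dist x y < \<eta>0 \<Longrightarrow> dist (m x) (m y) < e1"
    unfolding uniformly_continuous_on_def using e1 by metis
  define \<eta> where "\<eta> = min (\<eta>0 / 2) 1"
  have \<eta>: "0 < \<eta>" "\<And>x y. \<bar>x\<bar> \<le> Q \<Longrightarrow> \<bar>x - y\<bar> \<le> \<eta> \<Longrightarrow> \<bar>m x - m y\<bar> \<le> e1"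
  proof -
    show "0 < \<eta>" using \<eta>0 by (simp add: \<eta>_def)
    fix x y assume xy: "\<bar>x\<bar> \<le> Q" "\<bar>x - y\<bar> \<le> \<eta>"
    have "\<bar>x - y\<bar> \<le> 1" "\<bar>x - y\<bar> < \<eta>0" using xy(2) \<eta>0(1) by (auto simp: \<eta>_def)
    then have "dist (m x) (m y) < e1" using xy(1) R by (intro \<eta>0) (auto simp: dist_real_def)
    then show "\<bar>m x - m y\<bar> \<le> e1" by (simp add: dist_real_def)
  qed
  have "((\<lambda>Z. LBINT z. fejer z * indicator {z. \<bar>z\<bar> > Z} z) \<longlongrightarrow> (LBINT z::real. 0)) at_top"
  proof (rule integral_dominated_convergence_at_top[OF _ _ integrable_fejer])
    show "AE z in lborel. ((\<lambda>Z. fejer z * indicator {z. \<bar>z\<bar> > Z} z) \<longlongrightarrow> 0) at_top"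
    proof (intro AE_I2 tendsto_eventually)
      fix z :: real
      show "\<forall>\<^sub>F Z in at_top. fejer z * indicator {z. \<bar>z\<bar> > Z} z = 0"
        using eventually_ge_at_top[of "\<bar>z\<bar>"] by eventually_elim simp
    qed
    show "\<forall>\<^sub>F Z in at_top. AE z in lborel. norm (fejer z * indicator {z. \<bar>z\<bar> > Z} z) \<le> fejer z"
      by (intro always_eventually allI AE_I2) (auto simp: indicator_def fejer_nonneg)
  qed auto
  then have "\<forall>\<^sub>F Z in at_top. (LBINT z. fejer z * indicator {z. \<bar>z\<bar> > Z} z) < e1 / (2 * Mb)"
    by (rule order_tendstoD) (use e1 Mb in auto)
  then have "\<forall>\<^sub>F Z in at_top. (LBINT z. fejer z * indicator {z. \<bar>z\<bar> > Z} z) < e1 / (2 * Mb) \<and> 1 \<le> Z"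
    using eventually_ge_at_top[of "1::real"] by eventually_elim auto
  then obtain Z where Z: "(LBINT z. fejer z * indicator {z. \<bar>z\<bar> > Z} z) < e1 / (2 * Mb)" "1 \<le> Z"
    by (auto dest: eventually_happens)
  \<comment> \<open>The first entry makes the shift delta z at most eta for |z| <= Z. The second
    makes 8 R Mb delta at most e/2, as used for large x.\<close>
  define \<delta> where "\<delta> = min (\<eta> / Z) (e / (16 * R * Mb))"
  have d: "0 < \<delta>" using \<eta>(1) Z(2) e R Mb by (simp add: \<delta>_def)
  have dZ: "\<delta> * Z \<le> \<eta>" using Z(2) by (simp add: \<delta>_def min_def field_simps)
  have dR: "16 * R * Mb * \<delta> \<le> e" using R Mb by (simp add: \<delta>_def min_def field_simps)
  have eq: "(LBINT y. m y * (fejer ((x - y) / \<delta>) / \<delta>)) = (LBINT z. m (x - \<delta> * z) * fejer z)" for x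
  proof -
    have "(LBINT y. m y * (fejer ((x - y) / \<delta>) / \<delta>)) = \<bar>- \<delta>\<bar> *\<^sub>R (LBINT z. m (x + - \<delta> * z) * (fejer ((x - (x + - \<delta> * z)) / \<delta>) / \<delta>))"
      by (rule lborel_integral_real_affine) (use d in auto)
    then show ?thesis using d by simp
  qed
  have im: "integrable lborel (\<lambda>z. m (x - \<delta> * z) * fejer z)" for x
  proof (rule Bochner_Integration.integrable_bound)
    show "integrable lborel (\<lambda>z. Mb * fejer z)" by (intro integrable_mult_right integrable_fejer)
    show "AE z in lborel. norm (m (x - \<delta> * z) * fejer z) \<le> norm (Mb * fejer z)"
      using Mb by (auto simp: abs_mult fejer_nonneg intro!: mult_right_mono)
  qed measurable
  have "\<bar>m x - (LBINT y. m y * (fejer ((x - y) / \<delta>) / \<delta>))\<bar> \<le> e / (1 + x\<^sup>2)" for x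
  proof (cases "\<bar>x\<bar> \<le> Q")
    case True
    have "m x - (LBINT z. m (x - \<delta> * z) * fejer z) = (LBINT z. m x * fejer z - m (x - \<delta> * z) * fejer z)"
      using im integrable_fejer integral_fejer by simp
    also have "\<bar>\<dots>\<bar> \<le> (LBINT z. \<bar>m x * fejer z - m (x - \<delta> * z) * fejer z\<bar>)" by (rule integral_abs_bound)
    also have "\<dots> \<le> (LBINT z. e1 * fejer z + 2 * Mb * (fejer z * indicator {z. \<bar>z\<bar> > Z} z))"
    proof (rule integral_mono)
      show "integrable lborel (\<lambda>z. \<bar>m x * fejer z - m (x - \<delta> * z) * fejer z\<bar>)"
        by (intro integrable_abs Bochner_Integration.integrable_diff im integrable_mult_right integrable_fejer)
      have "integrable lborel (\<lambda>z. fejer z * indicator {z. \<bar>z\<bar> > Z} z)"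
        by (rule Bochner_Integration.integrable_bound[OF integrable_fejer]) (auto simp: indicator_def)
      then show "integrable lborel (\<lambda>z. e1 * fejer z + 2 * Mb * (fejer z * indicator {z. \<bar>z\<bar> > Z} z))"
        by (intro Bochner_Integration.integrable_add integrable_mult_right integrable_fejer)
      fix z :: real
      have "\<bar>m x - m (x - \<delta> * z)\<bar> \<le> e1 + 2 * Mb * indicator {z. \<bar>z\<bar> > Z} z"
      proof (cases "\<bar>z\<bar> \<le> Z")
        case True
        have "\<bar>x - (x - \<delta> * z)\<bar> \<le> \<eta>"
          using order_trans[OF mult_left_mono[OF True, of \<delta>] dZ] d by (simp add: abs_mult)
        then show ?thesis using \<eta>(2)[OF \<open>\<bar>x\<bar> \<le> Q\<close>] True by (simp add: indicator_def)
      next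
        case False
        have "\<bar>m x - m (x - \<delta> * z)\<bar> \<le> 2 * Mb"
          using Mb(2)[of x] Mb(2)[of "x - \<delta> * z"] by linarith
        then show ?thesis using False e1 by (simp add: indicator_def)
      qed
      then have *: "\<bar>m x - m (x - \<delta> * z)\<bar> * fejer z \<le> (e1 + 2 * Mb * indicator {z. \<bar>z\<bar> > Z} z) * fejer z"
        by (intro mult_right_mono fejer_nonneg)
      show "\<bar>m x * fejer z - m (x - \<delta> * z) * fejer z\<bar> \<le> e1 * fejer z + 2 * Mb * (fejer z * indicator {z. \<bar>z\<bar> > Z} z)"
      proof -
        have "\<bar>m x * fejer z - m (x - \<delta> * z) * fejer z\<bar> = \<bar>m x - m (x - \<delta> * z)\<bar> * fejer z"
          unfolding left_diff_distrib[symmetric] abs_mult using fejer_nonneg[of z] by simp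
        also note *
        finally show ?thesis by (simp add: algebra_simps)
      qed
    qed
    also have "\<dots> = e1 + 2 * Mb * (LBINT z. fejer z * indicator {z. \<bar>z\<bar> > Z} z)"
    proof -
      have "integrable lborel (\<lambda>z. fejer z * indicator {z. \<bar>z\<bar> > Z} z)"
        by (rule Bochner_Integration.integrable_bound[OF integrable_fejer]) (auto simp: indicator_def)
      then show ?thesis using integrable_fejer integral_fejer by simp
    qed
    also have "\<dots> \<le> e1 + e1" using Z(1) Mb(1) by (simp add: field_simps)
    also have "\<dots> = e / (1 + Q\<^sup>2)" unfolding e1_def by (rule field_sum_of_halves)
    also have "\<dots> \<le> e / (1 + x\<^sup>2)"
    proof -
      have "x\<^sup>2 \<le> Q\<^sup>2" using True by (metis abs_ge_zero power2_abs power_mono)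
      then show ?thesis using e by (intro divide_left_mono mult_pos_pos) (auto simp: add_pos_nonneg)
    qed
    finally show ?thesis unfolding eq .
  next
    case False
    then have x: "2 * R < \<bar>x\<bar>" by (simp add: Q_def)
    then have m0: "m x = 0" using R by (intro supp) auto
    have bd: "\<bar>m y * (fejer ((x - y) / \<delta>) / \<delta>)\<bar> \<le> (4 * Mb * \<delta> / x\<^sup>2) * indicator {-R..R} y" for y
    proof (cases "\<bar>y\<bar> \<le> R")
      case True
      have xy: "\<bar>x\<bar> / 2 \<le> \<bar>x - y\<bar>" using True x by linarith
      then have ne: "x - y \<noteq> 0" using x R by auto
      have "(x / 2)\<^sup>2 \<le> (x - y)\<^sup>2" using xy by (simp add: abs_le_square_iff[symmetric])
      moreover have "0 < (x - y)\<^sup>2" "0 < (x / 2)\<^sup>2" using ne x R by auto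
      ultimately have "1 / (x - y)\<^sup>2 \<le> 1 / (x / 2)\<^sup>2" by (intro divide_left_mono mult_pos_pos) auto
      then have "fejer ((x - y) / \<delta>) \<le> \<delta>\<^sup>2 * (4 / x\<^sup>2)"
        using fejer_le[of "(x - y) / \<delta>"] ne d mult_left_mono[of "1 / (x - y)\<^sup>2" "1 / (x / 2)\<^sup>2" "\<delta>\<^sup>2"]
        by (simp add: power_divide)
      then have "fejer ((x - y) / \<delta>) / \<delta> \<le> \<delta> * (4 / x\<^sup>2)" using d by (simp add: divide_le_eq power2_eq_square mult_ac)
      then have "\<bar>m y\<bar> * (fejer ((x - y) / \<delta>) / \<delta>) \<le> Mb * (\<delta> * (4 / x\<^sup>2))"
        using Mb fejer_nonneg[of "(x - y) / \<delta>"] d by (intro mult_mono) auto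
      then show ?thesis using True fejer_nonneg[of "(x - y) / \<delta>"] d by (simp add: abs_mult abs_le_iff mult_ac)
    next
      case False
      then show ?thesis using supp[of y] by (auto simp: indicator_def)
    qed
    have ii: "integrable lborel (\<lambda>y. (4 * Mb * \<delta> / x\<^sup>2) * indicator {-R..R} y)"
      using R by (intro integrable_mult_right integrable_real_indicator) auto
    have "\<bar>LBINT y. m y * (fejer ((x - y) / \<delta>) / \<delta>)\<bar> \<le> (LBINT y. \<bar>m y * (fejer ((x - y) / \<delta>) / \<delta>)\<bar>)"
      by (rule integral_abs_bound)
    also have "\<dots> \<le> (LBINT y. (4 * Mb * \<delta> / x\<^sup>2) * indicator {-R..R} y)"
      by (intro integral_mono' ii bd) (use Mb(1) d in auto)
    also have "\<dots> = 8 * R * Mb * \<delta> / x\<^sup>2" using R by simp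
    also have "\<dots> \<le> e / (2 * x\<^sup>2)" using dR x R by (simp add: field_simps)
    also have "\<dots> \<le> e / (1 + x\<^sup>2)"
    proof -
      have "1\<^sup>2 \<le> \<bar>x\<bar>\<^sup>2" by (rule power_mono) (use x R in auto)
      then have "1 \<le> x\<^sup>2" by simp
      moreover have "0 < x\<^sup>2" using x R by auto
      ultimately show ?thesis using e by (intro divide_left_mono mult_pos_pos) (auto simp: add_pos_nonneg)
    qed
    finally show ?thesis by (simp add: m0)
  qed
  then show ?thesis using d by blast
qed

lemma isCont_fourier_density:
  assumes \<phi>: "integrable lborel \<phi>"
  shows "isCont (fourier_density \<phi>) x"
proof -
  have [measurable]: "\<phi> \<in> borel_measurable borel" using \<phi> by auto
  have "isCont (\<lambda>x. CLBINT t. iexp (- (t * x)) * \<phi> t) x"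
    unfolding continuous_at_sequentially o_def
  proof (intro allI impI)
    fix X assume X: "X \<longlonglongrightarrow> x"
    show "(\<lambda>n. CLBINT t. iexp (- (t * X n)) * \<phi> t) \<longlonglongrightarrow> (CLBINT t. iexp (- (t * x)) * \<phi> t)"
    proof (rule integral_dominated_convergence[OF _ _ integrable_norm[OF \<phi>]])
      show "AE t in lborel. (\<lambda>n. iexp (- (t * X n)) * \<phi> t) \<longlonglongrightarrow> iexp (- (t * x)) * \<phi> t"
        by (intro AE_I2 tendsto_intros X)
    qed (auto simp: norm_mult)
  qed
  then show ?thesis unfolding fourier_density_def by (intro continuous_intros)
qed

lemma integrable_compact_support:
  fixes m :: "real \<Rightarrow> real"
  assumes cont: "continuous_on UNIV m" and supp: "\<And>x. R < \<bar>x\<bar> \<Longrightarrow> m x = 0"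
  shows "integrable lborel m"
proof -
  have "integrable lborel (\<lambda>x. indicator {-R..R} x *\<^sub>R m x)"
    using borel_integrable_atLeastAtMost'[of "-R" R m] continuous_on_subset[OF cont]
    by (auto simp: set_integrable_def)
  also have "(\<lambda>x. indicator {-R..R} x *\<^sub>R m x) = m"
    using supp by (force simp: indicator_def not_le fun_eq_iff)
  finally show ?thesis .
qed

section \<open>From band-limited to compactly supported test functions\<close>

context char_convergence
begin

text \<open>Convolution with the scaled kernel multiplies the transform of m by the triangle, which
  cuts it off at 1/delta. The further claims are the hypotheses of \<open>synth_local_limit\<close>
  and the value at 0 that produces the integral of m.\<close>

lemma synth_fejer_convolution:
  fixes m :: "real \<Rightarrow> real" and H :: "real \<Rightarrow> complex"
  assumes m: "integrable lborel m" and d: "0 < \<delta>"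
  defines "H \<equiv> \<lambda>s. (1 / (2 * pi)) * complex_of_real (triangle (\<delta> * s)) * (CLBINT y. m y * iexp (- (s * y)))"
  shows "fourier_synth H x = complex_of_real (LBINT y. m y * (fejer ((x - y) / \<delta>) / \<delta>))"
    and "H \<in> borel_measurable borel"
    and "cmod (H s) \<le> (LBINT y. \<bar>m y\<bar>) * indicator {-(1/\<delta>)..1/\<delta>} s"
    and "isCont H 0" and "2 * pi * H 0 = complex_of_real (LBINT y. m y)"
proof -
  have [measurable]: "m \<in> borel_measurable borel" using m by auto
  have ma: "integrable lborel (\<lambda>y. \<bar>m y\<bar>)" using m by (rule integrable_abs)
  define mh where "mh s = (CLBINT y. m y * iexp (- (s * y)))" for s
  have [measurable]: "mh \<in> borel_measurable borel" unfolding mh_def by measurable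
  have H: "H = (\<lambda>s. (1 / (2 * pi)) * complex_of_real (triangle (\<delta> * s)) * mh s)"
    by (simp add: H_def mh_def)
  show "H \<in> borel_measurable borel" unfolding H by measurable
  have mhb: "cmod (mh s) \<le> (LBINT y. \<bar>m y\<bar>)" for s
  proof -
    have "cmod (mh s) \<le> (LBINT y. cmod (m y * iexp (- (s * y))))" unfolding mh_def by (rule integral_norm_bound)
    then show ?thesis by (simp add: norm_mult)
  qed
  show "cmod (H s) \<le> (LBINT y. \<bar>m y\<bar>) * indicator {-(1/\<delta>)..1/\<delta>} s"
  proof -
    have "cmod (H s) = (1 / (2 * pi)) * triangle (\<delta> * s) * cmod (mh s)"
      by (simp add: H norm_mult norm_divide triangle_bounds)
    also have "\<dots> \<le> 1 * indicator {-1..1} (\<delta> * s) * (LBINT y. \<bar>m y\<bar>)"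
      using pi_gt3 by (intro mult_mono mhb triangle_bounds) (auto simp: triangle_bounds)
    also have "indicator {-1..1} (\<delta> * s) = (indicator {-(1/\<delta>)..1/\<delta>} s :: real)"
      using d by (auto simp: indicator_def field_simps)
    finally show ?thesis by (simp add: mult.commute)
  qed
  have "isCont mh 0" unfolding continuous_at_sequentially o_def
  proof (intro allI impI)
    fix X :: "nat \<Rightarrow> real" assume X: "X \<longlonglongrightarrow> 0"
    show "(\<lambda>n. mh (X n)) \<longlonglongrightarrow> mh 0" unfolding mh_def
    proof (rule integral_dominated_convergence[OF _ _ ma])
      show "AE y in lborel. (\<lambda>n. m y * iexp (- (X n * y))) \<longlonglongrightarrow> m y * iexp (- (0 * y))"
        by (intro AE_I2 tendsto_intros X)
    qed (auto simp: norm_mult)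
  qed
  moreover have "isCont (\<lambda>s. triangle (\<delta> * s)) 0"
    using isCont_o2[of 0 "\<lambda>s. \<delta> * s" triangle] isCont_triangle by auto
  ultimately show "isCont H 0" unfolding H by (intro continuous_intros) auto
  show "2 * pi * H 0 = complex_of_real (LBINT y. m y)" by (simp add: H mh_def)
  define F where "F = (\<lambda>(s, y). (1 / (2 * pi)) * complex_of_real (triangle (\<delta> * s)) * (m y * iexp (s * (x - y))))"
  have [measurable]: "F \<in> borel_measurable (lborel \<Otimes>\<^sub>M lborel)" unfolding F_def by measurable
  have nF: "norm (F (s, y)) = (1 / (2 * pi)) * triangle (\<delta> * s) * \<bar>m y\<bar>" for s y
    by (simp add: F_def norm_mult norm_divide triangle_bounds)
  have int: "integrable (lborel \<Otimes>\<^sub>M lborel) F"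
  proof (rule lborel_pair.Fubini_integrable)
    show "integrable lborel (\<lambda>s. LBINT y. norm (F (s, y)))"
      unfolding nF using integrable_triangle[of \<delta>] d by simp
    have "integrable lborel (\<lambda>y. F (s, y))" for s
      by (rule Bochner_Integration.integrable_bound[OF integrable_mult_right[OF ma, of "(1 / (2 * pi)) * triangle (\<delta> * s)"]])
         (auto simp: nF triangle_bounds abs_mult)
    then show "AE s in lborel. integrable lborel (\<lambda>y. F (s, y))" by simp
  qed auto
  have "fourier_synth H x = (CLBINT s. CLBINT y. F (s, y))"
    unfolding fourier_synth_def
  proof (intro Bochner_Integration.integral_cong refl)
    fix s
    have "(CLBINT y. F (s, y)) = (CLBINT y. (1 / (2 * pi)) * complex_of_real (triangle (\<delta> * s)) * iexp (s * x) * (m y * iexp (- (s * y))))"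
    proof (intro Bochner_Integration.integral_cong refl)
      fix y
      have E: "iexp (s * (x - y)) = iexp (s * x) * iexp (- (s * y))"
        by (simp add: exp_add[symmetric] algebra_simps)
      show "F (s, y) = (1 / (2 * pi)) * complex_of_real (triangle (\<delta> * s)) * iexp (s * x) * (m y * iexp (- (s * y)))"
        unfolding F_def prod.case E by (simp only: mult_ac)
    qed
    also have "\<dots> = (1 / (2 * pi)) * complex_of_real (triangle (\<delta> * s)) * iexp (s * x) * mh s"
      unfolding mh_def by (rule integral_mult_right_zero)
    finally show "H s * iexp (s * x) = (CLBINT y. F (s, y))" by (simp add: H mult_ac)
  qed
  also have "\<dots> = (CLBINT y. CLBINT s. F (s, y))"
    using lborel_pair.Fubini_integral[of "\<lambda>s y. F (s, y)"] int by simp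
  also have "\<dots> = (CLBINT y. complex_of_real (m y * (fejer ((x - y) / \<delta>) / \<delta>)))"
  proof (intro Bochner_Integration.integral_cong refl)
    fix y
    have "(CLBINT s. F (s, y)) = (CLBINT s. (m y * (1 / (2 * pi))) * (complex_of_real (triangle (\<delta> * s)) * iexp (s * (x - y))))"
      by (intro Bochner_Integration.integral_cong refl) (simp only: F_def prod.case of_real_mult mult_ac)
    also have "\<dots> = (m y * (1 / (2 * pi))) * (CLBINT s. complex_of_real (triangle (\<delta> * s)) * iexp (s * (x - y)))"
      by (rule integral_mult_right_zero)
    also have "\<dots> = m y * complex_of_real (fejer ((x - y) / \<delta>) / \<delta>)"
      unfolding fejer_scaled[OF d] by simp
    finally show "(CLBINT s. F (s, y)) = complex_of_real (m y * (fejer ((x - y) / \<delta>) / \<delta>))" by simp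
  qed
  finally show "fourier_synth H x = complex_of_real (LBINT y. m y * (fejer ((x - y) / \<delta>) / \<delta>))"
    unfolding integral_complex_of_real .
qed

text \<open>A shift of the kernel by pi is the factor iexp(- pi s) in the transform. So the majorant
  from \<open>fejer_lower\<close> falls under \<open>synth_local_limit\<close>.\<close>

lemma synth_fejer_pair:
  fixes H :: "real \<Rightarrow> complex"
  defines "H \<equiv> \<lambda>s. (1 / (2 * pi)) * complex_of_real (triangle s) * (1 + iexp (- (pi * s)))"
  shows "fourier_synth H x = complex_of_real (fejer x + fejer (x - pi))"
    and "H \<in> borel_measurable borel" and "cmod (H s) \<le> 1 * indicator {-1..1} s"
    and "isCont H 0" and "2 * pi * H 0 = 2"
proof -
  show "H \<in> borel_measurable borel" unfolding H_def by measurable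
  show "2 * pi * H 0 = 2" by (simp add: H_def)
  show "isCont H 0" unfolding H_def by (intro continuous_intros isCont_triangle) auto
  show "cmod (H s) \<le> 1 * indicator {-1..1} s"
  proof -
    have "cmod (1 + iexp (- (pi * s))) \<le> 2" using norm_triangle_ineq[of 1 "iexp (- (pi * s))"] by simp
    then have "(1 / (2 * pi)) * triangle s * cmod (1 + iexp (- (pi * s))) \<le> (1 / (2 * pi)) * indicator {-1..1} s * 2"
      by (intro mult_mono triangle_bounds) (auto simp: triangle_bounds)
    also have "\<dots> = (1 / pi) * indicator {-1..1} s" by simp
    also have "\<dots> \<le> 1 * indicator {-1..1} s" using pi_gt3 by (intro mult_right_mono) auto
    finally show ?thesis by (simp add: H_def norm_mult norm_divide triangle_bounds)
  qed
  have i: "integrable lborel (\<lambda>s. complex_of_real (triangle s) * iexp (s * z))" for z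
    by (rule Bochner_Integration.integrable_bound[OF integrable_triangle[of 1]]) (auto simp: norm_mult triangle_bounds)
  have "fourier_synth H x = (CLBINT s. (1 / (2 * pi)) * (complex_of_real (triangle s) * iexp (s * x)) +
      (1 / (2 * pi)) * (complex_of_real (triangle s) * iexp (s * (x - pi))))"
    unfolding fourier_synth_def H_def
  proof (intro Bochner_Integration.integral_cong refl)
    fix s :: real
    have "iexp (s * (x - pi)) = iexp (s * x) * iexp (- (pi * s))"
      by (simp add: exp_add[symmetric] algebra_simps)
    then show "(1 / (2 * pi)) * complex_of_real (triangle s) * (1 + iexp (- (pi * s))) * iexp (s * x) =
      (1 / (2 * pi)) * (complex_of_real (triangle s) * iexp (s * x)) +
      (1 / (2 * pi)) * (complex_of_real (triangle s) * iexp (s * (x - pi)))"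
      by (simp only: distrib_left distrib_right mult_1 mult_1_right mult_ac)
  qed
  also have "\<dots> = (1 / (2 * pi)) * (CLBINT s. complex_of_real (triangle s) * iexp (s * x)) +
      (1 / (2 * pi)) * (CLBINT s. complex_of_real (triangle s) * iexp (s * (x - pi)))"
    by (subst Bochner_Integration.integral_add) (intro integrable_mult_right i, intro integrable_mult_right i, simp)
  also have "\<dots> = complex_of_real (fejer x + fejer (x - pi))"
    unfolding integral_triangle_iexp by simp
  finally show "fourier_synth H x = complex_of_real (fejer x + fejer (x - pi))" .
qed

lemma fejer_le_1: "fejer x \<le> 1"
proof (cases "x = 0")
  case True
  then show ?thesis using pi_gt3 by (simp add: fejer_def)
next
  case False
  have "1 - cos x = 2 * (sin (x/2))\<^sup>2" using cos_double_sin[of "x/2"] by simp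
  also have "(sin (x/2))\<^sup>2 \<le> (x/2)\<^sup>2" using abs_sin_x_le_abs_x[of "x/2"] by (simp only: abs_le_square_iff)
  finally have "1 - cos x \<le> 2 * (x/2)\<^sup>2" by simp
  also have "\<dots> \<le> x\<^sup>2" by (simp add: power_divide)
  also have "\<dots> \<le> pi * x\<^sup>2" using pi_gt3 mult_right_mono[of 1 pi "x\<^sup>2"] by simp
  finally show ?thesis using False by (simp add: fejer_def divide_le_eq_1)
qed

text \<open>The smoothing error is at most e'/(1 + x^2), hence at most e' pi^3 g with g the sum of
  the two shifted kernels. The limit theorem for g itself bounds B n times the expectation of g(x +
  u) by G, uniformly in u; the limit theorem for the smoothed function h then gives the
  claim.\<close>

theorem local_limit:
  fixes m :: "real \<Rightarrow> real"
  assumes cont: "continuous_on UNIV m" and supp: "\<And>x. R < \<bar>x\<bar> \<Longrightarrow> m x = 0" and e: "0 < e"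
  shows "\<forall>\<^sub>F n in sequentially. \<forall>u.
    \<bar>B n * (\<integral>x. m (x + u) \<partial>P n) - Re (fourier_density \<phi> (- u / B n)) * (LBINT x. m x)\<bar> \<le> e"
proof -
  have mm[measurable]: "m \<in> borel_measurable borel" using cont by (rule borel_measurable_continuous_onI)
  have im: "integrable lborel m" by (rule integrable_compact_support[OF cont supp])
  \<comment> \<open>Twice the uniform bound of \<open>norm_fourier_density_le\<close>, as 2 pi H(0)
    = 2 for g, plus the error 1 granted in \<open>h2\<close>.\<close>
  define G where "G = 2 * (LBINT t. cmod (\<phi> t)) + 1"
  have G: "1 \<le> G" by (simp add: G_def)
  \<comment> \<open>Makes e' pi^3 G equal to e/2, the share of the smoothing error.\<close>
  define e' where "e' = e / (2 * pi ^ 3 * G)"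
  have e': "0 < e'" using e G by (simp add: e'_def)
  have "\<exists>\<delta>>0. \<forall>x. \<bar>m x - (LBINT y. m y * (fejer ((x - y) / \<delta>) / \<delta>))\<bar> \<le> e' / (1 + x\<^sup>2)"
    by (rule fejer_approximation[OF cont, where R = "max 1 R"]) (use supp e' in auto)
  then obtain \<delta> where d: "0 < \<delta>"
    and ap: "\<And>x. \<bar>m x - (LBINT y. m y * (fejer ((x - y) / \<delta>) / \<delta>))\<bar> \<le> e' / (1 + x\<^sup>2)" by blast
  define h where "h x = (LBINT y. m y * (fejer ((x - y) / \<delta>) / \<delta>))" for x
  have [measurable]: "h \<in> borel_measurable borel" unfolding h_def by measurable
  define H where "H s = (1 / (2 * pi)) * complex_of_real (triangle (\<delta> * s)) * (CLBINT y. m y * iexp (- (s * y)))" for s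
  have H: "fourier_synth H x = complex_of_real (h x)" "H \<in> borel_measurable borel"
    "cmod (H s) \<le> (LBINT y. \<bar>m y\<bar>) * indicator {-(1/\<delta>)..1/\<delta>} s" "isCont H 0" "2 * pi * H 0 = complex_of_real (LBINT y. m y)" for x s
    unfolding H_def[abs_def] h_def by (rule synth_fejer_convolution[OF im d])+
  have h1: "\<forall>\<^sub>F n in sequentially. \<forall>u. cmod (B n * (\<integral>x. fourier_synth H (x + u) \<partial>P n)
     - 2 * pi * H 0 * fourier_density \<phi> (- u / B n)) \<le> e / 2"
    by (rule synth_local_limit[OF H(2,3) _ H(4)]) (use d e in auto)
  define g where "g x = fejer x + fejer (x - pi)" for x
  have [measurable]: "g \<in> borel_measurable borel" unfolding g_def by measurable
  have h2: "\<forall>\<^sub>F n in sequentially. \<forall>u. cmod (B n * (\<integral>x. complex_of_real (g (x + u)) \<partial>P n)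
     - 2 * fourier_density \<phi> (- u / B n)) \<le> 1"
    using synth_local_limit[OF synth_fejer_pair(2,3) _ synth_fejer_pair(4), of 1]
    unfolding synth_fejer_pair(5) synth_fejer_pair(1) g_def by simp
  have Bp: "\<forall>\<^sub>F n in sequentially. 0 < B n" using B by (simp add: filterlim_at_top_dense)
  show ?thesis using h1 h2 Bp
  proof eventually_elim
    case (elim n)
    interpret R: real_distribution "P n" by (rule P)
    have [measurable_cong]: "sets (P n) = sets borel" by simp
    show ?case
    proof
      fix u
      have gb: "\<bar>g x\<bar> \<le> 2" for x
        using fejer_nonneg[of x] fejer_nonneg[of "x - pi"] fejer_le_1[of x] fejer_le_1[of "x - pi"] by (simp add: g_def)
      have ig: "integrable (P n) (\<lambda>x. g (x + u))" by (rule R.integrable_const_bound[where B = 2]) (auto simp: gb)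
      have "compact (m ` {-R..R})" by (intro compact_continuous_image continuous_on_subset[OF cont]) auto
      then obtain Mb where Mb: "\<And>x. x \<in> {-R..R} \<Longrightarrow> \<bar>m x\<bar> \<le> Mb"
        using compact_imp_bounded[of "m ` {-R..R}"] unfolding bounded_iff by (metis image_eqI real_norm_def)
      have mb: "\<bar>m x\<bar> \<le> max 0 Mb" for x using supp[of x] Mb[of x] by (cases "x \<in> {-R..R}") (force simp: le_max_iff_disj)+
      have imu: "integrable (P n) (\<lambda>x. m (x + u))" by (rule R.integrable_const_bound[where B = "max 0 Mb"]) (auto simp: mb)
      have pe: "e' / (1 + x\<^sup>2) \<le> e' * pi ^ 3 * g x" for x
      proof -
        have "(e' * pi ^ 3) * (1 / (pi ^ 3 * (1 + x\<^sup>2))) \<le> (e' * pi ^ 3) * g x"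
          unfolding g_def using e' by (intro mult_left_mono fejer_lower) auto
        then show ?thesis by simp
      qed
      have mh: "\<bar>m x - h x\<bar> \<le> e' * pi ^ 3 * g x" for x
        using ap[of x] pe[of x] unfolding h_def by linarith
      have mhb: "\<bar>m x - h x\<bar> \<le> e' * pi ^ 3 * 2" for x
      proof -
        have "e' * pi ^ 3 * g x \<le> e' * pi ^ 3 * 2"
          by (rule mult_left_mono) (use gb[of x] e' in \<open>auto simp: abs_le_iff\<close>)
        then show ?thesis using mh[of x] by linarith
      qed
      have hb: "\<bar>h x\<bar> \<le> max 0 Mb + e' * pi ^ 3 * 2" for x using mhb[of x] mb[of x] by linarith
      have ih: "integrable (P n) (\<lambda>x. h (x + u))"
        by (rule R.integrable_const_bound[where B = "max 0 Mb + e' * pi ^ 3 * 2"]) (auto simp: hb)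
      let ?fc = "fourier_density \<phi> (- u / B n)"
      let ?I = "LBINT x. m x"
      have G1: "B n * (\<integral>x. g (x + u) \<partial>P n) \<le> G"
      proof -
        have "B n * (\<integral>x. g (x + u) \<partial>P n) - Re (2 * ?fc) = Re (B n * (\<integral>x. complex_of_real (g (x + u)) \<partial>P n) - 2 * ?fc)"
          by simp
        also have "\<dots> \<le> 1" by (rule order_trans[OF complex_Re_le_cmod]) (use elim(2) in blast)
        finally have "B n * (\<integral>x. g (x + u) \<partial>P n) \<le> 1 + Re (2 * ?fc)" by simp
        also have "Re (2 * ?fc) \<le> 2 * cmod ?fc" using complex_Re_le_cmod[of ?fc] by simp
        also have "cmod ?fc \<le> (LBINT t. cmod (\<phi> t))" by (rule norm_fourier_density_le[OF \<phi>])
        finally show ?thesis by (simp add: G_def)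
      qed
      have "\<bar>B n * (\<integral>x. m (x + u) \<partial>P n) - B n * (\<integral>x. h (x + u) \<partial>P n)\<bar> = B n * \<bar>\<integral>x. m (x + u) - h (x + u) \<partial>P n\<bar>"
        using imu ih elim(3) by (simp add: abs_mult flip: right_diff_distrib)
      also have "\<dots> \<le> B n * (\<integral>x. e' * pi ^ 3 * g (x + u) \<partial>P n)"
      proof (intro mult_left_mono)
        have "\<bar>\<integral>x. m (x + u) - h (x + u) \<partial>P n\<bar> \<le> (\<integral>x. \<bar>m (x + u) - h (x + u)\<bar> \<partial>P n)" by (rule integral_abs_bound)
        also have "\<dots> \<le> (\<integral>x. e' * pi ^ 3 * g (x + u) \<partial>P n)"
          by (intro integral_mono integrable_abs Bochner_Integration.integrable_diff imu ih integrable_mult_right ig mh)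
        finally show "\<bar>\<integral>x. m (x + u) - h (x + u) \<partial>P n\<bar> \<le> (\<integral>x. e' * pi ^ 3 * g (x + u) \<partial>P n)" .
      qed (use elim(3) in simp)
      also have "\<dots> = e' * pi ^ 3 * (B n * (\<integral>x. g (x + u) \<partial>P n))" by simp
      also have "\<dots> \<le> e' * pi ^ 3 * G" using G1 e' by (intro mult_left_mono) auto
      also have "\<dots> = e / 2" using G by (simp add: e'_def)
      finally have A: "\<bar>B n * (\<integral>x. m (x + u) \<partial>P n) - B n * (\<integral>x. h (x + u) \<partial>P n)\<bar> \<le> e / 2" .
      have E: "B n * (\<integral>x. h (x + u) \<partial>P n) - Re ?fc * ?I =
          Re (B n * (\<integral>x. fourier_synth H (x + u) \<partial>P n) - 2 * pi * H 0 * ?fc)"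
        unfolding H(1) H(5) by simp
      have "\<bar>B n * (\<integral>x. h (x + u) \<partial>P n) - Re ?fc * ?I\<bar> \<le> e / 2"
        unfolding E by (rule order_trans[OF abs_Re_le_cmod]) (use elim(1) in blast)
      then show "\<bar>B n * (\<integral>x. m (x + u) \<partial>P n) - Re ?fc * ?I\<bar> \<le> e" using A by linarith
    qed
  qed
qed

end

section \<open>Densities of stable laws\<close>

lemma integral_iexp_Ioc:
  assumes ab: "a \<le> b" and t: "t \<noteq> 0"
  shows "(CLBINT x:{a<..b}. iexp (- (t * x))) = (iexp (- (t * a)) - iexp (- (t * b))) / (\<i> * t)"
proof -
  let ?F = "\<lambda>x. iexp (- (t * x)) / (- (\<i> * t))"
  have "(CLBINT x=ereal a..ereal b. iexp (- (t * x))) = ?F b - ?F a"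
  proof (rule interval_integral_FTC_finite)
    show "continuous_on {min a b..max a b} (\<lambda>x. iexp (- (t * x)))" by (intro continuous_intros)
    fix x
    show "(?F has_vector_derivative iexp (- (t * x))) (at x within {min a b..max a b})"
      using t by (auto intro!: derivative_eq_intros has_vector_derivative_real_field simp: mult_ac)
  qed
  also have "?F b - ?F a = (iexp (- (t * a)) - iexp (- (t * b))) / (\<i> * t)"
    using t by (simp add: field_simps)
  finally show ?thesis using ab by (simp add: interval_integral_Ioc)
qed

context real_distribution
begin

text \<open>Levy inversion gives the measure as a limit over [-T, T]. The integrand is the transform
  of the interval times the characteristic function, here integrable over the whole line, so the
  limit is a full integral and Fubini applies. The quotient formula for it fails only at t = 0, a
  null set.\<close>

lemma measure_Ioc_eq_fourier:
  assumes int: "integrable lborel (char M)" and ab: "a \<le> b" and a0: "measure M {a} = 0" and b0: "measure M {b} = 0"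
  shows "measure M {a<..b} = (LBINT x:{a<..b}. Re (fourier_density (char M) x))"
proof -
  let ?\<phi> = "char M"
  define F where "F = (\<lambda>(t, x). indicator {a<..b} x *\<^sub>R (iexp (- (t * x)) * ?\<phi> t))"
  have [measurable]: "F \<in> borel_measurable (lborel \<Otimes>\<^sub>M lborel)" unfolding F_def by measurable
  have nF: "norm (F (t, x)) = indicator {a<..b} x * cmod (?\<phi> t)" for t x by (simp add: F_def norm_mult)
  have ii: "integrable lborel (\<lambda>x. indicator {a<..b} x * c)" for c :: real
    using ab by (intro integrable_mult_left integrable_real_indicator) auto
  have intF: "integrable (lborel \<Otimes>\<^sub>M lborel) F"
  proof (rule lborel_pair.Fubini_integrable)
    show "integrable lborel (\<lambda>t. LBINT x. norm (F (t, x)))"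
      using ab int by (simp add: nF)
    have "integrable lborel (\<lambda>x. F (t, x))" for t
      by (rule Bochner_Integration.integrable_bound[OF ii[of "cmod (?\<phi> t)"]]) (auto simp: nF)
    then show "AE t in lborel. integrable lborel (\<lambda>x. F (t, x))" by simp
  qed simp
  define K where "K t = (CLBINT x. F (t, x))" for t
  have [measurable]: "K \<in> borel_measurable borel" unfolding K_def by measurable
  have Ki: "integrable lborel K" unfolding K_def using lborel_pair.integrable_fst'[OF intF] .
  have Keq: "K t = (iexp (- (t * a)) - iexp (- (t * b))) / (\<i> * t) * ?\<phi> t" if "t \<noteq> 0" for t
    using integral_iexp_Ioc[OF ab that] by (simp add: K_def F_def set_lebesgue_integral_def scaleR_conv_of_real mult.assoc[symmetric])
  have lev: "(\<lambda>T. 1 / (2 * pi) * (CLBINT t=- real T..real T. (iexp (- (t * a)) - iexp (- (t * b))) / (\<i> * t) * ?\<phi> t))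
      \<longlonglongrightarrow> complex_of_real (measure M {a<..b})"
    using Levy_Inversion[OF ab a0 b0] by simp
  have "(\<lambda>T. CLBINT t. indicator {- real T..real T} t *\<^sub>R K t) \<longlonglongrightarrow> (CLBINT t. K t)"
  proof (rule integral_dominated_convergence[OF _ _ integrable_norm[OF Ki]])
    show "AE t in lborel. (\<lambda>T. indicator {- real T..real T} t *\<^sub>R K t) \<longlonglongrightarrow> K t"
    proof (intro AE_I2 tendsto_eventually)
      fix t :: real
      obtain N :: nat where N: "\<bar>t\<bar> \<le> real N" using real_arch_simple by blast
      have "indicator {- real T..real T} t *\<^sub>R K t = K t" if "N \<le> T" for T
      proof -
        have "real N \<le> real T" using that by simp
        then have "t \<in> {- real T..real T}" using N by auto
        then show ?thesis by simp
      qed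
      then show "\<forall>\<^sub>F T in sequentially. indicator {- real T..real T} t *\<^sub>R K t = K t"
        unfolding eventually_sequentially by blast
    qed
    show "AE t in lborel. norm (indicator {- real T..real T} t *\<^sub>R K t) \<le> norm (K t)" for T
      by (intro AE_I2) (auto simp: indicator_def)
  qed auto
  moreover have "(CLBINT t. indicator {- real T..real T} t *\<^sub>R K t) =
      (CLBINT t=- real T..real T. (iexp (- (t * a)) - iexp (- (t * b))) / (\<i> * t) * ?\<phi> t)" for T
  proof -
    have "(CLBINT t=- real T..real T. (iexp (- (t * a)) - iexp (- (t * b))) / (\<i> * t) * ?\<phi> t) =
       (CLBINT t:{- real T..real T}. (iexp (- (t * a)) - iexp (- (t * b))) / (\<i> * t) * ?\<phi> t)"
      using interval_integral_Icc[of "- real T" "real T"] by simp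
    also have "\<dots> = (CLBINT t. indicator {- real T..real T} t *\<^sub>R K t)"
      unfolding set_lebesgue_integral_def
    proof (rule integral_cong_AE)
      show "AE t in lborel. indicator {- real T..real T} t *\<^sub>R ((iexp (- (t * a)) - iexp (- (t * b))) / (\<i> * t) * ?\<phi> t) =
          indicator {- real T..real T} t *\<^sub>R K t"
        using AE_lborel_singleton[of 0] by eventually_elim (simp add: Keq)
    qed auto
    finally show ?thesis by simp
  qed
  ultimately have "(\<lambda>T. 1 / (2 * pi) * (CLBINT t=- real T..real T. (iexp (- (t * a)) - iexp (- (t * b))) / (\<i> * t) * ?\<phi> t))
      \<longlonglongrightarrow> 1 / (2 * pi) * (CLBINT t. K t)"
    by (intro tendsto_intros) simp
  from LIMSEQ_unique[OF lev this] have 1: "complex_of_real (measure M {a<..b}) = 1 / (2 * pi) * (CLBINT t. K t)" .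
  have "(CLBINT t. K t) = (CLBINT x. CLBINT t. F (t, x))"
    unfolding K_def using lborel_pair.Fubini_integral[of "\<lambda>t x. F (t, x)"] intF by simp
  also have "\<dots> = (CLBINT x. indicator {a<..b} x *\<^sub>R (2 * pi * fourier_density ?\<phi> x))"
    by (intro Bochner_Integration.integral_cong refl) (simp add: F_def fourier_density_def)
  also have "\<dots> = (CLBINT x. 2 * pi * (indicator {a<..b} x *\<^sub>R fourier_density ?\<phi> x))"
    by (intro Bochner_Integration.integral_cong refl) (simp add: scaleR_conv_of_real)
  also have "\<dots> = 2 * pi * (CLBINT x:{a<..b}. fourier_density ?\<phi> x)"
    by (simp only: set_lebesgue_integral_def integral_mult_right_zero)
  finally have "complex_of_real (measure M {a<..b}) = (CLBINT x:{a<..b}. fourier_density ?\<phi> x)"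
    unfolding 1 by simp
  then have "measure M {a<..b} = Re (CLBINT x:{a<..b}. fourier_density ?\<phi> x)" by (metis Re_complex_of_real)
  also have "\<dots> = (LBINT x:{a<..b}. Re (fourier_density ?\<phi> x))"
    unfolding set_lebesgue_integral_def
  proof (subst integral_Re[symmetric])
    have cf: "continuous_on UNIV (fourier_density ?\<phi>)"
      by (intro continuous_at_imp_continuous_on ballI isCont_fourier_density int)
    have "set_integrable lborel {a..b} (fourier_density ?\<phi>)"
      by (rule borel_integrable_atLeastAtMost') (rule continuous_on_subset[OF cf], simp)
    then have "set_integrable lborel {a<..b} (fourier_density ?\<phi>)" by (rule set_integrable_subset) auto
    then show "integrable lborel (\<lambda>x. indicator {a<..b} x *\<^sub>R fourier_density ?\<phi> x)" by (simp add: set_integrable_def)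
  qed (simp add: scaleR_conv_of_real)
  finally show ?thesis .
qed

lemma ex_continuity_point: "x < y \<Longrightarrow> \<exists>z. x < z \<and> z < y \<and> measure M {z} = 0"
  using open_minus_countable[OF countable_support, of "{x<..<y}"] by auto

text \<open>Inversion gives interval probabilities only at continuity points, which are dense
  because atoms are countable. A negative value of f would give some short interval negative
  measure. General endpoints are approached from the right, in keeping with half-open
  intervals.\<close>

lemma density_fourier:
  assumes int: "integrable lborel (char M)"
  defines "f \<equiv> \<lambda>x. Re (fourier_density (char M) x)"
  shows "continuous_on UNIV f" and "0 \<le> f x" and "M = density lborel (\<lambda>x. ennreal (f x))"
proof -
  have isf: "isCont f x" for x
    using isCont_fourier_density[OF int, of x] by (simp add: isCont_def f_def tendsto_Re)
  show cf: "continuous_on UNIV f" by (intro continuous_at_imp_continuous_on ballI isf)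
  then have [measurable]: "f \<in> borel_measurable borel" by (rule borel_measurable_continuous_onI)
  have sf: "set_integrable lborel {a..b} f" for a b
    by (rule borel_integrable_atLeastAtMost') (rule continuous_on_subset[OF cf], simp)
  have sf': "set_integrable lborel {a<..b} f" for a b by (rule set_integrable_subset[OF sf[of a b]]) auto
  show nn: "0 \<le> f x" for x
  proof (rule ccontr)
    assume "\<not> 0 \<le> f x"
    then have "f x < 0" by simp
    then have "\<forall>\<^sub>F y in at x. f y < f x / 2"
      using isf[of x] by (intro order_tendstoD(2)[where y = "f x"]) (auto simp: isCont_def)
    then obtain d where d: "0 < d" "\<And>y. y \<noteq> x \<Longrightarrow> \<bar>y - x\<bar> < d \<Longrightarrow> f y < f x / 2"
      by (auto simp: eventually_at dist_real_def)
    obtain a where a: "x < a" "a < x + d / 2" "measure M {a} = 0" using ex_continuity_point[of x "x + d/2"] d by auto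
    obtain b where b: "x + d / 2 < b" "b < x + d" "measure M {b} = 0" using ex_continuity_point[of "x + d/2" "x + d"] d by auto
    have "measure M {a<..b} = (LBINT y:{a<..b}. f y)"
      unfolding f_def using a b by (intro measure_Ioc_eq_fourier int) auto
    also have "\<dots> \<le> (LBINT y:{a<..b}. f x / 2)"
    proof (rule set_integral_mono[OF sf'])
      show "set_integrable lborel {a<..b} (\<lambda>y. f x / 2)"
        unfolding set_integrable_def using a b by simp
      show "f y \<le> f x / 2" if "y \<in> {a<..b}" for y
        using d(2)[of y] that a b by (auto intro: less_imp_le)
    qed
    also have "\<dots> = (b - a) * (f x / 2)" using a b by (simp add: set_lebesgue_integral_def)
    also have "\<dots> < 0" using \<open>f x < 0\<close> a b by (intro mult_pos_neg) auto
    finally show False by (simp add: not_less[symmetric])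
  qed
  have Ieq: "measure M {a<..b} = (LBINT x:{a<..b}. f x)" if ab: "a < b" for a b
  proof -
    \<comment> \<open>Continuity points tending to a and b from the right, so that the indicators of
      the half-open intervals converge at every point. The halved width keeps \<open>u n\<close>
      below b.\<close>
    define u where "u n = (SOME z. a < z \<and> z < a + (b - a) / (2 * real (Suc n)) \<and> measure M {z} = 0)" for n
    define v where "v n = (SOME z. b < z \<and> z < b + (b - a) / (2 * real (Suc n)) \<and> measure M {z} = 0)" for n
    have p: "0 < (b - a) / (2 * real (Suc n))" for n using ab by simp
    have u: "a < u n" "u n < a + (b - a) / (2 * real (Suc n))" "measure M {u n} = 0" for n
      using someI_ex[OF ex_continuity_point[of a "a + (b - a) / (2 * real (Suc n))"]] p[of n] by (auto simp: u_def)
    have v: "b < v n" "v n < b + (b - a) / (2 * real (Suc n))" "measure M {v n} = 0" for n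
      using someI_ex[OF ex_continuity_point[of b "b + (b - a) / (2 * real (Suc n))"]] p[of n] by (auto simp: v_def)
    have hb: "(b - a) / (2 * real (Suc n)) \<le> (b - a) / 2" for n using ab by (intro divide_left_mono) auto
    have lim0: "(\<lambda>n. c + (b - a) / (2 * real (Suc n))) \<longlonglongrightarrow> c" for c by real_asymp
    have ul: "u \<longlonglongrightarrow> a"
      by (rule tendsto_sandwich[OF _ _ tendsto_const lim0[of a]]) (use u in \<open>auto intro!: always_eventually less_imp_le\<close>)
    have vl: "v \<longlonglongrightarrow> b"
      by (rule tendsto_sandwich[OF _ _ tendsto_const lim0[of b]]) (use v in \<open>auto intro!: always_eventually less_imp_le\<close>)
    have uv: "u n < b" for n
    proof -
      have "u n < a + (b - a) / 2" using u(2)[of n] hb[of n] by (meson add_left_mono less_le_trans)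
      also have "\<dots> < b" using ab by (simp add: field_simps)
      finally show ?thesis .
    qed
    have vb: "v n \<le> b + (b - a)" for n
    proof -
      have "v n < b + (b - a) / 2" using v(2)[of n] hb[of n] by (meson add_left_mono less_le_trans)
      also have "\<dots> \<le> b + (b - a)" using ab by simp
      finally show ?thesis by simp
    qed
    have ind: "(\<lambda>n. indicator {u n<..v n} x :: real) \<longlonglongrightarrow> indicator {a<..b} x" for x
    proof (cases "x \<in> {a<..b}")
      case True
      then have "\<forall>\<^sub>F n in sequentially. u n < x" by (intro order_tendstoD(2)[OF ul]) auto
      then have "\<forall>\<^sub>F n in sequentially. indicator {u n<..v n} x = (indicator {a<..b} x :: real)"
      proof eventually_elim
        case (elim n)
        then show ?case using True v(1)[of n] by (auto simp: indicator_def)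
      qed
      then show ?thesis by (rule tendsto_eventually)
    next
      case False
      then consider "x \<le> a" | "b < x" by force
      then have "\<forall>\<^sub>F n in sequentially. indicator {u n<..v n} x = (indicator {a<..b} x :: real)"
      proof cases
        case 1
        have "\<not> u n < x" for n using u(1)[of n] 1 by simp
        then show ?thesis using False by (auto simp: indicator_def)
      next
        case 2
        then have "\<forall>\<^sub>F n in sequentially. v n < x" by (intro order_tendstoD(2)[OF vl]) auto
        then show ?thesis by eventually_elim (use False in \<open>auto simp: indicator_def\<close>)
      qed
      then show ?thesis by (rule tendsto_eventually)
    qed
    have "(\<lambda>n. LBINT x:{u n<..v n}. f x) \<longlonglongrightarrow> (LBINT x:{a<..b}. f x)"
      unfolding set_lebesgue_integral_def
    proof (rule integral_dominated_convergence)
      show "integrable lborel (\<lambda>x. indicator {a<..b + (b - a)} x *\<^sub>R f x)" using sf' by (simp add: set_integrable_def)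
      show "AE x in lborel. (\<lambda>n. indicator {u n<..v n} x *\<^sub>R f x) \<longlonglongrightarrow> indicator {a<..b} x *\<^sub>R f x"
        by (intro AE_I2 tendsto_intros ind)
      show "AE x in lborel. norm (indicator {u n<..v n} x *\<^sub>R f x) \<le> indicator {a<..b + (b - a)} x *\<^sub>R f x" for n
        using u(1)[of n] vb[of n] nn by (intro AE_I2) (auto simp: indicator_def)
    qed auto
    moreover have "(LBINT x:{u n<..v n}. f x) = measure M {u n<..v n}" for n
      unfolding f_def by (rule measure_Ioc_eq_fourier[symmetric, OF int]) (use u v less_trans[OF uv[of n] v(1)[of n]] in auto)
    moreover have "(\<lambda>n. measure M {u n<..v n}) \<longlonglongrightarrow> measure M {a<..b}"
    proof -
      have "(\<lambda>n. \<integral>x. indicator {u n<..v n} x \<partial>M) \<longlonglongrightarrow> (\<integral>x. (indicator {a<..b} x :: real) \<partial>M)"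
      proof (rule integral_dominated_convergence[where w = "\<lambda>_. 1"])
        show "AE x in M. (\<lambda>n. indicator {u n<..v n} x :: real) \<longlonglongrightarrow> indicator {a<..b} x" by (intro AE_I2 ind)
      qed (auto simp: indicator_def)
      then show ?thesis by simp
    qed
    ultimately show ?thesis using LIMSEQ_unique by simp
  qed
  have em: "emeasure M {a<..b} = emeasure (density lborel (\<lambda>x. ennreal (f x))) {a<..b}" for a b
  proof (cases "a < b")
    case True
    have "emeasure (density lborel (\<lambda>x. ennreal (f x))) {a<..b} = (\<integral>\<^sup>+x. ennreal (indicator {a<..b} x *\<^sub>R f x) \<partial>lborel)"
      by (subst emeasure_density) (auto intro!: nn_integral_cong simp: indicator_def)
    also have "\<dots> = ennreal (LBINT x:{a<..b}. f x)"
      unfolding set_lebesgue_integral_def using sf' nn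
      by (intro nn_integral_eq_integral) (auto simp: set_integrable_def)
    also have "\<dots> = emeasure M {a<..b}" using Ieq[OF True] by (simp add: emeasure_eq_measure)
    finally show ?thesis by simp
  qed simp
  show "M = density lborel (\<lambda>x. ennreal (f x))"
  proof (rule measure_eqI_generator_eq[where \<Omega> = UNIV and E = "range (\<lambda>(a, b). {a<..b::real})" and A = "\<lambda>i. {- real i<..real i}"])
    show "(\<Union>i. {- real (i::nat)<..real i}) = UNIV" by (rule UN_Ioc_eq_UNIV)
    show "emeasure M X = emeasure (density lborel (\<lambda>x. ennreal (f x))) X" if "X \<in> range (\<lambda>(a, b). {a<..b})" for X
      using that em by auto
  qed (auto simp: borel_sigma_sets_Ioc Int_stable_def)
qed

text \<open>Two continuous densities agree almost everywhere, so the set where they differ is open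
  and null, hence empty. This resolves the definite description.\<close>

lemma continuous_density_eq:
  assumes int: "integrable lborel (char M)"
  shows "continuous_density M = (\<lambda>x. Re (fourier_density (char M) x))" (is "_ = ?f")
  unfolding continuous_density_def
proof (rule the_equality)
  show "continuous_on UNIV ?f \<and> (\<forall>x. 0 \<le> ?f x) \<and> M = density lborel (\<lambda>x. ennreal (?f x))"
    using density_fourier[OF int] by simp
next
  fix g assume g: "continuous_on UNIV g \<and> (\<forall>x. 0 \<le> g x) \<and> M = density lborel (\<lambda>x. ennreal (g x))"
  have cf: "continuous_on UNIV ?f" and f0: "\<And>x. 0 \<le> ?f x" and fM: "M = density lborel (\<lambda>x. ennreal (?f x))"
    using density_fourier[OF int] by auto
  have gm[measurable]: "g \<in> borel_measurable borel" and fm[measurable]: "?f \<in> borel_measurable borel"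
    using g cf by (auto intro: borel_measurable_continuous_onI)
  have "density lborel (\<lambda>x. ennreal (g x)) = density lborel (\<lambda>x. ennreal (?f x))" using g fM by simp
  then have "AE x in lborel. ennreal (g x) = ennreal (?f x)"
    by (intro sigma_finite_measure.density_unique[OF lborel.sigma_finite_measure_axioms]) auto
  then have ae: "AE x in lborel. g x = ?f x"
    using g f0 by (auto elim!: eventually_mono)
  have op: "open {x. g x \<noteq> ?f x}"
    using g cf by (intro open_Collect_neq) auto
  show "g = ?f"
  proof (rule ccontr)
    assume "g \<noteq> ?f"
    then obtain x where "x \<in> {x. g x \<noteq> ?f x}" by auto
    then obtain e where e: "0 < e" "ball x e \<subseteq> {x. g x \<noteq> ?f x}" using op open_contains_ball by blast
    obtain N where N: "{x. g x \<noteq> ?f x} \<subseteq> N" "N \<in> null_sets lborel"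
      using ae by (auto elim!: AE_E simp: null_sets_def)
    have "{x - e/2..x + e/2} \<subseteq> ball x e" using e(1) by (auto simp: dist_real_def abs_less_iff)
    then have "emeasure lborel {x - e/2..x + e/2} \<le> emeasure lborel N"
      using e N by (intro emeasure_mono) auto
    then have "emeasure lborel {x - e/2..x + e/2} = 0" using N by (simp add: null_sets_def)
    then show False using e(1) by simp
  qed
qed

end

section \<open>The norming constants and the characteristic functions of the sums\<close>

text \<open>For any p > 0 the exponential decays faster than 1/(1 + t^2), and K takes care of
  bounded t.\<close>

lemma integrable_exp_powr:
  fixes k p :: real
  assumes k: "0 < k" and p: "0 < p"
  shows "integrable lborel (\<lambda>t. exp (- k * \<bar>t\<bar> powr p))"
proof -
  have "((\<lambda>t::real. (1 + t\<^sup>2) * exp (- k * t powr p)) \<longlongrightarrow> 0) at_top"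
    using k p by real_asymp
  then have "\<forall>\<^sub>F t in at_top. (1 + t\<^sup>2) * exp (- k * t powr p) < 1" by (rule order_tendstoD) simp
  then obtain t0 where t0: "\<And>t. t0 \<le> t \<Longrightarrow> (1 + t\<^sup>2) * exp (- k * t powr p) < 1"
    by (auto simp: eventually_at_top_linorder)
  define K where "K = max 1 (1 + t0\<^sup>2)"
  have bd: "exp (- k * \<bar>t\<bar> powr p) \<le> K * inverse (1 + t\<^sup>2)" for t
  proof (cases "t0 \<le> \<bar>t\<bar>")
    case True
    have "(1 + t\<^sup>2) * exp (- k * \<bar>t\<bar> powr p) \<le> 1" using t0[OF True] by simp
    also have "1 \<le> K" by (simp add: K_def)
    finally show ?thesis using one_plus_sq_pos[of t] by (simp add: field_simps)
  next
    case False
    then have "\<bar>t\<bar>\<^sup>2 \<le> t0\<^sup>2" by (intro power_mono) auto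
    then have "1 + t\<^sup>2 \<le> K" by (simp add: K_def)
    moreover have "exp (- k * \<bar>t\<bar> powr p) \<le> 1" using k by simp
    ultimately have "(1 + t\<^sup>2) * exp (- k * \<bar>t\<bar> powr p) \<le> K * 1"
      using one_plus_sq_pos[of t] by (intro mult_mono) (auto simp: K_def)
    then show ?thesis using one_plus_sq_pos[of t] by (simp add: field_simps)
  qed
  have "integrable lborel (\<lambda>t::real. inverse (1 + t\<^sup>2))"
    using integrable_inverse_1_plus_square by (simp add: set_integrable_def)
  then have "integrable lborel (\<lambda>t::real. K * inverse (1 + t\<^sup>2))" by (rule integrable_mult_right)
  then show ?thesis
    by (rule Bochner_Integration.integrable_bound) (use bd in \<open>auto intro: order_trans[OF _ abs_ge_self]\<close>)
qed

lemma has_sum_diff: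
  fixes f g :: "'i \<Rightarrow> complex"
  assumes "(f has_sum a) A" "(g has_sum b) A"
  shows "((\<lambda>x. f x - g x) has_sum (a - b)) A"
proof -
  have "sum (\<lambda>x. f x - g x) = (\<lambda>F. sum f F - sum g F)" by (simp add: fun_eq_iff sum_subtractf)
  then show ?thesis using tendsto_diff[OF assms[unfolded has_sum_def]] by (simp add: has_sum_def)
qed

context stable_domain
begin

text \<open>Since \<open>W s / s\<^sup>2\<close> is antitone, the sum in the definition of \<^const>\<open>norming_const\<close> depends
  continuously on the scale, so the infimum is attained with equality.\<close>

lemma norming_const_sum:
  fixes bs :: "'i \<Rightarrow> real"
  defines "X \<equiv> {x. x \<ge> 1 \<and> (\<lambda>i. W (bs i / x)) summable_on UNIV \<and> (\<Sum>\<^sub>\<infinity>i. W (bs i / x)) \<le> 1}"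
    and "B \<equiv> norming_const \<alpha> \<mu> bs"
  assumes ne: "X \<noteq> {}" and B1: "1 < B"
  shows "((\<lambda>i. W (bs i / B)) has_sum 1) UNIV"
proof -
  have BX: "B = Inf X" by (simp add: B_def X_def norming_const_def)
  have bdd: "bdd_below X" by (rule bdd_belowI[of _ 1]) (simp add: X_def)
  have B0: "0 < B" using B1 by simp
  \<comment> \<open>As W(s)/s^2 is antitone, two scales compare with a quadratic factor that does
    not depend on i, and the comparison passes to the sums.\<close>
  have sc: "W (bs i / x) \<le> (y / x)\<^sup>2 * W (bs i / y)" if "0 < x" "x \<le> y" for x y i
  proof (cases "bs i = 0")
    case False
    have "W (bs i / x) \<le> ((bs i / x) / (bs i / y))\<^sup>2 * W (bs i / y)"
      using that False by (intro W_sq_antimono) (auto simp: divide_left_mono)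
    also have "(bs i / x) / (bs i / y) = y / x" using False by simp
    finally show ?thesis .
  qed simp
  have sms: "(\<lambda>i. W (bs i / x)) summable_on UNIV" if "0 < x" "x \<le> y" "(\<lambda>i. W (bs i / y)) summable_on UNIV" for x y
    by (rule summable_on_comparison_test[OF summable_on_cmult_right[OF that(3), of "(y / x)\<^sup>2"]])
       (use sc[OF that(1,2)] in \<open>auto simp: W_nonneg\<close>)
  have le: "(\<Sum>\<^sub>\<infinity>i. W (bs i / x)) \<le> (y / x)\<^sup>2 * (\<Sum>\<^sub>\<infinity>i. W (bs i / y))"
    if "0 < x" "x \<le> y" "(\<lambda>i. W (bs i / y)) summable_on UNIV" for x y
    unfolding infsum_cmult_right'[symmetric]
    by (intro infsum_mono sms[OF that] summable_on_cmult_right that(3) sc that(1,2))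
  obtain x0 where x0: "x0 \<in> X" using ne by blast
  have BleX: "B \<le> x" if "x \<in> X" for x unfolding BX using that bdd by (rule cInf_lower)
  have sB: "(\<lambda>i. W (bs i / B)) summable_on UNIV"
    by (rule sms[OF B0 BleX[OF x0]]) (use x0 in \<open>simp add: X_def\<close>)
  have "(\<Sum>\<^sub>\<infinity>i. W (bs i / B)) \<le> 1"
  proof (rule tendsto_lowerbound[where F = "at_right B" and f = "\<lambda>x. (x / B)\<^sup>2"])
    have "((\<lambda>x. (x / B)\<^sup>2) \<longlongrightarrow> (B / B)\<^sup>2) (at_right B)" using B0 by (intro tendsto_intros) auto
    then show "((\<lambda>x. (x / B)\<^sup>2) \<longlongrightarrow> 1) (at_right B)" using B0 by simp
    show "\<forall>\<^sub>F x in at_right B. (\<Sum>\<^sub>\<infinity>i. W (bs i / B)) \<le> (x / B)\<^sup>2"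
      unfolding eventually_at_filter
    proof (intro always_eventually allI impI)
      fix x assume "x \<in> {B<..}"
      then obtain x' where x': "x' \<in> X" "x' < x" using cInf_lessD[OF ne, of x] by (auto simp: BX)
      have "(\<Sum>\<^sub>\<infinity>i. W (bs i / B)) \<le> (x' / B)\<^sup>2 * (\<Sum>\<^sub>\<infinity>i. W (bs i / x'))"
        by (rule le[OF B0 BleX[OF x'(1)]]) (use x' in \<open>simp add: X_def\<close>)
      also have "\<dots> \<le> (x / B)\<^sup>2 * 1"
        using x' B0 BleX[OF x'(1)] by (intro mult_mono power_mono divide_right_mono) (auto simp: X_def intro!: infsum_nonneg W_nonneg)
      finally show "(\<Sum>\<^sub>\<infinity>i. W (bs i / B)) \<le> (x / B)\<^sup>2" by simp
    qed
  qed simp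
  \<comment> \<open>Because B > 1, points slightly to the left of B still satisfy x >= 1. Lying
    below the infimum they are not admissible, so their sums exceed 1.\<close>
  moreover have "1 \<le> (\<Sum>\<^sub>\<infinity>i. W (bs i / B))"
  proof (rule tendsto_upperbound[where F = "at_left B" and f = "\<lambda>x. (x / B)\<^sup>2"])
    have "((\<lambda>x. (x / B)\<^sup>2) \<longlongrightarrow> (B / B)\<^sup>2) (at_left B)" using B0 by (intro tendsto_intros) auto
    then show "((\<lambda>x. (x / B)\<^sup>2) \<longlongrightarrow> 1) (at_left B)" using B0 by simp
    have "\<forall>\<^sub>F x in at_left B. 1 < x \<and> x < B" by (intro eventually_at_leftI[of 1]) (use B1 in auto)
    then show "\<forall>\<^sub>F x in at_left B. (x / B)\<^sup>2 \<le> (\<Sum>\<^sub>\<infinity>i. W (bs i / B))"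
    proof eventually_elim
      case (elim x)
      then have x: "0 < x" "x \<le> B" by auto
      have "x \<notin> X" using BleX[of x] elim by auto
      then have "1 < (\<Sum>\<^sub>\<infinity>i. W (bs i / x))" using sms[OF x sB] elim by (auto simp: X_def)
      also have "\<dots> \<le> (B / x)\<^sup>2 * (\<Sum>\<^sub>\<infinity>i. W (bs i / B))" by (rule le[OF x sB])
      finally show ?case using x by (simp add: power_divide field_simps)
    qed
  qed simp
  ultimately show ?thesis using sB by (simp add: has_sum_iff)
qed

text \<open>Each factor is at most exp(-k W(t c_i)), and Potter's bound with |t| >= 1 gives W(t c_i)
  >= |t|^(alpha/2) W(c_i) / C. The weights W(c_i) sum to 1, so the whole product is at most
  exp(-(k/C) |t|^(alpha/2)).\<close>

lemma char_product_bound: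
  fixes c :: "'i \<Rightarrow> real"
  assumes nl: "non_lattice \<mu>" and R: "0 < R"
  shows "\<exists>k>0. \<forall>c t \<Phi>. 1 \<le> \<bar>t\<bar> \<longrightarrow> (\<forall>i::'i. \<bar>t * c i\<bar> \<le> R) \<longrightarrow> ((\<lambda>i. W (c i)) has_sum 1) UNIV \<longrightarrow>
     ((\<lambda>A. \<Prod>i\<in>A. char \<mu> (t * c i)) \<longlongrightarrow> \<Phi>) (finite_subsets_at_top UNIV) \<longrightarrow>
     cmod \<Phi> \<le> exp (- k * \<bar>t\<bar> powr (\<alpha> / 2))"
proof -
  obtain k where k: "0 < k" "\<And>s. \<bar>s\<bar> \<le> R \<Longrightarrow> cmod (char \<mu> s) \<le> exp (- k * W s)"
    using char_le_exp_W[OF nl R] by blast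
  obtain C where C: "0 < C" "\<And>s t. 0 < \<bar>s\<bar> \<Longrightarrow> \<bar>s\<bar> \<le> \<bar>t\<bar> \<Longrightarrow> \<bar>t\<bar> \<le> R \<Longrightarrow> W s \<le> C * (\<bar>s\<bar> / \<bar>t\<bar>) powr (\<alpha> / 2) * W t"
    using W_potter[OF R] by blast
  have "cmod \<Phi> \<le> exp (- (k / C) * \<bar>t\<bar> powr (\<alpha> / 2))"
    if t: "1 \<le> \<bar>t\<bar>" and cR: "\<And>i. \<bar>t * c i\<bar> \<le> R" and hs: "((\<lambda>i. W (c i)) has_sum 1) UNIV"
      and l: "((\<lambda>A. \<Prod>i\<in>A. char \<mu> (t * c i)) \<longlongrightarrow> \<Phi>) (finite_subsets_at_top UNIV)" for c :: "'i \<Rightarrow> real" and t \<Phi>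
  proof (rule tendsto_le[OF _ _ tendsto_norm[OF l]])
    show "finite_subsets_at_top (UNIV :: 'i set) \<noteq> bot" by simp
    have Wl: "\<bar>t\<bar> powr (\<alpha> / 2) / C * W (c i) \<le> W (t * c i)" for i
    proof (cases "c i = 0")
      case False
      have "W (c i) \<le> C * (\<bar>c i\<bar> / \<bar>t * c i\<bar>) powr (\<alpha> / 2) * W (t * c i)"
        using False t cR mult_right_mono[OF t, of "\<bar>c i\<bar>"] by (intro C) (auto simp: abs_mult)
      also have "(\<bar>c i\<bar> / \<bar>t * c i\<bar>) powr (\<alpha> / 2) = 1 / \<bar>t\<bar> powr (\<alpha> / 2)"
        using False by (simp add: abs_mult powr_divide)
      finally show ?thesis using C(1) t by (simp add: field_simps)
    qed simp
    have "((\<lambda>A. \<Sum>i\<in>A. W (c i)) \<longlongrightarrow> 1) (finite_subsets_at_top UNIV)" using hs by (simp add: has_sum_def)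
    then have "((\<lambda>A. exp (- (k / C) * \<bar>t\<bar> powr (\<alpha> / 2) * (\<Sum>i\<in>A. W (c i)))) \<longlongrightarrow> exp (- (k / C) * \<bar>t\<bar> powr (\<alpha> / 2) * 1))
        (finite_subsets_at_top UNIV)" by (intro tendsto_intros)
    then show "((\<lambda>A. exp (- (k / C) * \<bar>t\<bar> powr (\<alpha> / 2) * (\<Sum>i\<in>A. W (c i)))) \<longlongrightarrow> exp (- (k / C) * \<bar>t\<bar> powr (\<alpha> / 2)))
        (finite_subsets_at_top UNIV)" by simp
    show "\<forall>\<^sub>F A in finite_subsets_at_top UNIV. cmod (\<Prod>i\<in>A. char \<mu> (t * c i)) \<le> exp (- (k / C) * \<bar>t\<bar> powr (\<alpha> / 2) * (\<Sum>i\<in>A. W (c i)))"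
    proof (rule eventually_finite_subsets_at_top_weakI)
      fix A :: "'i set" assume A: "finite A"
      have "cmod (\<Prod>i\<in>A. char \<mu> (t * c i)) = (\<Prod>i\<in>A. cmod (char \<mu> (t * c i)))" by (simp add: prod_norm)
      also have "\<dots> \<le> (\<Prod>i\<in>A. exp (- (k / C) * \<bar>t\<bar> powr (\<alpha> / 2) * W (c i)))"
      proof (intro prod_mono conjI)
        fix i
        have "cmod (char \<mu> (t * c i)) \<le> exp (- k * W (t * c i))" by (rule k(2)[OF cR])
        also have "\<dots> \<le> exp (- (k / C) * \<bar>t\<bar> powr (\<alpha> / 2) * W (c i))"
          using mult_left_mono[OF Wl[of i], of k] k(1) by (simp add: mult_ac)
        finally show "cmod (char \<mu> (t * c i)) \<le> exp (- (k / C) * \<bar>t\<bar> powr (\<alpha> / 2) * W (c i))" .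
      qed auto
      also have "\<dots> = exp (- (k / C) * \<bar>t\<bar> powr (\<alpha> / 2) * (\<Sum>i\<in>A. W (c i)))"
        using A by (simp add: exp_sum sum_distrib_left)
      finally show "cmod (\<Prod>i\<in>A. char \<mu> (t * c i)) \<le> exp (- (k / C) * \<bar>t\<bar> powr (\<alpha> / 2) * (\<Sum>i\<in>A. W (c i)))" .
    qed
  qed
  moreover have "0 < k / C" using k C by simp
  ultimately show ?thesis by blast
qed

text \<open>Combines the expansion at t c with the limit |t|^alpha of W(t c)/W(c). The sign of c
  stays explicit because positive and negative coefficients contribute opposite imaginary
  parts.\<close>

lemma Ln_char_scaled:
  assumes t: "t \<noteq> 0"
  shows "((\<lambda>c. Ln (char \<mu> (t * c)) / W c + scale_const * \<bar>t\<bar> powr \<alpha> * (1 - \<i> * complex_of_real (\<beta> * tau0 * sgn t * sgn c))) \<longlongrightarrow> 0) (at 0)"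
proof -
  let ?g = "\<lambda>s. 1 - \<i> * complex_of_real (\<beta> * stable_tau \<alpha> s)"
  have fl: "filterlim (\<lambda>c. t * c) (at 0) (at 0)"
    using t by (auto simp: filterlim_at eventually_at_filter intro!: tendsto_eq_intros)
  have a: "((\<lambda>c. Ln (char \<mu> (t * c)) / W (t * c) + scale_const * ?g (t * c)) \<longlongrightarrow> 0) (at 0)"
    by (rule filterlim_compose[OF Ln_char_asymp fl])
  have r: "((\<lambda>c. complex_of_real (W (t * c) / W c)) \<longlongrightarrow> complex_of_real (\<bar>t\<bar> powr \<alpha>)) (at 0)"
    by (intro tendsto_of_real W_ratio t)
  have 1: "((\<lambda>c. (Ln (char \<mu> (t * c)) / W (t * c) + scale_const * ?g (t * c)) * complex_of_real (W (t * c) / W c)) \<longlongrightarrow> 0) (at 0)"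
    using tendsto_mult[OF a r] by simp
  have 2: "((\<lambda>c. complex_of_real (\<bar>t\<bar> powr \<alpha> - W (t * c) / W c) * (scale_const * ?g (t * c))) \<longlongrightarrow> 0) (at 0)"
  proof (rule lim_null_mult_right_bounded[where B = "scale_const * (1 + \<bar>\<beta> * tau0\<bar>)"])
    have "((\<lambda>c. \<bar>t\<bar> powr \<alpha> - W (t * c) / W c) \<longlongrightarrow> \<bar>t\<bar> powr \<alpha> - \<bar>t\<bar> powr \<alpha>) (at 0)"
      by (intro tendsto_diff tendsto_const W_ratio t)
    then have "((\<lambda>c. complex_of_real (\<bar>t\<bar> powr \<alpha> - W (t * c) / W c)) \<longlongrightarrow> complex_of_real (\<bar>t\<bar> powr \<alpha> - \<bar>t\<bar> powr \<alpha>)) (at 0)"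
      by (rule tendsto_of_real)
    then show "((\<lambda>c. complex_of_real (\<bar>t\<bar> powr \<alpha> - W (t * c) / W c)) \<longlongrightarrow> 0) (at 0)" by simp
    show "\<forall>\<^sub>F c in at 0. cmod (scale_const * ?g (t * c)) \<le> scale_const * (1 + \<bar>\<beta> * tau0\<bar>)"
      unfolding norm_mult using scale_const_pos by (intro always_eventually allI) (simp add: mult_left_mono[OF tau_bound] del: of_real_mult)
  qed
  have "((\<lambda>c. (Ln (char \<mu> (t * c)) / W (t * c) + scale_const * ?g (t * c)) * complex_of_real (W (t * c) / W c) +
      complex_of_real (\<bar>t\<bar> powr \<alpha> - W (t * c) / W c) * (scale_const * ?g (t * c))) \<longlongrightarrow> 0 + 0) (at 0)"
    by (rule tendsto_add[OF 1 2])
  then have l: "((\<lambda>c. (Ln (char \<mu> (t * c)) / W (t * c) + scale_const * ?g (t * c)) * complex_of_real (W (t * c) / W c) +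
      complex_of_real (\<bar>t\<bar> powr \<alpha> - W (t * c) / W c) * (scale_const * ?g (t * c))) \<longlongrightarrow> 0) (at 0)" by simp
  show ?thesis
  proof (rule Lim_transform_eventually[OF l])
    have "\<forall>\<^sub>F c::real in at 0. c \<noteq> 0" by (simp add: eventually_at_filter)
    then show "\<forall>\<^sub>F c in at 0. (Ln (char \<mu> (t * c)) / W (t * c) + scale_const * ?g (t * c)) * complex_of_real (W (t * c) / W c) +
      complex_of_real (\<bar>t\<bar> powr \<alpha> - W (t * c) / W c) * (scale_const * ?g (t * c)) =
      Ln (char \<mu> (t * c)) / W c + scale_const * \<bar>t\<bar> powr \<alpha> * (1 - \<i> * complex_of_real (\<beta> * tau0 * sgn t * sgn c))"
    proof eventually_elim
      case (elim c)
      have gen: "(L / w1 + K * g) * (w1 / w) + (T - w1 / w) * (K * g) = L / w + K * T * g" if "w1 \<noteq> 0" for L w1 K g w T :: complex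
        using that by (simp add: algebra_simps)
      have "W (t * c) \<noteq> 0" using W_pos[of "t * c"] t elim by auto
      moreover have "\<beta> * stable_tau \<alpha> (t * c) = \<beta> * tau0 * sgn t * sgn c"
        by (simp add: stable_tau_eq sgn_mult mult_ac)
      ultimately show ?case
        using gen[of "complex_of_real (W (t * c))" "Ln (char \<mu> (t * c))" "complex_of_real scale_const" "?g (t * c)"
             "complex_of_real (W c)" "complex_of_real (\<bar>t\<bar> powr \<alpha>)"]
        by (simp only: of_real_mult of_real_divide of_real_diff of_real_eq_0_iff not_False_eq_True simp_thms)
    qed
  qed
qed

text \<open>The coefficients become uniformly small, so each logarithm is W(c_ni) times its limit up
  to epsilon W(c_ni). As the weights sum to 1, the total error is at most epsilon. The hypothesis on
  kappa includes the factor beta tau, so that the sign sums themselves need not converge when this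
  factor is 0.\<close>

lemma char_product_limit:
  fixes c :: "nat \<Rightarrow> 'i \<Rightarrow> real"
  assumes hs: "\<forall>\<^sub>F n in sequentially. ((\<lambda>i. W (c n i)) has_sum 1) UNIV"
    and small: "\<And>\<delta>. 0 < \<delta> \<Longrightarrow> \<forall>\<^sub>F n in sequentially. \<forall>i. \<bar>c n i\<bar> < \<delta>"
    and \<kappa>: "(\<lambda>n. \<beta> * tau0 * (\<Sum>\<^sub>\<infinity>i. sgn (c n i) * W (c n i))) \<longlonglongrightarrow> \<kappa>"
    and l: "\<And>n. ((\<lambda>A. \<Prod>i\<in>A. char \<mu> (t * c n i)) \<longlongrightarrow> \<Phi> n) (finite_subsets_at_top UNIV)"
  shows "\<Phi> \<longlonglongrightarrow> exp (- complex_of_real (scale_const * \<bar>t\<bar> powr \<alpha>) * (1 - \<i> * complex_of_real (\<kappa> * sgn t)))"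
proof (cases "t = 0")
  case True
  have "\<Phi> n = 1" for n
    using l[of n] True char_zero tendsto_unique[OF _ l[of n], of 1] by simp
  then have "\<Phi> = (\<lambda>_. 1)" by auto
  then show ?thesis using True alpha_pos by simp
next
  case False
  note t = False
  define \<theta> where "\<theta> n = (\<Sum>\<^sub>\<infinity>i. sgn (c n i) * W (c n i))" for n
  define Q where "Q = complex_of_real (scale_const * \<bar>t\<bar> powr \<alpha>)"
  define \<Lambda> where "\<Lambda> n = (\<Sum>\<^sub>\<infinity>i. Ln (char \<mu> (t * c n i)))" for n
  have key: "\<forall>\<^sub>F n in sequentially. \<Phi> n = exp (\<Lambda> n) \<and> cmod (\<Lambda> n + Q * (1 - \<i> * complex_of_real (\<beta> * tau0 * \<theta> n * sgn t))) \<le> \<epsilon>"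
    if e: "0 < \<epsilon>" for \<epsilon>
  proof -
    have "\<forall>\<^sub>F x in at 0. cmod (Ln (char \<mu> (t * x)) / W x + scale_const * \<bar>t\<bar> powr \<alpha> * (1 - \<i> * complex_of_real (\<beta> * tau0 * sgn t * sgn x))) < \<epsilon>"
      using tendstoD[OF Ln_char_scaled[OF t] e] by simp
    moreover have "\<forall>\<^sub>F x in at 0. char \<mu> (t * x) \<noteq> 0"
    proof -
      have "((\<lambda>x. char \<mu> (t * x)) \<longlongrightarrow> 1) (at 0)"
        by (rule filterlim_compose[OF char_tendsto_1])
           (use t in \<open>auto simp: filterlim_at eventually_at_filter intro!: tendsto_eq_intros\<close>)
      then show ?thesis by (rule tendsto_imp_eventually_ne) simp
    qed
    ultimately have "\<forall>\<^sub>F x in at 0. cmod (Ln (char \<mu> (t * x)) / W x + scale_const * \<bar>t\<bar> powr \<alpha> * (1 - \<i> * complex_of_real (\<beta> * tau0 * sgn t * sgn x))) < \<epsilon>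
        \<and> char \<mu> (t * x) \<noteq> 0" by eventually_elim simp
    then obtain d where d: "0 < d" and dd: "\<And>x. x \<noteq> 0 \<Longrightarrow> \<bar>x\<bar> < d \<Longrightarrow>
        cmod (Ln (char \<mu> (t * x)) / W x + scale_const * \<bar>t\<bar> powr \<alpha> * (1 - \<i> * complex_of_real (\<beta> * tau0 * sgn t * sgn x))) < \<epsilon> \<and> char \<mu> (t * x) \<noteq> 0"
      by (auto simp: eventually_at dist_real_def)
    show ?thesis using hs small[OF d]
    proof eventually_elim
      case (elim n)
      \<comment> \<open>The negative of the expected logarithm, as a combination of W(c_ni) and
        sgn(c_ni) W(c_ni), whose sums over i are 1 and \<open>\<theta> n\<close>.\<close>
      let ?w = "\<lambda>i. Q * complex_of_real (W (c n i)) - \<i> * Q * complex_of_real (\<beta> * tau0 * sgn t) * complex_of_real (sgn (c n i) * W (c n i))"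
      define r where "r i = Ln (char \<mu> (t * c n i)) + ?w i" for i
      have nz: "char \<mu> (t * c n i) \<noteq> 0" for i
        using dd[of "c n i"] elim(2) char_zero by (cases "c n i = 0") auto
      have rb: "cmod (r i) \<le> \<epsilon> * W (c n i)" for i
      proof (cases "c n i = 0")
        case True
        then show ?thesis by (simp add: r_def char_zero)
      next
        case False
        then have Wp: "0 < W (c n i)" by (rule W_pos)
        let ?z = "Ln (char \<mu> (t * c n i)) / W (c n i) + scale_const * \<bar>t\<bar> powr \<alpha> * (1 - \<i> * complex_of_real (\<beta> * tau0 * sgn t * sgn (c n i)))"
        have "r i = ?z * complex_of_real (W (c n i))"
        proof -
          have gen: "L + (q * w - \<i> * q * x * (y * w)) = (L / w + q * (1 - \<i> * (x * y))) * w" if "w \<noteq> 0" for L q x y w :: complex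
            using that by (simp add: field_simps)
          show ?thesis
            using gen[of "complex_of_real (W (c n i))" "Ln (char \<mu> (t * c n i))" Q "complex_of_real (\<beta> * tau0 * sgn t)" "complex_of_real (sgn (c n i))"] Wp
            unfolding r_def Q_def by (simp only: of_real_mult of_real_eq_0_iff less_imp_neq[THEN not_sym] not_False_eq_True simp_thms)
        qed
        then have "cmod (r i) = cmod ?z * W (c n i)" using Wp by (simp only: norm_mult norm_of_real abs_of_pos)
        also have "\<dots> \<le> \<epsilon> * W (c n i)" using dd[OF False] elim(2) Wp by (intro mult_right_mono) (auto intro: less_imp_le)
        finally show ?thesis .
      qed
      have sW: "(\<lambda>i. W (c n i)) summable_on UNIV" and W1: "(\<Sum>\<^sub>\<infinity>i. W (c n i)) = 1"
        using elim(1) by (auto simp: has_sum_iff)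
      have rn: "(\<lambda>i. norm (r i)) summable_on UNIV"
        by (rule summable_on_comparison_test[OF summable_on_cmult_right[OF sW, of \<epsilon>]]) (use rb in auto)
      then have rs: "r summable_on UNIV" by (rule abs_summable_summable)
      have "(\<lambda>i. norm (sgn (c n i) * W (c n i))) summable_on UNIV"
        by (rule summable_on_comparison_test[OF sW]) (auto simp: abs_mult sgn_if W_nonneg)
      then have sg: "(\<lambda>i. sgn (c n i) * W (c n i)) summable_on UNIV" by (rule abs_summable_summable)
      have hw: "(?w has_sum (Q * complex_of_real 1 - \<i> * Q * complex_of_real (\<beta> * tau0 * sgn t) * complex_of_real (\<theta> n))) UNIV"
        unfolding \<theta>_def by (intro has_sum_diff has_sum_cmult_right has_sum_of_real elim(1) has_sum_infsum sg)
      have hL: "((\<lambda>i. r i - ?w i) has_sum (infsum r UNIV - (Q * complex_of_real 1 - \<i> * Q * complex_of_real (\<beta> * tau0 * sgn t) * complex_of_real (\<theta> n)))) UNIV"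
        by (intro has_sum_diff has_sum_infsum rs hw)
      have eqL: "(\<lambda>i. r i - ?w i) = (\<lambda>i. Ln (char \<mu> (t * c n i)))" by (simp add: r_def)
      have \<Lambda>eq: "\<Lambda> n = infsum r UNIV - Q * (1 - \<i> * complex_of_real (\<beta> * tau0 * \<theta> n * sgn t))"
        using infsumI[OF hL[unfolded eqL]] by (simp add: \<Lambda>_def algebra_simps)
      have "((\<lambda>i. Ln (char \<mu> (t * c n i))) has_sum \<Lambda> n) UNIV"
        using hL[unfolded eqL] unfolding \<Lambda>_def by (simp add: has_sum_iff)
      then have "((\<lambda>A. exp (\<Sum>i\<in>A. Ln (char \<mu> (t * c n i)))) \<longlongrightarrow> exp (\<Lambda> n)) (finite_subsets_at_top UNIV)"
        unfolding has_sum_def by (rule tendsto_exp)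
      \<comment> \<open>The choice of branch is harmless: the logarithms are undone factor by
        factor, by exp(Ln z) = z for nonzero z.\<close>
      moreover have "\<forall>\<^sub>F A in finite_subsets_at_top UNIV. exp (\<Sum>i\<in>A. Ln (char \<mu> (t * c n i))) = (\<Prod>i\<in>A. char \<mu> (t * c n i))"
        by (rule eventually_finite_subsets_at_top_weakI) (simp add: exp_sum nz)
      ultimately have "((\<lambda>A. \<Prod>i\<in>A. char \<mu> (t * c n i)) \<longlongrightarrow> exp (\<Lambda> n)) (finite_subsets_at_top UNIV)"
        by (rule Lim_transform_eventually)
      then have 1: "\<Phi> n = exp (\<Lambda> n)" using tendsto_unique[OF _ l[of n]] by simp
      have "cmod (infsum r UNIV) \<le> (\<Sum>\<^sub>\<infinity>i. norm (r i))" by (rule norm_infsum_bound[OF rn])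
      also have "\<dots> \<le> (\<Sum>\<^sub>\<infinity>i. \<epsilon> * W (c n i))" by (intro infsum_mono rn summable_on_cmult_right sW rb)
      also have "\<dots> = \<epsilon>" unfolding infsum_cmult_right' W1 by simp
      finally have "cmod (infsum r UNIV) \<le> \<epsilon>" .
      then show ?case using 1 by (simp add: \<Lambda>eq)
    qed
  qed
  have "(\<lambda>n. \<Lambda> n + Q * (1 - \<i> * complex_of_real (\<beta> * tau0 * \<theta> n * sgn t))) \<longlonglongrightarrow> 0"
  proof (rule tendstoI)
    fix e :: real assume "0 < e"
    then have "0 < e / 2" by simp
    from key[OF this] show "\<forall>\<^sub>F n in sequentially. dist (\<Lambda> n + Q * (1 - \<i> * complex_of_real (\<beta> * tau0 * \<theta> n * sgn t))) 0 < e"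
      by eventually_elim (use \<open>0 < e\<close> in simp)
  qed
  moreover have "(\<lambda>n. Q * (1 - \<i> * complex_of_real (\<beta> * tau0 * \<theta> n * sgn t))) \<longlonglongrightarrow> Q * (1 - \<i> * complex_of_real (\<kappa> * sgn t))"
    using \<kappa> unfolding \<theta>_def[symmetric] by (intro tendsto_intros)
  ultimately have "(\<lambda>n. (\<Lambda> n + Q * (1 - \<i> * complex_of_real (\<beta> * tau0 * \<theta> n * sgn t))) - Q * (1 - \<i> * complex_of_real (\<beta> * tau0 * \<theta> n * sgn t)))
     \<longlonglongrightarrow> 0 - Q * (1 - \<i> * complex_of_real (\<kappa> * sgn t))" by (rule tendsto_diff)
  then have "\<Lambda> \<longlonglongrightarrow> - Q * (1 - \<i> * complex_of_real (\<kappa> * sgn t))" by simp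
  then have l2: "(\<lambda>n. exp (\<Lambda> n)) \<longlonglongrightarrow> exp (- Q * (1 - \<i> * complex_of_real (\<kappa> * sgn t)))" by (rule tendsto_exp)
  have "\<forall>\<^sub>F n in sequentially. exp (\<Lambda> n) = \<Phi> n" using key[of 1] by (auto elim!: eventually_mono)
  then show ?thesis using Lim_transform_eventually[OF l2] unfolding Q_def by simp
qed

end

section \<open>The limit laws of the two cases\<close>

lemma real_distribution_mixed_stable:
  assumes G: "real_distribution G"
  shows "real_distribution (mixed_stable_law \<alpha> c G)"
    and "char (mixed_stable_law \<alpha> c G) t = char G (t * c powr (1 / \<alpha>)) * char G (- (t * (1 - c) powr (1 / \<alpha>)))"
proof -
  interpret G: real_distribution G by (rule G)
  interpret GG: pair_prob_space G G ..
  have [measurable_cong]: "sets G = sets borel" by simp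
  let ?h = "\<lambda>(s', s''). c powr (1 / \<alpha>) * s' - (1 - c) powr (1 / \<alpha>) * s'' :: real"
  have [measurable]: "?h \<in> borel_measurable (G \<Otimes>\<^sub>M G)" by measurable
  interpret D: prob_space "distr (G \<Otimes>\<^sub>M G) borel ?h" by (rule GG.prob_space_distr) simp
  show "real_distribution (mixed_stable_law \<alpha> c G)"
    unfolding mixed_stable_law_def by unfold_locales simp_all
  let ?f = "\<lambda>s'. iexp (t * c powr (1 / \<alpha>) * s')" and ?g = "\<lambda>s''. iexp (- (t * (1 - c) powr (1 / \<alpha>)) * s'')"
  have int: "integrable (G \<Otimes>\<^sub>M G) (\<lambda>x. ?f (fst x) * ?g (snd x))"
    by (rule GG.integrable_const_bound[where B = 1]) (auto simp: norm_mult)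
  have "char (mixed_stable_law \<alpha> c G) t = (\<integral>x. iexp (t * ?h x) \<partial>(G \<Otimes>\<^sub>M G))"
    unfolding char_def mixed_stable_law_def by (rule integral_distr) auto
  also have "\<dots> = (\<integral>x. ?f (fst x) * ?g (snd x) \<partial>(G \<Otimes>\<^sub>M G))"
    by (intro Bochner_Integration.integral_cong refl) (auto simp: exp_add[symmetric] algebra_simps)
  also have "\<dots> = (\<integral>s'. (\<integral>s''. ?f s' * ?g s'' \<partial>G) \<partial>G)"
    using GG.integral_fst'[OF int] by simp
  also have "\<dots> = char G (t * c powr (1 / \<alpha>)) * char G (- (t * (1 - c) powr (1 / \<alpha>)))"
    by (simp only: integral_mult_right_zero integral_mult_left_zero char_def)
  finally show "char (mixed_stable_law \<alpha> c G) t = char G (t * c powr (1 / \<alpha>)) * char G (- (t * (1 - c) powr (1 / \<alpha>)))" .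
qed

text \<open>In \<open>ennreal\<close> the supremum over u exists without any boundedness, so
  eventual bounds that are uniform in u suffice.\<close>

lemma ennreal_SUP_tendsto_0:
  fixes h :: "nat \<Rightarrow> 'u \<Rightarrow> real"
  assumes "\<And>e. 0 < e \<Longrightarrow> \<forall>\<^sub>F n in sequentially. \<forall>u. h n u \<le> e"
  shows "(\<lambda>n. SUP u. ennreal (h n u)) \<longlonglongrightarrow> 0"
proof (rule order_tendstoI)
  fix x :: ennreal assume "0 < x"
  then obtain y where y: "0 < y" "y < x" using dense by blast
  have "y < top" by (rule less_le_trans[OF y(2)]) simp
  then obtain e where e: "y = ennreal e" "0 \<le> e" by (cases y) auto
  then have "0 < e" using y by (cases "e = 0") auto
  from assms[OF this] show "\<forall>\<^sub>F n in sequentially. (SUP u. ennreal (h n u)) < x"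
  proof eventually_elim
    case (elim n)
    have "(SUP u. ennreal (h n u)) \<le> ennreal e" by (rule SUP_least) (use elim in \<open>auto intro: ennreal_leI\<close>)
    then show ?case using y e by simp
  qed
qed simp

context stable_domain
begin

text \<open>Symmetry makes the two one-sided tails equal, hence cp = cm by uniqueness of limits. At
  alpha = 2, where cp and cm are unconstrained, tan(pi) = 0 does it instead.\<close>

lemma beta_tau_symmetric: "symmetric_law \<mu> \<Longrightarrow> \<beta> * tau0 = 0"
proof (cases "\<alpha> < 2")
  case False
  then have "\<alpha> = 2" using alpha_le by simp
  then have "tau0 = 0" unfolding tau0_def by auto
  then show ?thesis by simp
next
  case True
  assume s: "symmetric_law \<mu>"
  have "measure \<mu> {y. y > x} = measure \<mu> {y. y < - x}" for x
  proof -
    have "measure \<mu> {y. y > x} = measure (distr \<mu> borel uminus) {y. y > x}"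
      using s by (simp add: symmetric_law_def)
    also have "\<dots> = measure \<mu> (uminus -` {y. y > x} \<inter> space \<mu>)" by (rule measure_distr) auto
    also have "uminus -` {y. y > x} \<inter> space \<mu> = {y. y < - x}" by auto
    finally show ?thesis .
  qed
  then have "cp = cm" using attraction True
    by (auto simp: domain_of_attraction_def intro: tendsto_unique[OF trivial_limit_at_top_linorder])
  then show ?thesis by simp
qed

lemma infsum_sgn_W:
  fixes c :: "'i \<Rightarrow> real"
  assumes "((\<lambda>i. W (c i)) has_sum 1) UNIV"
  shows "(\<Sum>\<^sub>\<infinity>i. sgn (c i) * W (c i)) = (\<Sum>\<^sub>\<infinity>i\<in>{i. c i > 0}. W (c i)) - (\<Sum>\<^sub>\<infinity>i\<in>{i. c i < 0}. W (c i))"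
proof -
  have sW: "(\<lambda>i. W (c i)) summable_on A" for A
    using assms summable_on_subset_banach[of "\<lambda>i. W (c i)" UNIV A] by (auto simp: summable_on_def)
  have "(\<lambda>i. norm (sgn (c i) * W (c i))) summable_on UNIV"
    by (rule summable_on_comparison_test[OF sW]) (auto simp: abs_mult sgn_if W_nonneg)
  then have "(\<lambda>i. sgn (c i) * W (c i)) summable_on UNIV" by (rule abs_summable_summable)
  then have sg: "(\<lambda>i. sgn (c i) * W (c i)) summable_on A" for A
    by (rule summable_on_subset_banach) simp
  have "(\<Sum>\<^sub>\<infinity>i. sgn (c i) * W (c i)) = (\<Sum>\<^sub>\<infinity>i\<in>{i. c i > 0} \<union> {i. c i < 0}. sgn (c i) * W (c i))"
    by (rule infsum_cong_neutral) (auto simp: sgn_if)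
  also have "\<dots> = (\<Sum>\<^sub>\<infinity>i\<in>{i. c i > 0}. sgn (c i) * W (c i)) + (\<Sum>\<^sub>\<infinity>i\<in>{i. c i < 0}. sgn (c i) * W (c i))"
    by (rule infsum_Un_disjoint[OF sg sg]) auto
  also have "(\<Sum>\<^sub>\<infinity>i\<in>{i. c i > 0}. sgn (c i) * W (c i)) = (\<Sum>\<^sub>\<infinity>i\<in>{i. c i > 0}. W (c i))"
    by (intro infsum_cong) auto
  also have "(\<Sum>\<^sub>\<infinity>i\<in>{i. c i < 0}. sgn (c i) * W (c i)) = (\<Sum>\<^sub>\<infinity>i\<in>{i. c i < 0}. - W (c i))"
    by (intro infsum_cong) auto
  finally show ?thesis by (simp add: infsum_uminus)
qed

lemma stable_char_eq:
  "stable_char \<alpha> \<beta> scale_const t =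
    exp (- complex_of_real (scale_const * \<bar>t\<bar> powr \<alpha>) * (1 - \<i> * complex_of_real (\<beta> * tau0 * sgn t)))"
proof -
  have "\<beta> * stable_tau \<alpha> t = \<beta> * tau0 * sgn t" by (simp add: stable_tau_eq mult_ac)
  then show ?thesis unfolding stable_char_def by (simp only:)
qed

text \<open>Scaling by d^(1/alpha) multiplies |t|^alpha by d, so the exponents of the independent
  parts add up with weights c and 1 - c. The minus sign before the second part reverses its
  skewness, which leaves the factor c - (1 - c).\<close>

lemma char_mixed_stable:
  assumes G: "real_distribution G" and charG: "\<And>t. char G t = stable_char \<alpha> \<beta> scale_const t" and c: "0 \<le> c" "c \<le> 1"
  shows "char (mixed_stable_law \<alpha> c G) t =
    exp (- complex_of_real (scale_const * \<bar>t\<bar> powr \<alpha>) * (1 - \<i> * complex_of_real (\<beta> * tau0 * (c - (1 - c)) * sgn t)))"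
proof -
  have p: "\<bar>t * d powr (1 / \<alpha>)\<bar> powr \<alpha> = d * \<bar>t\<bar> powr \<alpha>" if "0 \<le> d" for d
    using that alpha_pos by (simp add: abs_mult powr_mult powr_powr)
  \<comment> \<open>The factor d on both sides covers d = 0, where the scaled argument has sign
    0.\<close>
  have q: "d * sgn (t * d powr (1 / \<alpha>)) = d * sgn t" if "0 \<le> d" for d
    using that by (cases "d = 0") (auto simp: sgn_mult)
  have E: "- complex_of_real (scale_const * \<bar>x * (t * d powr (1 / \<alpha>))\<bar> powr \<alpha>) * (1 - \<i> * complex_of_real (\<beta> * tau0 * sgn (x * (t * d powr (1 / \<alpha>))))) =
      - complex_of_real (scale_const * \<bar>t\<bar> powr \<alpha>) * (complex_of_real d - \<i> * complex_of_real (\<beta> * tau0 * sgn t * (x * d)))"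
    if d: "0 \<le> d" and x: "x = 1 \<or> x = -1" for d x
  proof -
    have "- complex_of_real (scale_const * \<bar>x * (t * d powr (1 / \<alpha>))\<bar> powr \<alpha>) * (1 - \<i> * complex_of_real (\<beta> * tau0 * sgn (x * (t * d powr (1 / \<alpha>))))) =
       - complex_of_real (scale_const * (d * \<bar>t\<bar> powr \<alpha>)) * (1 - \<i> * complex_of_real (\<beta> * tau0 * (x * sgn (t * d powr (1 / \<alpha>)))))"
      using x p[OF d] by auto
    also have "\<dots> = - complex_of_real (scale_const * \<bar>t\<bar> powr \<alpha>) * (complex_of_real d - \<i> * complex_of_real (\<beta> * tau0 * x * (d * sgn (t * d powr (1 / \<alpha>)))))"
      by (simp add: algebra_simps)
    also have "\<beta> * tau0 * x * (d * sgn (t * d powr (1 / \<alpha>))) = \<beta> * tau0 * sgn t * (x * d)"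
      unfolding q[OF d] by (simp add: mult_ac)
    finally show ?thesis .
  qed
  have "char (mixed_stable_law \<alpha> c G) t = char G (1 * (t * c powr (1 / \<alpha>))) * char G ((-1) * (t * (1 - c) powr (1 / \<alpha>)))"
    using real_distribution_mixed_stable(2)[OF G, of \<alpha> c t] by simp
  also have "\<dots> = exp (- complex_of_real (scale_const * \<bar>t\<bar> powr \<alpha>) * (complex_of_real c - \<i> * complex_of_real (\<beta> * tau0 * sgn t * (1 * c))) +
     - complex_of_real (scale_const * \<bar>t\<bar> powr \<alpha>) * (complex_of_real (1 - c) - \<i> * complex_of_real (\<beta> * tau0 * sgn t * ((-1) * (1 - c)))))"
    unfolding charG stable_char_eq exp_add using c by (subst E E, simp, simp)+ simp
  also have "- complex_of_real (scale_const * \<bar>t\<bar> powr \<alpha>) * (complex_of_real c - \<i> * complex_of_real (\<beta> * tau0 * sgn t * (1 * c))) +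
     - complex_of_real (scale_const * \<bar>t\<bar> powr \<alpha>) * (complex_of_real (1 - c) - \<i> * complex_of_real (\<beta> * tau0 * sgn t * ((-1) * (1 - c)))) =
     - complex_of_real (scale_const * \<bar>t\<bar> powr \<alpha>) * (1 - \<i> * complex_of_real (\<beta> * tau0 * (c - (1 - c)) * sgn t))"
    by (simp add: algebra_simps)
  finally show ?thesis .
qed

text \<open>Pointwise convergence is dominated through \<open>char_product_bound\<close>. As the
  coefficients are bounded by A, for |t| <= K B n all arguments t b_ni / B n stay within a fixed R;
  this is why the intervals may grow like B n.\<close>

lemma char_convergence_linear:
  fixes c :: "nat \<Rightarrow> 'i \<Rightarrow> real" and P :: "nat \<Rightarrow> real measure" and B :: "nat \<Rightarrow> real"
  assumes nl: "non_lattice \<mu>" and P: "\<And>n. real_distribution (P n)" and B: "filterlim B at_top sequentially"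
    and bA: "\<And>n i. \<bar>b' n i\<bar> \<le> A"
    and hs: "\<forall>\<^sub>F n in sequentially. ((\<lambda>i. W (b' n i / B n)) has_sum 1) UNIV"
    and \<kappa>: "(\<lambda>n. \<beta> * tau0 * (\<Sum>\<^sub>\<infinity>i. sgn (b' n i / B n) * W (b' n i / B n))) \<longlonglongrightarrow> \<kappa>"
    and l: "\<And>n s. ((\<lambda>F. \<Prod>i\<in>F. char \<mu> (s * b' n i)) \<longlongrightarrow> char (P n) s) (finite_subsets_at_top (UNIV :: 'i set))"
  defines "\<psi> \<equiv> \<lambda>t. exp (- complex_of_real (scale_const * \<bar>t\<bar> powr \<alpha>) * (1 - \<i> * complex_of_real (\<kappa> * sgn t)))"
  shows "integrable lborel \<psi>" and "char_convergence P B \<psi>"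
proof -
  have [measurable]: "\<psi> \<in> borel_measurable borel" unfolding \<psi>_def by measurable
  have n\<psi>: "cmod (\<psi> t) = exp (- scale_const * \<bar>t\<bar> powr \<alpha>)" for t by (simp add: \<psi>_def norm_exp_eq_Re)
  have i\<psi>: "integrable lborel (\<lambda>t. exp (- scale_const * \<bar>t\<bar> powr \<alpha>))"
    by (rule integrable_exp_powr[OF scale_const_pos alpha_pos])
  show int: "integrable lborel \<psi>"
    by (rule Bochner_Integration.integrable_bound[OF i\<psi>]) (auto simp: n\<psi>)
  have Bp: "\<forall>\<^sub>F n in sequentially. 0 < B n" using B by (simp add: filterlim_at_top_dense)
  have A0: "0 \<le> A" using order_trans[OF abs_ge_zero bA] .
  have lc: "((\<lambda>F. \<Prod>i\<in>F. char \<mu> (t * (b' n i / B n))) \<longlongrightarrow> char (P n) (t / B n)) (finite_subsets_at_top UNIV)" for n t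
    using l[of "t / B n" n] by simp
  have small: "\<forall>\<^sub>F n in sequentially. \<forall>i. \<bar>b' n i / B n\<bar> < \<delta>" if d: "0 < \<delta>" for \<delta>
  proof -
    have "(\<lambda>n. A / B n) \<longlonglongrightarrow> 0" by (rule real_tendsto_divide_at_top[OF tendsto_const B])
    then have "\<forall>\<^sub>F n in sequentially. A / B n < \<delta>" by (rule order_tendstoD) (rule d)
    then show ?thesis using Bp
    proof eventually_elim
      case (elim n)
      have "\<bar>b' n i / B n\<bar> \<le> A / B n" for i using bA[of n i] elim(2) by (simp add: divide_right_mono)
      then show ?case using elim(1) by (meson le_less_trans)
    qed
  qed
  have ptw: "(\<lambda>n. char (P n) (t / B n)) \<longlonglongrightarrow> \<psi> t" for t
    unfolding \<psi>_def by (rule char_product_limit[OF hs small \<kappa> lc])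
  have cm[measurable]: "char (P n) \<in> borel_measurable borel" for n
    using real_distribution.char_measurable[OF P] by simp
  have "(\<lambda>n. LBINT t:{-(K * B n)..K * B n}. cmod (char (P n) (t / B n) - \<psi> t)) \<longlonglongrightarrow> 0" if K: "0 < K" for K
  proof -
    \<comment> \<open>A + 1 instead of A keeps R positive if A = 0.\<close>
    define R where "R = K * (A + 1)"
    have R: "0 < R" using K A0 by (simp add: R_def)
    obtain k where k: "0 < k" "\<And>(c :: 'i \<Rightarrow> real) t \<Phi>. 1 \<le> \<bar>t\<bar> \<Longrightarrow> (\<forall>i. \<bar>t * c i\<bar> \<le> R) \<Longrightarrow> ((\<lambda>i. W (c i)) has_sum 1) UNIV \<Longrightarrow>
     ((\<lambda>A. \<Prod>i\<in>A. char \<mu> (t * c i)) \<longlongrightarrow> \<Phi>) (finite_subsets_at_top UNIV) \<Longrightarrow> cmod \<Phi> \<le> exp (- k * \<bar>t\<bar> powr (\<alpha> / 2))"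
      using char_product_bound[OF nl R, where 'i = 'i] by blast
    \<comment> \<open>The factor exp k extends the product bound to |t| < 1, where only the trivial
      bound 1 is at hand. The last term bounds the limit function.\<close>
    define w where "w t = exp k * exp (- k * \<bar>t\<bar> powr (\<alpha> / 2)) + exp (- scale_const * \<bar>t\<bar> powr \<alpha>)" for t
    have iw: "integrable lborel w" unfolding w_def
      by (intro Bochner_Integration.integrable_add integrable_mult_right integrable_exp_powr i\<psi>) (use k alpha_pos in auto)
    have bd: "\<forall>\<^sub>F n in sequentially. \<forall>t. \<bar>t\<bar> \<le> K * B n \<longrightarrow> cmod (char (P n) (t / B n) - \<psi> t) \<le> w t"
      using hs Bp
    proof eventually_elim
      case (elim n)
      show ?case
      proof (intro allI impI)
        fix t assume t: "\<bar>t\<bar> \<le> K * B n"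
        have "cmod (char (P n) (t / B n)) \<le> exp k * exp (- k * \<bar>t\<bar> powr (\<alpha> / 2))"
        proof (cases "1 \<le> \<bar>t\<bar>")
          case True
          have "\<bar>t * (b' n i / B n)\<bar> \<le> R" for i
          proof -
            have "\<bar>t * (b' n i / B n)\<bar> = \<bar>t\<bar> / B n * \<bar>b' n i\<bar>" using elim(2) by (simp add: abs_mult)
            also have "\<dots> \<le> K * (A + 1)"
              using t elim(2) bA[of n i] K by (intro mult_mono) (auto simp: field_simps)
            finally show ?thesis by (simp add: R_def)
          qed
          then have "cmod (char (P n) (t / B n)) \<le> exp (- k * \<bar>t\<bar> powr (\<alpha> / 2))"
            by (intro k(2)[OF True _ elim(1) lc]) auto
          also have "\<dots> \<le> exp k * exp (- k * \<bar>t\<bar> powr (\<alpha> / 2))" using k(1) by simp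
          finally show ?thesis .
        next
          case False
          have "cmod (char (P n) (t / B n)) \<le> 1" using real_distribution.cmod_char_le_1[OF P] by simp
          also have "1 \<le> exp (k - k * \<bar>t\<bar> powr (\<alpha> / 2))"
            using False k(1) alpha_pos mult_left_mono[OF powr_le1[of "\<alpha> / 2" "\<bar>t\<bar>"], of k] by simp
          also have "\<dots> = exp k * exp (- k * \<bar>t\<bar> powr (\<alpha> / 2))" by (simp add: exp_add[symmetric])
          finally show ?thesis .
        qed
        then show "cmod (char (P n) (t / B n) - \<psi> t) \<le> w t"
          using norm_triangle_ineq4[of "char (P n) (t / B n)" "\<psi> t"] unfolding w_def n\<psi> by linarith
      qed
    qed
    then obtain N where N: "\<And>n t. N \<le> n \<Longrightarrow> \<bar>t\<bar> \<le> K * B n \<Longrightarrow> cmod (char (P n) (t / B n) - \<psi> t) \<le> w t"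
      unfolding eventually_sequentially by blast
    have w0: "0 \<le> w t" for t by (simp add: w_def)
    \<comment> \<open>The majorant is valid from N on; shifting the sequence by N makes it valid for
      every term, as dominated convergence requires.\<close>
    have "(\<lambda>n. LBINT t:{-(K * B (n + N))..K * B (n + N)}. cmod (char (P (n + N)) (t / B (n + N)) - \<psi> t)) \<longlonglongrightarrow> (LBINT t::real. 0)"
      unfolding set_lebesgue_integral_def
    proof (rule integral_dominated_convergence[OF _ _ iw])
      show "AE t in lborel. norm (indicator {-(K * B (n + N))..K * B (n + N)} t *\<^sub>R cmod (char (P (n + N)) (t / B (n + N)) - \<psi> t)) \<le> w t" for n
        using N[of "n + N"] w0 by (auto simp: indicator_def abs_le_iff)
      show "AE t in lborel. (\<lambda>n. indicator {-(K * B (n + N))..K * B (n + N)} t *\<^sub>R cmod (char (P (n + N)) (t / B (n + N)) - \<psi> t)) \<longlonglongrightarrow> 0"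
      proof (intro AE_I2)
        fix t
        have "(\<lambda>n. cmod (char (P n) (t / B n) - \<psi> t)) \<longlonglongrightarrow> 0"
          using tendsto_norm_zero[OF LIM_zero[OF ptw[of t]]] .
        from LIMSEQ_ignore_initial_segment[OF this, of N]
        show "(\<lambda>n. indicator {-(K * B (n + N))..K * B (n + N)} t *\<^sub>R cmod (char (P (n + N)) (t / B (n + N)) - \<psi> t)) \<longlonglongrightarrow> 0"
          by (rule Lim_null_comparison[rotated]) (auto simp: indicator_def)
      qed
    qed measurable
    then have "(\<lambda>n. LBINT t:{-(K * B (n + N))..K * B (n + N)}. cmod (char (P (n + N)) (t / B (n + N)) - \<psi> t)) \<longlonglongrightarrow> 0" by simp
    then show ?thesis by (rule LIMSEQ_offset[where k = N])
  qed
  then show "char_convergence P B \<psi>" using P B int unfolding char_convergence_def by blast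
qed

end

theorem theorem4p3:
  fixes M :: "'w measure"
    and \<xi> :: "int ^ 'd \<Rightarrow> 'w \<Rightarrow> real"
    and \<mu> G \<nu> :: "real measure"
    and \<alpha> cp cm :: real
    and a :: "int ^ 'd \<Rightarrow> real"
    and e :: "nat \<Rightarrow> int ^ 'd"
    and \<Gamma> :: "nat \<Rightarrow> (int ^ 'd) set"
    and m :: "real \<Rightarrow> real"
  defines "b \<equiv> (\<lambda>n i. \<Sum>j\<in>\<Gamma> n. a (j - i))"
  defines "B \<equiv> (\<lambda>n. norming_const \<alpha> \<mu> (b n))"
  defines "S \<equiv> (\<lambda>n \<omega>. \<Sum>j\<in>\<Gamma> n. linear_process e a \<xi> j \<omega>)"
  assumes "0 < \<alpha>" and "\<alpha> \<le> 2"
    and "prob_space M"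
    and "prob_space.indep_vars M (\<lambda>_. borel) \<xi> UNIV"
    and "\<And>i. distr M borel (\<xi> i) = \<mu>"
    and "domain_of_attraction \<alpha> cp cm \<mu>"
    and "(\<integral>\<^sup>+y. ennreal (y\<^sup>2) \<partial>\<mu>) = \<infinity>"
    and "condition_A \<alpha> \<mu>"
    and "non_lattice \<mu>"
    and "real_distribution G"
    and "\<And>t. char G t = stable_char \<alpha> (cp - cm) (char_const \<alpha> (cp - cm) \<mu>) t"
    and "bij e"
    and "(\<lambda>i. L_weight \<alpha> \<mu> (a i)) summable_on UNIV"
    and "(\<lambda>i. \<bar>a i\<bar>) summable_on UNIV"
    and "\<And>n. n \<ge> 1 \<Longrightarrow> finite (\<Gamma> n)"
    and "filterlim B at_top sequentially"
    and "(\<exists>c. 0 \<le> c \<and> c \<le> 1 \<and>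
            (\<lambda>n. \<Sum>\<^sub>\<infinity>i\<in>{i. b n i / B n > 0}. L_weight \<alpha> \<mu> (b n i / B n)) \<longlonglongrightarrow> c \<and>
            (\<lambda>n. \<Sum>\<^sub>\<infinity>i\<in>{i. b n i / B n < 0}. L_weight \<alpha> \<mu> (b n i / B n)) \<longlonglongrightarrow> 1 - c \<and>
            \<nu> = mixed_stable_law \<alpha> c G)
         \<or> (symmetric_law \<mu> \<or> (\<forall>i. a i \<ge> 0)) \<and> \<nu> = G"
    and "continuous_on UNIV m"
    and "compact (closure {t. m t \<noteq> 0})"
  shows "(\<lambda>n. SUP u. ennreal \<bar>B n * (\<integral>\<omega>. m (S n \<omega> + u) \<partial>M)
            - continuous_density \<nu> (- u / B n) * (\<integral>t. m t \<partial>lborel)\<bar>) \<longlonglongrightarrow> 0"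
proof -
  let ?W = "L_weight \<alpha> \<mu>"
  interpret M: prob_space M by fact
  have ind: "M.indep_vars (\<lambda>_. borel) \<xi> UNIV" by fact
  then have [measurable]: "\<xi> i \<in> borel_measurable M" for i by (simp add: M.indep_vars_def)
  have law: "distr M borel (\<xi> i) = \<mu>" for i by fact
  have rd: "real_distribution \<mu>"
    unfolding law[of 0, symmetric] by (rule M.real_distribution_distr) simp
  interpret D: stable_domain \<mu> \<alpha> cp cm
    using rd \<open>0 < \<alpha>\<close> \<open>\<alpha> \<le> 2\<close> \<open>domain_of_attraction \<alpha> cp cm \<mu>\<close> \<open>(\<integral>\<^sup>+y. ennreal (y\<^sup>2) \<partial>\<mu>) = \<infinity>\<close> \<open>condition_A \<alpha> \<mu>\<close>
    by (intro stable_domain.intro stable_domain_axioms.intro)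
  have sa: "(\<lambda>i. \<bar>a i\<bar>) summable_on UNIV" and sW: "(\<lambda>i. ?W (a i)) summable_on UNIV" by fact+
  have B_lim: "filterlim B at_top sequentially" by fact
  have fin: "finite (\<Gamma> n)" if "1 \<le> n" for n using that by fact
  have G: "real_distribution G" by fact
  have charG: "char G t = stable_char \<alpha> (cp - cm) D.scale_const t" for t
    using \<open>\<And>t. char G t = stable_char \<alpha> (cp - cm) (char_const \<alpha> (cp - cm) \<mu>) t\<close> by (simp add: D.char_const_eq)
  have hs: "\<forall>\<^sub>F n in sequentially. ((\<lambda>i. ?W (b n i / B n)) has_sum 1) UNIV"
  proof -
    \<comment> \<open>If no scale were admissible, B n would be the infimum of the empty set, an
      unspecified but fixed real number. Eventually B n exceeds it, so the set of admissible scales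
      is nonempty.\<close>
    have "\<forall>\<^sub>F n in sequentially. max 1 (Inf {}) < B n" using B_lim by (simp only: filterlim_at_top_dense)
    then show ?thesis
    proof eventually_elim
      case (elim n)
      show ?case unfolding B_def
      proof (rule D.norming_const_sum)
        show "1 < norming_const \<alpha> \<mu> (b n)" using elim by (simp add: B_def)
        show "{x. 1 \<le> x \<and> (\<lambda>i. ?W (b n i / x)) summable_on UNIV \<and> (\<Sum>\<^sub>\<infinity>i. ?W (b n i / x)) \<le> 1} \<noteq> {}"
        proof
          assume "{x. 1 \<le> x \<and> (\<lambda>i. ?W (b n i / x)) summable_on UNIV \<and> (\<Sum>\<^sub>\<infinity>i. ?W (b n i / x)) \<le> 1} = {}"
          then have "B n = Inf {}" unfolding B_def norming_const_def by (simp only:)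
          then show False using elim by simp
        qed
      qed
    qed
  qed
  \<comment> \<open>All alternatives lead to a characteristic function of one shape with parameter
    kappa: beta tau (2c - 1) for signed coefficients, 0 for symmetric innovations, beta tau for
    nonnegative coefficients.\<close>
  have "\<exists>\<kappa>. real_distribution \<nu> \<and>
      (\<forall>t. char \<nu> t = exp (- complex_of_real (D.scale_const * \<bar>t\<bar> powr \<alpha>) * (1 - \<i> * complex_of_real (\<kappa> * sgn t)))) \<and>
      (\<lambda>n. (cp - cm) * D.tau0 * (\<Sum>\<^sub>\<infinity>i. sgn (b n i / B n) * ?W (b n i / B n))) \<longlonglongrightarrow> \<kappa>"
    using \<open>_ \<or> _\<close>
  proof (elim disjE exE conjE)
    fix c assume c: "0 \<le> c" "c \<le> 1"
      and pos: "(\<lambda>n. \<Sum>\<^sub>\<infinity>i\<in>{i. b n i / B n > 0}. ?W (b n i / B n)) \<longlonglongrightarrow> c"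
      and neg: "(\<lambda>n. \<Sum>\<^sub>\<infinity>i\<in>{i. b n i / B n < 0}. ?W (b n i / B n)) \<longlonglongrightarrow> 1 - c"
      and \<nu>: "\<nu> = mixed_stable_law \<alpha> c G"
    have l: "(\<lambda>n. (cp - cm) * D.tau0 * ((\<Sum>\<^sub>\<infinity>i\<in>{i. b n i / B n > 0}. ?W (b n i / B n)) - (\<Sum>\<^sub>\<infinity>i\<in>{i. b n i / B n < 0}. ?W (b n i / B n))))
        \<longlonglongrightarrow> (cp - cm) * D.tau0 * (c - (1 - c))"
      by (intro tendsto_intros pos neg)
    have ev: "\<forall>\<^sub>F n in sequentially. (cp - cm) * D.tau0 * ((\<Sum>\<^sub>\<infinity>i\<in>{i. b n i / B n > 0}. ?W (b n i / B n)) - (\<Sum>\<^sub>\<infinity>i\<in>{i. b n i / B n < 0}. ?W (b n i / B n)))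
        = (cp - cm) * D.tau0 * (\<Sum>\<^sub>\<infinity>i. sgn (b n i / B n) * ?W (b n i / B n))"
      using hs by eventually_elim (simp only: D.infsum_sgn_W)
    show ?thesis
      using Lim_transform_eventually[OF l ev] real_distribution_mixed_stable(1)[OF G, of \<alpha> c]
        D.char_mixed_stable[OF G charG c] unfolding \<nu> by blast
  next
    assume s: "symmetric_law \<mu>" and \<nu>: "\<nu> = G"
    have 0: "(cp - cm) * D.tau0 = 0" by (rule D.beta_tau_symmetric[OF s])
    show ?thesis unfolding 0 \<nu> using G charG D.stable_char_eq
      by (intro exI[of _ 0]) (simp add: 0)
  next
    assume a0: "\<forall>i. 0 \<le> a i" and \<nu>: "\<nu> = G"
    have "\<forall>\<^sub>F n in sequentially. 0 < B n" using B_lim by (simp add: filterlim_at_top_dense)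
    with hs have ev: "\<forall>\<^sub>F n in sequentially. (cp - cm) * D.tau0 = (cp - cm) * D.tau0 * (\<Sum>\<^sub>\<infinity>i. sgn (b n i / B n) * ?W (b n i / B n))"
    proof eventually_elim
      case (elim n)
      have "0 \<le> b n i / B n" for i using a0 elim(2) by (auto simp: b_def intro!: divide_nonneg_pos sum_nonneg)
      then have "(\<Sum>\<^sub>\<infinity>i. sgn (b n i / B n) * ?W (b n i / B n)) = (\<Sum>\<^sub>\<infinity>i. ?W (b n i / B n))"
        by (intro infsum_cong) (metis D.W_0 less_eq_real_def mult_1 mult_zero_right sgn_pos)
      also have "\<dots> = 1" using elim(1) by (rule infsumI)
      finally show ?case by simp
    qed
    have "(\<lambda>n. (cp - cm) * D.tau0 * (\<Sum>\<^sub>\<infinity>i. sgn (b n i / B n) * ?W (b n i / B n))) \<longlonglongrightarrow> (cp - cm) * D.tau0"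
      by (rule Lim_transform_eventually[OF tendsto_const ev])
    moreover have "char G t = exp (- complex_of_real (D.scale_const * \<bar>t\<bar> powr \<alpha>) * (1 - \<i> * complex_of_real ((cp - cm) * D.tau0 * sgn t)))" for t
      unfolding charG D.stable_char_eq by (rule refl)
    ultimately show ?thesis unfolding \<nu> using G by blast
  qed
  then obtain \<kappa> where \<nu>: "real_distribution \<nu>"
    and char\<nu>: "\<And>t. char \<nu> t = exp (- complex_of_real (D.scale_const * \<bar>t\<bar> powr \<alpha>) * (1 - \<i> * complex_of_real (\<kappa> * sgn t)))"
    and \<kappa>: "(\<lambda>n. (cp - cm) * D.tau0 * (\<Sum>\<^sub>\<infinity>i. sgn (b n i / B n) * ?W (b n i / B n))) \<longlonglongrightarrow> \<kappa>"
    by blast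
  \<comment> \<open>The index is shifted because \<open>\<Gamma> n\<close> is known to be finite for
    n >= 1 only; the shift is undone at the end.\<close>
  define P where "P n = distr M borel (S (Suc n))" for n
  have Sm[measurable]: "S (Suc n) \<in> borel_measurable M" for n
    unfolding S_def
    by (rule D.char_linear_process(1)[OF \<open>prob_space M\<close> ind law \<open>bij e\<close> sW sa fin]) simp
  have P: "real_distribution (P n)" for n unfolding P_def by (rule M.real_distribution_distr) simp
  have prods: "((\<lambda>F. \<Prod>i\<in>F. char \<mu> (s * b (Suc n) i)) \<longlongrightarrow> char (P n) s) (finite_subsets_at_top UNIV)" for n s
    unfolding P_def S_def b_def
    by (rule D.char_linear_process(2)[OF \<open>prob_space M\<close> ind law \<open>bij e\<close> sW sa fin]) simp
  \<comment> \<open>For fixed i the indices j - i are distinct, so the bound is the full sum of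
    |a_x|, whatever the size of \<open>\<Gamma> n\<close>.\<close>
  have bA: "\<bar>b (Suc n) i\<bar> \<le> (\<Sum>\<^sub>\<infinity>x. \<bar>a x\<bar>)" for n i
  proof -
    have "\<bar>b (Suc n) i\<bar> \<le> (\<Sum>j\<in>\<Gamma> (Suc n). \<bar>a (j - i)\<bar>)" unfolding b_def by (rule sum_abs)
    also have "\<dots> = (\<Sum>x\<in>(\<lambda>j. j - i) ` \<Gamma> (Suc n). \<bar>a x\<bar>)" by (subst sum.reindex) (auto simp: inj_on_def)
    also have "\<dots> \<le> (\<Sum>\<^sub>\<infinity>x. \<bar>a x\<bar>)" by (intro finite_sum_le_infsum sa finite_imageI fin) auto
    finally show ?thesis .
  qed
  note cc = D.char_convergence_linear[OF \<open>non_lattice \<mu>\<close> P filterlim_compose[OF B_lim filterlim_Suc] bA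
      eventually_compose_filterlim[OF hs filterlim_Suc] LIMSEQ_Suc[OF \<kappa>] prods]
  have char\<nu>': "char \<nu> = (\<lambda>t. exp (- complex_of_real (D.scale_const * \<bar>t\<bar> powr \<alpha>) * (1 - \<i> * complex_of_real (\<kappa> * sgn t))))"
    using char\<nu> by blast
  have int: "integrable lborel (char \<nu>)" unfolding char\<nu>' by (rule cc(1))
  interpret C: char_convergence P "\<lambda>n. B (Suc n)" "char \<nu>" unfolding char\<nu>' by (rule cc(2))
  have f: "continuous_density \<nu> = (\<lambda>x. Re (fourier_density (char \<nu>) x))"
    by (rule real_distribution.continuous_density_eq[OF \<nu> int])
  obtain R where R: "\<And>x. x \<in> closure {t. m t \<noteq> 0} \<Longrightarrow> \<bar>x\<bar> \<le> R"
    using compact_imp_bounded[OF \<open>compact (closure {t. m t \<noteq> 0})\<close>] unfolding bounded_iff by auto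
  have supp: "m x = 0" if "R < \<bar>x\<bar>" for x
    using R[of x] closure_subset[of "{t. m t \<noteq> 0}"] that by force
  have [measurable]: "m \<in> borel_measurable borel"
    using \<open>continuous_on UNIV m\<close> by (rule borel_measurable_continuous_onI)
  have "(\<lambda>n. SUP u. ennreal \<bar>B (Suc n) * (\<integral>\<omega>. m (S (Suc n) \<omega> + u) \<partial>M)
            - continuous_density \<nu> (- u / B (Suc n)) * (\<integral>t. m t \<partial>lborel)\<bar>) \<longlonglongrightarrow> 0"
  proof (rule ennreal_SUP_tendsto_0)
    fix \<epsilon> :: real assume "0 < \<epsilon>"
    have "\<forall>\<^sub>F n in sequentially. \<forall>u. \<bar>B (Suc n) * (\<integral>x. m (x + u) \<partial>P n)
        - Re (fourier_density (char \<nu>) (- u / B (Suc n))) * (LBINT x. m x)\<bar> \<le> \<epsilon>"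
      using \<open>continuous_on UNIV m\<close> supp \<open>0 < \<epsilon>\<close> by (rule C.local_limit)
    then show "\<forall>\<^sub>F n in sequentially. \<forall>u. \<bar>B (Suc n) * (\<integral>\<omega>. m (S (Suc n) \<omega> + u) \<partial>M)
            - continuous_density \<nu> (- u / B (Suc n)) * (\<integral>t. m t \<partial>lborel)\<bar> \<le> \<epsilon>"
    proof eventually_elim
      case (elim n)
      have "(\<integral>x. m (x + u) \<partial>P n) = (\<integral>\<omega>. m (S (Suc n) \<omega> + u) \<partial>M)" for u
        unfolding P_def by (rule integral_distr) auto
      then show ?case using elim unfolding f by simp
    qed
  qed
  then show ?thesis by (rule LIMSEQ_imp_Suc)
qed

end
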